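(* Suppose that $Z\subset X$ is a nonempty closed subset with metric given by the restriction of the metric of $X$. Suppose that $X$ is a geodesic metric space such that the Assouad-Nagata dimension $\dim_{\text{AN}}(X)$ of $X$ is finite. Suppose that one of the following is true: (1) $Z$ is Lipschitz $n$--connected. (2) $X$ is Lipschitz $n$--connected, and if $X_p,p\in P$ are the connected components of $X\smallsetminus Z$, then the sets $H_p=\partial X_p$ are Lipschitz $n$--connected with uniformly bounded implicit constant. Then $Z$ is undistorted up to dimension $n+1$.
   Context: A metric space $Y$ is Lipschitz $n$--connected if there is a constant $c$ such that for every $k\le n$, every Lipschitz map $f\colon S^k\to Y$ extends to a Lipschitz map $D^{k+1}\to Y$ whose Lipschitz constant is at most $c$ times the Lipschitz constant of $f$. "$Z$ is undistorted up to dimension $n+1$" means that for every Lipschitz $m$--cycle $\alpha$ in $Z$ with $m\le n$, the filling volume of $\alpha$ in $Z$ is bounded above, up to a uniform multiplicative constant, by its filling volume in $X$. That is, $\mathrm{FV}_Z(\alpha)\lesssim \mathrm{FV}_X(\alpha)$. *)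

theory Defs
  imports "HOL-Analysis.Analysis"
begin

text \<open>Points of R^(k+1) are functions nat => real vanishing at indices > k.\<close>

definition edist :: "nat \<Rightarrow> (nat \<Rightarrow> real) \<Rightarrow> (nat \<Rightarrow> real) \<Rightarrow> real" where
  "edist k x y = sqrt (\<Sum>i\<le>k. (x i - y i)^2)"

definition sphere_k :: "nat \<Rightarrow> (nat \<Rightarrow> real) set" where
  "sphere_k k = {x. (\<forall>i>k. x i = 0) \<and> (\<Sum>i\<le>k. (x i)^2) = 1}"

definition disk_k1 :: "nat \<Rightarrow> (nat \<Rightarrow> real) set" where
  "disk_k1 k = {x. (\<forall>i>k. x i = 0) \<and> (\<Sum>i\<le>k. (x i)^2) \<le> 1}"

definition simplex_k :: "nat \<Rightarrow> (nat \<Rightarrow> real) set" where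
  "simplex_k k = {x. (\<forall>i>k. x i = 0) \<and> (\<forall>i\<le>k. 0 \<le> x i) \<and> (\<Sum>i\<le>k. x i) = 1}"

definition lip_on_k :: "nat \<Rightarrow> real \<Rightarrow> (nat \<Rightarrow> real) set \<Rightarrow> ((nat \<Rightarrow> real) \<Rightarrow> 'a::metric_space) \<Rightarrow> bool" where
  "lip_on_k k L A f \<longleftrightarrow> 0 \<le> L \<and> (\<forall>x\<in>A. \<forall>y\<in>A. dist (f x) (f y) \<le> L * edist k x y)"

definition lip_connected_const :: "'a::metric_space set \<Rightarrow> nat \<Rightarrow> real \<Rightarrow> bool" where
  "lip_connected_const Y n c \<longleftrightarrow>
     (\<forall>k\<le>n. \<forall>f L. f ` sphere_k k \<subseteq> Y \<and> lip_on_k k L (sphere_k k) f \<longrightarrow>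
        (\<exists>g. g ` disk_k1 k \<subseteq> Y \<and> (\<forall>x\<in>sphere_k k. g x = f x) \<and> lip_on_k k (c * L) (disk_k1 k) g))"

definition lip_connected :: "'a::metric_space set \<Rightarrow> nat \<Rightarrow> bool" where
  "lip_connected Y n \<longleftrightarrow> (\<exists>c. lip_connected_const Y n c)"

definition geodesic_space :: "'a::metric_space itself \<Rightarrow> bool" where
  "geodesic_space _ \<longleftrightarrow> (\<forall>x y::'a. \<exists>\<gamma>::real \<Rightarrow> 'a. \<gamma> 0 = x \<and> \<gamma> (dist x y) = y \<and>
      (\<forall>s\<in>{0..dist x y}. \<forall>t\<in>{0..dist x y}. dist (\<gamma> s) (\<gamma> t) = \<bar>s - t\<bar>))"

definition AN_dim_le :: "'a::metric_space itself \<Rightarrow> nat \<Rightarrow> bool" where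
  "AN_dim_le _ n \<longleftrightarrow> (\<exists>c>0. \<forall>s>0. \<exists>\<U>::'a set set. \<Union>\<U> = UNIV \<and>
      (\<forall>U\<in>\<U>. bounded U \<and> diameter U \<le> c * s) \<and>
      (\<forall>B. bounded B \<and> diameter B \<le> s \<longrightarrow>
          finite {U\<in>\<U>. U \<inter> B \<noteq> {}} \<and> card {U\<in>\<U>. U \<inter> B \<noteq> {}} \<le> n + 1))"

definition AN_dim_finite :: "'a::metric_space itself \<Rightarrow> bool" where
  "AN_dim_finite T \<longleftrightarrow> (\<exists>n. AN_dim_le T n)"

definition hausdorff_pre :: "nat \<Rightarrow> real \<Rightarrow> 'a::metric_space set \<Rightarrow> ennreal" where
  "hausdorff_pre k \<delta> A = Inf {(\<Sum>i. if C i = {} then 0 else ennreal (diameter (C i)) ^ k) | C.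
       A \<subseteq> (\<Union>i. C i) \<and> (\<forall>i. bounded (C i) \<and> diameter (C i) \<le> \<delta>)}"

definition hausdorff_outer :: "nat \<Rightarrow> 'a::metric_space set \<Rightarrow> ennreal" where
  "hausdorff_outer k A = (SUP \<delta>\<in>{0<..}. hausdorff_pre k \<delta> A)"

text \<open>k-dimensional Hausdorff measure on the Borel sets (unnormalized; normalizing
  constants are irrelevant for the statement, which is up to multiplicative constants).\<close>
definition hausdorff_measure :: "nat \<Rightarrow> 'a::metric_space measure" where
  "hausdorff_measure k = measure_of UNIV (sets borel) (hausdorff_outer k)"

definition lip_simplex :: "'a::metric_space set \<Rightarrow> nat \<Rightarrow> ((nat \<Rightarrow> real) \<Rightarrow> 'a) \<Rightarrow> bool" where
  "lip_simplex S k \<sigma> \<longleftrightarrow> (\<exists>L. lip_on_k k L (simplex_k k) \<sigma>) \<and> \<sigma> ` simplex_k k \<subseteq> S \<and>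
     (\<forall>x. x \<notin> simplex_k k \<longrightarrow> \<sigma> x = undefined)"

type_synonym 'a chain = "((nat \<Rightarrow> real) \<Rightarrow> 'a) \<Rightarrow> int"

definition supp :: "'a chain \<Rightarrow> ((nat \<Rightarrow> real) \<Rightarrow> 'a) set" where
  "supp c = {\<sigma>. c \<sigma> \<noteq> 0}"

definition lip_chain :: "'a::metric_space set \<Rightarrow> nat \<Rightarrow> 'a chain \<Rightarrow> bool" where
  "lip_chain S k c \<longleftrightarrow> finite (supp c) \<and> (\<forall>\<sigma>\<in>supp c. lip_simplex S k \<sigma>)"

definition face_map :: "nat \<Rightarrow> (nat \<Rightarrow> real) \<Rightarrow> (nat \<Rightarrow> real)" where
  "face_map i x = (\<lambda>j. if j < i then x j else if j = i then 0 else x (j - 1))"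

definition face :: "nat \<Rightarrow> nat \<Rightarrow> ((nat \<Rightarrow> real) \<Rightarrow> 'a) \<Rightarrow> ((nat \<Rightarrow> real) \<Rightarrow> 'a)" where
  "face k i \<sigma> = (\<lambda>x. if x \<in> simplex_k (k - 1) then \<sigma> (face_map i x) else undefined)"

definition boundary :: "nat \<Rightarrow> 'a chain \<Rightarrow> 'a chain" where
  "boundary k c = (\<lambda>\<tau>. \<Sum>\<sigma>\<in>supp c. \<Sum>i\<le>k. if face k i \<sigma> = \<tau> then (-1)^i * c \<sigma> else 0)"

definition lip_cycle :: "'a::metric_space set \<Rightarrow> nat \<Rightarrow> 'a chain \<Rightarrow> bool" where
  "lip_cycle S m c \<longleftrightarrow> lip_chain S m c \<and> (0 < m \<longrightarrow> boundary m c = (\<lambda>_. 0))"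

definition multiplicity :: "nat \<Rightarrow> ((nat \<Rightarrow> real) \<Rightarrow> 'a) \<Rightarrow> 'a \<Rightarrow> ennreal" where
  "multiplicity k \<sigma> y = (let P = {x\<in>simplex_k k. \<sigma> x = y} in
     if finite P then of_nat (card P) else \<infinity>)"

definition simplex_volume :: "nat \<Rightarrow> ((nat \<Rightarrow> real) \<Rightarrow> 'a::metric_space) \<Rightarrow> ennreal" where
  "simplex_volume k \<sigma> = (\<integral>\<^sup>+ y. multiplicity k \<sigma> y \<partial>hausdorff_measure k)"

definition mass :: "nat \<Rightarrow> 'a::metric_space chain \<Rightarrow> ennreal" where
  "mass k c = (\<Sum>\<sigma>\<in>supp c. ennreal (real_of_int \<bar>c \<sigma>\<bar>) * simplex_volume k \<sigma>)"

definition filling_volume :: "'a::metric_space set \<Rightarrow> nat \<Rightarrow> 'a chain \<Rightarrow> ennreal" where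
  "filling_volume S m \<alpha> = Inf {mass (Suc m) \<beta> | \<beta>. lip_chain S (Suc m) \<beta> \<and> boundary (Suc m) \<beta> = \<alpha>}"

text \<open>Z is undistorted (in the whole space X = UNIV) up to dimension n+1.\<close>
definition undistorted_up_to :: "'a::metric_space set \<Rightarrow> nat \<Rightarrow> bool" where
  "undistorted_up_to Z n \<longleftrightarrow> (\<exists>C::real. 0 \<le> C \<and> (\<forall>m\<le>n. \<forall>\<alpha>. lip_cycle Z m \<alpha> \<longrightarrow>
       filling_volume Z m \<alpha> \<le> ennreal C * filling_volume (UNIV::'a set) m \<alpha>))"

end

theory Submission
  imports Defs "HOL-Library.Poly_Mapping"
begin

text \<open>Hypothesis (2) implies (1): a Lipschitz sphere in \<open>Z\<close> bounds a Lipschitz disk in \<open>X\<close>, and the part of the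
  disk lying in a complementary component is replaced by a Lipschitz extension with values in the frontier of
  that component. Under (1), let \<open>\<beta>\<close> fill an \<open>m\<close>-cycle \<open>\<alpha>\<close> of \<open>Z\<close> in \<open>X\<close>, and subdivide \<open>\<alpha>\<close> to mesh \<open>\<epsilon>\<close>. Finite
  Assouad-Nagata dimension yields a partition of unity of bounded multiplicity whose pieces have size
  comparable to \<open>max \<epsilon> (dist x Z)\<close>; it maps \<open>\<beta>\<close> to a simplicial complex whose \<open>(m+1)\<close>-skeleton is sent to \<open>Z\<close> by
  Lipschitz connectivity. Pushing to the skeleton after reweighting the barycentric coordinates by random
  factors in \<open>[1,2]\<close> costs on average a bounded factor of volume, as the inverse distance to the singular set has
  bounded \<open>(m+1)\<close>-st moment. A prism and cones repair the boundary; they cost \<open>O(\<epsilon>^(m+1))\<close> per simplex of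
  the subdivision, which tends to 0 in total.\<close>

section \<open>Lipschitz maps for the l1 metric\<close>

type_synonym pt = "nat => real"

abbreviation "Sx == simplex_k"

definition l1 :: "nat => pt => pt => real" where
 "l1 k x y = (SUM i<=k. abs (x i - y i))"

definition lipl :: "nat => real => pt set => (pt => 'a::metric_space) => bool" where
 "lipl k L A f = (0 <= L & (ALL x:A. ALL y:A. dist (f x) (f y) <= L * l1 k x y))"

lemma l1_nonneg [simp]: "0 <= l1 k x y"
 by (simp add: l1_def sum_nonneg)

lemma l1_same [simp]: "l1 k x x = 0"
 by (simp add: l1_def)

lemma l1_commute: "l1 k x y = l1 k y x"
 by (simp add: l1_def abs_minus_commute)

lemma l1_triangle: "l1 k x z <= l1 k x y + l1 k y z"
 unfolding l1_def sum.distrib[symmetric] by (rule sum_mono) linarith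

lemma l1_component: "i <= k ==> abs (x i - y i) <= l1 k x y"
 unfolding l1_def by (rule member_le_sum) auto

lemma l1_le_bound:
 assumes "!!i. i <= k ==> abs (x i - y i) <= s"
 shows "l1 k x y <= real (Suc k) * s"
proof -
 have "l1 k x y <= (SUM i<=k. s)" unfolding l1_def using assms by (intro sum_mono) auto
 thus ?thesis by simp
qed

definition seg :: "pt => pt => real => pt" where
 "seg x y t = (%i. (1 - t) * x i + t * y i)"

definition seg_convex :: "pt set => bool" where
 "seg_convex S = (ALL x:S. ALL y:S. ALL t:{0..1}. seg x y t : S)"

lemma seg_0 [simp]: "seg x y 0 = x" and seg_1 [simp]: "seg x y 1 = y"
 by (simp_all add: seg_def)

lemma seg_convexD: "seg_convex S ==> x : S ==> y : S ==> t : {0..1} ==> seg x y t : S"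
 by (simp add: seg_convex_def)

lemma l1_seg: "l1 N (seg x y t) (seg x y u) = abs (t - u) * l1 N x y"
proof -
 have "seg x y t i - seg x y u i = (u - t)*(x i - y i)" for i by (simp add: seg_def algebra_simps)
 thus ?thesis by (simp add: l1_def abs_mult sum_distrib_left abs_minus_commute)
qed

lemma edist_le_l1: "edist k x y <= l1 k x y"
 using L2_set_le_sum_abs[of "%i. x i - y i" "{..k}"] by (simp add: edist_def l1_def L2_set_def)

lemma l1_le_edist: "l1 k x y <= real (Suc k) * edist k x y"
proof (rule l1_le_bound)
 fix i assume "i <= k"
 hence "(x i - y i)^2 <= (SUM i<=k. (x i - y i)^2)" by (intro member_le_sum) auto
 thus "abs (x i - y i) <= edist k x y" unfolding edist_def by (metis real_sqrt_abs real_sqrt_le_mono)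
qed

lemma edist_nonneg [simp]: "0 <= edist k x y"
 by (simp add: edist_def sum_nonneg)

lemma edist_triangle: "edist k x z <= edist k x y + edist k y z"
 using L2_set_triangle_ineq[of "%i. x i - y i" "%i. y i - z i" "{..k}"]
 by (simp add: edist_def L2_set_def)

lemma liplI: "0 <= L ==> (!!x y. x : A ==> y : A ==> dist (f x) (f y) <= L * l1 k x y) ==> lipl k L A f"
 by (simp add: lipl_def)

lemma lipl_nonneg: "lipl k L A f ==> 0 <= L"
 by (simp add: lipl_def)

lemma lipl_dist: "lipl k L A f ==> x : A ==> y : A ==> dist (f x) (f y) <= L * l1 k x y"
 by (simp add: lipl_def)

lemma lipl_mono: "lipl k L A f ==> B <= A ==> L <= M ==> lipl k M B f"
 unfolding lipl_def by (meson l1_nonneg mult_right_mono order_trans subsetD)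

lemma lipl_cong: "(!!x. x : A ==> f x = g x) ==> lipl k L A f = lipl k L A g"
 unfolding lipl_def by auto

lemma lipl_compose:
 assumes f: "lipl k L A f" and h: "h ` B <= A" "0 <= M" "!!u v. u : B ==> v : B ==> l1 k (h u) (h v) <= M * l1 j u v"
 shows "lipl j (L * M) B (f \<circ> h)"
proof (rule liplI)
 show "0 <= L * M" using lipl_nonneg[OF f] h(2) by simp
 fix u v assume uv: "u : B" "v : B"
 have "dist (f (h u)) (f (h v)) <= L * l1 k (h u) (h v)" using h(1) uv by (intro lipl_dist[OF f]) auto
 also have "... <= L*(M * l1 j u v)" using h(3)[OF uv] lipl_nonneg[OF f] by (rule mult_left_mono)
 finally show "dist ((f \<circ> h) u) ((f \<circ> h) v) <= L * M * l1 j u v" by simp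
qed

lemma lipl_imp_lip_on: "lipl k L A f ==> lip_on_k k (real (Suc k) * L) A f"
 unfolding lip_on_k_def
proof (intro conjI ballI)
 assume f: "lipl k L A f"
 show "0 <= real (Suc k) * L" using lipl_nonneg[OF f] by simp
 fix x y assume "x : A" "y : A"
 hence "dist (f x) (f y) <= L * l1 k x y" by (rule lipl_dist[OF f])
 also have "... <= L*(real (Suc k) * edist k x y)" using lipl_nonneg[OF f] l1_le_edist by (intro mult_left_mono) auto
 finally show "dist (f x) (f y) <= real (Suc k) * L * edist k x y" by (simp add: mult_ac)
qed

lemma lip_on_imp_lipl: "lip_on_k k L A f ==> lipl k L A f"
 unfolding lipl_def lip_on_k_def by (meson edist_le_l1 mult_left_mono order_trans)

lemma lip_on_k_mono: "lip_on_k k L A f ==> L <= M ==> lip_on_k k M A f"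
 unfolding lip_on_k_def by (meson edist_nonneg mult_right_mono order_trans)

lemma lipl_Inf:
 assumes f: "lipl k L A f"
 shows "lipl k (Inf {L. lipl k L A f}) A f"
proof (rule liplI)
 let ?S = "{L. lipl k L A f}"
 have ne: "?S ~= {}" using f by auto
 show nonneg: "0 <= Inf ?S" using ne by (rule cInf_greatest) (auto dest: lipl_nonneg)
 fix x y assume xy: "x : A" "y : A"
 show "dist (f x) (f y) <= Inf ?S * l1 k x y"
 proof (cases "l1 k x y = 0")
  case True
  thus ?thesis using lipl_dist[OF f xy] by simp
 next
  case False
  hence pos: "0 < l1 k x y" using l1_nonneg[of k x y] by linarith
  have "dist (f x) (f y)/l1 k x y <= Inf ?S"
   using ne lipl_dist[OF _ xy] pos by (intro cInf_greatest) (auto simp: pos_divide_le_eq)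
  thus ?thesis using pos by (simp add: pos_divide_le_eq)
 qed
qed

text \<open>Extension theorems provide an extension for each Lipschitz constant of \<open>f\<close>; applied to the least one,
 they provide one extension for all of them.\<close>

lemma uniform_extension:
 assumes "lipl k L A f" and "0 <= C"
  and "!!M. lipl k M A f ==> EX g. P g & lipl k (C * M) B g"
 shows "EX g. P g & (ALL M. lipl k M A f --> lipl k (C * M) B g)"
proof -
 let ?I = "Inf {L. lipl k L A f}"
 from lipl_Inf[OF assms(1)] assms(3) obtain g where g: "P g" "lipl k (C*?I) B g" by blast
 have "lipl k (C * M) B g" if "lipl k M A f" for M
 proof -
  have "?I <= M" using that by (intro cInf_lower) (auto simp: bdd_below_def lipl_def)
  thus ?thesis using g(2) assms(2) by (intro lipl_mono[OF g(2)]) (auto intro: mult_left_mono)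
 qed
 thus ?thesis using g(1) by blast
qed

lemma lip_connected_constD:
 assumes "lip_connected_const Y n c" "k <= n" "f ` sphere_k k <= Y" "lip_on_k k L (sphere_k k) f"
 obtains g where "g ` disk_k1 k <= Y" "ALL x:sphere_k k. g x = f x" "lip_on_k k (c * L) (disk_k1 k) g"
 using assms(1)[unfolded lip_connected_const_def, rule_format, OF assms(2) conjI[OF assms(3,4)]]
 by (elim exE conjE)

lemma lip_connected_const_nonneg:
 fixes Y :: "'a::metric_space set"
 assumes "lip_connected_const Y n c" and "Y ~= {}"
 shows "0 <= c"
proof -
 obtain y where y: "y : Y" using assms by auto
 have "lip_on_k 0 1 (sphere_k 0) (%_. y)" by (simp add: lip_on_k_def)
 moreover have "(%_. y) ` sphere_k 0 <= Y" using y by auto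
 ultimately obtain g :: "pt => 'a" where "lip_on_k 0 (c*1) (disk_k1 0) g"
  using lip_connected_constD[OF assms(1) le0] by metis
 thus ?thesis by (auto simp: lip_on_k_def)
qed

lemma local_to_global_lipschitz:
 fixes phi :: "real => 'a::metric_space"
 assumes "!!t0. t0 : {0..1} ==> eventually (%t. t : {0..1} --> dist (phi t) (phi t0) <= M * abs (t - t0)) (nhds t0)"
 shows "dist (phi 0) (phi 1) <= M"
proof -
 define lip where "lip = (%a b. 0 <= a & b <= 1 --> dist (phi a) (phi b) <= M*(b - a))"
 have "lip 0 1"
 proof (rule Bolzano)
  fix a b c assume "lip a b" "lip b c" "a <= b" "b <= c"
  thus "lip a c" using dist_triangle[of "phi a" "phi c" "phi b"] by (auto simp: lip_def algebra_simps)
 next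
  fix x :: real assume "0 <= x" "x <= 1"
  then obtain d where d: "d > 0" "!!t. abs (t - x) < d ==> t : {0..1} ==> dist (phi t) (phi x) <= M * abs (t - x)"
   using assms[of x] by (auto simp: eventually_nhds_metric dist_real_def)
  have "lip a b" if ab: "a <= x" "x <= b" "b - a < d" for a b
   using d(2)[of a] d(2)[of b] ab dist_triangle2[of "phi a" "phi b" "phi x"] by (auto simp: lip_def algebra_simps)
  thus "EX d>0. ALL a b. a <= x & x <= b & b - a < d --> lip a b" using d(1) by blast
 qed simp
 thus ?thesis by (simp add: lip_def)
qed

lemma lipl_of_local:
 assumes "0 <= M" "seg_convex S"
  and loc: "!!x y t0. x : S ==> y : S ==> t0 : {0..1} ==> eventually (%t. t : {0..1} -->
    dist (g (seg x y t)) (g (seg x y t0)) <= M * l1 k (seg x y t) (seg x y t0)) (nhds t0)"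
 shows "lipl k M S g"
proof (rule liplI[OF assms(1)])
 fix x y assume xy: "x : S" "y : S"
 have "dist (g (seg x y 0)) (g (seg x y 1)) <= M * l1 k x y"
  using loc[OF xy] by (intro local_to_global_lipschitz) (simp add: l1_seg mult_ac)
 thus "dist (g x) (g y) <= M * l1 k x y" by simp
qed

section \<open>Extension from the boundary of a cube\<close>

definition cube :: "nat => pt set" where
 "cube k = {x. (ALL i>k. x i = 0) & (ALL i<=k. abs (x i) <= 1)}"

definition cube_bd :: "nat => pt set" where
 "cube_bd k = {x : cube k. EX i<=k. abs (x i) = 1}"

definition supn :: "nat => pt => real" where
 "supn k x = Max ((%i. abs (x i)) ` {..k})"

definition enorm :: "nat => pt => real" where
 "enorm k x = edist k x (%_. 0)"

lemma cube_bdD: "x : cube_bd k ==> x : cube k"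
 by (simp add: cube_bd_def)

lemma supn_ge: "i <= k ==> abs (x i) <= supn k x"
 unfolding supn_def by (intro Max_ge) auto

lemma supn_attained: "EX i<=k. abs (x i) = supn k x"
proof -
 have "supn k x : (%i. abs (x i)) ` {..k}" unfolding supn_def by (intro Max_in) auto
 thus ?thesis by auto
qed

lemma supn_lip: "abs (supn k x - supn k y) <= l1 k x y"
proof -
 obtain i where i: "i <= k" "abs (x i) = supn k x" using supn_attained by blast
 obtain j where j: "j <= k" "abs (y j) = supn k y" using supn_attained by blast
 have "abs (y i) <= supn k y" "abs (x j) <= supn k x" "abs (x i - y i) <= l1 k x y" "abs (x j - y j) <= l1 k x y"
  using i j supn_ge l1_component by auto
 thus ?thesis using i j by linarith
qed

lemma supn_scale: "0 <= t ==> supn k (%i. t * x i) = t * supn k x"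
proof -
 assume t: "0 <= t"
 obtain i where i: "i <= k" "abs (x i) = supn k x" using supn_attained by blast
 obtain j where j: "j <= k" "abs (t * x j) = supn k (%i. t * x i)" using supn_attained[of k "%i. t * x i"] by blast
 have "abs (t * x i) <= supn k (%i. t * x i)" by (rule supn_ge[OF i(1), where x="%i. t * x i"])
 moreover have "t * abs (x j) <= t * supn k x" using t j supn_ge by (intro mult_left_mono) auto
 ultimately show ?thesis using i j t by (simp add: abs_mult)
qed

lemma l1_le_supn: "l1 k x (%_. 0) <= real (Suc k) * supn k x"
 by (rule l1_le_bound) (simp add: supn_ge)

lemma l1_le_enorm: "l1 k x (%_. 0) <= real (Suc k) * enorm k x"
 unfolding enorm_def by (rule l1_le_edist)

lemma enorm_sq: "(enorm k x)^2 = (SUM i<=k. (x i)^2)"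
 by (simp add: enorm_def edist_def sum_nonneg)

lemma enorm_nonneg [simp]: "0 <= enorm k x"
 by (simp add: enorm_def)

lemma enorm_scale: "0 <= t ==> enorm k (%i. t * x i) = t * enorm k x"
 by (simp add: enorm_def edist_def power_mult_distrib sum_distrib_left[symmetric] real_sqrt_mult)

lemma enorm_lip: "abs (enorm k x - enorm k y) <= l1 k x y"
proof -
 have "edist k y x = edist k x y" by (simp add: edist_def power2_commute)
 thus ?thesis using edist_triangle[of k x "%_. 0" y] edist_triangle[of k y "%_. 0" x] edist_le_l1[of k x y]
  unfolding enorm_def by linarith
qed

lemma supn_le_enorm: "supn k x <= enorm k x"
proof -
 obtain i where i: "i <= k" "abs (x i) = supn k x" using supn_attained by blast
 have "(x i)^2 <= (SUM i<=k. (x i)^2)" using i by (intro member_le_sum) auto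
 hence "sqrt ((x i)^2) <= enorm k x" unfolding enorm_def edist_def by (simp only: diff_zero real_sqrt_le_iff)
 thus ?thesis using i by simp
qed

lemma enorm_le_supn: "enorm k x <= real (Suc k) * supn k x"
 using edist_le_l1[of k x "%_. 0"] l1_le_supn[of k x] by (simp add: enorm_def)

lemma disk_iff: "x : disk_k1 k \<longleftrightarrow> (ALL i>k. x i = 0) & enorm k x <= 1"
proof -
 have "(enorm k x)\<^sup>2 <= 1 \<longleftrightarrow> enorm k x <= 1"
  using enorm_nonneg[of k x] by (metis abs_of_nonneg abs_square_le_1)
 thus ?thesis unfolding disk_k1_def by (simp add: enorm_sq)
qed

lemma disk_convex: "seg_convex (disk_k1 k)"
 unfolding seg_convex_def
proof (intro ballI)
 fix x y and t :: real assume xy: "x : disk_k1 k" "y : disk_k1 k" and t: "t : {0..1}"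
 have "enorm k (seg x y t) <= enorm k (%i. (1 - t) * x i) + enorm k (%i. t * y i)"
  using L2_set_triangle_ineq[of "%i. (1 - t) * x i" "%i. t * y i" "{..k}"] by (simp add: seg_def enorm_def edist_def L2_set_def)
 also have "... = (1 - t) * enorm k x + t * enorm k y" using t by (simp add: enorm_scale)
 also have "... <= 1" using xy t by (intro convex_bound_le) (auto simp: disk_iff)
 finally show "seg x y t : disk_k1 k" using xy by (auto simp: disk_iff seg_def)
qed

lemma disk_subset_cube: "disk_k1 k <= cube k"
 using supn_ge supn_le_enorm by (fastforce simp: disk_iff cube_def intro: order_trans)

lemma sphere_iff: "x : sphere_k k \<longleftrightarrow> (ALL i>k. x i = 0) & enorm k x = 1"
proof -
 have "(enorm k x)\<^sup>2 = 1 \<longleftrightarrow> enorm k x = 1" unfolding power2_eq_1_iff using enorm_nonneg[of k x] by (smt (verit))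
 thus ?thesis unfolding sphere_k_def by (simp add: enorm_sq)
qed

lemma l1_normalize:
 assumes r: "0 < r" "r <= a" "r <= b" and ab: "abs (a - b) <= l1 k x y" and y: "l1 k y (%_. 0) <= m * b"
 shows "l1 k (%i. x i/a) (%i. y i/b) <= (1 + m)/r * l1 k x y"
proof -
 have pos: "0 < a" "0 < b" using r by auto
 have m: "0 <= m" using y pos l1_nonneg[of k y "%_. 0"] by (smt (verit) mult_neg_pos)
 have component: "abs (x i/a - y i/b) <= abs (x i - y i)/r + abs (y i) * l1 k x y/(a * b)" for i
 proof -
  have "x i/a - y i/b = (x i - y i)/a + y i*(b - a)/(a * b)"
   using pos by (simp add: field_simps)
  also have "abs (...) <= abs (x i - y i)/a + abs (y i) * abs (b - a)/(a * b)"
   using pos by (intro order_trans[OF abs_triangle_ineq]) (simp add: abs_mult)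
  also have "abs (x i - y i)/a <= abs (x i - y i)/r" using r pos by (intro divide_left_mono) auto
  also have "abs (y i) * abs (b - a)/(a * b) <= abs (y i) * l1 k x y/(a * b)"
   using pos ab by (intro divide_right_mono mult_left_mono) auto
  finally show ?thesis by simp
 qed
 have "l1 k (%i. x i/a) (%i. y i/b) <= (SUM i<=k. abs (x i - y i)/r + abs (y i) * l1 k x y/(a * b))"
  unfolding l1_def[of k "%i. x i/a"] by (intro sum_mono component)
 also have "... = l1 k x y/r + l1 k y (%_. 0) * l1 k x y/(a * b)"
  by (simp add: sum.distrib l1_def sum_divide_distrib sum_distrib_right)
 also have "l1 k y (%_. 0) * l1 k x y/(a * b) <= (m * b) * l1 k x y/(a * b)"
  using pos y by (intro divide_right_mono mult_right_mono) auto
 also have "(m * b) * l1 k x y/(a * b) = m * l1 k x y/a" using pos by simp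
 also have "... <= m * l1 k x y/r" using r pos m by (intro divide_left_mono) auto
 finally show ?thesis by (simp add: distrib_right add_divide_distrib)
qed

definition cube_proj :: "nat => pt => pt" where
 "cube_proj k u = (%i. u i/supn k u)"

definition disk_proj :: "nat => pt => pt" where
 "disk_proj k v = (%i. v i/max (enorm k v) 1)"

lemma supn_sphere_ge: "u : sphere_k k ==> 1/real (Suc k) <= supn k u"
 using enorm_le_supn[of k u] by (simp add: sphere_iff pos_divide_le_eq mult.commute)

lemma cube_proj_cube_bd:
 assumes u: "u : sphere_k k" shows "cube_proj k u : cube_bd k"
proof -
 have pos: "0 < supn k u" using supn_sphere_ge[OF u] by (meson divide_pos_pos less_le_trans of_nat_0_less_iff zero_less_Suc zero_less_one)
 obtain i where i: "i <= k" "abs (u i) = supn k u" using supn_attained by blast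
 have "abs (cube_proj k u i) = 1" using i pos by (simp add: cube_proj_def)
 moreover have "abs (cube_proj k u j) <= 1" if "j <= k" for j using supn_ge[OF that, of u] pos by (simp add: cube_proj_def)
 moreover have "cube_proj k u j = 0" if "j > k" for j using that u by (simp add: cube_proj_def sphere_k_def)
 ultimately show ?thesis using i by (auto simp: cube_bd_def cube_def)
qed

lemma cube_proj_lip:
 assumes "u : sphere_k k" "v : sphere_k k"
 shows "l1 k (cube_proj k u) (cube_proj k v) <= 2 * real (Suc k)^2 * l1 k u v"
proof -
 let ?d = "real (Suc k)"
 have "l1 k (cube_proj k u) (cube_proj k v) <= (1 + ?d)/(1/?d) * l1 k u v"
  unfolding cube_proj_def using supn_sphere_ge assms supn_lip l1_le_supn by (intro l1_normalize) auto
 also have "... <= 2*?d^2 * l1 k u v" by (intro mult_right_mono) (simp_all add: power2_eq_square field_simps)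
 finally show ?thesis .
qed

lemma disk_proj_disk:
 assumes "v : cube k" shows "disk_proj k v : disk_k1 k"
proof -
 have "enorm k (disk_proj k v) <= 1"
  using enorm_scale[of "1/max (enorm k v) 1" k v] by (simp add: disk_proj_def)
 thus ?thesis using assms by (auto simp: disk_iff cube_def disk_proj_def)
qed

lemma disk_proj_lip: "l1 k (disk_proj k u) (disk_proj k v) <= 2 * real (Suc k) * l1 k u v"
proof -
 have "l1 k (disk_proj k u) (disk_proj k v) <= (1 + real (Suc k))/1 * l1 k u v"
  unfolding disk_proj_def
 proof (rule l1_normalize)
  show "abs (max (enorm k u) 1 - max (enorm k v) 1) <= l1 k u v" using enorm_lip[of k u v] by linarith
  have "real (Suc k) * enorm k v <= real (Suc k) * max (enorm k v) 1" by (intro mult_left_mono) auto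
  thus "l1 k v (%_. 0) <= real (Suc k) * max (enorm k v) 1" using l1_le_enorm[of k v] by linarith
 qed auto
 also have "... <= 2 * real (Suc k) * l1 k u v" by (intro mult_right_mono) auto
 finally show ?thesis .
qed

lemma cube_proj_disk_proj:
 assumes v: "v : cube_bd k"
 shows "disk_proj k v : sphere_k k" "cube_proj k (disk_proj k v) = v"
proof -
 obtain i where "i <= k" "abs (v i) = 1" using v by (auto simp: cube_bd_def)
 hence "1 <= supn k v" using supn_ge by metis
 moreover have "supn k v <= 1" using v supn_attained[of k v] by (auto simp: cube_bd_def cube_def)
 ultimately have sup1: "supn k v = 1" by simp
 hence e1: "1 <= enorm k v" using supn_le_enorm[of k v] by simp
 hence scaled: "disk_proj k v = (%i. (1/enorm k v) * v i)" by (simp add: disk_proj_def max_def)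
 have "enorm k (disk_proj k v) = 1" unfolding scaled using e1 enorm_scale[of "1/enorm k v" k v] by simp
 thus "disk_proj k v : sphere_k k" using v by (simp add: sphere_iff disk_proj_def cube_bd_def cube_def)
 have "supn k (disk_proj k v) = 1/enorm k v" unfolding scaled using supn_scale[of "1/enorm k v" k v] sup1 by simp
 thus "cube_proj k (disk_proj k v) = v" using e1 by (auto simp: cube_proj_def scaled)
qed

definition cube_const :: "nat => real => real" where
 "cube_const k c = 4 * real (Suc k)^4 * abs c"

lemma cube_const_nonneg: "0 <= cube_const k c"
 by (simp add: cube_const_def)

lemma cube_const_mono: "k <= N ==> cube_const k c <= cube_const N c"
 unfolding cube_const_def by (intro mult_right_mono mult_left_mono power_mono) auto

lemma cube_extension:
 assumes Y: "lip_connected_const Y n c" and k: "k <= n" and f: "f ` cube_bd k <= Y"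
  and lf: "lipl k L (cube_bd k) f"
 shows "EX g. (g ` cube k <= Y & (ALL x:cube_bd k. g x = f x)) & lipl k (cube_const k c * L) (cube k) g"
proof -
 let ?d = "real (Suc k)"
 let ?f = "f \<circ> cube_proj k"
 have "lipl k (L*(2*?d^2)) (sphere_k k) ?f"
  using cube_proj_cube_bd cube_proj_lip by (intro lipl_compose[OF lf]) auto
 hence "lip_on_k k (?d*(L*(2*?d^2))) (sphere_k k) ?f" by (rule lipl_imp_lip_on)
 moreover have "?f ` sphere_k k <= Y" using cube_proj_cube_bd f by auto
 ultimately obtain g where g: "g ` disk_k1 k <= Y" "ALL x:sphere_k k. g x = ?f x"
   and lip_g: "lip_on_k k (c*(?d*(L*(2*?d^2)))) (disk_k1 k) g"
  using lip_connected_constD[OF Y k] by metis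
 have "lipl k (c*(?d*(L*(2*?d^2)))*(2*?d)) (cube k) (g \<circ> disk_proj k)"
  using disk_proj_disk disk_proj_lip by (intro lipl_compose[OF lip_on_imp_lipl[OF lip_g]]) auto
 moreover have "c*(?d*(L*(2*?d^2)))*(2*?d) <= cube_const k c * L"
 proof -
  have "c*(?d*(L*(2*?d^2)))*(2*?d) = c*(4*?d^4 * L)" by (simp add: power2_eq_square power4_eq_xxxx)
  also have "... <= abs c*(4*?d^4 * L)" using lipl_nonneg[OF lf] by (intro mult_right_mono) auto
  finally show ?thesis by (simp add: cube_const_def mult_ac)
 qed
 ultimately have "lipl k (cube_const k c * L) (cube k) (g \<circ> disk_proj k)" by (blast intro: lipl_mono)
 moreover have "(g \<circ> disk_proj k) ` cube k <= Y" using disk_proj_disk g(1) by auto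
 moreover have "ALL x:cube_bd k. (g \<circ> disk_proj k) x = f x" using cube_proj_disk_proj g(2) by auto
 ultimately show ?thesis by blast
qed

section \<open>Cells of a cubical grid\<close>

text \<open>\<open>cell N s x\<close> is the smallest closed cell of the grid of mesh \<open>s\<close> that contains \<open>x\<close>.\<close>

definition free :: "nat => real => pt => nat set" where
 "free N s x = {i. i <= N & x i/s ~: \<int>}"

definition cell :: "nat => real => pt => pt set" where
 "cell N s x = {y. ALL i. if i : free N s x
   then s * of_int (floor (x i/s)) <= y i & y i <= s*(of_int (floor (x i/s)) + 1) else y i = x i}"

definition cell_bd :: "nat => real => pt => pt set" where
 "cell_bd N s x = {y : cell N s x. cell N s y ~= cell N s x}"

lemma finite_free [simp]: "finite (free N s x)"
 unfolding free_def by (rule finite_subset[of _ "{..N}"]) auto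

lemma free_le: "i : free N s x ==> i <= N"
 by (simp add: free_def)

lemma card_free_le: "card (free N s x) <= Suc N"
 using card_mono[of "{..N}" "free N s x"] by (auto simp: free_def)

lemma carD1: "y : cell N s x ==> i : free N s x ==> s * of_int (floor (x i/s)) <= y i & y i <= s*(of_int (floor (x i/s)) + 1)"
 unfolding cell_def by (auto split: if_splits)

lemma carD2: "y : cell N s x ==> i ~: free N s x ==> y i = x i"
 unfolding cell_def by (auto split: if_splits)

lemma carI: "(!!i. i : free N s x ==> s * of_int (floor (x i/s)) <= y i & y i <= s*(of_int (floor (x i/s)) + 1))
  ==> (!!i. i ~: free N s x ==> y i = x i) ==> y : cell N s x"
 unfolding cell_def by auto

lemma cell_bdD: "y : cell_bd N s x ==> y : cell N s x"
 by (simp add: cell_bd_def)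

context
 fixes N :: nat and s :: real
 assumes s: "0 < s"
begin

lemma cell_self: "x : cell N s x"
proof (rule carI)
 fix i
 have "s * of_int (floor (x i/s)) <= s*(x i/s)" "s*(x i/s) <= s*(of_int (floor (x i/s)) + 1)"
  using s by (intro mult_left_mono; linarith)+
 thus "s * of_int (floor (x i/s)) <= x i & x i <= s*(of_int (floor (x i/s)) + 1)"
  using s by simp
qed simp

lemma cell_floor_bounds:
 assumes "y : cell N s x" "i : free N s x"
 shows "of_int (floor (x i/s)) <= y i/s" "y i/s <= of_int (floor (x i/s)) + 1"
 using carD1[OF assms] s by (simp_all add: pos_le_divide_eq pos_divide_le_eq mult.commute)

lemma cell_floor:
 assumes y: "y : cell N s x" "i : free N s x" "i : free N s y"
 shows "floor (y i/s) = floor (x i/s)"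
proof -
 have "y i/s ~= of_int (floor (x i/s) + 1)"
  using y(3) by (metis (mono_tags, lifting) Ints_of_int free_def mem_Collect_eq)
 thus ?thesis using cell_floor_bounds[OF y(1,2)] by (intro floor_unique) auto
qed

lemma free_mono: "y : cell N s x ==> free N s y <= free N s x"
proof
 fix i assume y: "y : cell N s x" and i: "i : free N s y"
 show "i : free N s x"
 proof (rule ccontr)
  assume n: "i ~: free N s x"
  thus False using carD2[OF y n] i by (simp add: free_def)
 qed
qed

lemma cell_trans: "y : cell N s x ==> cell N s y <= cell N s x"
proof
 fix z assume y: "y : cell N s x" and z: "z : cell N s y"
 show "z : cell N s x"
 proof (rule carI)
  fix i assume i: "i : free N s x"
  show "s * of_int (floor (x i/s)) <= z i & z i <= s*(of_int (floor (x i/s)) + 1)"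
  proof (cases "i : free N s y")
   case True
   thus ?thesis using carD1[OF z True] cell_floor[OF y i True] by simp
  next
   case False
   thus ?thesis using carD2[OF z False] carD1[OF y i] by simp
  qed
 next
  fix i assume i: "i ~: free N s x"
  hence "i ~: free N s y" using free_mono[OF y] by auto
  thus "z i = x i" using carD2[OF z] carD2[OF y i] by simp
 qed
qed

lemma cell_eq:
 assumes y: "y : cell N s x" "free N s y = free N s x"
 shows "cell N s y = cell N s x"
proof (rule equalityI[OF cell_trans[OF y(1)] cell_trans])
 show "x : cell N s y"
 proof (rule carI)
  fix i assume i: "i : free N s y"
  thus "s * of_int (floor (y i/s)) <= x i & x i <= s*(of_int (floor (y i/s)) + 1)"
   using cell_floor[OF y(1) _ i] y(2) carD1[OF cell_self, of i x] by simp
 next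
  fix i assume "i ~: free N s y"
  thus "x i = y i" using carD2[OF y(1)] y(2) by simp
 qed
qed

lemma cell_eq_iff: "y : cell N s x ==> cell N s y = cell N s x \<longleftrightarrow> free N s y = free N s x"
 using cell_eq free_mono cell_self by blast

lemma cell_bd_iff: "y : cell_bd N s x \<longleftrightarrow> y : cell N s x & (EX i:free N s x. y i/s : \<int>)"
 using cell_eq_iff[of y x] free_mono[of y x] by (auto simp: cell_bd_def) (auto simp: free_def)

lemma cell_bd_card_less:
 assumes "y : cell_bd N s x" shows "card (free N s y) < card (free N s x)"
proof (rule psubset_card_mono)
 show "free N s y < free N s x" using assms free_mono[of y x] unfolding cell_bd_iff by (auto simp: free_def)
qed simp

lemma cell_diam:
 assumes y: "y : cell N s x" and z: "z : cell N s x"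
 shows "l1 N y z <= real (Suc N) * s"
proof (rule l1_le_bound)
 fix i assume "i <= N"
 show "abs (y i - z i) <= s"
 proof (cases "i : free N s x")
  case True
  thus ?thesis using carD1[OF y True] carD1[OF z True] unfolding distrib_left abs_le_iff by linarith
 next
  case False
  thus ?thesis using carD2[OF y False] carD2[OF z False] s by simp
 qed
qed

lemma cell_update:
 assumes "i : free N s x" "y : cell N s x" "z : cell N s x"
 shows "y(i := z i) : cell N s x"
 using assms carD1 carD2 by (intro carI) (auto simp: carD1 carD2)

lemma cell_facet:
 assumes i: "i : free N s x" and w: "w : cell N s x" "w i/s : \<int>"
 shows "EX v:cell_bd N s x. ALL y:cell N s x. y i = w i --> y : cell N s v"
proof -
 let ?v = "x(i := w i)"
 have "?v : cell N s x" by (rule cell_update[OF i cell_self w(1)])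
 hence v: "?v : cell_bd N s x" using i w(2) unfolding cell_bd_iff by auto
 have fr: "free N s ?v = free N s x - {i}" using w(2) by (auto simp: free_def)
 have "y : cell N s ?v" if y: "y : cell N s x" "y i = w i" for y
 proof (rule carI)
  fix j assume "j : free N s ?v"
  thus "s * of_int (floor (?v j/s)) <= y j & y j <= s*(of_int (floor (?v j/s)) + 1)"
   using fr carD1[OF y(1)] by auto
 next
  fix j assume "j ~: free N s ?v"
  thus "y j = ?v j" using fr y carD2[OF y(1)] by auto
 qed
 thus ?thesis using v by blast
qed

lemma cell_integral_coord:
 assumes "y : cell N s x" "i : free N s x" "y i/s : \<int>"
 shows "y i = s * of_int (floor (x i/s)) | y i = s*(of_int (floor (x i/s)) + 1)"
proof -
 obtain m where m: "y i/s = of_int m" using assms(3) by (auto elim: Ints_cases)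
 hence "m = floor (x i/s) | m = floor (x i/s) + 1" using cell_floor_bounds[OF assms(1,2)] by linarith
 moreover have "y i = s*(y i/s)" using s by simp
 ultimately show ?thesis using m by (metis of_int_1 of_int_add)
qed

lemma cell_vertex:
 assumes i: "i : free N s x" and w: "w : cell N s x" "w i/s : \<int>"
 shows "EX v:cell N s x. free N s v = {} & v i = w i"
proof -
 let ?v = "%j. if j = i then w i else if j : free N s x then s * of_int (floor (x j/s)) else x j"
 have "?v : cell N s x" using carD1[OF w(1) i] s i by (intro carI) auto
 moreover have "free N s ?v = {}" using w(2) s i by (auto simp: free_def split: if_splits)
 ultimately show ?thesis by (intro bexI[of _ ?v]) auto
qed

lemma cell_has_vertex: "EX v:cell N s x. free N s v = {}"
proof (cases "free N s x = {}")
 case True thus ?thesis using cell_self by blast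
next
 case False
 then obtain i where i: "i : free N s x" by blast
 let ?w = "x(i := s * of_int (floor (x i/s)))"
 have "?w : cell N s x" using i s carD1[OF cell_self i] carD1[OF cell_self] by (intro carI) auto
 moreover have "?w i/s : \<int>" using s by simp
 ultimately show ?thesis using cell_vertex[OF i] by blast
qed

context
 fixes F :: "pt => 'a::metric_space" and x :: pt and m :: real
 assumes m: "0 <= m" and face_lip: "!!y. y : cell_bd N s x ==> lipl N m (cell N s y) F"
begin

lemma dist_same_facet:
 assumes "l : free N s x" "y : cell N s x" "y l/s : \<int>" "z : cell N s x" "y l = z l"
 shows "dist (F y) (F z) <= m * l1 N y z"
proof -
 obtain v where "v : cell_bd N s x" "ALL y':cell N s x. y' l = y l --> y' : cell N s v"
  using cell_facet[OF assms(1-3)] by blast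
 thus ?thesis using face_lip assms by (auto intro: lipl_dist)
qed

lemma dist_adjacent_facets:
 assumes y: "i : free N s x" "y : cell N s x" "y i/s : \<int>" and z: "j : free N s x" "z : cell N s x" "z j/s : \<int>"
  and ij: "i ~= j"
 shows "dist (F y) (F z) <= 3 * m * l1 N y z"
proof -
 let ?u = "y(j := z j)"
 have u: "?u : cell N s x" by (rule cell_update[OF z(1) y(2) z(2)])
 have "l1 N y ?u = abs (y j - z j)"
  unfolding l1_def by (subst sum.remove[of _ j]) (use free_le[OF z(1)] in \<open>auto intro!: sum.neutral\<close>)
 hence yu: "l1 N y ?u <= l1 N y z" using l1_component[OF free_le[OF z(1)]] by metis
 have zu: "l1 N z ?u <= l1 N z y + l1 N y ?u" by (rule l1_triangle)
 have "dist (F y) (F z) <= dist (F y) (F ?u) + dist (F z) (F ?u)" by (rule dist_triangle2)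
 also have "dist (F y) (F ?u) <= m * l1 N y ?u" using dist_same_facet[OF y u] ij by simp
 also have "dist (F z) (F ?u) <= m * l1 N z ?u" using dist_same_facet[OF z u] by simp
 also have "m * l1 N y ?u + m * l1 N z ?u <= m*(3 * l1 N y z)"
  unfolding distrib_left[symmetric] using yu zu m by (intro mult_left_mono) (auto simp: l1_commute)
 finally show ?thesis by simp
qed

lemma dist_opposite_facets:
 assumes vertices: "!!v w. v : cell N s x ==> w : cell N s x ==> free N s v = {} ==> free N s w = {} ==> dist (F v) (F w) <= m * s"
  and i: "i : free N s x" and y: "y : cell N s x" "y i/s : \<int>" and z: "z : cell N s x" "z i/s : \<int>" and ne: "y i ~= z i"
 shows "dist (F y) (F z) <= real (2 * N + 3) * m * l1 N y z"
proof -
 have "abs (y i - z i) = s"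
  using cell_integral_coord[OF y(1) i y(2)] cell_integral_coord[OF z(1) i z(2)] ne s by (auto simp: distrib_left)
 hence sl: "s <= l1 N y z" using l1_component[OF free_le[OF i]] by metis
 have to_vertex: "EX v:cell N s x. free N s v = {} & dist (F u) (F v) <= m*(real (Suc N) * s)"
  if u: "u : cell N s x" "u i/s : \<int>" for u
 proof -
  obtain v where v: "v : cell N s x" "free N s v = {}" "v i = u i" using cell_vertex[OF i u] by blast
  have "dist (F u) (F v) <= m * l1 N u v" using v by (intro dist_same_facet[OF i u]) auto
  also have "... <= m*(real (Suc N) * s)" using cell_diam[OF u(1) v(1)] m by (rule mult_left_mono)
  finally show ?thesis using v by blast
 qed
 obtain v where v: "v : cell N s x" "free N s v = {}" "dist (F y) (F v) <= m*(real (Suc N) * s)" using to_vertex[OF y] by blast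
 obtain w where w: "w : cell N s x" "free N s w = {}" "dist (F z) (F w) <= m*(real (Suc N) * s)" using to_vertex[OF z] by blast
 have "dist (F v) (F w) <= m * s" by (rule vertices[OF v(1) w(1) v(2) w(2)])
 hence "dist (F y) (F z) <= real (2 * N + 3) * m * s"
  using dist_triangle[of "F y" "F z" "F v"] dist_triangle2[of "F v" "F z" "F w"] v(3) w(3) by (simp add: algebra_simps)
 also have "... <= real (2 * N + 3) * m * l1 N y z" using sl m by (intro mult_left_mono) auto
 finally show ?thesis .
qed

lemma cell_boundary_lipschitz:
 assumes vertices: "!!v w. v : cell N s x ==> w : cell N s x ==> free N s v = {} ==> free N s w = {} ==> dist (F v) (F w) <= m * s"
 shows "lipl N (real (2 * N + 3) * m) (cell_bd N s x) F"
proof (rule liplI)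
 show "0 <= real (2 * N + 3) * m" using m by simp
 fix y z assume "y : cell_bd N s x" "z : cell_bd N s x"
 then obtain i j where y: "i : free N s x" "y : cell N s x" "y i/s : \<int>" and z: "j : free N s x" "z : cell N s x" "z j/s : \<int>"
  by (auto simp: cell_bd_iff)
 have weaken: "m * l1 N y z <= real (2 * N + 3) * m * l1 N y z" "3 * m * l1 N y z <= real (2 * N + 3) * m * l1 N y z"
  using m by (intro mult_right_mono; simp add: mult_le_cancel_right1)+
 consider "i ~= j" | "i = j" "y i = z i" | "i = j" "y i ~= z i" by blast
 thus "dist (F y) (F z) <= real (2 * N + 3) * m * l1 N y z"
 proof cases
  case 1 thus ?thesis using dist_adjacent_facets[OF y z] weaken(2) by linarith
 next
  case 2 thus ?thesis using dist_same_facet[OF y z(2)] weaken(1) by linarith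
 next
  case 3 thus ?thesis using z by (intro dist_opposite_facets[OF vertices y]) auto
 qed
qed

end

context
 fixes x :: pt and k :: nat and e :: "nat => nat"
 assumes e: "bij_betw e {..k} (free N s x)"
begin

definition cell_centre :: pt where
 "cell_centre i = s*(of_int (floor (x i/s)) + 1/2)"

definition cube_to_cell :: "pt => pt" where
 "cube_to_cell v i = (if i : free N s x then cell_centre i + s/2 * v (inv_into {..k} e i) else x i)"

definition cell_to_cube :: "pt => pt" where
 "cell_to_cube y j = (if j <= k then 2/s*(y (e j) - cell_centre (e j)) else 0)"

lemma chart_index:
 shows "j <= k ==> e j : free N s x" and "j <= k ==> inv_into {..k} e (e j) = j"
  and "i : free N s x ==> inv_into {..k} e i <= k" and "i : free N s x ==> e (inv_into {..k} e i) = i"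
 using bij_betw_apply[OF e, of j] bij_betw_inv_into_left[OF e, of j]
  bij_betw_apply[OF bij_betw_inv_into[OF e], of i] bij_betw_inv_into_right[OF e, of i] by simp_all

lemma cell_radius:
 assumes y: "y : cell N s x" "i : free N s x" shows "abs (y i - cell_centre i) <= s/2"
 using carD1[OF y] unfolding cell_centre_def distrib_left abs_le_iff by simp

lemma cube_to_cell_mem:
 assumes "v : cube k" shows "cube_to_cell v : cell N s x"
proof (rule carI)
 fix i assume i: "i : free N s x"
 have "abs (v (inv_into {..k} e i)) <= 1" using assms chart_index(3)[OF i] by (auto simp: cube_def)
 hence "abs (s/2 * v (inv_into {..k} e i)) <= s/2*1" using s by (simp add: abs_mult)
 thus "s * of_int (floor (x i/s)) <= cube_to_cell v i & cube_to_cell v i <= s*(of_int (floor (x i/s)) + 1)"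
  using i unfolding cube_to_cell_def cell_centre_def by (auto simp: distrib_left)
qed (simp add: cube_to_cell_def)

lemma cube_to_cell_bd:
 assumes v: "v : cube_bd k" shows "cube_to_cell v : cell_bd N s x"
proof -
 obtain j where j: "j <= k" "abs (v j) = 1" using v by (auto simp: cube_bd_def)
 have "cube_to_cell v (e j)/s = of_int (floor (x (e j)/s)) + 1/2 + v j/2"
  using s chart_index(1,2)[OF j(1)] by (simp add: cube_to_cell_def cell_centre_def field_simps)
 moreover have "v j = 1 | v j = -1" using j by linarith
 ultimately have "cube_to_cell v (e j)/s = of_int (floor (x (e j)/s) + 1) | cube_to_cell v (e j)/s = of_int (floor (x (e j)/s))" by auto
 hence "cube_to_cell v (e j)/s : \<int>" by (metis Ints_of_int)
 thus ?thesis using chart_index(1)[OF j(1)] cube_to_cell_mem cube_bdD[OF v] unfolding cell_bd_iff by blast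
qed

lemma cell_to_cube_mem:
 assumes y: "y : cell N s x" shows "cell_to_cube y : cube k"
proof -
 have "abs (cell_to_cube y j) <= 1" if "j <= k" for j
  using cell_radius[OF y chart_index(1)[OF that]] that s by (simp add: cell_to_cube_def abs_mult del: right_diff_distrib_numeral)
 thus ?thesis by (auto simp: cube_def cell_to_cube_def)
qed

lemma cell_to_cube_bd:
 assumes y: "y : cell_bd N s x" shows "cell_to_cube y : cube_bd k"
proof -
 obtain i where i: "i : free N s x" "y i/s : \<int>" and yc: "y : cell N s x" using y by (auto simp: cell_bd_iff)
 have "abs (y i - cell_centre i) = s/2" using cell_integral_coord[OF yc i] s by (auto simp: cell_centre_def distrib_left)
 hence "abs (cell_to_cube y (inv_into {..k} e i)) = 1"
  using chart_index(3,4)[OF i(1)] s by (simp add: cell_to_cube_def abs_mult del: right_diff_distrib_numeral)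
 thus ?thesis using cell_to_cube_mem[OF yc] chart_index(3)[OF i(1)] by (auto simp: cube_bd_def)
qed

lemma cube_to_cell_to_cube:
 assumes "y : cell N s x" shows "cube_to_cell (cell_to_cube y) = y"
proof
 fix i
 show "cube_to_cell (cell_to_cube y) i = y i"
  using chart_index(3,4)[of i] carD2[OF assms, of i] s
  by (simp add: cube_to_cell_def cell_to_cube_def del: right_diff_distrib_numeral)
qed

lemma l1_cube_to_cell: "l1 N (cube_to_cell u) (cube_to_cell v) = s/2 * l1 k u v"
proof -
 have "l1 N (cube_to_cell u) (cube_to_cell v) = (SUM i:free N s x. abs (cube_to_cell u i - cube_to_cell v i))"
  unfolding l1_def by (rule sum.mono_neutral_right) (auto simp: free_def cube_to_cell_def)
 also have "... = (SUM j<=k. abs (cube_to_cell u (e j) - cube_to_cell v (e j)))"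
  by (rule sum.reindex_bij_betw[OF e, symmetric])
 also have "... = (SUM j<=k. s/2 * abs (u j - v j))"
 proof (rule sum.cong)
  fix j assume "j : {..k}"
  hence scaled: "cube_to_cell u (e j) - cube_to_cell v (e j) = s/2*(u j - v j)"
   using chart_index(1,2)[of j] by (simp add: cube_to_cell_def right_diff_distrib)
  show "abs (cube_to_cell u (e j) - cube_to_cell v (e j)) = s/2 * abs (u j - v j)" unfolding scaled abs_mult using s by simp
 qed simp
 finally show ?thesis by (simp add: l1_def sum_distrib_left)
qed

lemma l1_cell_to_cube: "l1 k (cell_to_cube y) (cell_to_cube z) <= 2/s * l1 N y z"
proof -
 have "abs (cell_to_cube y j - cell_to_cube z j) = 2/s * abs (y (e j) - z (e j))" if "j <= k" for j
 proof -
  have scaled: "cell_to_cube y j - cell_to_cube z j = 2/s*(y (e j) - z (e j))" using that by (simp add: cell_to_cube_def right_diff_distrib)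
  show ?thesis unfolding scaled abs_mult using s by simp
 qed
 hence "l1 k (cell_to_cube y) (cell_to_cube z) = (SUM j<=k. 2/s * abs (y (e j) - z (e j)))"
  unfolding l1_def by (intro sum.cong) auto
 also have "... = 2/s*(SUM i:free N s x. abs (y i - z i))"
  unfolding sum_distrib_left using sum.reindex_bij_betw[OF e, of "%i. 2/s * abs (y i - z i)"] by simp
 also have "... <= 2/s * l1 N y z" unfolding l1_def using s
  by (intro mult_left_mono sum_mono2) (auto simp: free_def)
 finally show ?thesis .
qed

end

lemma cell_extension:
 fixes f :: "pt => 'a::metric_space"
 assumes Y: "lip_connected_const Y n c" and N: "N <= n" and fr: "free N s x ~= {}"
  and f: "f ` cell_bd N s x <= Y" and lf: "lipl N L (cell_bd N s x) f"
 shows "EX g. (g ` cell N s x <= Y & (ALL y:cell_bd N s x. g y = f y)) & lipl N (cube_const N c * L) (cell N s x) g"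
proof -
 define k where "k = card (free N s x) - 1"
 have card: "card (free N s x) = Suc k" using fr by (simp add: k_def card_gt_0_iff)
 hence kN: "k <= N" using card_free_le[of N s x] by simp
 obtain e where e: "bij_betw e {..k} (free N s x)"
  using ex_bij_betw_nat_finite[OF finite_free, of N s x] card by (auto simp: atLeast0LessThan lessThan_Suc_atMost)
 let ?to = "cell_to_cube x k e" and ?from = "cube_to_cell x k e"
 have L0: "0 <= L" by (rule lipl_nonneg[OF lf])
 have "lipl k (L*(s/2)) (cube_bd k) (f \<circ> ?from)"
  using s cube_to_cell_bd[OF e] l1_cube_to_cell[OF e] by (intro lipl_compose[OF lf]) auto
 moreover have "(f \<circ> ?from) ` cube_bd k <= Y" using cube_to_cell_bd[OF e] f by auto
 ultimately obtain g where g: "g ` cube k <= Y" "ALL v:cube_bd k. g v = (f \<circ> ?from) v"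
  and lip_g: "lipl k (cube_const k c*(L*(s/2))) (cube k) g"
  using cube_extension[OF Y order_trans[OF kN N]] by metis
 have "lipl N (cube_const k c*(L*(s/2))*(2/s)) (cell N s x) (g \<circ> ?to)"
  using s cell_to_cube_mem[OF e] l1_cell_to_cube[OF e] by (intro lipl_compose[OF lip_g]) auto
 moreover have "cube_const k c*(L*(s/2))*(2/s) <= cube_const N c * L"
  using s mult_right_mono[OF cube_const_mono[OF kN] L0] by simp
 ultimately have "lipl N (cube_const N c * L) (cell N s x) (g \<circ> ?to)" by (blast intro: lipl_mono)
 moreover have "(g \<circ> ?to) ` cell N s x <= Y" using g(1) cell_to_cube_mem[OF e] by auto
 moreover have "ALL y:cell_bd N s x. (g \<circ> ?to) y = f y"
  using g(2) cell_to_cube_bd[OF e] cube_to_cell_to_cube[OF e] cell_bdD by auto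
 ultimately show ?thesis by blast
qed

end

section \<open>Extension over a subcomplex of the grid\<close>

definition skel_step :: "nat => real => real" where
 "skel_step N c = 1 + cube_const N c * real (2 * N + 3)"

definition skel_const :: "nat => real => real" where
 "skel_const N c = skel_step N c^Suc N"

lemma skel_step_ge1: "1 <= skel_step N c"
 using cube_const_nonneg by (simp add: skel_step_def)

lemma skel_const_ge1: "1 <= skel_const N c"
 unfolding skel_const_def by (rule one_le_power[OF skel_step_ge1])

text \<open>\<open>V\<close> is prescribed on the subcomplex \<open>K0\<close> and at the vertices of \<open>K1\<close>; its other values are irrelevant.\<close>

definition cell_bound :: "nat => real => pt set => (pt => 'a::metric_space) => real => pt => bool" where
 "cell_bound N s K0 V m x = (0 <= m & (ALL y:cell N s x Int K0. lipl N m (cell N s y) V) &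
   (ALL v:cell N s x. ALL w:cell N s x. free N s v = {} --> free N s w = {} --> dist (V v) (V w) <= m * s))"

lemma cell_boundI:
 assumes "0 <= m" "!!y. y : cell N s x ==> y : K0 ==> lipl N m (cell N s y) V"
  "!!v w. v : cell N s x ==> w : cell N s x ==> free N s v = {} ==> free N s w = {} ==> dist (V v) (V w) <= m * s"
 shows "cell_bound N s K0 V m x"
 using assms unfolding cell_bound_def by blast

locale cell_complex_pair =
 fixes N n :: nat and s c :: real and Y :: "'a::metric_space set" and K0 K1 :: "pt set" and V :: "pt => 'a"
 assumes s: "0 < s" and Y: "lip_connected_const Y n c" and N: "N <= n"
  and K01: "K0 <= K1" and K0_cell: "!!x. x : K0 ==> cell N s x <= K0" and K1_cell: "!!x. x : K1 ==> cell N s x <= K1"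
  and VY: "V ` K1 <= Y" and bounded: "!!x. x : K1 ==> EX m. cell_bound N s K0 V m x"
begin

definition skel :: "nat => pt set" where
 "skel i = K0 Un {x : K1. card (free N s x) <= i}"

definition extends_over :: "nat => (pt => 'a) => bool" where
 "extends_over i f = (f ` skel i <= Y & (ALL x:K0. f x = V x) & (ALL x:K1. free N s x = {} --> f x = V x) &
   (ALL x:skel i. ALL m. cell_bound N s K0 V m x --> lipl N (skel_step N c^i * m) (cell N s x) f))"

definition fills_cell :: "(pt => 'a) => pt set => (pt => 'a) => bool" where
 "fills_cell f C g = (g ` C <= Y & (ALL y:C. cell N s y ~= C --> g y = f y) &
   (ALL M. lipl N M {y : C. cell N s y ~= C} f --> lipl N (cube_const N c * M) C g))"

definition cell_filling :: "(pt => 'a) => pt set => pt => 'a" where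
 "cell_filling f C = (SOME g. fills_cell f C g)"

definition extend_step :: "nat => (pt => 'a) => pt => 'a" where
 "extend_step i f x = (if x : skel i then f x else cell_filling f (cell N s x) x)"

lemma skel_sub: "skel i <= K1" "K0 <= skel i"
 using K01 by (auto simp: skel_def)

lemma cell_skel: "x : skel i ==> cell N s x <= skel i"
proof
 fix y assume x: "x : skel i" and y: "y : cell N s x"
 have "card (free N s y) <= card (free N s x)" using free_mono[OF s y] by (intro card_mono) auto
 thus "y : skel i" using x y K0_cell[of x] K1_cell[of x] by (auto simp: skel_def)
qed

lemma cell_bd_skel:
 assumes x: "x : skel (Suc i) - skel i" shows "cell_bd N s x <= skel i"
proof
 fix y assume y: "y : cell_bd N s x"
 have "y : K1" using x cell_bdD[OF y] K1_cell skel_sub by blast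
 thus "y : skel i" using x cell_bd_card_less[OF s y] by (auto simp: skel_def)
qed

lemma cell_bound_sub: "cell_bound N s K0 V m x ==> y : cell N s x ==> cell_bound N s K0 V m y"
 using cell_trans[OF s] unfolding cell_bound_def by blast

lemma skel_power_ge: "0 <= m ==> m <= skel_step N c^i * m"
 using one_le_power[OF skel_step_ge1[of N c], of i] by (simp add: mult_le_cancel_right1)

lemma extends_over_0: "extends_over 0 V"
 unfolding extends_over_def
proof (intro conjI ballI allI impI)
 show "V ` skel 0 <= Y" using VY skel_sub by blast
 fix x m assume x: "x : skel 0" and m: "cell_bound N s K0 V m x"
 show "lipl N (skel_step N c^0 * m) (cell N s x) V"
 proof (cases "x : K0")
  case True thus ?thesis using m cell_self[OF s] by (auto simp: cell_bound_def)
 next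
  case False
  hence "free N s x = {}" using x by (auto simp: skel_def)
  hence "cell N s x = {x}" by (auto simp: cell_def)
  thus ?thesis using m by (simp add: lipl_def cell_bound_def)
 qed
qed auto

context
 fixes i :: nat and f :: "pt => 'a"
 assumes f: "extends_over i f"
begin

lemma boundary_lip:
 assumes x: "x : skel (Suc i) - skel i" and m: "cell_bound N s K0 V m x"
 shows "lipl N (real (2 * N + 3)*(skel_step N c^i * m)) (cell_bd N s x) f"
proof (rule cell_boundary_lipschitz[OF s])
 have m0: "0 <= m" using m by (simp add: cell_bound_def)
 show "0 <= skel_step N c^i * m" using skel_power_ge[OF m0, of i] m0 by linarith
 show "lipl N (skel_step N c^i * m) (cell N s y) f" if "y : cell_bd N s x" for y
  using f cell_bd_skel[OF x] cell_bound_sub[OF m cell_bdD[OF that]] that unfolding extends_over_def by blast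
 fix v w assume vw: "v : cell N s x" "w : cell N s x" "free N s v = {}" "free N s w = {}"
 have "v : K1" "w : K1" using vw x K1_cell skel_sub by blast+
 hence "dist (f v) (f w) = dist (V v) (V w)" using f vw unfolding extends_over_def by auto
 also have "... <= m * s" using m vw unfolding cell_bound_def by blast
 also have "... <= skel_step N c^i * m * s" using skel_power_ge[OF m0] s by (intro mult_right_mono) auto
 finally show "dist (f v) (f w) <= skel_step N c^i * m * s" .
qed

lemma extend_step_fills:
 assumes x: "x : skel (Suc i) - skel i"
 shows "fills_cell f (cell N s x) (cell_filling f (cell N s x))"
proof -
 have fr: "free N s x ~= {}" using x by (auto simp: skel_def)
 have fY: "f ` cell_bd N s x <= Y" using cell_bd_skel[OF x] f unfolding extends_over_def by blast
 obtain m where "cell_bound N s K0 V m x" using bounded x skel_sub by blast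
 hence "EX g. (g ` cell N s x <= Y & (ALL y:cell_bd N s x. g y = f y)) &
   (ALL M. lipl N M (cell_bd N s x) f --> lipl N (cube_const N c * M) (cell N s x) g)"
  using cell_extension[OF s Y N fr fY] by (intro uniform_extension[OF boundary_lip[OF x] cube_const_nonneg]) auto
 hence "EX g. fills_cell f (cell N s x) g" unfolding fills_cell_def cell_bd_def by blast
 thus ?thesis unfolding cell_filling_def by (rule someI_ex)
qed

lemma extend_step_new:
 assumes x: "x : skel (Suc i) - skel i" and y: "y : cell N s x"
 shows "extend_step i f y = cell_filling f (cell N s x) y"
proof (cases "y : skel i")
 case True
 hence "cell N s y ~= cell N s x" using cell_skel[OF True] cell_self[OF s, where x=x and N=N] x by blast
 thus ?thesis using extend_step_fills[OF x] True y by (auto simp: extend_step_def fills_cell_def)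
next
 case False
 hence "cell N s y = cell N s x" using cell_bd_skel[OF x] y by (auto simp: cell_bd_def)
 thus ?thesis using False by (simp add: extend_step_def)
qed

lemma extend_step_lip:
 assumes x: "x : skel (Suc i)" and m: "cell_bound N s K0 V m x"
 shows "lipl N (skel_step N c^Suc i * m) (cell N s x) (extend_step i f)"
proof -
 have m0: "0 <= skel_step N c^i * m" using m skel_power_ge[of m i] unfolding cell_bound_def by linarith
 show ?thesis
 proof (cases "x : skel i")
  case True
  have "lipl N (skel_step N c^i * m) (cell N s x) f" using f True m unfolding extends_over_def by blast
  hence "lipl N (skel_step N c^i * m) (cell N s x) (extend_step i f)"
   using cell_skel[OF True] by (subst lipl_cong[of _ _ f]) (auto simp: extend_step_def)
  moreover have "skel_step N c^i * m <= skel_step N c^Suc i * m"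
   using mult_right_mono[OF skel_step_ge1[of N c] m0] by (simp add: mult.assoc)
  ultimately show ?thesis by (blast intro: lipl_mono)
 next
  case False
  hence new: "x : skel (Suc i) - skel i" using x by simp
  let ?g = "cell_filling f (cell N s x)"
  have "lipl N (cube_const N c*(real (2 * N + 3)*(skel_step N c^i * m))) (cell N s x) ?g"
   using extend_step_fills[OF new] boundary_lip[OF new m] unfolding fills_cell_def cell_bd_def by blast
  hence "lipl N (cube_const N c*(real (2 * N + 3)*(skel_step N c^i * m))) (cell N s x) (extend_step i f)"
   using extend_step_new[OF new] by (subst lipl_cong[of _ _ ?g]) auto
  moreover have "cube_const N c*(real (2 * N + 3)*(skel_step N c^i * m)) <= skel_step N c^Suc i * m"
   using m0 by (simp add: skel_step_def algebra_simps)
  ultimately show ?thesis by (blast intro: lipl_mono)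
 qed
qed

lemma extends_over_Suc: "extends_over (Suc i) (extend_step i f)"
 unfolding extends_over_def
proof (intro conjI ballI allI impI)
 show "extend_step i f ` skel (Suc i) <= Y"
 proof (rule image_subsetI)
  fix x assume x: "x : skel (Suc i)"
  show "extend_step i f x : Y"
  proof (cases "x : skel i")
   case True thus ?thesis using f by (auto simp: extend_step_def extends_over_def)
  next
   case False
   thus ?thesis using extend_step_fills[of x] x cell_self[OF s] by (auto simp: extend_step_def fills_cell_def)
  qed
 qed
 show "extend_step i f x = V x" if "x : K0" for x
  using that f skel_sub by (auto simp: extend_step_def extends_over_def)
 show "extend_step i f x = V x" if "x : K1" "free N s x = {}" for x
  using that f by (auto simp: extend_step_def extends_over_def skel_def)
qed (rule extend_step_lip)

end

lemma skeleton_extension: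
 "EX f. f ` K1 <= Y & (ALL x:K0. f x = V x) & (ALL x:K1. free N s x = {} --> f x = V x) &
   (ALL x:K1. ALL m. cell_bound N s K0 V m x --> lipl N (skel_const N c * m) (cell N s x) f)"
proof -
 have "EX f. extends_over i f" for i by (induction i) (use extends_over_0 extends_over_Suc in blast)+
 then obtain f where "extends_over (Suc N) f" by blast
 moreover have "skel (Suc N) = K1" using K01 card_free_le by (auto simp: skel_def)
 ultimately show ?thesis unfolding extends_over_def skel_const_def by (intro exI[of _ f]) auto
qed

end

section \<open>Refining the grid towards a subset\<close>

lemma floor_between:
 fixes u :: real
 assumes "of_int m < u" "u < of_int m + 1" shows "floor u = m" "u ~: \<int>"
proof -
 show fl: "floor u = m" using assms by (intro floor_unique) auto
 hence "0 < frac u" using assms by (simp add: frac_def)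
 thus "u ~: \<int>" by (simp add: frac_gt_0_iff)
qed

lemma floor_double:
 fixes u :: real
 shows "2 * of_int (floor u) <= (of_int (floor (2 * u)) :: real)" "of_int (floor (2 * u)) + 1 <= (2*(of_int (floor u) + 1) :: real)"
proof -
 have "2 * floor u <= floor (2 * u)" "floor (2 * u) < 2 * floor u + 2"
  unfolding le_floor_iff floor_less_iff using floor_correct[of u] by (simp_all, linarith)
 hence "of_int (2 * floor u) <= (of_int (floor (2 * u)) :: real)" "of_int (floor (2 * u) + 1) <= (of_int (2*(floor u + 1)) :: real)"
  unfolding of_int_le_iff by simp_all
 thus "2 * of_int (floor u) <= (of_int (floor (2 * u)) :: real)" "of_int (floor (2 * u)) + 1 <= (2*(of_int (floor u) + 1) :: real)"
  by simp_all
qed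

lemma cell_refine:
 assumes s: "0 < s" shows "cell N (s/2) x <= cell N s x"
proof
 fix y assume y: "y : cell N (s/2) x"
 show "y : cell N s x"
 proof (rule carI)
  fix i assume i: "i : free N s x"
  show "s * of_int (floor (x i/s)) <= y i & y i <= s*(of_int (floor (x i/s)) + 1)"
  proof (cases "i : free N (s/2) x")
   case False
   thus ?thesis using carD2[OF y False] carD1[OF cell_self[OF s] i] by simp
  next
   case True
   let ?u = "x i/s"
   have "s/2 * of_int (floor (2*?u)) <= y i" "y i <= s/2*(of_int (floor (2*?u)) + 1)"
    using carD1[OF y True] by (auto simp: mult.commute)
   moreover have "s/2*(2 * of_int (floor ?u)) <= s/2 * of_int (floor (2*?u))"
      "s/2*(of_int (floor (2*?u)) + 1) <= s/2*(2*(of_int (floor ?u) + 1))"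
    using floor_double[of ?u] s by (intro mult_left_mono; simp)+
   ultimately show ?thesis by (simp add: distrib_left)
  qed
 next
  fix i assume i: "i ~: free N s x"
  have "i ~: free N (s/2) x"
  proof
   assume "i : free N (s/2) x"
   hence "i <= N" "2*(x i/s) ~: \<int>" by (auto simp: free_def mult.commute)
   moreover have "x i/s : \<int>" using i \<open>i <= N\<close> by (simp add: free_def)
   ultimately show False by (metis Ints_mult Ints_numeral)
  qed
  thus "y i = x i" using carD2[OF y] by simp
 qed
qed

definition mesh :: "nat => real" where
 "mesh j = (1/2)^j"

lemma mesh_pos [simp]: "0 < mesh j"
 by (simp add: mesh_def)

lemma mesh_Suc: "mesh j = 2 * mesh (Suc j)"
 by (simp add: mesh_def)

lemma mesh_le: "0 < r ==> EX j. mesh j < r"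
 unfolding mesh_def using real_arch_pow_inv[of r "1/2"] by simp

lemma cell_cube:
 assumes x: "x : cube N" shows "cell N (mesh j) x <= cube N"
proof
 fix y assume y: "y : cell N (mesh j) x"
 have "abs (y i) <= 1" if iN: "i <= N" for i
 proof (cases "i : free N (mesh j) x")
  case False thus ?thesis using carD2[OF y False] x iN by (simp add: cube_def)
 next
  case True
  let ?u = "x i/mesh j"
  have u: "?u = x i*2^j" by (simp add: mesh_def power_divide)
  have "abs (x i) <= 1" using x iN by (simp add: cube_def)
  hence "x i*2^j <= 1*2^j" "-1*2^j <= x i*2^j" by (intro mult_right_mono; simp)+
  hence bounds: "?u <= of_int (2^j)" "of_int (- (2^j)) <= ?u" unfolding u by simp_all
  have "?u ~= of_int (2^j)" using True by (metis (mono_tags, lifting) Ints_of_int free_def mem_Collect_eq)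
  hence "floor ?u + 1 <= 2^j" "- (2^j) <= floor ?u" using bounds by linarith+
  hence "of_int (floor ?u + 1) <= (of_int (2^j) :: real)" "of_int (- (2^j)) <= (of_int (floor ?u) :: real)"
   by (simp_all only: of_int_le_iff)
  hence "mesh j*(of_int (floor ?u) + 1) <= mesh j*2^j" "mesh j*(- (2^j)) <= mesh j * of_int (floor ?u)"
   by (intro mult_left_mono; simp add: mesh_def)+
  moreover have "mesh j*2^j = 1" by (simp add: mesh_def power_divide)
  ultimately show ?thesis using carD1[OF y True] by (simp add: abs_le_iff)
 qed
 moreover have "y i = 0" if "i > N" for i
  using carD2[OF y, of i] that x by (simp add: free_def cube_def)
 ultimately show "y : cube N" by (simp add: cube_def)
qed

lemma eventually_floor_bounds:
 fixes u0 :: real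
 shows "eventually (%u. u = u0 | u ~: \<int> & of_int (floor u) <= u0 & u0 <= of_int (floor u) + 1) (nhds u0)"
proof (cases "u0 : \<int>")
 case True
 then obtain m where m: "u0 = of_int m" by (auto elim: Ints_cases)
 have "eventually (%u. u : {of_int m - 1<..<of_int m + 1}) (nhds u0)" by (rule eventually_nhds_in_open) (auto simp: m)
 thus ?thesis
 proof (rule eventually_mono)
  fix u :: real assume u: "u : {of_int m - 1<..<of_int m + 1}"
  consider "u = u0" | "u < u0" | "u0 < u" by linarith
  thus "u = u0 | u ~: \<int> & of_int (floor u) <= u0 & u0 <= of_int (floor u) + 1"
   using floor_between[of m u] floor_between[of "m - 1" u] u by cases (auto simp: m)
 qed
next
 case False
 have "of_int (floor u0) < u0" using of_int_floor_le[of u0] False by (metis Ints_of_int less_le)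
 hence "u0 : {of_int (floor u0)<..<of_int (floor u0) + 1}" using floor_correct[of u0] by auto
 hence "eventually (%u. u : {of_int (floor u0)<..<of_int (floor u0) + 1}) (nhds u0)" by (intro eventually_nhds_in_open) auto
 thus ?thesis
 proof (rule eventually_mono)
  fix u :: real assume "u : {of_int (floor u0)<..<of_int (floor u0) + 1}"
  thus "u = u0 | u ~: \<int> & of_int (floor u) <= u0 & u0 <= of_int (floor u) + 1"
   using floor_between[of "floor u0" u] floor_correct[of u0] by auto
 qed
qed

lemma eventually_segment_carrier:
 assumes s: "0 < s" and x: "x : cube N" and y: "y : cube N"
 shows "eventually (%t. seg x y t0 : cell N s (seg x y t)) (nhds t0)"
proof -
 let ?ok = "%u u0. u = u0 | u ~: \<int> & of_int (floor u) <= u0 & u0 <= of_int (floor u) + 1"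
 have "eventually (%t. ?ok (seg x y t i/s) (seg x y t0 i/s)) (nhds t0)" for i
 proof -
  have "((%t. seg x y t i/s) \<longlongrightarrow> seg x y t0 i/s) (nhds t0)"
   unfolding seg_def using s by (intro tendsto_intros filterlim_ident) auto
  thus ?thesis by (rule eventually_compose_filterlim[OF eventually_floor_bounds])
 qed
 hence "eventually (%t. ALL i:{..N}. ?ok (seg x y t i/s) (seg x y t0 i/s)) (nhds t0)"
  by (intro eventually_ball_finite) auto
 thus ?thesis
 proof (rule eventually_mono)
  fix t assume near: "ALL i:{..N}. ?ok (seg x y t i/s) (seg x y t0 i/s)"
  show "seg x y t0 : cell N s (seg x y t)"
  proof (rule carI)
   fix i assume i: "i : free N s (seg x y t)"
   let ?p = "floor (seg x y t i/s)"
   from near free_le[OF i] consider "seg x y t i/s = seg x y t0 i/s" | "of_int ?p <= seg x y t0 i/s & seg x y t0 i/s <= of_int ?p + 1"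
    by auto
   hence "of_int ?p <= seg x y t0 i/s" "seg x y t0 i/s <= of_int ?p + 1" by (cases; linarith)+
   thus "s * of_int ?p <= seg x y t0 i & seg x y t0 i <= s*(of_int ?p + 1)"
    using s by (simp add: pos_le_divide_eq pos_divide_le_eq mult.commute)
  next
   fix i assume i: "i ~: free N s (seg x y t)"
   show "seg x y t0 i = seg x y t i"
   proof (cases "i <= N")
    case True
    hence "seg x y t i/s = seg x y t0 i/s" using near i by (auto simp: free_def)
    thus ?thesis using s by simp
   next
    case False thus ?thesis using x y by (simp add: cube_def seg_def)
   qed
  qed
 qed
qed

section \<open>The Lipschitz extension theorem\<close>

text \<open>The extension has Lipschitz constant \<open>lip_near * L\<close> on the cells next to \<open>A\<close> and \<open>lip_far * L\<close> on all cells, and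
 \<open>dist (F x) (f a) <= val_near * L * l1 N x a\<close> next to \<open>A\<close>, \<open>val_far\<close> in place of \<open>val_near\<close> elsewhere.\<close>

definition lip_near :: "nat => real => real" where
 "lip_near N c = skel_const N c*(29 * real (Suc N))"

definition val_near :: "nat => real => real" where
 "val_near N c = lip_near N c + 6"

definition lip_far :: "nat => real => real" where
 "lip_far N c = skel_const N c*(24 * real (Suc N) * val_near N c)"

definition val_far :: "nat => real => real" where
 "val_far N c = lip_far N c + 2 * val_near N c"

definition ext_const :: "nat => real => real" where
 "ext_const N c = lip_far N c + val_far N c"

lemma lip_near_ge1: "1 <= lip_near N c"
 unfolding lip_near_def using skel_const_ge1[of N c] mult_mono[of 1 "skel_const N c" 1 "29 * real (Suc N)"] by auto

lemma val_near_ge: "7 <= val_near N c"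
 using lip_near_ge1[of N c] by (simp add: val_near_def)

lemma lip_near_le: "lip_near N c <= 24 * real (Suc N) * val_near N c"
proof -
 have "1 * val_near N c <= 24 * real (Suc N) * val_near N c" using val_near_ge[of N c] by (intro mult_right_mono) auto
 thus ?thesis by (simp add: val_near_def)
qed

lemma lip_far_ge: "24 * real (Suc N) * val_near N c <= lip_far N c"
 unfolding lip_far_def using val_near_ge[of N c] mult_right_mono[OF skel_const_ge1[of N c], of "24 * real (Suc N) * val_near N c"] by simp

lemma lip_far_ge1: "1 <= lip_far N c"
 using lip_near_ge1[of N c] lip_near_le[of N c] lip_far_ge[of N c] by linarith

lemma ext_const_nonneg: "0 <= ext_const N c"
 using lip_far_ge1[of N c] val_near_ge[of N c] by (simp add: ext_const_def val_far_def)

locale lipschitz_extension =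
 fixes N n :: nat and c L :: real and Y :: "'a::metric_space set" and A S :: "pt set" and f :: "pt => 'a"
 assumes Y: "lip_connected_const Y n c" and N: "N <= n" and AS: "A <= S" and S_cube: "S <= cube N" and S_convex: "seg_convex S"
  and A_closed: "!!x. x : S - A ==> EX r>0. ALL a:A. r <= l1 N x a"
  and A_ne: "A ~= {}" and fY: "f ` A <= Y" and f_lip: "lipl N L A f"
begin

definition d :: real where
 "d = real (Suc N)"

definition far :: "nat => pt set" where
 "far j = {x : cube N. ALL y:cell N (mesh j) x. ALL a:A. 4 * d * mesh j < l1 N y a}"

definition near_A :: "nat => pt => bool" where
 "near_A j x = (EX y:cell N (mesh j) x. EX a:A. l1 N y a <= 6 * d * mesh j)"

definition nearest :: "pt => pt" where
 "nearest v = (SOME a. a : A & (ALL b:A. l1 N v a <= 2 * l1 N v b))"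

definition good :: "nat => (pt => 'a) => bool" where
 "good j F = (F ` far j <= Y & (ALL x:far j. lipl N (lip_far N c * L) (cell N (mesh j) x) F &
   (ALL a:A. dist (F x) (f a) <= val_far N c * L * l1 N x a) &
   (near_A j x --> lipl N (lip_near N c * L) (cell N (mesh j) x) F &
     (ALL a:A. dist (F x) (f a) <= val_near N c * L * l1 N x a))))"

lemma d_ge1: "1 <= d"
 by (simp add: d_def)

lemma L_nonneg: "0 <= L"
 by (rule lipl_nonneg[OF f_lip])

lemma d_mesh_pos: "0 < d * mesh j"
 using d_ge1 by simp

lemma cell_mesh_self: "x : cell N (mesh j) x"
 by (rule cell_self) simp

lemma cell_mesh_diam: "y : cell N (mesh j) x ==> z : cell N (mesh j) x ==> l1 N y z <= d * mesh j"
 using cell_diam[OF mesh_pos] by (simp add: d_def)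

lemma cell_mesh_refine: "cell N (mesh (Suc j)) x <= cell N (mesh j) x"
 using cell_refine[of "mesh j" N x] mesh_Suc[of j] by simp

lemma far_cell: "x : far j ==> cell N (mesh j) x <= far j"
 using cell_trans[OF mesh_pos] cell_cube[of x N j] unfolding far_def by blast

lemma far_dist: "x : far j ==> a : A ==> 4 * d * mesh j < l1 N x a"
 using cell_mesh_self unfolding far_def by blast

lemma far_Suc: "far j <= far (Suc j)"
proof
 fix x assume x: "x : far j"
 have "4 * d * mesh (Suc j) < l1 N y a" if "y : cell N (mesh (Suc j)) x" "a : A" for y a
 proof -
  have "4 * d * mesh j < l1 N y a" using x that cell_mesh_refine unfolding far_def by blast
  thus ?thesis using d_mesh_pos[of "Suc j"] unfolding mesh_Suc[of j] by simp
 qed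
 thus "x : far (Suc j)" using x unfolding far_def by blast
qed

lemma far_notin: "x : far j ==> x ~: A"
 using far_dist[of x j x] d_mesh_pos[of j] by auto

lemma far_0: "far 0 = {}"
proof -
 obtain a where a: "a : A" using A_ne by auto
 have "x ~: far 0" for x
 proof
  assume x: "x : far 0"
  have "abs (x i - a i) <= 2" if "i <= N" for i
  proof -
   have "abs (x i) <= 1" "abs (a i) <= 1" using x a AS S_cube that by (auto simp: far_def cube_def)
   thus ?thesis by linarith
  qed
  hence "l1 N x a <= real (Suc N)*2" by (rule l1_le_bound)
  moreover have "4 * d < l1 N x a" using far_dist[OF x a] by (simp add: mesh_def)
  ultimately show False using d_ge1 by (simp add: d_def)
 qed
 thus ?thesis by auto
qed

lemma not_far:
 assumes "x : cube N" "x ~: far j" shows "EX a:A. l1 N x a <= 5 * d * mesh j"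
proof -
 obtain y a where ya: "y : cell N (mesh j) x" "a : A" "l1 N y a <= 4 * d * mesh j" using assms unfolding far_def by force
 have "l1 N x a <= l1 N x y + l1 N y a" by (rule l1_triangle)
 also have "l1 N x y <= d * mesh j" by (rule cell_mesh_diam[OF cell_mesh_self ya(1)])
 finally show ?thesis using ya by (intro bexI[of _ a]) auto
qed

lemma nearest:
 assumes v: "v : far j" shows "nearest v : A" "b : A ==> l1 N v (nearest v) <= 2 * l1 N v b"
proof -
 let ?I = "Inf (l1 N v ` A)"
 have bdd: "bdd_below (l1 N v ` A)" by (rule bdd_belowI[of _ 0]) auto
 have "4 * d * mesh j <= ?I" using A_ne far_dist[OF v] by (intro cInf_greatest) (auto simp: less_imp_le)
 hence "?I < 2*?I" using d_mesh_pos[of j] by linarith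
 then obtain a where a: "a : A" "l1 N v a < 2*?I"
  using cInf_lessD[of "l1 N v ` A"] A_ne by (metis (no_types, lifting) empty_is_image imageE)
 have "l1 N v a <= 2 * l1 N v b" if "b : A" for b using a(2) cInf_lower[OF _ bdd, of "l1 N v b"] that by auto
 hence "nearest v : A & (ALL b:A. l1 N v (nearest v) <= 2 * l1 N v b)"
  unfolding nearest_def using a(1) by (intro someI_ex[where P="%a. a : A & (ALL b:A. l1 N v a <= 2 * l1 N v b)"]) blast
 thus "nearest v : A" "b : A ==> l1 N v (nearest v) <= 2 * l1 N v b" by auto
qed

lemma dist_nearest:
 assumes "v : far j" "a : A" shows "dist (f (nearest v)) (f a) <= 3 * L * l1 N v a"
proof -
 have "dist (f (nearest v)) (f a) <= L * l1 N (nearest v) a" by (rule lipl_dist[OF f_lip nearest(1)[OF assms(1)] assms(2)])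
 also have "l1 N (nearest v) a <= 3 * l1 N v a"
  using l1_triangle[of N "nearest v" a v] nearest(2)[OF assms] l1_commute[of N v "nearest v"] by linarith
 hence "L * l1 N (nearest v) a <= L*(3 * l1 N v a)" using L_nonneg by (rule mult_left_mono)
 finally show ?thesis by simp
qed

context
 fixes j :: nat and F :: "pt => 'a"
 assumes F: "good j F"
begin

definition prescribed :: "pt => 'a" where
 "prescribed v = (if v : far j then F v else f (nearest v))"

lemma good_lip: "x : far j ==> lipl N (lip_far N c * L) (cell N (mesh j) x) F"
 using F by (simp add: good_def)

lemma new_near:
 assumes x: "x : far (Suc j) - far j" and y: "y : cell N (mesh (Suc j)) x"
 shows "near_A j y"
proof -
 obtain a where a: "a : A" "l1 N x a <= 5 * d * mesh j" using not_far[of x j] x unfolding far_def by blast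
 have "l1 N y a <= l1 N y x + l1 N x a" by (rule l1_triangle)
 also have "l1 N y x <= d * mesh (Suc j)" by (rule cell_mesh_diam[OF y cell_mesh_self])
 also have "... <= d * mesh j" using d_mesh_pos[of "Suc j"] unfolding mesh_Suc[of j] by simp
 finally show ?thesis unfolding near_A_def using a cell_mesh_self[of y j] by (intro bexI[of _ y] bexI[of _ a]) auto
qed

lemma new_value:
 assumes x: "x : far (Suc j) - far j" and v: "v : cell N (mesh (Suc j)) x" and a: "a : A"
 shows "dist (prescribed v) (f a) <= val_near N c * L * l1 N v a"
proof (cases "v : far j")
 case True thus ?thesis using F new_near[OF x v] a by (simp add: prescribed_def good_def)
next
 case False
 have "v : far (Suc j)" using far_cell x v by blast
 hence "dist (prescribed v) (f a) <= 3 * L * l1 N v a" using dist_nearest a False by (simp add: prescribed_def)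
 also have "... <= val_near N c * L * l1 N v a" using val_near_ge[of N c] L_nonneg by (intro mult_right_mono) auto
 finally show ?thesis .
qed

lemma new_cell_bound:
 assumes x: "x : far (Suc j) - far j"
 shows "cell_bound N (mesh (Suc j)) (far j) prescribed (24 * d * val_near N c * L) x"
proof (rule cell_boundI)
 have nonneg: "0 <= val_near N c * L" using val_near_ge[of N c] L_nonneg by simp
 show "0 <= 24 * d * val_near N c * L" using mult_nonneg_nonneg[OF _ nonneg, of "24 * d"] d_ge1 by (simp add: mult.assoc)
 show "lipl N (24 * d * val_near N c * L) (cell N (mesh (Suc j)) y) prescribed"
  if y: "y : cell N (mesh (Suc j)) x" "y : far j" for y
 proof -
  have "lipl N (lip_near N c * L) (cell N (mesh j) y) F" using F new_near[OF x y(1)] y(2) by (simp add: good_def)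
  hence "lipl N (24 * d * val_near N c * L) (cell N (mesh (Suc j)) y) F"
   by (rule lipl_mono[OF _ cell_mesh_refine]) (use lip_near_le L_nonneg in \<open>auto simp: d_def intro: mult_right_mono\<close>)
  thus ?thesis using far_cell[OF y(2)] cell_mesh_refine by (subst lipl_cong[of _ _ F]) (auto simp: prescribed_def)
 qed
 fix v w assume v: "v : cell N (mesh (Suc j)) x" and w: "w : cell N (mesh (Suc j)) x"
 obtain a where a: "a : A" "l1 N x a <= 5 * d * mesh j" using not_far[of x j] x unfolding far_def by blast
 have val: "dist (prescribed z) (f a) <= val_near N c * L*(12 * d * mesh (Suc j))" if z: "z : cell N (mesh (Suc j)) x" for z
 proof -
  have "l1 N z a <= l1 N z x + l1 N x a" by (rule l1_triangle)
  also have "l1 N z x <= d * mesh (Suc j)" by (rule cell_mesh_diam[OF z cell_mesh_self])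
  finally have "l1 N z a <= 12 * d * mesh (Suc j)" using a(2) d_mesh_pos[of "Suc j"] unfolding mesh_Suc[of j] by simp
  thus ?thesis using new_value[OF x z a(1)] mult_left_mono[OF _ nonneg] by (meson order_trans)
 qed
 show "dist (prescribed v) (prescribed w) <= 24 * d * val_near N c * L * mesh (Suc j)"
  using dist_triangle2[of "prescribed v" "prescribed w" "f a"] val[OF v] val[OF w] by (simp add: mult_ac)
qed

lemma old_cell_bound:
 assumes x: "x : far j"
 shows "cell_bound N (mesh (Suc j)) (far j) prescribed (lip_far N c * L * d) x"
proof (rule cell_boundI)
 have nonneg: "0 <= lip_far N c * L" using lip_far_ge1[of N c] L_nonneg by simp
 show "0 <= lip_far N c * L * d" using nonneg d_ge1 by simp
 show "lipl N (lip_far N c * L * d) (cell N (mesh (Suc j)) y) prescribed" if y: "y : far j" for y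
 proof -
  have "lipl N (lip_far N c * L * d) (cell N (mesh (Suc j)) y) F"
   by (rule lipl_mono[OF good_lip[OF y] cell_mesh_refine]) (use nonneg d_ge1 in \<open>simp add: mult_le_cancel_left1\<close>)
  thus ?thesis using far_cell[OF y] cell_mesh_refine by (subst lipl_cong[of _ _ F]) (auto simp: prescribed_def)
 qed
 fix v w assume vw: "v : cell N (mesh (Suc j)) x" "w : cell N (mesh (Suc j)) x"
 hence coarse: "v : cell N (mesh j) x" "w : cell N (mesh j) x" using cell_mesh_refine by blast+
 hence "dist (prescribed v) (prescribed w) = dist (F v) (F w)" using far_cell[OF x] by (auto simp: prescribed_def)
 also have "... <= lip_far N c * L * l1 N v w" by (rule lipl_dist[OF good_lip[OF x] coarse])
 also have "... <= lip_far N c * L*(d * mesh (Suc j))" using cell_mesh_diam[OF vw] nonneg by (rule mult_left_mono)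
 finally show "dist (prescribed v) (prescribed w) <= lip_far N c * L * d * mesh (Suc j)" by simp
qed

lemma far_pair: "cell_complex_pair N n (mesh (Suc j)) c Y (far j) (far (Suc j)) prescribed"
proof
 show "cell N (mesh (Suc j)) x <= far j" if "x : far j" for x using far_cell[OF that] cell_mesh_refine by blast
 show "prescribed ` far (Suc j) <= Y" using nearest(1) F fY by (auto simp: prescribed_def good_def)
 show "EX m. cell_bound N (mesh (Suc j)) (far j) prescribed m x" if "x : far (Suc j)" for x
  using that old_cell_bound new_cell_bound by (cases "x : far j") blast+
qed (use Y N far_Suc far_cell in auto)

context
 fixes F' :: "pt => 'a"
 assumes F'_old: "!!x. x : far j ==> F' x = F x"
  and F'_vertex: "!!x. x : far (Suc j) ==> free N (mesh (Suc j)) x = {} ==> F' x = prescribed x"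
  and F'_lip: "!!x m. x : far (Suc j) ==> cell_bound N (mesh (Suc j)) (far j) prescribed m x ==>
    lipl N (skel_const N c * m) (cell N (mesh (Suc j)) x) F'"
begin

lemma step_value:
 assumes x: "x : far (Suc j)" and a: "a : A" and g: "lipl N (g * L) (cell N (mesh (Suc j)) x) F'" "0 <= g"
  and h: "!!v. v : cell N (mesh (Suc j)) x ==> dist (prescribed v) (f a) <= h * L * l1 N v a" "0 <= h"
 shows "dist (F' x) (f a) <= (g + 2 * h) * L * l1 N x a"
proof -
 obtain v where v: "v : cell N (mesh (Suc j)) x" "free N (mesh (Suc j)) v = {}" using cell_has_vertex[OF mesh_pos] by blast
 have small: "d * mesh (Suc j) <= l1 N x a" using far_dist[OF x a] d_mesh_pos[of "Suc j"] by linarith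
 have "dist (F' x) (F' v) <= g * L * l1 N x v" by (rule lipl_dist[OF g(1) cell_mesh_self v(1)])
 also have "... <= g * L * l1 N x a" using cell_mesh_diam[OF cell_mesh_self v(1)] small g(2) L_nonneg by (intro mult_left_mono) auto
 finally have to_corner: "dist (F' x) (F' v) <= g * L * l1 N x a" .
 have "F' v = prescribed v" using F'_vertex far_cell[OF x] v by blast
 hence "dist (F' v) (f a) <= h * L * l1 N v a" using h(1)[OF v(1)] by simp
 also have "l1 N v a <= 2 * l1 N x a"
  using l1_triangle[of N v a x] cell_mesh_diam[OF v(1) cell_mesh_self] small by linarith
 hence "h * L * l1 N v a <= h * L*(2 * l1 N x a)" using h(2) L_nonneg by (intro mult_left_mono) auto
 finally show ?thesis using dist_triangle[of "F' x" "f a" "F' v"] to_corner by (simp add: algebra_simps)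
qed

lemma step_far:
 assumes x: "x : far (Suc j)"
 shows "lipl N (lip_far N c * L) (cell N (mesh (Suc j)) x) F'" "a : A ==> dist (F' x) (f a) <= val_far N c * L * l1 N x a"
proof -
 have "lipl N (lip_far N c * L) (cell N (mesh (Suc j)) x) F' & (ALL a:A. dist (F' x) (f a) <= val_far N c * L * l1 N x a)"
 proof (cases "x : far j")
  case True
  have "lipl N (lip_far N c * L) (cell N (mesh (Suc j)) x) F" by (rule lipl_mono[OF good_lip[OF True] cell_mesh_refine order_refl])
  hence "lipl N (lip_far N c * L) (cell N (mesh (Suc j)) x) F'"
   using F'_old far_cell[OF True] cell_mesh_refine[of j x] by (subst lipl_cong[of _ _ F]) auto
  thus ?thesis using F F'_old True by (simp add: good_def)
 next
  case False
  hence new: "x : far (Suc j) - far j" using x by simp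
  have lip: "lipl N (lip_far N c * L) (cell N (mesh (Suc j)) x) F'"
   using F'_lip[OF x new_cell_bound[OF new]] by (simp add: lip_far_def d_def mult_ac)
  have "dist (F' x) (f a) <= val_far N c * L * l1 N x a" if a: "a : A" for a
   unfolding val_far_def using lip_far_ge1[of N c] val_near_ge[of N c] new_value[OF new _ a] by (intro step_value[OF x a lip]) auto
  thus ?thesis using lip by blast
 qed
 thus "lipl N (lip_far N c * L) (cell N (mesh (Suc j)) x) F'" "a : A ==> dist (F' x) (f a) <= val_far N c * L * l1 N x a" by auto
qed

lemma step_near:
 assumes x: "x : far (Suc j)" and near: "near_A (Suc j) x"
 shows "lipl N (lip_near N c * L) (cell N (mesh (Suc j)) x) F'" "a : A ==> dist (F' x) (f a) <= val_near N c * L * l1 N x a"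
proof -
 let ?C = "cell N (mesh (Suc j)) x"
 obtain y b where yb: "y : ?C" "b : A" "l1 N y b <= 6 * d * mesh (Suc j)" using near unfolding near_A_def by blast
 have b_close: "l1 N z b <= 7 * d * mesh (Suc j)" if "z : ?C" for z
  using l1_triangle[of N z b y] cell_mesh_diam[OF that yb(1)] yb(3) by linarith
 have fresh: "z : far (Suc j)" "prescribed z = f (nearest z)" "z ~: far j" if z: "z : ?C" for z
 proof -
  show "z : far (Suc j)" using far_cell[OF x] z by blast
  show "z ~: far j"
   using far_dist[of z j b] yb(2) b_close[OF z] d_mesh_pos[of "Suc j"] unfolding mesh_Suc[of j] by auto
  thus "prescribed z = f (nearest z)" by (simp add: prescribed_def)
 qed
 have "cell_bound N (mesh (Suc j)) (far j) prescribed (29 * d * L) x"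
 proof (rule cell_boundI)
  fix v w assume v: "v : ?C" and w: "w : ?C"
  have close: "l1 N z (nearest z) <= 14 * d * mesh (Suc j)" if z: "z : ?C" for z
   using nearest(2)[OF fresh(1)[OF z] yb(2)] b_close[OF z] by linarith
  have "dist (prescribed v) (prescribed w) <= L * l1 N (nearest v) (nearest w)"
   unfolding fresh(2)[OF v] fresh(2)[OF w] by (rule lipl_dist[OF f_lip nearest(1)[OF fresh(1)[OF v]] nearest(1)[OF fresh(1)[OF w]]])
  also have "l1 N (nearest v) (nearest w) <= 29 * d * mesh (Suc j)"
   using l1_triangle[of N "nearest v" "nearest w" v] l1_triangle[of N v "nearest w" w] close[OF v] close[OF w]
    cell_mesh_diam[OF v w] l1_commute[of N v "nearest v"] by linarith
  hence "L * l1 N (nearest v) (nearest w) <= L*(29 * d * mesh (Suc j))" using L_nonneg by (rule mult_left_mono)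
  finally show "dist (prescribed v) (prescribed w) <= 29 * d * L * mesh (Suc j)" by (simp add: mult_ac)
 qed (use fresh(3) d_ge1 L_nonneg in auto)
 from F'_lip[OF x this] show lip: "lipl N (lip_near N c * L) ?C F'" by (simp add: lip_near_def d_def mult_ac)
 show "dist (F' x) (f a) <= val_near N c * L * l1 N x a" if a: "a : A"
  using step_value[OF x a lip, of 3] lip_near_ge1[of N c] dist_nearest[OF fresh(1) a] fresh(2) by (simp add: val_near_def)
qed

end

lemma good_Suc: "EX F'. good (Suc j) F' & (ALL x:far j. F' x = F x)"
proof -
 obtain F' where F': "F' ` far (Suc j) <= Y" "ALL x:far j. F' x = prescribed x"
   "ALL x:far (Suc j). free N (mesh (Suc j)) x = {} --> F' x = prescribed x"
   "ALL x:far (Suc j). ALL m. cell_bound N (mesh (Suc j)) (far j) prescribed m x --> lipl N (skel_const N c * m) (cell N (mesh (Suc j)) x) F'"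
  using cell_complex_pair.skeleton_extension[OF far_pair] by blast
 have old: "F' x = F x" if "x : far j" for x using F'(2) that by (simp add: prescribed_def)
 note F'_props = old F'(3)[rule_format] F'(4)[rule_format]
 have "good (Suc j) F'"
  unfolding good_def using F'(1) step_far[OF F'_props] step_near[OF F'_props] by blast
 thus ?thesis using old by blast
qed

end

context
 fixes Fs :: "nat => pt => 'a"
 assumes Fs_good: "!!j. good j (Fs j)" and Fs_Suc: "!!j x. x : far j ==> Fs (Suc j) x = Fs j x"
begin

definition glued :: "pt => 'a" where
 "glued x = (if x : A then f x else Fs (LEAST j. x : far j) x)"

lemma glued_far:
 assumes x: "x : far j" shows "glued x = Fs j x"
proof -
 have stable: "x : far (i + k) & Fs (i + k) x = Fs i x" if "x : far i" for i k
  using that Fs_Suc far_Suc by (induction k) auto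
 let ?i = "LEAST j. x : far j"
 have "x : far ?i" "?i <= j" using x by (auto intro: LeastI Least_le)
 hence "Fs j x = Fs ?i x" using stable[of ?i "j - ?i"] by simp
 thus ?thesis using far_notin[OF x] by (simp add: glued_def)
qed

lemma exists_far:
 assumes x: "x : S - A" obtains j where "x : far j"
proof -
 obtain r where r: "r > 0" "ALL a:A. r <= l1 N x a" using A_closed[OF x] by blast
 obtain j where "mesh j < r/(5 * d)" using mesh_le[of "r/(5 * d)"] r(1) d_ge1 by auto
 hence "5 * d * mesh j < r" using d_ge1 by (simp add: pos_less_divide_eq mult.commute)
 hence "x : far j" using not_far[of x j] x S_cube r(2) by force
 thus ?thesis by (rule that)
qed

lemma glued_Y: "glued ` S <= Y"
proof (rule image_subsetI)
 fix x assume x: "x : S"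
 show "glued x : Y"
 proof (cases "x : A")
  case True thus ?thesis using fY by (auto simp: glued_def)
 next
  case False
  then obtain j where "x : far j" using exists_far x by blast
  thus ?thesis using Fs_good[of j] glued_far by (auto simp: good_def)
 qed
qed

lemma glued_value:
 assumes x: "x : S" and a: "a : A"
 shows "dist (glued x) (f a) <= ext_const N c * L * l1 N x a"
proof (cases "x : A")
 case True
 have "dist (glued x) (f a) <= L * l1 N x a" using True by (simp add: glued_def lipl_dist[OF f_lip True a])
 also have "L <= ext_const N c * L" using lip_far_ge1[of N c] val_near_ge[of N c] L_nonneg
  by (simp add: ext_const_def val_far_def mult_le_cancel_right1)
 hence "L * l1 N x a <= ext_const N c * L * l1 N x a" by (intro mult_right_mono) auto
 finally show ?thesis .
next
 case False
 then obtain j where j: "x : far j" using exists_far x by blast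
 hence "dist (glued x) (f a) <= val_far N c * L * l1 N x a" using Fs_good[of j] a by (simp add: glued_far good_def)
 also have "... <= ext_const N c * L * l1 N x a"
  using lip_far_ge1[of N c] L_nonneg by (intro mult_right_mono) (auto simp: ext_const_def)
 finally show ?thesis .
qed

lemma glued_local_lipschitz:
 assumes x: "x : S" and y: "y : S" and t0: "t0 : {0..1}"
 shows "eventually (%t. t : {0..1} -->
   dist (glued (seg x y t)) (glued (seg x y t0)) <= ext_const N c * L * l1 N (seg x y t) (seg x y t0)) (nhds t0)"
proof (cases "seg x y t0 : A")
 case True
 hence "glued (seg x y t0) = f (seg x y t0)" by (simp add: glued_def)
 thus ?thesis using glued_value[OF seg_convexD[OF S_convex x y] True] by (intro always_eventually) simp
next
 case False
 then obtain r where r: "r > 0" "ALL a:A. r <= l1 N (seg x y t0) a" using A_closed seg_convexD[OF S_convex x y t0] by blast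
 obtain J where "mesh J < r/2/(5 * d)" using mesh_le[of "r/2/(5 * d)"] r(1) d_ge1 by auto
 hence J: "5 * d * mesh J < r/2" using d_ge1 by (simp add: pos_less_divide_eq mult.commute mult.left_commute)
 have "((%t. abs (t - t0) * l1 N x y) \<longlongrightarrow> abs (t0 - t0) * l1 N x y) (nhds t0)" by (intro tendsto_intros filterlim_ident)
 hence "eventually (%t. abs (t - t0) * l1 N x y < r/2) (nhds t0)" using r(1) by (intro order_tendstoD(2)) auto
 moreover have "eventually (%t. ALL j:{..J}. seg x y t0 : cell N (mesh j) (seg x y t)) (nhds t0)"
  using x y S_cube by (intro eventually_ball_finite ballI eventually_segment_carrier) auto
 ultimately show ?thesis
 proof eventually_elim
  case (elim t)
  have "dist (glued (seg x y t)) (glued (seg x y t0)) <= ext_const N c * L * l1 N (seg x y t) (seg x y t0)" if t: "t : {0..1}"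
  proof -
   have "5 * d * mesh J < l1 N (seg x y t) a" if "a : A" for a
    using l1_triangle[of N "seg x y t0" a "seg x y t"] r(2) that elim(1) J l1_seg[of N x y t0 t] by (force simp: abs_minus_commute)
   hence in_J: "seg x y t : far J" using not_far[of "seg x y t" J] seg_convexD[OF S_convex x y t] S_cube by force
   define j where "j = (LEAST j. seg x y t : far j)"
   have j: "seg x y t : far j" "j <= J" unfolding j_def using in_J by (auto intro: LeastI Least_le)
   hence in_cell: "seg x y t0 : cell N (mesh j) (seg x y t)" using elim(2) by simp
   hence "dist (glued (seg x y t)) (glued (seg x y t0)) = dist (Fs j (seg x y t)) (Fs j (seg x y t0))"
    using glued_far j(1) far_cell[OF j(1)] by auto
   also have "... <= lip_far N c * L * l1 N (seg x y t) (seg x y t0)" by (rule lipl_dist[OF good_lip[OF Fs_good j(1)] cell_mesh_self in_cell])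
   also have "... <= ext_const N c * L * l1 N (seg x y t) (seg x y t0)"
    using lip_far_ge1[of N c] val_near_ge[of N c] L_nonneg by (intro mult_right_mono) (auto simp: ext_const_def val_far_def)
   finally show ?thesis .
  qed
  thus ?case by blast
 qed
qed

end

theorem extension: "EX g. (g ` S <= Y & (ALL x:A. g x = f x)) & lipl N (ext_const N c * L) S g"
proof -
 have "EX Fs. ALL j. good j (Fs j) & (ALL x:far j. Fs (Suc j) x = Fs j x)"
  by (rule dependent_nat_choice) (use far_0 good_Suc in \<open>auto simp: good_def\<close>)
 then obtain Fs where Fs: "!!j. good j (Fs j)" "!!j x. x : far j ==> Fs (Suc j) x = Fs j x" by blast
 have "lipl N (ext_const N c * L) S (glued Fs)"
  using ext_const_nonneg L_nonneg S_convex glued_local_lipschitz[OF Fs] by (intro lipl_of_local) auto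
 thus ?thesis using glued_Y[OF Fs] by (intro exI[of _ "glued Fs"]) (auto simp: glued_def[OF Fs])
qed

end

section \<open>Replacing a disk in the space by a disk in the subset\<close>

lemma geodesic_open_component:
 fixes U :: "'a::metric_space set"
 assumes geo: "geodesic_space TYPE('a)" and U: "open U"
 shows "open (connected_component_set U p)"
proof (rule openI)
 fix q assume q: "q : connected_component_set U p"
 hence "q : U" by (meson connected_component_in mem_Collect_eq)
 then obtain r where r: "r > 0" "ball q r <= U" using U by (meson openE)
 have "y : connected_component_set U p" if y: "y : ball q r" for y
 proof -
  obtain gam where ends: "gam 0 = q" "gam (dist q y) = y"
   and iso: "ALL s:{0..dist q y}. ALL t:{0..dist q y}. dist (gam s) (gam t) = abs (s - t)"
   using geo unfolding geodesic_space_def by blast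
  have "1-lipschitz_on {0..dist q y} gam" using iso by (intro lipschitz_onI) (auto simp: dist_real_def)
  hence "connected (gam ` {0..dist q y})" by (intro connected_continuous_image lipschitz_on_continuous_on) auto
  moreover have "gam ` {0..dist q y} <= U"
  proof (rule image_subsetI)
   fix s assume s: "s : {0..dist q y}"
   have "dist q (gam s) = abs (0 - s)" using ends(1) iso s by (metis atLeastAtMost_iff order_refl zero_le_dist)
   thus "gam s : U" using s y r(2) by auto
  qed
  moreover have "q : gam ` {0..dist q y}" "y : gam ` {0..dist q y}"
   using ends by (force intro: image_eqI[of _ _ 0], force intro: image_eqI[of _ _ "dist q y"])
  ultimately have "connected_component U q y" unfolding connected_component_def by blast
  thus ?thesis using q connected_component_trans[of U p q y] by simp
 qed
 thus "EX e>0. ball q e <= connected_component_set U p" using r(1) by blast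
qed

lemma geodesic_frontier_component:
 fixes Z :: "'a::metric_space set"
 assumes geo: "geodesic_space TYPE('a)" and Z: "closed Z"
 shows "frontier (connected_component_set (- Z) p) <= Z"
proof
 let ?C = "connected_component_set (- Z)"
 fix q assume q: "q : frontier (?C p)"
 have op: "open (?C r)" for r using geodesic_open_component[OF geo, of "- Z"] Z by auto
 show "q : Z"
 proof (rule ccontr)
  assume "q ~: Z"
  hence qq: "q : ?C q" by simp
  have "q : closure (?C p)" using q by (simp add: frontier_def)
  hence "?C q Int ?C p ~= {}" using op[of q] qq by (meson closure_iff_nhds_not_empty disjoint_iff open_contains_ball inf_commute order_refl)
  hence "?C q = ?C p" by (meson connected_component_nonoverlap)
  hence "q : interior (?C p)" using qq op[of p] by (simp add: interior_open)
  thus False using q by (simp add: frontier_def)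
 qed
qed

locale disk_in_space =
 fixes Z :: "'a::metric_space set" and n k :: nat and c K :: real and g :: "pt => 'a"
 assumes Z: "closed Z" and geo: "geodesic_space TYPE('a)" and k: "k <= n"
  and H: "!!p. p ~: Z ==> lip_connected_const (frontier (connected_component_set (- Z) p)) n c"
  and g_lip: "lipl k K (disk_k1 k) g" and g_sphere: "g ` sphere_k k <= Z"
begin

abbreviation comp :: "'a => 'a set" where
 "comp == connected_component_set (- Z)"

lemma K_nonneg: "0 <= K"
 by (rule lipl_nonneg[OF g_lip])

lemma comp_notin: "q : Z ==> q ~: comp p"
 using connected_component_in[of "- Z" p q] by auto

lemma dist_seg:
 assumes "x : disk_k1 k" "y : disk_k1 k" "t : {0..1}" "u : {0..1}"
 shows "dist (g (seg x y t)) (g (seg x y u)) <= K * l1 k (seg x y t) (seg x y u)"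
 using assms by (intro lipl_dist[OF g_lip] seg_convexD[OF disk_convex])

lemma frontier_crossing:
 assumes xy: "x : disk_k1 k" "y : disk_k1 k" and t: "t : {0..1}" "t0 : {0..1}"
  and T: "g (seg x y t) : T" "g (seg x y t0) ~: T"
 obtains u where "u : {min t t0..max t t0}" "u : {0..1}" "g (seg x y u) : frontier T"
proof -
 let ?I = "{min t t0..max t t0}"
 have I: "?I <= {0..1}" using t by auto
 have "(K * l1 k x y)-lipschitz_on ?I (%u. g (seg x y u))"
 proof (rule lipschitz_onI)
  fix u v assume "u : ?I" "v : ?I"
  hence "dist (g (seg x y u)) (g (seg x y v)) <= K * l1 k (seg x y u) (seg x y v)" using I by (intro dist_seg[OF xy]) auto
  thus "dist (g (seg x y u)) (g (seg x y v)) <= K * l1 k x y * dist u v" by (simp add: l1_seg dist_real_def mult_ac)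
 qed (use K_nonneg in simp)
 hence "connected ((%u. g (seg x y u)) ` ?I)" by (intro connected_continuous_image lipschitz_on_continuous_on) auto
 moreover have "g (seg x y t) : (%u. g (seg x y u)) ` ?I" "g (seg x y t0) : (%u. g (seg x y u)) ` ?I" by auto
 ultimately have "(%u. g (seg x y u)) ` ?I Int frontier T ~= {}" using T by (intro connected_Int_frontier) blast+
 thus ?thesis using that I by blast
qed

definition comp_lip :: real where
 "comp_lip = ext_const k c * K"

definition comp_map :: "'a set => (pt => 'a) => bool" where
 "comp_map T h = (h ` disk_k1 k <= frontier T & (ALL a:disk_k1 k. g a : frontier T --> h a = g a) & lipl k comp_lip (disk_k1 k) h)"

definition the_comp_map :: "'a set => pt => 'a" where
 "the_comp_map T = (SOME h. comp_map T h)"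

definition pushed :: "pt => 'a" where
 "pushed x = (if g x : Z then g x else the_comp_map (comp (g x)) x)"

lemma preimage_closed:
 assumes "closed T" "y : disk_k1 k" "g y ~: T"
 shows "EX r>0. ALL a:{a : disk_k1 k. g a : T}. r <= l1 k y a"
proof -
 obtain r where r: "r > 0" "ball (g y) r <= - T" using assms by (meson ComplI open_Compl openE)
 have "r/(K + 1) <= l1 k y a" if a: "a : disk_k1 k" "g a : T" for a
 proof -
  have "g a ~: ball (g y) r" using a r(2) by blast
  hence "r <= K * l1 k y a" using lipl_dist[OF g_lip assms(2) a(1)] by simp
  also have "... <= l1 k y a*(K + 1)" by (simp add: algebra_simps)
  finally show ?thesis using K_nonneg by (simp add: pos_divide_le_eq)
 qed
 thus ?thesis using r(1) K_nonneg by (intro exI[of _ "r/(K + 1)"]) auto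
qed

lemma the_comp_map:
 assumes x: "x : disk_k1 k" "g x ~: Z"
 shows "comp_map (comp (g x)) (the_comp_map (comp (g x)))"
proof -
 let ?T = "comp (g x)" and ?A = "{a : disk_k1 k. g a : frontier (comp (g x))}"
 define e :: pt where "e = (%i. if i = 0 then 1 else 0)"
 have "(SUM i<=k. (e i)\<^sup>2) = (SUM i:{0::nat}. 1)" unfolding e_def by (rule sum.mono_neutral_cong_right) auto
 hence e: "e : sphere_k k" "e : disk_k1 k" by (auto simp: sphere_k_def disk_k1_def e_def)
 have ends: "g (seg x e 0) : ?T" "g (seg x e 1) ~: ?T" using x(2) comp_notin g_sphere e(1) by auto
 obtain u where "u : {0..1}" "g (seg x e u) : frontier ?T" by (rule frontier_crossing[OF x(1) e(2) _ _ ends]) auto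
 hence "seg x e u : ?A" using seg_convexD[OF disk_convex x(1) e(2)] by simp
 hence ne: "?A ~= {}" by blast
 interpret lipschitz_extension k n c K "frontier ?T" ?A "disk_k1 k" g
 proof
  show "lip_connected_const (frontier ?T) n c" by (rule H[OF x(2)])
  show "EX r>0. ALL a:?A. r <= l1 k y a" if "y : disk_k1 k - ?A" for y
   using that by (intro preimage_closed frontier_closed) auto
  show "lipl k K ?A g" by (rule lipl_mono[OF g_lip]) auto
 qed (use k ne disk_subset_cube disk_convex in auto)
 have "EX h. comp_map ?T h" using extension unfolding comp_map_def comp_lip_def by auto
 thus ?thesis unfolding the_comp_map_def by (rule someI_ex)
qed

lemma comp_lip_nonneg: "0 <= comp_lip"
 using K_nonneg ext_const_nonneg by (simp add: comp_lip_def)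

lemma pushed_in_Z: "pushed ` disk_k1 k <= Z"
 using the_comp_map geodesic_frontier_component[OF geo Z] by (fastforce simp: pushed_def comp_map_def)

lemma pushed_in_comp:
 assumes "x : disk_k1 k" "g x ~: Z" "y : disk_k1 k" "g y : comp (g x)" "z : disk_k1 k"
 shows "dist (pushed y) (the_comp_map (comp (g x)) z) <= comp_lip * l1 k y z"
proof -
 have same: "comp (g y) = comp (g x)" using connected_component_eq[OF assms(4)] by simp
 have "g y ~: Z" using comp_notin assms(4) by blast
 hence "pushed y = the_comp_map (comp (g x)) y" by (simp add: pushed_def same)
 thus ?thesis using the_comp_map[OF assms(1,2)] assms(3,5) unfolding comp_map_def by (auto intro: lipl_dist)
qed

lemma lip_le_sum:
 "comp_lip * l1 k u v <= (comp_lip + K) * l1 k u v" "K * l1 k u v <= (comp_lip + K) * l1 k u v"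
 using comp_lip_nonneg K_nonneg by (intro mult_right_mono; simp)+

lemma pushed_dist_from_Z:
 assumes xy: "x : disk_k1 k" "y : disk_k1 k" and t: "t : {0..1}" and t0: "t0 : {0..1}" and Z0: "g (seg x y t0) : Z"
 shows "dist (pushed (seg x y t)) (pushed (seg x y t0)) <= (comp_lip + K) * l1 k (seg x y t) (seg x y t0)"
proof (cases "g (seg x y t) : Z")
 case True
 thus ?thesis using Z0 dist_seg[OF xy t t0] lip_le_sum(2)[of "seg x y t" "seg x y t0"] by (simp add: pushed_def)
next
 case False
 let ?q = "seg x y" and ?M = "comp_lip + K"
 let ?T = "comp (g (?q t))"
 note in_disk = seg_convexD[OF disk_convex xy]
 have sides: "g (?q t) : ?T" "g (?q t0) ~: ?T" using False comp_notin[OF Z0] by simp_all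
 obtain u where u: "u : {min t t0..max t t0}" "u : {0..1}" "g (?q u) : frontier ?T" by (rule frontier_crossing[OF xy t t0 sides])
 have "the_comp_map ?T (?q u) = g (?q u)" using the_comp_map[OF in_disk[OF t] False] in_disk[OF u(2)] u(3) unfolding comp_map_def by blast
 hence "dist (pushed (?q t)) (pushed (?q t0)) <= dist (pushed (?q t)) (the_comp_map ?T (?q u)) + dist (g (?q u)) (g (?q t0))"
  using Z0 False dist_triangle[of "pushed (?q t)" "g (?q t0)" "g (?q u)"] by (simp add: pushed_def)
 also have "... <= ?M * l1 k (?q t) (?q u) + ?M * l1 k (?q u) (?q t0)"
  using pushed_in_comp[OF in_disk[OF t] False in_disk[OF t] sides(1) in_disk[OF u(2)]] dist_seg[OF xy u(2) t0]
   lip_le_sum(1)[of "?q t" "?q u"] lip_le_sum(2)[of "?q u" "?q t0"] by linarith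
 also have "... = ?M*((abs (t - u) + abs (u - t0)) * l1 k x y)" by (simp add: l1_seg algebra_simps)
 also have "abs (t - u) + abs (u - t0) = abs (t - t0)" using u(1) by (auto simp: min_def max_def split: if_splits)
 finally show ?thesis by (simp add: l1_seg)
qed

lemma pushed_local_lipschitz:
 assumes xy: "x : disk_k1 k" "y : disk_k1 k" and t0: "t0 : {0..1}"
 shows "eventually (%t. t : {0..1} -->
   dist (pushed (seg x y t)) (pushed (seg x y t0)) <= (comp_lip + K) * l1 k (seg x y t) (seg x y t0)) (nhds t0)"
proof -
 let ?q = "seg x y" and ?M = "comp_lip + K"
 note in_disk = seg_convexD[OF disk_convex xy]
 show ?thesis
 proof (cases "g (?q t0) : Z")
  case True
  thus ?thesis using pushed_dist_from_Z[OF xy _ t0] by (intro always_eventually) blast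
 next
  case False
  let ?T = "comp (g (?q t0))"
  have "open ?T" "g (?q t0) : ?T" using geodesic_open_component[OF geo, of "- Z"] Z False by auto
  then obtain r where r: "r > 0" "ball (g (?q t0)) r <= ?T" by (meson openE)
  have "((%t. K*(abs (t - t0) * l1 k x y)) \<longlongrightarrow> K*(abs (t0 - t0) * l1 k x y)) (nhds t0)" by (intro tendsto_intros filterlim_ident)
  hence "eventually (%t. K*(abs (t - t0) * l1 k x y) < r) (nhds t0)" using r(1) by (intro order_tendstoD(2)) auto
  thus ?thesis
  proof (rule eventually_mono)
   fix t assume close: "K*(abs (t - t0) * l1 k x y) < r"
   have "dist (pushed (?q t)) (pushed (?q t0)) <= ?M * l1 k (?q t) (?q t0)" if t: "t : {0..1}"
   proof -
    have "g (?q t) : ball (g (?q t0)) r" using dist_seg[OF xy t t0] close by (simp add: l1_seg dist_commute)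
    hence "g (?q t) : ?T" using r(2) by blast
    thus ?thesis using pushed_in_comp[OF in_disk[OF t0] False in_disk[OF t] _ in_disk[OF t0]] lip_le_sum(1)[of "?q t" "?q t0"] False
     by (simp add: pushed_def)
   qed
   thus "t : {0..1} --> dist (pushed (?q t)) (pushed (?q t0)) <= ?M * l1 k (?q t) (?q t0)" by blast
  qed
 qed
qed

lemma pushed_lip: "lipl k (comp_lip + K) (disk_k1 k) pushed"
 using comp_lip_nonneg K_nonneg by (intro lipl_of_local disk_convex pushed_local_lipschitz) auto

lemma pushed_sphere: "x : sphere_k k ==> pushed x = g x"
 using g_sphere by (auto simp: pushed_def)

end

theorem lip_connected_of_complement:
 fixes Z :: "'a::metric_space set"
 assumes Z: "closed Z" and geo: "geodesic_space TYPE('a)"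
  and X: "lip_connected (UNIV :: 'a set) n"
  and H: "ALL p:- Z. lip_connected_const (frontier (connected_component_set (- Z) p)) n c2"
 shows "lip_connected Z n"
proof -
 obtain c1 where c1: "lip_connected_const (UNIV :: 'a set) n c1" using X by (auto simp: lip_connected_def)
 have c1_nonneg: "0 <= c1" by (rule lip_connected_const_nonneg[OF c1]) simp
 define C where "C = (%k. real (Suc k)*((ext_const k c2 + 1) * c1))"
 have C_nonneg: "0 <= C k" for k unfolding C_def using c1_nonneg ext_const_nonneg[of k c2] by simp
 have "lip_connected_const Z n (SUM k<=n. C k)"
  unfolding lip_connected_const_def
 proof (intro allI impI)
  fix k f L assume k: "k <= n" and f: "f ` sphere_k k <= Z & lip_on_k k L (sphere_k k) f"
  obtain g where g: "ALL x:sphere_k k. g x = f x" and g_lip: "lip_on_k k (c1 * L) (disk_k1 k) g"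
   using lip_connected_constD[OF c1 k _ conjunct2[OF f]] by (metis top_greatest)
  interpret disk_in_space Z n k c2 "c1 * L" g
   using Z geo k H f g lip_on_imp_lipl[OF g_lip] by unfold_locales auto
  have "lip_on_k k (real (Suc k)*(comp_lip + c1 * L)) (disk_k1 k) pushed" by (rule lipl_imp_lip_on[OF pushed_lip])
  moreover have "real (Suc k)*(comp_lip + c1 * L) = C k * L" unfolding C_def comp_lip_def by (simp add: algebra_simps)
  moreover have "C k * L <= (SUM k<=n. C k) * L"
   using k C_nonneg f by (intro mult_right_mono member_le_sum) (auto simp: lip_on_k_def)
  ultimately have "lip_on_k k ((SUM k<=n. C k) * L) (disk_k1 k) pushed" by (metis lip_on_k_mono)
  thus "EX g. g ` disk_k1 k <= Z & (ALL x:sphere_k k. g x = f x) & lip_on_k k ((SUM k<=n. C k) * L) (disk_k1 k) g"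
   using pushed_in_Z pushed_sphere g by auto
 qed
 thus ?thesis by (auto simp: lip_connected_def)
qed

section \<open>Filling the boundary of a simplex\<close>

definition rim :: "nat => pt set" where
 "rim p = {x : Sx p. EX i<=p. x i = 0}"

definition vtx :: "nat => pt" where
 "vtx i = (%j. if j = i then 1 else 0)"

definition dface :: "nat => pt => pt" where
 "dface i y = (%j. if j < i then y j else y (Suc j))"

lemma simplex_nonneg: "p : Sx M ==> 0 <= p i"
 by (cases "i <= M") (auto simp: simplex_k_def)

lemma simplex_le1: "x : Sx p ==> i <= p ==> x i <= 1"
 using member_le_sum[of i "{..p}" x] by (auto simp: simplex_k_def)

lemma simplex_0: "Sx 0 = {vtx 0}"
 by (auto simp: simplex_k_def fun_eq_iff vtx_def)

lemma vtx_simplex: "i <= p ==> vtx i : Sx p"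
 by (auto simp: vtx_def simplex_k_def)

lemma simplex_convex: "seg_convex (Sx p)"
 by (auto simp: seg_convex_def seg_def simplex_k_def sum.distrib sum_distrib_left[symmetric])

lemma simplex_diam:
 assumes "x : Sx p" "y : Sx p" shows "l1 p x y <= 2"
proof -
 have "l1 p x y <= (SUM i<=p. x i + y i)"
  unfolding l1_def using simplex_nonneg[OF assms(1)] simplex_nonneg[OF assms(2)] by (intro sum_mono) (simp add: abs_le_iff add_increasing)
 also have "... = 2" using assms by (simp add: sum.distrib simplex_k_def)
 finally show ?thesis .
qed

lemma sum_remove_index:
 fixes h :: "nat => 'b::ab_group_add"
 assumes "i <= Suc q"
 shows "(SUM j<=Suc q. h j) = h i + (SUM j<=q. h (if j < i then j else Suc j))"
proof -
 let ?s = "%j. if j < i then j else Suc j"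
 have "bij_betw ?s {..q} ({..Suc q} - {i})"
 proof (rule bij_betwI[where g="%j. if j < i then j else j - 1"])
  show "?s : {..q} \<rightarrow> {..Suc q} - {i}" by auto
  show "(%j. if j < i then j else j - 1) : {..Suc q} - {i} \<rightarrow> {..q}" using assms by (auto split: if_splits)
 qed auto
 hence "(SUM j<=q. h (?s j)) = sum h ({..Suc q} - {i})" by (rule sum.reindex_bij_betw)
 thus ?thesis using sum.remove[of "{..Suc q}" i h] assms by simp
qed

lemma face_map_index: "face_map i x (if j < i then j else Suc j) = x j"
 by (auto simp: face_map_def)

lemma dface_index: "dface i y j = y (if j < i then j else Suc j)"
 by (simp add: dface_def)

lemma face_map_zero [simp]: "face_map i x i = 0"
 by (simp add: face_map_def)

lemma face_map_simplex:
 assumes "x : Sx q" "i <= Suc q"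
 shows "face_map i x : Sx (Suc q)"
proof -
 have "(SUM j<=Suc q. face_map i x j) = 1"
  unfolding sum_remove_index[OF assms(2)] face_map_index using assms(1) by (simp add: simplex_k_def)
 thus ?thesis using assms by (auto simp: simplex_k_def face_map_def)
qed

lemma dface_face_map [simp]: "dface i (face_map i x) = x"
 by (rule ext) (auto simp: dface_def face_map_def)

lemma face_map_dface: "y i = 0 ==> face_map i (dface i y) = y"
 by (rule ext) (auto simp: dface_def face_map_def)

lemma dface_simplex:
 assumes "y : Sx (Suc q)" "i <= Suc q" "y i = 0"
 shows "dface i y : Sx q"
proof -
 have "(SUM j<=q. dface i y j) = 1"
  using sum_remove_index[OF assms(2), of y] assms by (simp add: simplex_k_def dface_index)
 thus ?thesis using assms by (auto simp: simplex_k_def dface_def)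
qed

lemma l1_face_map:
 assumes "i <= Suc q" shows "l1 (Suc q) (face_map i x) (face_map i y) = l1 q x y"
 unfolding l1_def sum_remove_index[OF assms] face_map_index by simp

lemma l1_dface: "i <= Suc q ==> x i = 0 ==> y i = 0 ==> l1 q (dface i x) (dface i y) = l1 (Suc q) x y"
 using l1_face_map[of i q "dface i x" "dface i y"] by (simp add: face_map_dface)

lemma face_map_commute: "i < l ==> face_map l (face_map i w) = face_map i (face_map (l - 1) w)"
 by (rule ext) (auto simp: face_map_def)

definition corner :: "nat => pt set" where
 "corner q = {y. (ALL i>q. y i = 0) & (ALL i<=q. 0 <= y i) & (SUM i<=q. y i) <= 1}"

definition simplex_to_corner :: "nat => pt => pt" where
 "simplex_to_corner q x = x(Suc q := 0)"

definition corner_to_simplex :: "nat => pt => pt" where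
 "corner_to_simplex q y = y(Suc q := 1 - (SUM i<=q. y i))"

lemma corner_to_simplex_mem: "y : corner q ==> corner_to_simplex q y : Sx (Suc q)"
 by (auto simp: corner_to_simplex_def corner_def simplex_k_def le_Suc_eq)

lemma simplex_to_corner_mem: "x : Sx (Suc q) ==> simplex_to_corner q x : corner q"
 by (auto simp: simplex_to_corner_def corner_def simplex_k_def)

lemma corner_to_simplex_to_corner: "x : Sx (Suc q) ==> corner_to_simplex q (simplex_to_corner q x) = x"
 by (auto simp: corner_to_simplex_def simplex_to_corner_def simplex_k_def fun_eq_iff)

lemma simplex_to_corner_to_simplex: "y : corner q ==> simplex_to_corner q (corner_to_simplex q y) = y"
 by (auto simp: corner_to_simplex_def simplex_to_corner_def corner_def fun_eq_iff)

lemma l1_simplex_to_corner: "l1 q (simplex_to_corner q x) (simplex_to_corner q y) <= 1 * l1 (Suc q) x y"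
 by (simp add: l1_def simplex_to_corner_def)

lemma l1_corner_to_simplex: "l1 (Suc q) (corner_to_simplex q y) (corner_to_simplex q z) <= 2 * l1 q y z"
proof -
 have "l1 (Suc q) (corner_to_simplex q y) (corner_to_simplex q z) = l1 q y z + abs ((SUM i<=q. z i) - (SUM i<=q. y i))"
  by (simp add: l1_def corner_to_simplex_def)
 also have "(SUM i<=q. z i) - (SUM i<=q. y i) = (SUM i<=q. z i - y i)" by (simp add: sum_subtractf)
 also have "abs (...) <= l1 q z y" unfolding l1_def by (rule sum_abs)
 finally show ?thesis by (simp add: l1_commute)
qed

lemma corner_cube: "corner q <= cube q"
proof
 fix y assume y: "y : corner q"
 hence "y i <= 1" if "i <= q" for i using member_le_sum[of i "{..q}" y] that by (auto simp: corner_def)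
 thus "y : cube q" using y by (auto simp: corner_def cube_def abs_le_iff intro: order_trans[of _ 0])
qed

lemma corner_convex: "seg_convex (corner q)"
 by (auto simp: seg_convex_def seg_def corner_def sum.distrib sum_distrib_left[symmetric] intro!: convex_bound_le)

lemma simplex_boundary_dist_pos:
 assumes x: "x : Sx p - rim p" shows "EX r>0. ALL a:rim p. r <= l1 p x a"
proof -
 let ?m = "Min (x ` {..p})"
 have "0 < x i" if "i <= p" for i using x that simplex_nonneg[of x p i] by (auto simp: rim_def less_le)
 hence "0 < ?m" by (subst Min_gr_iff) auto
 moreover have "?m <= l1 p x a" if a: "a : rim p" for a
 proof -
  obtain i where i: "i <= p" "a i = 0" using a by (auto simp: rim_def)
  have "?m <= x i" using i by (intro Min_le) auto
  also have "... <= l1 p x a" using l1_component[OF i(1), of x a] i(2) by simp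
  finally show ?thesis .
 qed
 ultimately show ?thesis by blast
qed

lemma simplex_boundary_extension:
 assumes Y: "lip_connected_const Y n c" and q: "q <= n"
  and fY: "f ` rim (Suc q) <= Y" and f_lip: "lipl (Suc q) L (rim (Suc q)) f"
 shows "EX g. (g ` Sx (Suc q) <= Y & (ALL x:rim (Suc q). g x = f x)) &
   lipl (Suc q) (2 * ext_const q c * L) (Sx (Suc q)) g"
proof -
 let ?to = "simplex_to_corner q" and ?from = "corner_to_simplex q"
 let ?A = "?to ` rim (Suc q)"
 have bd: "rim (Suc q) <= Sx (Suc q)" by (auto simp: rim_def)
 have from_A: "?from a : rim (Suc q)" if "a : ?A" for a using that corner_to_simplex_to_corner bd by auto
 interpret lipschitz_extension q n c "L*2" Y ?A "corner q" "f \<circ> ?from"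
 proof
  show "EX r>0. ALL a:?A. r <= l1 q y a" if y: "y : corner q - ?A" for y
  proof -
   have "?from y : Sx (Suc q) - rim (Suc q)"
    using y simplex_to_corner_to_simplex[of y q] corner_to_simplex_mem[of y q] by (metis DiffD1 DiffD2 DiffI image_eqI)
   then obtain r where r: "r > 0" "ALL a:rim (Suc q). r <= l1 (Suc q) (?from y) a" using simplex_boundary_dist_pos by blast
   hence "r/2 <= l1 q y a" if "a : ?A" for a using from_A[OF that] l1_corner_to_simplex[of q y a] by fastforce
   thus ?thesis using r(1) by (intro exI[of _ "r/2"]) auto
  qed
  have "vtx 0 : rim (Suc q)" by (auto simp: rim_def simplex_k_def vtx_def intro: exI[of _ "Suc q"])
  thus "?A ~= {}" by blast
  show "lipl q (L*2) ?A (f \<circ> ?from)" using from_A l1_corner_to_simplex by (intro lipl_compose[OF f_lip]) auto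
 qed (use Y q corner_cube corner_convex simplex_to_corner_mem bd from_A fY in auto)
 obtain g where g: "g ` corner q <= Y" "ALL x:?A. g x = (f \<circ> ?from) x" "lipl q (ext_const q c*(L*2)) (corner q) g"
  using extension by (elim exE conjE)
 have "lipl (Suc q) (ext_const q c*(L*2)*1) (Sx (Suc q)) (g \<circ> ?to)"
  using simplex_to_corner_mem l1_simplex_to_corner by (intro lipl_compose[OF g(3)]) auto
 moreover have "(g \<circ> ?to) ` Sx (Suc q) <= Y" using g(1) simplex_to_corner_mem by auto
 moreover have "ALL x:rim (Suc q). (g \<circ> ?to) x = f x" using g(2) corner_to_simplex_to_corner bd by auto
 ultimately show ?thesis by (intro exI[of _ "g \<circ> ?to"]) (auto simp: mult_ac)
qed

text \<open>For \<open>q = 0\<close> the faces are points, so their Lipschitz constants do not bound the distance between them.\<close>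

definition faces_lip :: "nat => real => (nat => pt => 'a::metric_space) => bool" where
 "faces_lip q L fs = ((ALL i<=Suc q. lipl q L (Sx q) (fs i)) & (q = 0 --> dist (fs 0 (vtx 0)) (fs 1 (vtx 0)) <= L))"

definition fill_const :: "nat => real => real" where
 "fill_const q c = 2 * ext_const q c*5"

definition fills :: "'a::metric_space set => real => nat => (nat => pt => 'a) => (pt => 'a) => bool" where
 "fills Y c q fs g = (g ` Sx (Suc q) <= Y & (ALL x. x ~: Sx (Suc q) --> g x = undefined) &
   (ALL i<=Suc q. ALL x:Sx q. g (face_map i x) = fs i x) &
   (ALL L. faces_lip q L fs --> lipl (Suc q) (fill_const q c * L) (Sx (Suc q)) g))"

lemma fill_const_nonneg: "0 <= fill_const q c"
 using ext_const_nonneg by (simp add: fill_const_def)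

lemma faces_lip_exists:
 assumes "!!i. i <= Suc q ==> EX L. lipl q L (Sx q) (fs i)"
 obtains L where "faces_lip q L fs"
proof -
 obtain LL where LL: "!!i. i <= Suc q ==> lipl q (LL i) (Sx q) (fs i)" using assms by metis
 define L where "L = (SUM i<=Suc q. LL i) + dist (fs 0 (vtx 0)) (fs 1 (vtx 0))"
 have LL0: "0 <= LL i" if "i <= Suc q" for i by (rule lipl_nonneg[OF LL[OF that]])
 have "lipl q L (Sx q) (fs i)" if i: "i <= Suc q" for i
 proof (rule lipl_mono[OF LL[OF i] order_refl])
  have "LL i <= (SUM i<=Suc q. LL i)" using i LL0 by (intro member_le_sum) auto
  thus "LL i <= L" by (simp add: L_def add_increasing2)
 qed
 moreover have "0 <= (SUM i<=Suc q. LL i)" using LL0 by (intro sum_nonneg) auto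
 hence "dist (fs 0 (vtx 0)) (fs 1 (vtx 0)) <= L" by (simp add: L_def)
 ultimately show ?thesis by (intro that[of L]) (simp add: faces_lip_def)
qed

definition shift_mass :: "nat => nat => pt => pt" where
 "shift_mass j k x = x(j := 0, k := x k + x j)"

lemma sum_shift_mass:
 fixes h :: "real => nat => real"
 assumes "j <= p" "k <= p" "k ~= j"
 shows "(SUM l<=p. h (shift_mass j k x l) l) = (SUM l<=p. h (x l) l) + (h (x k + x j) k - h (x k) k) + (h 0 j - h (x j) j)"
proof -
 have split: "(SUM l<=p. u l) = u k + (u j + (SUM l:{..p} - {k} - {j}. u l))" for u :: "nat => real"
  using assms sum.remove[of "{..p}" k u] sum.remove[of "{..p} - {k}" j u] by simp
 have "(SUM l:{..p} - {k} - {j}. h (shift_mass j k x l) l) = (SUM l:{..p} - {k} - {j}. h (x l) l)"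
  by (rule sum.cong) (auto simp: shift_mass_def)
 thus ?thesis unfolding split[of "%l. h (shift_mass j k x l) l"] split[of "%l. h (x l) l"] using assms(3)
  by (simp add: shift_mass_def)
qed

lemma shift_mass_simplex:
 assumes x: "x : Sx p" and jk: "j <= p" "k <= p" "k ~= j" shows "shift_mass j k x : Sx p"
proof -
 have "(SUM l<=p. shift_mass j k x l) = 1" using sum_shift_mass[OF jk, of "%a l. a"] x by (simp add: simplex_k_def)
 thus ?thesis using x jk simplex_nonneg[OF x, of j] by (auto simp: simplex_k_def shift_mass_def)
qed

lemma l1_shift_mass:
 assumes "x : Sx p" "j <= p" "k <= p" "k ~= j" shows "l1 p (shift_mass j k x) x = 2 * x j"
 unfolding l1_def using sum_shift_mass[OF assms(2-4), of "%a l. abs (a - x l)"] simplex_nonneg[OF assms(1), of j] by simp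

context
 fixes q :: nat and fs :: "nat => pt => 'a::metric_space"
 assumes compat: "!!i l w. 1 <= q ==> i < l ==> l <= Suc q ==> w : Sx (q - 1) ==> fs l (face_map i w) = fs i (face_map (l - 1) w)"
begin

definition glue_faces :: "pt => 'a" where
 "glue_faces y = (let i = LEAST i. y i = 0 in fs i (dface i y))"

lemma faces_agree:
 assumes il: "i < l" "l <= Suc q" and y: "y : Sx (Suc q)" "y i = 0" "y l = 0"
 shows "fs i (dface i y) = fs l (dface l y)"
proof (cases q)
 case 0
 hence "i = 0" "l = 1" using il by auto
 hence "(SUM j<=Suc q. y j) = 0" using y 0 by simp
 thus ?thesis using y(1) by (simp add: simplex_k_def)
next
 case (Suc p)
 let ?u = "dface l y" and ?w = "dface i (dface l y)"
 have u: "?u : Sx q" using dface_simplex[OF y(1) il(2) y(3)] .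
 have ui: "?u i = 0" using il y by (simp add: dface_def)
 have w: "?w : Sx p" using dface_simplex[of ?u p i] u ui il Suc by simp
 have "y = face_map i (face_map (l - 1) ?w)"
  using face_map_dface[of y l] y(3) face_map_dface[of ?u i] ui face_map_commute[OF il(1), of ?w] by simp
 hence "dface i y = face_map (l - 1) ?w" by (metis dface_face_map)
 thus ?thesis using compat[of i l ?w] Suc il w face_map_dface[of ?u i] ui by simp
qed

lemma glue_faces_eq:
 assumes y: "y : Sx (Suc q)" "i <= Suc q" "y i = 0"
 shows "glue_faces y = fs i (dface i y)"
proof -
 let ?l = "LEAST i. y i = 0"
 have l: "y ?l = 0" "?l <= i" using y(3) by (auto intro: LeastI Least_le)
 show ?thesis unfolding glue_faces_def Let_def using faces_agree[of ?l i y] l y by (cases "?l = i") auto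
qed

lemma glue_faces_face_map: "i <= Suc q ==> x : Sx q ==> glue_faces (face_map i x) = fs i x"
 using glue_faces_eq[OF face_map_simplex] by simp

context
 fixes L :: real
 assumes L: "faces_lip q L fs"
begin

lemma faces_lip_nonneg: "0 <= L"
 using L lipl_nonneg unfolding faces_lip_def by blast

lemma glue_faces_same_face:
 assumes "x : Sx (Suc q)" "y : Sx (Suc q)" "i <= Suc q" "x i = 0" "y i = 0"
 shows "dist (glue_faces x) (glue_faces y) <= L * l1 (Suc q) x y"
proof -
 have "dist (glue_faces x) (glue_faces y) = dist (fs i (dface i x)) (fs i (dface i y))" using glue_faces_eq assms by simp
 also have "... <= L * l1 q (dface i x) (dface i y)" using L assms dface_simplex by (auto simp: lipl_def faces_lip_def)
 finally show ?thesis using l1_dface assms by simp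
qed

lemma glue_faces_edge:
 assumes q: "q = 0" and x: "x : Sx (Suc q)" "i <= Suc q" "x i = 0" and y: "y : Sx (Suc q)" "j <= Suc q" "y j = 0" and ij: "i ~= j"
 shows "dist (glue_faces x) (glue_faces y) <= L * l1 (Suc q) x y"
proof -
 have endpoints: "i = 0 & j = 1 | i = 1 & j = 0" using ij x(2) y(2) q by auto
 have "dface i x = vtx 0" "dface j y = vtx 0" using dface_simplex[OF x] dface_simplex[OF y] q simplex_0 by auto
 hence "dist (glue_faces x) (glue_faces y) = dist (fs i (vtx 0)) (fs j (vtx 0))" using glue_faces_eq[OF x] glue_faces_eq[OF y] by simp
 also have "... <= L*1" using endpoints L q by (auto simp: faces_lip_def dist_commute)
 also have "... <= L * l1 (Suc q) x y"
 proof (rule mult_left_mono[OF _ faces_lip_nonneg])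
  have "x j = 1" using endpoints x q by (auto simp: simplex_k_def)
  thus "1 <= l1 (Suc q) x y" using l1_component[OF y(2), of x y] y(3) by simp
 qed
 finally show ?thesis .
qed

text \<open>If \<open>1 <= q\<close>, then moving the mass at \<open>j\<close> to a third vertex leads from the face \<open>i\<close> to the face \<open>j\<close> inside the face \<open>i\<close>.\<close>

lemma glue_faces_different_faces:
 assumes q: "1 <= q" and x: "x : Sx (Suc q)" "i <= Suc q" "x i = 0" and y: "y : Sx (Suc q)" "j <= Suc q" "y j = 0" and ij: "i ~= j"
 shows "dist (glue_faces x) (glue_faces y) <= 5 * L * l1 (Suc q) x y"
proof -
 have "EX k:{0::nat,1,2}. k ~= i & k ~= j" by auto
 then obtain k where "k : {0::nat,1,2}" "k ~= i & k ~= j" by (elim bexE)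
 hence k: "k <= Suc q" "k ~= i" "k ~= j" using q by auto
 let ?z = "shift_mass j k x"
 have z: "?z : Sx (Suc q)" "?z i = 0" "?z j = 0"
  using shift_mass_simplex[OF x(1) y(2) k(1,3)] x(3) k ij by (auto simp: shift_mass_def)
 have "x j <= l1 (Suc q) x y" using l1_component[OF y(2), of x y] y(3) by simp
 hence zx: "l1 (Suc q) ?z x <= 2 * l1 (Suc q) x y" unfolding l1_shift_mass[OF x(1) y(2) k(1,3)] by simp
 have zy: "l1 (Suc q) ?z y <= 3 * l1 (Suc q) x y" using l1_triangle[of "Suc q" ?z y x] zx by linarith
 have "dist (glue_faces x) (glue_faces y) <= dist (glue_faces ?z) (glue_faces x) + dist (glue_faces ?z) (glue_faces y)" by (rule dist_triangle3)
 also have "dist (glue_faces ?z) (glue_faces x) <= L * l1 (Suc q) ?z x" by (rule glue_faces_same_face[OF z(1) x(1,2) z(2) x(3)])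
 also have "dist (glue_faces ?z) (glue_faces y) <= L * l1 (Suc q) ?z y" by (rule glue_faces_same_face[OF z(1) y(1,2) z(3) y(3)])
 also have "L * l1 (Suc q) ?z x + L * l1 (Suc q) ?z y <= L*(2 * l1 (Suc q) x y) + L*(3 * l1 (Suc q) x y)"
  using zx zy faces_lip_nonneg by (intro add_mono mult_left_mono)
 finally show ?thesis by simp
qed

lemma glue_faces_lip: "lipl (Suc q) (5 * L) (rim (Suc q)) glue_faces"
proof (rule liplI)
 show "0 <= 5 * L" using faces_lip_nonneg by simp
 fix x y assume "x : rim (Suc q)" "y : rim (Suc q)"
 then obtain i j where x: "x : Sx (Suc q)" "i <= Suc q" "x i = 0" and y: "y : Sx (Suc q)" "j <= Suc q" "y j = 0"
  by (auto simp: rim_def)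
 have weaken: "L * l1 (Suc q) x y <= 5 * L * l1 (Suc q) x y" using faces_lip_nonneg by (intro mult_right_mono) auto
 consider "i = j" | "i ~= j" "q = 0" | "i ~= j" "1 <= q" by linarith
 thus "dist (glue_faces x) (glue_faces y) <= 5 * L * l1 (Suc q) x y"
 proof cases
  case 1 thus ?thesis using glue_faces_same_face[OF x(1) y(1) x(2,3)] y(3) weaken by simp
 next
  case 2 thus ?thesis using glue_faces_edge[OF _ x y] weaken by linarith
 next
  case 3 thus ?thesis using glue_faces_different_faces[OF _ x y] by blast
 qed
qed

end

lemma simplex_filling:
 assumes Y: "lip_connected_const Y n c" and q: "q <= n"
  and fY: "!!i. i <= Suc q ==> fs i ` Sx q <= Y"
  and f_lip: "!!i. i <= Suc q ==> EX L. lipl q L (Sx q) (fs i)"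
 shows "EX g. fills Y c q fs g"
proof -
 obtain L where "faces_lip q L fs" using faces_lip_exists[of q fs] f_lip by blast
 note lip_L = glue_faces_lip[OF this]
 have bY: "glue_faces ` rim (Suc q) <= Y" using glue_faces_eq fY dface_simplex by (fastforce simp: rim_def)
 have "EX g. (g ` Sx (Suc q) <= Y & (ALL x:rim (Suc q). g x = glue_faces x)) &
   (ALL M. lipl (Suc q) M (rim (Suc q)) glue_faces --> lipl (Suc q) (2 * ext_const q c * M) (Sx (Suc q)) g)"
  by (rule uniform_extension[OF lip_L]) (use simplex_boundary_extension[OF Y q bY] ext_const_nonneg in auto)
 then obtain g where g: "g ` Sx (Suc q) <= Y" "ALL x:rim (Suc q). g x = glue_faces x"
   "ALL M. lipl (Suc q) M (rim (Suc q)) glue_faces --> lipl (Suc q) (2 * ext_const q c * M) (Sx (Suc q)) g"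
  by (elim exE conjE)
 define g' where "g' = (%x. if x : Sx (Suc q) then g x else undefined)"
 have face: "g' (face_map i x) = fs i x" if ix: "i <= Suc q" "x : Sx q" for i x
 proof -
  have in_simplex: "face_map i x : Sx (Suc q)" by (rule face_map_simplex[OF ix(2,1)])
  hence "face_map i x : rim (Suc q)" using ix(1) by (auto simp: rim_def intro: exI[of _ i])
  thus ?thesis using g(2) glue_faces_face_map[OF ix] in_simplex by (simp add: g'_def)
 qed
 have "lipl (Suc q) (fill_const q c * M) (Sx (Suc q)) g'" if "faces_lip q M fs" for M
 proof -
  have "lipl (Suc q) (2 * ext_const q c*(5 * M)) (Sx (Suc q)) g" using g(3) glue_faces_lip[OF that] by blast
  thus ?thesis by (subst lipl_cong[of _ g' g]) (auto simp: g'_def fill_const_def mult_ac)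
 qed
 hence "fills Y c q fs g'" using g(1) face by (auto simp: fills_def g'_def)
 thus ?thesis by blast
qed

end

section \<open>Cones and the extension to the skeleton of a simplicial complex\<close>

definition constS :: "'a => pt => 'a" where
 "constS z = (%x. if x : Sx 0 then z else undefined)"

fun coneS :: "'a::metric_space set => real => 'a => nat => (pt => 'a) => (pt => 'a)" where
 "coneS Y c z 0 tau = (SOME g. fills Y c 0 (%i. if i = 0 then tau else constS z) g)"
| "coneS Y c z (Suc q) tau = (SOME g. fills Y c (Suc q) (%i. if i = 0 then tau else coneS Y c z q (face (Suc q) (i - 1) tau)) g)"

definition cone_faces :: "'a::metric_space set => real => 'a => nat => (pt => 'a) => nat => (pt => 'a)" where
 "cone_faces Y c z q tau i = (if i = 0 then tau else (case q of 0 => constS z | Suc q' => coneS Y c z q' (face q (i - 1) tau)))"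

lemma coneS_unfold: "coneS Y c z q tau = (SOME g. fills Y c q (cone_faces Y c z q tau) g)"
proof (cases q)
 case 0
 have "cone_faces Y c z 0 tau = (%i. if i = 0 then tau else constS z)" by (rule ext) (simp add: cone_faces_def)
 thus ?thesis using 0 by simp
next
 case (Suc q')
 have "cone_faces Y c z (Suc q') tau = (%i. if i = 0 then tau else coneS Y c z q' (face (Suc q') (i - 1) tau))"
  by (rule ext) (simp add: cone_faces_def)
 thus ?thesis using Suc by simp
qed

lemma lip_simplex_iff:
 "lip_simplex S k sig \<longleftrightarrow> (EX L. lipl k L (Sx k) sig) & sig ` Sx k <= S & (ALL x. x ~: Sx k --> sig x = undefined)"
proof -
 have "(EX L. lip_on_k k L (Sx k) sig) \<longleftrightarrow> (EX L. lipl k L (Sx k) sig)"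
  using lip_on_imp_lipl[of k _ "Sx k" sig] lipl_imp_lip_on[of k _ "Sx k" sig] by blast
 thus ?thesis by (simp add: lip_simplex_def)
qed

lemma face_apply: "x : Sx q ==> face (Suc q) i tau x = tau (face_map i x)"
 by (simp add: face_def)

lemma face_outside: "x ~: Sx q ==> face (Suc q) i tau x = undefined"
 by (simp add: face_def)

lemma face_lipl:
 assumes "lipl (Suc q) L (Sx (Suc q)) tau" "i <= Suc q"
 shows "lipl q L (Sx q) (face (Suc q) i tau)"
 using assms face_map_simplex[OF _ assms(2)] l1_face_map[OF assms(2)] unfolding lipl_def by (simp add: face_apply) metis

lemma face_lip_simplex:
 assumes "lip_simplex Y (Suc q) tau" "i <= Suc q"
 shows "lip_simplex Y q (face (Suc q) i tau)"
 using assms face_lipl[OF _ assms(2)] face_map_simplex[OF _ assms(2)]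
 unfolding lip_simplex_iff by (auto simp: face_apply face_outside)

lemma face_face:
 assumes "i < l" "l <= Suc (Suc q)"
 shows "face (Suc q) i (face (Suc (Suc q)) l tau) = face (Suc q) (l - 1) (face (Suc (Suc q)) i tau)"
proof
 fix x
 have "face_map i x : Sx (Suc q)" "face_map (l - 1) x : Sx (Suc q)" if "x : Sx q"
  using face_map_simplex[OF that] assms by auto
 thus "face (Suc q) i (face (Suc (Suc q)) l tau) x = face (Suc q) (l - 1) (face (Suc (Suc q)) i tau) x"
  by (cases "x : Sx q") (simp_all add: face_apply face_outside face_map_commute[OF assms(1)])
qed

lemma constS_lip: "z : Y ==> lip_simplex Y 0 (constS z)"
 unfolding lip_simplex_iff by (auto simp: constS_def lipl_def simplex_0 intro: exI[of _ 0])

lemma fills_lip_simplex: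
 assumes f: "fills Y c q fs g" and fs: "!!i. i <= Suc q ==> lip_simplex Y q (fs i)"
 shows "lip_simplex Y (Suc q) g"
proof -
 obtain L where "faces_lip q L fs" using faces_lip_exists[of q fs] fs unfolding lip_simplex_iff by blast
 thus ?thesis using f unfolding fills_def lip_simplex_iff by blast
qed

lemma fills_face:
 assumes f: "fills Y c q fs g" and i: "i <= Suc q" and o: "!!x. x ~: Sx q ==> fs i x = undefined"
 shows "face (Suc q) i g = fs i"
proof
 fix x
 show "face (Suc q) i g x = fs i x"
  using f i o by (cases "x : Sx q") (simp_all add: face_apply face_outside fills_def)
qed

context
 fixes Y :: "'a::metric_space set" and n :: nat and c :: real and z :: 'a
 assumes Y: "lip_connected_const Y n c" and z: "z : Y"
begin

lemma coneS_fills: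
 assumes "q <= n" and lip: "!!i. i <= Suc q ==> lip_simplex Y q (cone_faces Y c z q tau i)"
  and "!!i l w. 1 <= q ==> i < l ==> l <= Suc q ==> w : Sx (q - 1) ==>
   cone_faces Y c z q tau l (face_map i w) = cone_faces Y c z q tau i (face_map (l - 1) w)"
 shows "fills Y c q (cone_faces Y c z q tau) (coneS Y c z q tau) & lip_simplex Y (Suc q) (coneS Y c z q tau)"
proof -
 have "EX g. fills Y c q (cone_faces Y c z q tau) g"
  using assms by (intro simplex_filling[OF _ Y]) (auto simp: lip_simplex_iff)
 hence "fills Y c q (cone_faces Y c z q tau) (coneS Y c z q tau)" unfolding coneS_unfold by (rule someI_ex)
 thus ?thesis using fills_lip_simplex lip by blast
qed

lemma cone_faces_compat:
 assumes ih: "!!j. j <= Suc q ==> fills Y c q (cone_faces Y c z q (face (Suc q) j tau)) (coneS Y c z q (face (Suc q) j tau))"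
  and il: "i < l" "l <= Suc (Suc q)" and w: "w : Sx q"
 shows "cone_faces Y c z (Suc q) tau l (face_map i w) = cone_faces Y c z (Suc q) tau i (face_map (l - 1) w)"
proof -
 have cone: "cone_faces Y c z (Suc q) tau (Suc j) (face_map k w) = cone_faces Y c z q (face (Suc q) j tau) k w" if "j <= Suc q" "k <= Suc q" for j k
  using ih[OF that(1)] that(2) w by (simp add: cone_faces_def fills_def)
 obtain l' where l: "l = Suc l'" using il(1) by (cases l) auto
 show ?thesis
 proof (cases i)
  case 0
  thus ?thesis using cone[of l' 0] il w by (simp add: l cone_faces_def face_apply)
 next
  case (Suc i')
  have "cone_faces Y c z q (face (Suc q) l' tau) i w = cone_faces Y c z q (face (Suc q) i' tau) l' w"
  proof (cases q)
   case 0 thus ?thesis using il Suc by (simp add: l cone_faces_def)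
  next
   case q: (Suc q')
   have "face (Suc q') i' (face (Suc (Suc q')) l' tau) = face (Suc q') (l' - 1) (face (Suc (Suc q')) i' tau)"
    by (rule face_face) (use il Suc q l in auto)
   thus ?thesis using il Suc q by (simp add: l cone_faces_def)
  qed
  thus ?thesis using cone[of l' i] cone[of i' l'] il by (simp add: l Suc)
 qed
qed

lemma cone_fills_lip:
 "q <= n ==> lip_simplex Y q tau ==>
  fills Y c q (cone_faces Y c z q tau) (coneS Y c z q tau) & lip_simplex Y (Suc q) (coneS Y c z q tau)"
proof (induction q arbitrary: tau)
 case 0
 thus ?case using constS_lip[OF z] by (intro coneS_fills) (auto simp: cone_faces_def)
next
 case (Suc q)
 have ih: "fills Y c q (cone_faces Y c z q (face (Suc q) j tau)) (coneS Y c z q (face (Suc q) j tau))"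
  "lip_simplex Y (Suc q) (coneS Y c z q (face (Suc q) j tau))" if "j <= Suc q" for j
  using Suc.IH[of "face (Suc q) j tau"] face_lip_simplex[OF Suc.prems(2) that] Suc.prems(1) by simp_all
 show ?case
 proof (rule coneS_fills[OF Suc.prems(1)])
  fix i assume "i <= Suc (Suc q)"
  thus "lip_simplex Y (Suc q) (cone_faces Y c z (Suc q) tau i)" using ih(2)[of "i - 1"] Suc.prems(2) by (simp add: cone_faces_def)
 next
  fix i l w assume "i < l" "l <= Suc (Suc q)" "w : Sx (Suc q - 1)"
  thus "cone_faces Y c z (Suc q) tau l (face_map i w) = cone_faces Y c z (Suc q) tau i (face_map (l - 1) w)"
   using cone_faces_compat[OF ih(1)] by simp
 qed
qed

end

primrec cone_const :: "real => nat => real" where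
 "cone_const c 0 = fill_const 0 c"
| "cone_const c (Suc q) = fill_const (Suc q) c*(1 + cone_const c q)"

lemma cone_const_nonneg: "0 <= cone_const c q"
 using fill_const_nonneg by (induction q) auto

context
 fixes Y :: "'a::metric_space set" and n :: nat and c :: real
 assumes Y: "lip_connected_const Y n c"
begin

lemma cone_lip_simplex: "z : Y ==> q <= n ==> lip_simplex Y q tau ==> lip_simplex Y (Suc q) (coneS Y c z q tau)"
 using cone_fills_lip[OF Y] by blast

lemma cone_face_0:
 assumes "z : Y" "q <= n" "lip_simplex Y q tau"
 shows "face (Suc q) 0 (coneS Y c z q tau) = tau"
 using fills_face[OF conjunct1[OF cone_fills_lip[OF Y assms]], of 0] assms(3) by (simp add: cone_faces_def lip_simplex_iff)

lemma cone_face_const: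
 assumes "z : Y" "lip_simplex Y 0 tau"
 shows "face (Suc 0) (Suc 0) (coneS Y c z 0 tau) = constS z"
 using fills_face[OF conjunct1[OF cone_fills_lip[OF Y assms(1) _ assms(2)]], of "Suc 0"] by (simp add: cone_faces_def constS_def)

lemma cone_face_Suc:
 assumes "z : Y" "Suc q <= n" "lip_simplex Y (Suc q) tau" "i <= Suc q"
 shows "face (Suc (Suc q)) (Suc i) (coneS Y c z (Suc q) tau) = coneS Y c z q (face (Suc q) i tau)"
proof -
 have "lip_simplex Y (Suc q) (coneS Y c z q (face (Suc q) i tau))"
  using assms by (intro cone_lip_simplex face_lip_simplex) auto
 thus ?thesis using fills_face[OF conjunct1[OF cone_fills_lip[OF Y assms(1-3)]], of "Suc i"] assms(4)
  by (simp add: cone_faces_def lip_simplex_iff)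
qed

lemma cone_lipl:
 assumes "z : Y"
 shows "q <= n ==> lip_simplex Y q tau ==> lipl q L (Sx q) tau ==> (!!x. x : Sx q ==> dist (tau x) z <= L) ==>
  lipl (Suc q) (cone_const c q * L) (Sx (Suc q)) (coneS Y c z q tau)"
proof (induction q arbitrary: tau)
 case 0
 have L0: "0 <= L" using 0 by (simp add: lipl_def)
 have f: "fills Y c 0 (cone_faces Y c z 0 tau) (coneS Y c z 0 tau)" using cone_fills_lip[OF Y assms] 0 by blast
 have "lipl 0 L (Sx 0) (constS z)" using L0 by (simp add: lipl_def constS_def simplex_0)
 hence "faces_lip 0 L (cone_faces Y c z 0 tau)" using 0 by (simp add: faces_lip_def cone_faces_def constS_def simplex_0)
 thus ?case using f unfolding fills_def cone_const.simps by blast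
next
 case (Suc q)
 have L0: "0 <= L" using Suc by (simp add: lipl_def)
 have f: "fills Y c (Suc q) (cone_faces Y c z (Suc q) tau) (coneS Y c z (Suc q) tau)" using cone_fills_lip[OF Y assms] Suc by blast
 have L_le: "L <= (1 + cone_const c q) * L" "cone_const c q * L <= (1 + cone_const c q) * L"
  using L0 cone_const_nonneg[of c q] by (simp_all add: distrib_right)
 have "lipl (Suc q) ((1 + cone_const c q) * L) (Sx (Suc q)) (cone_faces Y c z (Suc q) tau i)" if i: "i <= Suc (Suc q)" for i
 proof (cases "i = 0")
  case True
  have "lipl (Suc q) ((1 + cone_const c q) * L) (Sx (Suc q)) tau" by (rule lipl_mono[OF Suc.prems(3) order_refl L_le(1)])
  thus ?thesis using True by (simp add: cone_faces_def)
 next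
  case False
  have "lipl (Suc q) (cone_const c q * L) (Sx (Suc q)) (coneS Y c z q (face (Suc q) (i - 1) tau))"
  proof (rule Suc.IH)
   show "q <= n" "lip_simplex Y q (face (Suc q) (i - 1) tau)" "lipl q L (Sx q) (face (Suc q) (i - 1) tau)"
    using Suc.prems i False by (auto intro!: face_lip_simplex face_lipl)
   show "dist (face (Suc q) (i - 1) tau x) z <= L" if "x : Sx q" for x
    using Suc.prems(4)[OF face_map_simplex[OF that, of "i - 1"]] i False that by (simp add: face_apply)
  qed
  from lipl_mono[OF this order_refl L_le(2)] show ?thesis using False by (simp add: cone_faces_def)
 qed
 hence "lipl (Suc (Suc q)) (fill_const (Suc q) c*((1 + cone_const c q) * L)) (Sx (Suc (Suc q))) (coneS Y c z (Suc q) tau)"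
  using f unfolding fills_def faces_lip_def by (elim conjE) simp
 thus ?case by (simp add: mult_ac)
qed

end

fun lab_fill :: "'a::metric_space set => real => (nat => 'a) => nat list => (pt => 'a)" where
 "lab_fill Y c z [] = undefined"
| "lab_fill Y c z [v] = constS (z v)"
| "lab_fill Y c z (v # w # l) = coneS Y c (z v) (length l) (lab_fill Y c z (w # l))"

primrec lab_bound :: "real => nat => real" where
 "lab_bound c 0 = 0"
| "lab_bound c (Suc p) = cone_const c p*(2 * lab_bound c p + 1)"

lemma lab_bound_nonneg: "0 <= lab_bound c p"
 using cone_const_nonneg by (induction p) auto

definition del :: "nat => 'b list => 'b list" where
 "del i l = take i l @ drop (Suc i) l"

lemma del_0 [simp]: "del 0 (v # l) = l" and del_Suc [simp]: "del (Suc i) (v # l) = v # del i l"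
 by (simp_all add: del_def)

lemma length_del: "i < length l ==> length (del i l) = length l - 1"
 by (auto simp: del_def)

lemma set_del: "set (del i l) <= set l"
 by (auto simp: del_def dest: in_set_takeD in_set_dropD)

context
 fixes Y :: "'a::metric_space set" and n :: nat and c :: real and z :: "nat => 'a"
 assumes Y: "lip_connected_const Y n c"
begin

lemma lab_fill_lip_simplex:
 "length l = Suc p ==> p <= Suc n ==> z ` set l <= Y ==> lip_simplex Y p (lab_fill Y c z l)"
proof (induction p arbitrary: l)
 case 0
 then obtain v where "l = [v]" by (auto simp: length_Suc_conv)
 thus ?case using 0 constS_lip by auto
next
 case (Suc p)
 then obtain v w l' where l: "l = v # w # l'" "length l' = p" by (auto simp: length_Suc_conv)
 have "lip_simplex Y p (lab_fill Y c z (w # l'))" using Suc.IH[of "w # l'"] Suc.prems l by auto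
 thus ?case using cone_lip_simplex[OF Y, of "z v" p] Suc.prems l by auto
qed

lemma lab_fill_face:
 "length l = Suc (Suc p) ==> p <= n ==> z ` set l <= Y ==> i <= Suc p ==> face (Suc p) i (lab_fill Y c z l) = lab_fill Y c z (del i l)"
proof (induction p arbitrary: l i)
 case 0
 then obtain v w where l: "l = [v, w]" by (auto simp: length_Suc_conv)
 have lw: "lip_simplex Y 0 (constS (z w))" using 0 l constS_lip by auto
 have "i = 0 | i = Suc 0" using 0 by auto
 thus ?case
 proof
  assume "i = 0" thus ?thesis using cone_face_0[OF Y _ _ lw, of "z v"] 0 l by simp
 next
  assume "i = Suc 0" thus ?thesis using cone_face_const[OF Y _ lw, of "z v"] 0 l by simp
 qed
next
 case (Suc p)
 then obtain v w l' where l: "l = v # w # l'" "length l' = Suc p" by (auto simp: length_Suc_conv)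
 have ls: "lip_simplex Y (Suc p) (lab_fill Y c z (w # l'))" using lab_fill_lip_simplex[of "w # l'" "Suc p"] Suc.prems l by auto
 have zv: "z v : Y" using Suc.prems l by auto
 show ?case
 proof (cases i)
  case 0 thus ?thesis using cone_face_0[OF Y zv _ ls] Suc.prems l by simp
 next
  case (Suc j)
  have j: "j <= Suc p" using Suc Suc.prems by simp
  have "face (Suc (Suc p)) i (lab_fill Y c z l) = coneS Y c (z v) p (face (Suc p) j (lab_fill Y c z (w # l')))"
   using cone_face_Suc[OF Y zv _ ls j] Suc.prems l Suc by simp
  also have "face (Suc p) j (lab_fill Y c z (w # l')) = lab_fill Y c z (del j (w # l'))"
   using Suc.IH[of "w # l'" j] Suc.prems l j by auto
  finally have outer_face: "face (Suc (Suc p)) i (lab_fill Y c z l) = coneS Y c (z v) p (lab_fill Y c z (del j (w # l')))" .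
  have "length (del j (w # l')) = Suc p" using length_del[of j "w # l'"] l j by simp
  then obtain y ys where y: "del j (w # l') = y # ys" "length ys = p" by (auto simp: length_Suc_conv)
  thus ?thesis using outer_face l Suc by simp
 qed
qed

lemma lab_fill_value:
 "length l = Suc p ==> p <= Suc n ==> z ` set l <= Y ==> w : set l ==> EX x:Sx p. lab_fill Y c z l x = z w"
proof (induction p arbitrary: l)
 case 0
 then obtain v where "l = [v]" by (auto simp: length_Suc_conv)
 thus ?case using 0 by (auto simp: constS_def simplex_0)
next
 case (Suc p)
 then obtain v u l' where l: "l = v # u # l'" "length l' = p" by (auto simp: length_Suc_conv)
 define i :: nat where "i = (if w = v then 1 else 0)"
 have shorter: "length (del i l) = Suc p" "w : set (del i l)" "z ` set (del i l) <= Y"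
  using l Suc.prems by (auto simp: i_def)
 obtain x where x: "x : Sx p" "lab_fill Y c z (del i l) x = z w" using Suc.IH[OF shorter(1) _ shorter(3,2)] Suc.prems by auto
 have "face (Suc p) i (lab_fill Y c z l) = lab_fill Y c z (del i l)" using Suc.prems by (intro lab_fill_face) (auto simp: i_def)
 hence "lab_fill Y c z l (face_map i x) = z w" using x face_apply[of x p i "lab_fill Y c z l"] by simp
 moreover have "face_map i x : Sx (Suc p)" using x by (intro face_map_simplex) (auto simp: i_def)
 ultimately show ?case by blast
qed

lemma lab_fill_lipl:
 assumes s: "0 <= s"
 shows "length l = Suc p ==> p <= Suc n ==> z ` set l <= Y ==> (!!v w. v : set l ==> w : set l ==> dist (z v) (z w) <= s) ==>
  lipl p (lab_bound c p * s) (Sx p) (lab_fill Y c z l)"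
proof (induction p arbitrary: l)
 case 0
 then obtain v where "l = [v]" by (auto simp: length_Suc_conv)
 thus ?case by (auto simp: lipl_def constS_def)
next
 case (Suc p)
 then obtain v u l' where l: "l = v # u # l'" "length l' = p" by (auto simp: length_Suc_conv)
 have ih: "lipl p (lab_bound c p * s) (Sx p) (lab_fill Y c z (u # l'))" using Suc.IH[of "u # l'"] Suc.prems l by auto
 have ls: "lip_simplex Y p (lab_fill Y c z (u # l'))" using lab_fill_lip_simplex[of "u # l'" p] Suc.prems l by auto
 have near: "dist (lab_fill Y c z (u # l') x) (z v) <= (2 * lab_bound c p + 1) * s" if x: "x : Sx p" for x
 proof -
  obtain y where y: "y : Sx p" "lab_fill Y c z (u # l') y = z u" using lab_fill_value[of "u # l'" p u] Suc.prems l by auto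
  have "dist (lab_fill Y c z (u # l') x) (z u) <= lab_bound c p * s * l1 p x y" using ih x y unfolding lipl_def by metis
  also have "... <= lab_bound c p * s*2" using simplex_diam[OF x y(1)] lab_bound_nonneg s by (intro mult_left_mono) auto
  finally have "dist (lab_fill Y c z (u # l') x) (z u) <= 2 * lab_bound c p * s" by simp
  moreover have "dist (z u) (z v) <= s" using Suc.prems(4) l by simp
  ultimately show ?thesis using dist_triangle[of "lab_fill Y c z (u # l') x" "z v" "z u"] by (simp add: algebra_simps)
 qed
 have "lab_bound c p * s <= (2 * lab_bound c p + 1) * s" using lab_bound_nonneg[of c p] s by (intro mult_right_mono) auto
 from lipl_mono[OF ih order_refl this]
 have "lipl (Suc p) (cone_const c p*((2 * lab_bound c p + 1) * s)) (Sx (Suc p)) (coneS Y c (z v) p (lab_fill Y c z (u # l')))"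
  using Suc.prems l ls near by (intro cone_lipl[OF Y]) auto
 thus ?case using l by (simp add: mult_ac)
qed

end

definition support :: "pt => nat set" where
 "support p = {i. p i ~= 0}"

definition coords :: "nat list => pt => pt" where
 "coords l p = (%j. if j < length l then p (l ! j) else 0)"

lemma support_simplex: "p : Sx M ==> support p <= {..M}"
 by (auto simp: support_def simplex_k_def) (meson not_le)

lemma finite_support: "p : Sx M ==> finite (support p)"
 using support_simplex finite_subset by blast

lemma support_nonempty: "p : Sx M ==> support p ~= {}"
proof
 assume p: "p : Sx M" and e: "support p = {}"
 have "p i = 0" for i using e by (auto simp: support_def)
 thus False using p by (simp add: simplex_k_def)
qed

lemma sum_coords:
 assumes "distinct l" "length l = Suc d"
 shows "(SUM j<=d. h (l ! j)) = (SUM i:set l. h i)"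
 using sum.reindex_bij_betw[OF bij_betw_nth[OF assms(1) refl refl], of h] assms(2) by (simp add: lessThan_Suc_atMost)

lemma sum_supset:
 assumes "p : Sx M" "finite I" "support p <= I" shows "(SUM i:I. p i) = 1"
proof -
 have "(SUM i:I. p i) = (SUM i:support p. p i)" using assms by (intro sum.mono_neutral_right) (auto simp: support_def)
 also have "... = (SUM i<=M. p i)" using support_simplex[OF assms(1)] by (intro sum.mono_neutral_left) (auto simp: support_def)
 finally show ?thesis using assms(1) by (simp add: simplex_k_def)
qed

lemma coords_simplex:
 assumes "p : Sx M" "distinct l" "length l = Suc d" "support p <= set l"
 shows "coords l p : Sx d"
proof -
 have "(SUM j<=d. coords l p j) = (SUM j<=d. p (l ! j))" using assms(3) by (intro sum.cong) (auto simp: coords_def)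
 also have "... = 1" using sum_coords[OF assms(2,3), of p] sum_supset[OF assms(1) _ assms(4)] by simp
 finally show ?thesis using assms simplex_nonneg[OF assms(1)] by (auto simp: simplex_k_def coords_def)
qed

lemma coords_del: "i < length l ==> coords (del i l) p = dface i (coords l p)"
 by (rule ext) (auto simp: coords_def dface_def del_def nth_append min_def)

lemma l1_coords:
 assumes "p : Sx M" "q : Sx M" "distinct l" "length l = Suc d" "support p <= set l" "support q <= set l"
 shows "l1 d (coords l p) (coords l q) = l1 M p q"
proof -
 have "l1 d (coords l p) (coords l q) = (SUM j<=d. abs (p (l ! j) - q (l ! j)))"
  unfolding l1_def using assms(4) by (intro sum.cong) (auto simp: coords_def)
 also have "... = (SUM i:set l. abs (p i - q i))" using sum_coords[OF assms(3,4), of "%i. abs (p i - q i)"] .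
 also have "... = (SUM i:support p Un support q. abs (p i - q i))" using assms(5,6) by (intro sum.mono_neutral_right) (auto simp: support_def)
 also have "... = l1 M p q" unfolding l1_def using support_simplex[OF assms(1)] support_simplex[OF assms(2)]
  by (intro sum.mono_neutral_left) (auto simp: support_def)
 finally show ?thesis .
qed

definition face_proj :: "nat set => pt => pt" where
 "face_proj I u = (%i. if i : I then u i/(SUM j:I. u j) else 0)"

lemma face_proj_simplex:
 assumes u: "u : Sx M" and I: "I <= support u" and pos: "0 < (SUM i:I. u i)"
 shows "face_proj I u : Sx M" "l1 M u (face_proj I u) = 2*(1 - (SUM i:I. u i))"
proof -
 let ?m = "SUM i:I. u i"
 have IM: "I <= {..M}" and fin: "finite (support u)" using I support_simplex[OF u] finite_support[OF u] by auto
 have split: "(SUM i:support u. h i) = (SUM i:support u - I. h i) + (SUM i:I. h i)" for h :: pt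
  using sum.subset_diff[OF I fin] .
 have total: "?m + (SUM i:support u - I. u i) = 1" using sum_supset[OF u fin order_refl] split[of u] by simp
 have m1: "?m <= 1" using total sum_nonneg[of "support u - I" u] simplex_nonneg[OF u] by (smt (verit))
 have normalized: "(SUM i:I. u i/?m) = 1" using pos by (simp add: sum_divide_distrib[symmetric])
 have "(SUM i<=M. face_proj I u i) = (SUM i:I. u i/?m)"
  unfolding face_proj_def using IM by (intro sum.mono_neutral_cong_right) auto
 thus "face_proj I u : Sx M" using normalized simplex_nonneg[OF u] pos IM by (auto simp: simplex_k_def face_proj_def)
 have inside: "abs (u i - face_proj I u i) = u i/?m*(1 - ?m)" if i: "i : I" for i
 proof -
  have "face_proj I u i - u i = u i/?m*(1 - ?m)" using pos i by (simp add: face_proj_def field_simps)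
  moreover have "0 <= u i/?m*(1 - ?m)" using pos m1 simplex_nonneg[OF u, of i] by simp
  ultimately show ?thesis by linarith
 qed
 have "l1 M u (face_proj I u) = (SUM i:support u. abs (u i - face_proj I u i))"
  unfolding l1_def using support_simplex[OF u] I by (intro sum.mono_neutral_right) (auto simp: support_def face_proj_def)
 also have "... = (SUM i:support u - I. u i) + (SUM i:I. u i/?m*(1 - ?m))"
  unfolding split using simplex_nonneg[OF u] inside by (intro arg_cong2[of _ _ _ _ "(+)"] sum.cong) (auto simp: face_proj_def)
 also have "... = 2*(1 - ?m)" unfolding sum_distrib_right[symmetric] normalized using total by simp
 finally show "l1 M u (face_proj I u) = 2*(1 - ?m)" .
qed

lemma face_proj_common:
 assumes p: "p : Sx M" and close: "l1 M p q < 1"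
 defines "I == support p Int support q"
 shows "face_proj I p : Sx M" "support (face_proj I p) <= I" "l1 M p (face_proj I p) <= 2 * l1 M p q"
proof -
 have "(SUM i:support p - I. p i) <= (SUM i:support p - I. abs (p i - q i))"
  by (intro sum_mono) (auto simp: support_def I_def)
 also have "... <= l1 M p q" unfolding l1_def using support_simplex[OF p] by (intro sum_mono2) auto
 finally have outside: "(SUM i:support p - I. p i) <= l1 M p q" .
 have "(SUM i:support p - I. p i) + (SUM i:I. p i) = 1"
  using sum_supset[OF p finite_support[OF p] order_refl] sum.subset_diff[of I "support p" p] finite_support[OF p] by (simp add: I_def)
 hence mass: "0 < (SUM i:I. p i)" "1 - (SUM i:I. p i) <= l1 M p q" using outside close by linarith+
 show "face_proj I p : Sx M" "l1 M p (face_proj I p) <= 2 * l1 M p q"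
  using face_proj_simplex[OF p _ mass(1)] mass(2) by (auto simp: I_def)
 show "support (face_proj I p) <= I" by (auto simp: support_def face_proj_def)
qed

definition lab_const :: "real => nat => real" where
 "lab_const c n = (SUM d<=Suc n. lab_bound c d)"

lemma lab_bound_le: "d <= Suc n ==> lab_bound c d <= lab_const c n"
 unfolding lab_const_def by (rule member_le_sum) (auto simp: lab_bound_nonneg)

lemma lab_const_nonneg: "0 <= lab_const c n"
 unfolding lab_const_def by (intro sum_nonneg lab_bound_nonneg)

definition lab_map_on :: "'a::metric_space set => real => (nat => 'a) => nat list => pt => 'a" where
 "lab_map_on Y c z l p = lab_fill Y c z l (coords l p)"

definition lab_map :: "'a::metric_space set => real => (nat => 'a) => pt => 'a" where
 "lab_map Y c z p = lab_map_on Y c z (sorted_list_of_set (support p)) p"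

lemma remove1_del:
 assumes "distinct l" "i < length l" shows "remove1 (l ! i) l = del i l"
proof -
 have l: "l = take i l @ l ! i # drop (Suc i) l" using assms(2) by (rule id_take_nth_drop)
 have "distinct (take i l @ l ! i # drop (Suc i) l)" using assms(1) l by simp
 hence n: "l ! i ~: set (take i l)" by auto
 have "remove1 (l ! i) (take i l @ l ! i # drop (Suc i) l) = take i l @ drop (Suc i) l"
  unfolding remove1_append using n by simp
 thus ?thesis unfolding del_def using id_take_nth_drop[OF assms(2)] by simp
qed

context
 fixes Y :: "'a::metric_space set" and n :: nat and c :: real and z :: "nat => 'a"
 assumes Y: "lip_connected_const Y n c" and zY: "!!i. z i : Y"
begin

lemma lab_map_on_del:
 assumes "p : Sx M" "distinct l" "length l = Suc (Suc d)" "d <= n" "i <= Suc d" "p (l ! i) = 0" "support p <= set l"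
 shows "lab_map_on Y c z l p = lab_map_on Y c z (del i l) p"
proof -
 have cs: "coords l p : Sx (Suc d)" by (rule coords_simplex[OF assms(1-3,7)])
 have c0: "coords l p i = 0" using assms by (simp add: coords_def)
 have ds: "dface i (coords l p) : Sx d" by (rule dface_simplex[OF cs assms(5) c0])
 have "lab_map_on Y c z l p = lab_fill Y c z l (face_map i (dface i (coords l p)))"
  unfolding lab_map_on_def using face_map_dface[of "coords l p" i] c0 by simp
 also have "... = face (Suc d) i (lab_fill Y c z l) (dface i (coords l p))" by (simp only: face_apply[OF ds])
 also have "face (Suc d) i (lab_fill Y c z l) = lab_fill Y c z (del i l)" using zY by (intro lab_fill_face[OF Y assms(3,4) _ assms(5)]) auto
 finally show ?thesis unfolding lab_map_on_def using coords_del[of i l p] assms by simp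
qed

lemma lab_map_on_supset:
 assumes p: "p : Sx M"
 shows "finite I ==> support p <= I ==> card I <= Suc (Suc n) ==> lab_map_on Y c z (sorted_list_of_set I) p = lab_map Y c z p"
proof (induction "card (I - support p)" arbitrary: I)
 case 0
 hence "I = support p" by auto
 thus ?case by (simp add: lab_map_def)
next
 case (Suc r)
 have "I - support p ~= {}" using Suc(2) by (metis card.empty nat.distinct(1))
 then obtain a where a: "a : I" "p a = 0" by (auto simp: support_def)
 let ?l = "sorted_list_of_set I"
 have "support p ~= {}" by (rule support_nonempty[OF p])
 then obtain b where b: "b : support p" by blast
 have "card {a, b} <= card I" using a b Suc.prems by (intro card_mono) auto
 moreover have "a ~= b" using a b by (auto simp: support_def)
 ultimately have "card I = Suc (Suc (card I - 2))" by simp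
 then obtain d where d: "card I = Suc (Suc d)" by blast
 have len: "length ?l = Suc (Suc d)" using d Suc.prems by simp
 have "a : set ?l" using a Suc.prems by simp
 then obtain i where i: "i < length ?l" "?l ! i = a" by (auto simp: in_set_conv_nth)
 have "lab_map_on Y c z ?l p = lab_map_on Y c z (del i ?l) p"
  using Suc.prems d i a len by (intro lab_map_on_del[OF p _ len]) auto
 also have "del i ?l = sorted_list_of_set (I - {a})"
  using remove1_del[of ?l i] i Suc.prems(1) by (simp add: sorted_list_of_set_remove)
 also have "lab_map_on Y c z (sorted_list_of_set (I - {a})) p = lab_map Y c z p"
 proof (rule Suc.hyps(1))
  have "I - {a} - support p = (I - support p) - {a}" by auto
  thus "r = card (I - {a} - support p)" using Suc(2) a by (simp add: support_def)
  show "support p <= I - {a}" using Suc.prems a by (auto simp: support_def)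
  show "card (I - {a}) <= Suc (Suc n)" using Suc.prems by (meson card_Diff1_le le_trans)
 qed (use Suc.prems in auto)
 finally show ?case .
qed

lemma lab_map_lip_same:
 assumes p: "p : Sx M" and q: "q : Sx M" and I: "finite I" "support p <= I" "support q <= I" "card I <= Suc (Suc n)"
  and s: "0 <= s" "!!i j. i : I ==> j : I ==> dist (z i) (z j) <= s"
 shows "dist (lab_map Y c z p) (lab_map Y c z q) <= lab_const c n * s * l1 M p q"
proof -
 let ?l = "sorted_list_of_set I"
 have "I ~= {}" using support_nonempty[OF p] I by auto
 then obtain d where d: "card I = Suc d" using I(1) by (metis card_eq_0_iff not0_implies_Suc)
 have len: "length ?l = Suc d" using d I by simp
 have ps: "support p <= set ?l" "support q <= set ?l" using I by auto
 have lip: "lipl d (lab_bound c d * s) (Sx d) (lab_fill Y c z ?l)"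
  using s zY I d by (intro lab_fill_lipl[OF Y s(1) len]) auto
 have "dist (lab_map Y c z p) (lab_map Y c z q) = dist (lab_map_on Y c z ?l p) (lab_map_on Y c z ?l q)"
  using lab_map_on_supset[OF p I(1,2,4)] lab_map_on_supset[OF q I(1,3,4)] by simp
 also have "... <= lab_bound c d * s * l1 d (coords ?l p) (coords ?l q)"
  unfolding lab_map_on_def using lip coords_simplex[OF p _ len ps(1)] coords_simplex[OF q _ len ps(2)] by (simp add: lipl_def)
 also have "l1 d (coords ?l p) (coords ?l q) = l1 M p q" by (rule l1_coords[OF p q _ len ps]) simp
 also have "lab_bound c d * s * l1 M p q <= lab_const c n * s * l1 M p q"
  using lab_bound_le[of d n c] d I s by (intro mult_right_mono) auto
 finally show ?thesis .
qed

lemma lab_map_in: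
 assumes p: "p : Sx M" and "card (support p) <= Suc (Suc n)" shows "lab_map Y c z p : Y"
proof -
 let ?l = "sorted_list_of_set (support p)"
 obtain d where d: "card (support p) = Suc d" using finite_support[OF p] support_nonempty[OF p] by (metis card_eq_0_iff not0_implies_Suc)
 have "lip_simplex Y d (lab_fill Y c z ?l)" using d assms zY by (intro lab_fill_lip_simplex[OF Y]) auto
 moreover have "coords ?l p : Sx d" using d finite_support[OF p] by (intro coords_simplex[OF p]) auto
 ultimately show ?thesis unfolding lab_map_def lab_map_on_def lip_simplex_iff by auto
qed

lemma lab_map_near:
 assumes p: "p : Sx M" and cp: "card (support p) <= Suc (Suc n)" and i: "i : support p"
  and s: "0 <= s" "!!i j. i : support p ==> j : support p ==> dist (z i) (z j) <= s"
 shows "dist (lab_map Y c z p) (z i) <= 2 * lab_const c n * s"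
proof -
 let ?l = "sorted_list_of_set (support p)"
 obtain d where d: "card (support p) = Suc d" using finite_support[OF p] support_nonempty[OF p] by (metis card_eq_0_iff not0_implies_Suc)
 have len: "length ?l = Suc d" using d by simp
 have cs: "coords ?l p : Sx d" using d finite_support[OF p] by (intro coords_simplex[OF p]) auto
 obtain x where x: "x : Sx d" "lab_fill Y c z ?l x = z i"
  using lab_fill_value[OF Y len, of z i] d cp zY i finite_support[OF p] by auto
 have lip: "lipl d (lab_bound c d * s) (Sx d) (lab_fill Y c z ?l)"
  using s zY finite_support[OF p] d cp by (intro lab_fill_lipl[OF Y s(1) len]) auto
 have "dist (lab_map Y c z p) (z i) <= lab_bound c d * s * l1 d (coords ?l p) x"
  unfolding lab_map_def lab_map_on_def x(2)[symmetric] using lip cs x(1) by (simp add: lipl_def)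
 also have "... <= lab_const c n * s*2"
  using lab_bound_le[of d n c] d cp s simplex_diam[OF cs x(1)] lab_const_nonneg[of c n] by (intro mult_mono mult_right_mono mult_nonneg_nonneg) auto
 finally show ?thesis by simp
qed

context
 fixes p q :: pt and M :: nat and s :: real
 assumes p: "p : Sx M" and q: "q : Sx M" and cp: "card (support p) <= Suc (Suc n)" and cq: "card (support q) <= Suc (Suc n)"
  and s: "0 <= s" "!!i j. i : support p Un support q ==> j : support p Un support q ==> dist (z i) (z j) <= s"
begin

lemma lab_map_lip_far:
 assumes far: "1 <= l1 M p q"
 shows "dist (lab_map Y c z p) (lab_map Y c z q) <= (9 * lab_const c n + 1) * s * l1 M p q"
proof -
 let ?h = "lab_map Y c z"
 obtain i j where ij: "i : support p" "j : support q" using support_nonempty p q by blast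
 have "dist (?h p) (?h q) <= dist (?h p) (z i) + dist (z i) (z j) + dist (?h q) (z j)"
  using dist_triangle[of "?h p" "?h q" "z i"] dist_triangle2[of "z i" "?h q" "z j"] by linarith
 also have "... <= 2 * lab_const c n * s + s + 2 * lab_const c n * s"
  using lab_map_near[OF p cp ij(1) s(1)] lab_map_near[OF q cq ij(2) s(1)] s(2) ij by (intro add_mono) auto
 also have "... <= (9 * lab_const c n + 1) * s*1" using lab_const_nonneg[of c n] s(1) by (simp add: distrib_right)
 also have "... <= (9 * lab_const c n + 1) * s * l1 M p q" using far lab_const_nonneg[of c n] s(1) by (intro mult_left_mono) auto
 finally show ?thesis .
qed

lemma lab_map_lip_close:
 assumes close: "l1 M p q < 1"
 shows "dist (lab_map Y c z p) (lab_map Y c z q) <= 9 * lab_const c n * s * l1 M p q"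
proof -
 let ?h = "lab_map Y c z" and ?I = "support p Int support q" and ?C = "lab_const c n * s"
 let ?p = "face_proj ?I p" and ?q = "face_proj ?I q"
 have fin: "finite (support p)" "finite (support q)" using finite_support p q by auto
 have p': "?p : Sx M" "support ?p <= ?I" "l1 M p ?p <= 2 * l1 M p q" using face_proj_common[OF p close] by auto
 have q': "?q : Sx M" "support ?q <= ?I" "l1 M q ?q <= 2 * l1 M p q"
  using face_proj_common[OF q, of p] close by (auto simp: l1_commute[of M q p] Int_commute)
 have C: "0 <= ?C" using lab_const_nonneg[of c n] s(1) by simp
 have "dist (?h p) (?h ?p) <= ?C * l1 M p ?p" using p' s fin cp by (intro lab_map_lip_same[OF p _ fin(1)]) auto
 also have "... <= ?C*(2 * l1 M p q)" using p'(3) C by (rule mult_left_mono)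
 finally have pp: "dist (?h p) (?h ?p) <= ?C*(2 * l1 M p q)" .
 have "dist (?h q) (?h ?q) <= ?C * l1 M q ?q" using q' s fin cq by (intro lab_map_lip_same[OF q _ fin(2)]) auto
 also have "... <= ?C*(2 * l1 M p q)" using q'(3) C by (rule mult_left_mono)
 finally have qq: "dist (?h q) (?h ?q) <= ?C*(2 * l1 M p q)" .
 have cI: "card ?I <= Suc (Suc n)" using cp fin by (meson card_mono inf_le1 le_trans)
 have "l1 M ?p ?q <= 5 * l1 M p q"
  using l1_triangle[of M ?p ?q p] l1_triangle[of M p ?q q] p'(3) q'(3) l1_commute[of M p ?p] by linarith
 hence "?C * l1 M ?p ?q <= ?C*(5 * l1 M p q)" using C by (rule mult_left_mono)
 moreover have "dist (?h ?p) (?h ?q) <= ?C * l1 M ?p ?q" using p' q' s fin cI by (intro lab_map_lip_same[of _ M _ ?I]) auto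
 moreover have "dist (?h p) (?h q) <= dist (?h p) (?h ?p) + dist (?h ?p) (?h ?q) + dist (?h q) (?h ?q)"
  using dist_triangle[of "?h p" "?h q" "?h ?p"] dist_triangle2[of "?h ?p" "?h q" "?h ?q"] by linarith
 ultimately show ?thesis using pp qq by simp
qed

lemma lab_map_lip: "dist (lab_map Y c z p) (lab_map Y c z q) <= (9 * lab_const c n + 1) * s * l1 M p q"
proof (cases "1 <= l1 M p q")
 case True
 show ?thesis by (rule lab_map_lip_far[OF True])
next
 case False
 hence "dist (lab_map Y c z p) (lab_map Y c z q) <= 9 * lab_const c n * s * l1 M p q" by (intro lab_map_lip_close) auto
 also have "... <= (9 * lab_const c n + 1) * s * l1 M p q" using s(1) by (intro mult_right_mono) auto
 finally show ?thesis .
qed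

end

end

section \<open>Pushing towards the skeleton\<close>

text \<open>\<open>push_pt k M b\<close> has at most \<open>Suc k\<close> nonzero coordinates; it is undefined (zero) only if \<open>gap k M b = 0\<close>, that is, if the
 largest \<open>Suc k + 1\<close> coordinates of \<open>b\<close> agree.\<close>

definition above_set :: "nat => pt => real => nat set" where
 "above_set M b t = {i. i <= M & t < b i}"

definition thresholds :: "nat => nat => pt => real set" where
 "thresholds k M b = {t. 0 <= t & card (above_set M b t) <= Suc k}"

definition thresh :: "nat => nat => pt => real" where
 "thresh k M b = Inf (thresholds k M b)"

definition excess :: "nat => nat => pt => nat => real" where
 "excess k M b i = (if i <= M then max 0 (b i - thresh k M b) else 0)"

definition gap :: "nat => nat => pt => real" where
 "gap k M b = (SUM i<=M. excess k M b i)"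

definition push_pt :: "nat => nat => pt => nat => real" where
 "push_pt k M b i = excess k M b i/gap k M b"

lemma finite_above_set [simp]: "finite (above_set M b t)"
 by (simp add: above_set_def)

lemma card_above_mono: "above_set M b t <= above_set M b' t' ==> card (above_set M b t) <= card (above_set M b' t')"
 by (simp add: card_mono)

lemma bdd_below_thresholds: "bdd_below (thresholds k M b)"
 by (rule bdd_belowI[of _ 0]) (simp add: thresholds_def)

lemma thresholds_nonempty: "thresholds k M b ~= {}"
proof -
 let ?m = "Max ((%i. abs (b i)) ` {..M})"
 have bm: "abs (b i) <= ?m" if "i <= M" for i using that by (intro Max_ge) auto
 hence "above_set M b ?m = {}" by (force simp: above_set_def abs_le_iff not_less)
 moreover have "0 <= ?m" using order_trans[OF abs_ge_zero bm[of 0]] by simp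
 ultimately have "?m : thresholds k M b" by (simp add: thresholds_def)
 thus ?thesis by blast
qed

lemma thresh_nonneg: "0 <= thresh k M b"
 unfolding thresh_def using thresholds_nonempty[of k M b] by (intro cInf_greatest) (auto simp: thresholds_def)

lemma thresh_le: "0 <= t ==> card (above_set M b t) <= Suc k ==> thresh k M b <= t"
 unfolding thresh_def by (intro cInf_lower bdd_below_thresholds) (simp add: thresholds_def)

lemma thresh_card: "card (above_set M b (thresh k M b)) <= Suc k"
proof (cases "above_set M b (thresh k M b) = {}")
 case True thus ?thesis by simp
next
 case False
 define m where "m = Min (b ` above_set M b (thresh k M b))"
 have "thresh k M b < m" unfolding m_def using False by (subst Min_gr_iff) (auto simp: above_set_def)
 then obtain t where t: "t : thresholds k M b" "t < m"
  using cInf_lessD[OF thresholds_nonempty, of k M b m] unfolding thresh_def by blast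
 have "m <= b i" if "i : above_set M b (thresh k M b)" for i unfolding m_def using that by (intro Min_le) auto
 hence "above_set M b (thresh k M b) <= above_set M b t" using t(2) by (fastforce simp: above_set_def)
 hence "card (above_set M b (thresh k M b)) <= card (above_set M b t)" by (rule card_above_mono)
 thus ?thesis using t(1) by (simp add: thresholds_def)

qed

lemma thresh_card_ge:
 assumes pos: "0 < thresh k M b"
 shows "Suc (Suc k) <= card {i. i <= M & thresh k M b <= b i}"
proof (rule ccontr)
 assume "~ ?thesis"
 hence few: "card {i. i <= M & thresh k M b <= b i} <= Suc k" by simp
 define t where "t = Max (insert 0 (b ` {i. i <= M & b i < thresh k M b}))"
 have t0: "0 <= t" unfolding t_def by (intro Max_ge) auto
 have "b i <= t" if "i <= M" "b i < thresh k M b" for i unfolding t_def using that by (intro Max_ge) auto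
 hence "above_set M b t <= {i. i <= M & thresh k M b <= b i}" by (force simp: above_set_def not_le)
 hence "card (above_set M b t) <= card {i. i <= M & thresh k M b <= b i}" by (intro card_mono) auto
 hence "thresh k M b <= t" using few by (intro thresh_le[OF t0]) simp
 moreover have "t < thresh k M b" unfolding t_def using pos by (subst Max_less_iff) auto
 ultimately show False by simp
qed

lemma thresh_lip: "abs (thresh k M b - thresh k M b') <= l1 M b b'"
proof -
 have one_sided: "thresh k M b' <= thresh k M b + l1 M b b'" for b b'
 proof (rule thresh_le)
  show "0 <= thresh k M b + l1 M b b'" using thresh_nonneg[of k M b] by simp
  have "above_set M b' (thresh k M b + l1 M b b') <= above_set M b (thresh k M b)"
   using l1_component[of _ M b b'] by (force simp: abs_le_iff above_set_def)
  thus "card (above_set M b' (thresh k M b + l1 M b b')) <= Suc k" using card_above_mono thresh_card[of M b k] by (meson order_trans)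
 qed
 show ?thesis using one_sided[of b b'] one_sided[of b' b] by (simp add: l1_commute abs_le_iff)
qed

lemma excess_nonneg: "0 <= excess k M b i"
 by (simp add: excess_def)

lemma gap_nonneg: "0 <= gap k M b"
 unfolding gap_def by (intro sum_nonneg excess_nonneg)

lemma excess_pos_iff: "excess k M b i ~= 0 \<longleftrightarrow> i : above_set M b (thresh k M b)"
 by (auto simp: excess_def max_def above_set_def)

lemma excess_lip: "l1 M (excess k M b) (excess k M b') <= real (2 * k + 3) * l1 M b b'"
proof -
 let ?I = "above_set M b (thresh k M b) Un above_set M b' (thresh k M b')"
 have card: "card ?I <= 2 * Suc k" using card_Un_le[of "above_set M b (thresh k M b)" "above_set M b' (thresh k M b')"] thresh_card[of M b k] thresh_card[of M b' k] by simp
 have "l1 M (excess k M b) (excess k M b') = (SUM i:?I. abs (excess k M b i - excess k M b' i))"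
  unfolding l1_def
 proof (rule sum.mono_neutral_right)
  show "ALL i:{..M} - ?I. abs (excess k M b i - excess k M b' i) = 0" by (auto simp flip: excess_pos_iff)
 qed (auto simp: above_set_def)
 also have "... <= (SUM i:?I. abs (b i - b' i) + l1 M b b')"
  using thresh_lip[of k M b b'] by (intro sum_mono) (auto simp: excess_def max_def abs_le_iff)
 also have "... = (SUM i:?I. abs (b i - b' i)) + real (card ?I) * l1 M b b'" by (simp add: sum.distrib)
 also have "... <= l1 M b b' + real (2 * Suc k) * l1 M b b'"
 proof (rule add_mono)
  show "(SUM i:?I. abs (b i - b' i)) <= l1 M b b'" unfolding l1_def by (intro sum_mono2) (auto simp: above_set_def)
  show "real (card ?I) * l1 M b b' <= real (2 * Suc k) * l1 M b b'" using card by (intro mult_right_mono) (auto simp del: of_nat_Suc of_nat_mult)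
 qed
 finally show ?thesis by (simp add: algebra_simps)
qed

lemma gap_diff_le: "abs (gap k M b - gap k M b') <= l1 M (excess k M b) (excess k M b')"
 unfolding gap_def l1_def sum_subtractf[symmetric] by (rule sum_abs)

lemma gap_lip: "abs (gap k M b - gap k M b') <= real (2 * k + 3) * l1 M b b'"
 by (rule order_trans[OF gap_diff_le excess_lip])

lemma push_pt_lip:
 assumes "0 < r" "r <= gap k M b" "r <= gap k M b'"
 shows "l1 M (push_pt k M b) (push_pt k M b') <= 2/r * real (2 * k + 3) * l1 M b b'"
proof -
 have "l1 M (%i. excess k M b i/gap k M b) (%i. excess k M b' i/gap k M b') <= (1 + 1)/r * l1 M (excess k M b) (excess k M b')"
  using excess_nonneg by (intro l1_normalize[OF assms] gap_diff_le) (simp add: l1_def gap_def)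
 also have "... <= (1 + 1)/r*(real (2 * k + 3) * l1 M b b')" using assms(1) by (intro mult_left_mono excess_lip) auto
 finally show ?thesis by (simp add: push_pt_def[abs_def] algebra_simps)
qed

lemma push_pt_simplex:
 assumes "0 < gap k M b" shows "push_pt k M b : Sx M"
proof -
 have "(SUM i<=M. push_pt k M b i) = 1" using assms by (simp add: push_pt_def sum_divide_distrib[symmetric] gap_def[symmetric])
 thus ?thesis using assms by (auto simp: simplex_k_def push_pt_def excess_def)
qed

lemma push_pt_support: "0 < gap k M b ==> support (push_pt k M b) = above_set M b (thresh k M b)"
 using excess_pos_iff[of k M b] by (auto simp: push_pt_def support_def)

lemma gap_small_imp:
 assumes b0: "!!i. i <= M ==> 0 <= b i" and b1: "t < (SUM i<=M. b i)" and small: "gap k M b <= t"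
 obtains i0 T where "i0 <= M" "T <= {..M}" "card T = Suc k" "i0 ~: T" "!!i. i <= M ==> b i <= b i0"
  "!!i. i : T ==> 0 < b i" "!!i. i : T ==> b i0 - t <= b i"
proof -
 let ?th = "thresh k M b"
 have th: "0 < ?th"
 proof (rule ccontr)
  assume "~ 0 < ?th"
  hence "?th = 0" using thresh_nonneg[of k M b] by simp
  hence "gap k M b = (SUM i<=M. b i)" unfolding gap_def using b0 by (intro sum.cong) (auto simp: excess_def)
  thus False using b1 small by simp
 qed
 have "Max (b ` {..M}) : b ` {..M}" by (intro Max_in) auto
 then obtain i0 where i0: "i0 : {..M}" "Max (b ` {..M}) = b i0" by (elim imageE)
 have max: "b i <= b i0" if "i <= M" for i unfolding i0(2)[symmetric] using that by (intro Max_ge) auto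
 let ?I = "{i. i <= M & ?th <= b i}"
 have "Suc (Suc k) <= card ?I" by (rule thresh_card_ge[OF th])
 moreover have "card ?I - 1 <= card (?I - {i0})" by (simp add: card_Diff_singleton_if)
 ultimately have "Suc k <= card (?I - {i0})" by simp
 then obtain T where T: "T <= ?I - {i0}" "card T = Suc k" by (rule obtain_subset_with_card_n)
 have "excess k M b i0 <= gap k M b" unfolding gap_def using i0 excess_nonneg by (intro member_le_sum) auto
 hence "b i0 - ?th <= t" using small i0 by (simp add: excess_def)
 hence "0 < b i" "b i0 - t <= b i" if "i : T" for i using T(1) that th by fastforce+
 thus ?thesis using T i0 max by (intro that[of i0 T]) auto
qed

section \<open>Random weights\<close>

text \<open>The barycentric coordinates are reweighted by factors from a finite subset of \<open>[1,2]\<close>. On average the pushed vectors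
 stay away from the singular set, with finite inverse moments.\<close>

definition reweight :: "pt => pt => pt" where
 "reweight a u = (%i. a i * u i)"

definition wt_grid :: "nat => nat => (nat => nat) set" where
 "wt_grid M J = PiE {..M} (%_. {..<J})"

definition grid_wt :: "nat => nat => (nat => nat) => pt" where
 "grid_wt M J g i = (if i <= M then 1 + real (g i)/real J else 1)"

definition tie_const :: "nat => nat => real" where
 "tie_const N k = real N*2^N*(5 * real N)^Suc k"

lemma tie_const_nonneg: "0 <= tie_const N k"
 by (simp add: tie_const_def)

lemma finite_wt_grid [simp]: "finite (wt_grid M J)"
 unfolding wt_grid_def by (intro finite_PiE) auto

lemma card_wt_grid: "card (wt_grid M J) = J^Suc M"
 unfolding wt_grid_def by (subst card_PiE) auto

lemma grid_wt_ge1: "1 <= grid_wt M J g i"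
 by (simp add: grid_wt_def)

lemma grid_wt_le2: "g : wt_grid M J ==> grid_wt M J g i <= 2"
 by (force simp: grid_wt_def wt_grid_def PiE_iff divide_le_eq_1 less_imp_le)

lemma card_real_interval:
 fixes lo len :: real
 assumes "0 <= len"
 shows "real (card {g. g < J & lo <= real g & real g <= lo + len}) <= len + 1"
proof -
 define S where "S = {g. g < J & lo <= real g & real g <= lo + len}"
 show ?thesis
 proof (cases "S = {}")
  case True
  show ?thesis unfolding S_def[symmetric] True using assms by simp
 next
  case False
  have fin: "finite S" by (simp add: S_def)
  have "S <= {Min S..Max S}" using fin by auto
  hence "card S <= Suc (Max S) - Min S" using card_mono[of "{Min S..Max S}" S] by simp
  moreover have ends: "Min S : S" "Max S : S" using fin False by auto
  moreover have "Min S <= Max S" using fin ends(1) by (rule Max_ge)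
  ultimately have "real (card S) <= real (Max S) + 1 - real (Min S)" by linarith
  moreover have "real (Max S) <= lo + len" "lo <= real (Min S)" using ends unfolding S_def by blast+
  ultimately show ?thesis unfolding S_def by linarith
 qed
qed

context
 fixes M N J k :: nat and t :: real and u :: pt
 assumes u: "u : Sx M" and N: "card (support u) <= N" and J: "0 < J" and t: "1/real J <= t"
begin

abbreviation weighted :: "(nat => nat) => pt" where
 "weighted g == reweight (grid_wt M J g) u"

definition nearly_tied :: "nat \<times> nat set => (nat => nat) set" where
 "nearly_tied = (%(i0, T). {g : wt_grid M J. 1/real N <= weighted g i0 &
   (ALL i:T. weighted g i <= weighted g i0 & weighted g i0 - t <= weighted g i)})"

lemma N_ge1: "1 <= N"
 using N support_nonempty[OF u] finite_support[OF u] by (metis One_nat_def Suc_leI card_gt_0_iff le_trans)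

lemma t_pos: "0 < t"
 using t J by (meson divide_pos_pos less_le_trans of_nat_0_less_iff zero_less_one)

lemma weighted_ge: "u i <= weighted g i"
 using grid_wt_ge1[of M J g i] simplex_nonneg[OF u, of i] by (simp add: reweight_def mult_le_cancel_right1)

lemma exists_nearly_tied:
 assumes g: "g : wt_grid M J" and small: "gap k M (weighted g) <= t" and tN: "4 * real N * t < 1"
 obtains i0 T where "i0 : support u" "T <= support u" "card T = Suc k" "i0 ~: T" "g : nearly_tied (i0, T)"
proof -
 have nonneg: "0 <= weighted g i" for i using weighted_ge[of i g] simplex_nonneg[OF u, of i] by linarith
 have "(SUM i<=M. u i) <= (SUM i<=M. weighted g i)" by (intro sum_mono weighted_ge)
 moreover have "1 * t <= 4 * real N * t" using N_ge1 t_pos by (intro mult_right_mono) auto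
 ultimately have "t < (SUM i<=M. weighted g i)" using u tN by (simp add: simplex_k_def)
 then obtain i0 T where iT: "i0 <= M" "T <= {..M}" "card T = Suc k" "i0 ~: T" "!!i. i <= M ==> weighted g i <= weighted g i0"
  "!!i. i : T ==> 0 < weighted g i" "!!i. i : T ==> weighted g i0 - t <= weighted g i"
  using gap_small_imp[OF nonneg _ small] by blast
 have large: "1/real N <= weighted g i0"
 proof (rule ccontr)
  assume "~ ?thesis"
  hence "u i < 1/real N" if "i : support u" for i
   using iT(5)[of i] weighted_ge[of i g] that support_simplex[OF u] by force
  hence "(SUM i:support u. u i) < (SUM i:support u. 1/real N)"
   using finite_support[OF u] support_nonempty[OF u] by (intro sum_strict_mono) auto
  also have "... <= 1" using N N_ge1 by (simp add: divide_le_eq_1)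
  finally show False using sum_supset[OF u finite_support[OF u] order_refl] by simp
 qed
 hence "0 < weighted g i0" using N_ge1 by (meson divide_pos_pos less_le_trans of_nat_0_less_iff zero_less_one One_nat_def Suc_le_eq)
 hence "i0 : support u" by (auto simp: support_def reweight_def)
 moreover have "u i ~= 0" if "i : T" for i using iT(6)[OF that] by (auto simp: reweight_def)
 hence "T <= support u" by (auto simp: support_def)
 moreover have "g : nearly_tied (i0, T)" using g iT large by (auto simp: nearly_tied_def)
 ultimately show ?thesis using iT by (intro that[of i0 T])
qed

lemma card_nearly_tied_weights:
 fixes B v :: real
 assumes v: "0 < v" and tN: "4 * real N * t < 1"
 shows "real (card {g. g < J & 1/real N <= B & (1 + real g/real J) * v <= B & B - t <= (1 + real g/real J) * v}) <= real J*(5 * real N * t)"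
 (is "real (card ?W) <= _")
proof (cases "?W = {}")
 case True
 show ?thesis unfolding True using t_pos by simp

next
 case False
 have Jr: "0 < real J" using J by simp
 obtain g where g: "g < J" "1/real N <= B" "B - t <= (1 + real g/real J) * v" using False by auto
 have "(1 + real g/real J) * v <= 2 * v" using g(1) v by (intro mult_right_mono) auto
 moreover have "t <= 1/(4 * real N)" using tN N_ge1 by (simp add: pos_le_divide_eq mult.commute)
 moreover have "1/real N = 4*(1/(4 * real N))" "0 <= 1/(4 * real N)" using N_ge1 by simp_all
 ultimately have v_ge: "1/(4 * real N) <= v" using g(2,3) by linarith
 define lo where "lo = ((B - t)/v - 1) * real J"
 define len where "len = t/v * real J"
 have len0: "0 <= len" unfolding len_def using t_pos v by simp
 have "?W <= {g. g < J & lo <= real g & real g <= lo + len}"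
 proof
  fix g assume g: "g : ?W"
  have "(B - t)/v <= 1 + real g/real J" "1 + real g/real J <= B/v" using g v by (simp_all add: pos_divide_le_eq pos_le_divide_eq)
  hence "lo <= (real g/real J) * real J" "(real g/real J) * real J <= (B/v - 1) * real J"
   unfolding lo_def using Jr by (intro mult_right_mono; linarith)+
  moreover have "(B/v - 1) * real J = lo + len" unfolding lo_def len_def by (simp add: diff_divide_distrib algebra_simps)
  ultimately show "g : {g. g < J & lo <= real g & real g <= lo + len}" using g Jr by simp
 qed
 hence "card ?W <= card {g. g < J & lo <= real g & real g <= lo + len}" by (intro card_mono) auto
 hence "real (card ?W) <= len + 1" using card_real_interval[OF len0, of J lo] by linarith
 also have "len <= 4 * real N * t * real J"
 proof -
  have "t/v <= t/(1/(4 * real N))" using v_ge t_pos v N_ge1 by (intro divide_left_mono) auto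
  hence "t/v * real J <= (4 * real N * t) * real J" using Jr by (intro mult_right_mono) (auto simp: mult_ac)
  thus ?thesis by (simp add: len_def)
 qed
 also have "1 <= real N * t * real J" using t Jr N_ge1 mult_mono[of 1 "real N" 1 "t * real J"] by (simp add: pos_divide_le_eq mult_ac)
 finally show ?thesis by (simp add: algebra_simps)
qed

lemma card_nearly_tied:
 assumes iT: "i0 : support u" "T <= support u" "card T = Suc k" "i0 ~: T" and tN: "4 * real N * t < 1"
 shows "real (card (nearly_tied (i0, T))) <= (5 * real N * t)^Suc k * real J^Suc M"
proof -
 have Jr: "0 < real J" using J by simp
 have in_M: "i0 <= M" "T <= {..M}" using iT support_simplex[OF u] by auto
 have finT: "finite T" using in_M(2) finite_subset by blast
 define B where "B = (%v::nat. (1 + real v/real J) * u i0)"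
 define slot where "slot = (%v i. if i = i0 then {v} else if i : T then
  {g. g < J & 1/real N <= B v & (1 + real g/real J) * u i <= B v & B v - t <= (1 + real g/real J) * u i} else {..<J})"
 define ratio where "ratio = (%i. if i = i0 then 1/real J else if i : T then 5 * real N * t else 1)"
 have sub: "nearly_tied (i0, T) <= (UN v<J. PiE {..M} (slot v))"
 proof
  fix g assume g: "g : nearly_tied (i0, T)"
  hence "g : PiE {..M} (slot (g i0))"
   using in_M by (auto simp: nearly_tied_def slot_def B_def grid_wt_def reweight_def wt_grid_def PiE_iff)
  moreover have "g i0 < J" using g in_M(1) by (auto simp: nearly_tied_def wt_grid_def PiE_iff)
  ultimately show "g : (UN v<J. PiE {..M} (slot v))" by blast
 qed
 have fin: "finite (slot v i)" for v i by (auto simp: slot_def)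
 have "real (card (slot v i)) <= real J * ratio i" for v i
 proof -
  have "0 < u i" if "i : T" using that iT(2) simplex_nonneg[OF u, of i] by (auto simp: support_def less_le)
  thus ?thesis using Jr card_nearly_tied_weights[OF _ tN, of "u i" "B v"] by (auto simp: slot_def ratio_def)
 qed
 hence "real (card (PiE {..M} (slot v))) <= (PROD i<=M. real J * ratio i)" for v
  by (subst card_PiE) (auto intro: prod_mono)
 also have "(PROD i<=M. real J * ratio i) = real J^Suc M*(PROD i<=M. ratio i)" by (simp only: prod.distrib prod_constant card_atMost)
 also have "(PROD i<=M. ratio i) = (PROD i:insert i0 T. ratio i)" using in_M finT by (intro prod.mono_neutral_right) (auto simp: ratio_def)
 also have "... = 1/real J*(PROD i:T. ratio i)" using finT iT(4) by (simp add: ratio_def)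
 also have "(PROD i:T. ratio i) = (PROD i:T. 5 * real N * t)" using iT(4) by (intro prod.cong) (auto simp: ratio_def)
 also have "... = (5 * real N * t)^Suc k" using iT(3) by (simp only: prod_constant)
 finally have slots: "real (card (PiE {..M} (slot v))) <= real J^Suc M*(1/real J*(5 * real N * t)^Suc k)" for v .
 have "card (nearly_tied (i0, T)) <= card (UN v<J. PiE {..M} (slot v))" by (rule card_mono[OF _ sub]) (auto intro!: finite_PiE fin)
 also have "... <= (SUM v<J. card (PiE {..M} (slot v)))" by (rule card_UN_le) auto
 finally have "real (card (nearly_tied (i0, T))) <= real (SUM v<J. card (PiE {..M} (slot v)))" by (rule of_nat_mono)
 also have "... <= (SUM v<J. real J^Suc M*(1/real J*(5 * real N * t)^Suc k))" unfolding of_nat_sum by (intro sum_mono slots)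
 also have "... = (5 * real N * t)^Suc k * real J^Suc M" using Jr by simp
 finally show ?thesis .
qed

lemma count_small_coarse:
 assumes "1 <= 4 * real N * t"
 shows "real (card {g : wt_grid M J. gap k M (weighted g) <= t}) <= tie_const N k * t^Suc k * real J^Suc M"
proof -
 have "1 <= (5 * real N) * t" using assms t_pos mult_right_mono[of 4 5 "real N * t"] by (simp add: mult.assoc)
 hence "1 <= ((5 * real N) * t)^Suc k" by (rule one_le_power)
 moreover have "1 <= real N*2^N" using N_ge1 mult_mono[of 1 "real N" 1 "2^N"] by simp
 ultimately have "1*1 <= (real N*2^N)*(((5 * real N) * t)^Suc k)" by (intro mult_mono) auto
 also have "... = tie_const N k * t^Suc k" unfolding tie_const_def by (simp only: power_mult_distrib mult.assoc)
 finally have "1 * real J^Suc M <= tie_const N k * t^Suc k * real J^Suc M" by (intro mult_right_mono) auto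
 moreover have "card {g : wt_grid M J. gap k M (weighted g) <= t} <= J^Suc M"
  unfolding card_wt_grid[symmetric] by (intro card_mono) auto
 hence "real (card {g : wt_grid M J. gap k M (weighted g) <= t}) <= real J^Suc M"
  unfolding of_nat_power[symmetric] by (rule of_nat_mono)
 ultimately show ?thesis by linarith
qed

lemma count_small:
 "real (card {g : wt_grid M J. gap k M (weighted g) <= t}) <= tie_const N k * t^Suc k * real J^Suc M"
proof (cases "4 * real N * t < 1")
 case False
 thus ?thesis by (intro count_small_coarse) simp
next
 case True
 let ?S = "support u" and ?c = "(5 * real N * t)^Suc k * real J^Suc M"
 define Q where "Q = {(i0, T). i0 : ?S & T <= ?S & card T = Suc k & i0 ~: T}"
 have finS: "finite ?S" by (rule finite_support[OF u])
 have Q_sub: "Q <= ?S \<times> Pow ?S" by (auto simp: Q_def)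
 have finQ: "finite Q" using Q_sub finS by (meson finite_Pow_iff finite_SigmaI finite_subset)
 have "card Q <= card ?S*2^card ?S" using card_mono[OF _ Q_sub] finS by (simp add: card_cartesian_product card_Pow)
 also have "... <= N*2^N" using N by (intro mult_mono power_increasing) auto
 finally have cardQ: "card Q <= N*2^N" .
 have "{g : wt_grid M J. gap k M (weighted g) <= t} <= (UN q:Q. nearly_tied q)"
 proof
  fix g assume "g : {g : wt_grid M J. gap k M (weighted g) <= t}"
  then obtain i0 T where "i0 : ?S" "T <= ?S" "card T = Suc k" "i0 ~: T" "g : nearly_tied (i0, T)"
   using exists_nearly_tied[OF _ _ True] by blast
  thus "g : (UN q:Q. nearly_tied q)" by (intro UN_I[of "(i0, T)"]) (auto simp: Q_def)
 qed
 moreover have "finite (nearly_tied q)" for q by (cases q) (auto simp: nearly_tied_def)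
 ultimately have "card {g : wt_grid M J. gap k M (weighted g) <= t} <= card (UN q:Q. nearly_tied q)" using finQ by (intro card_mono) auto
 also have "... <= (SUM q:Q. card (nearly_tied q))" by (rule card_UN_le[OF finQ])
 finally have "real (card {g : wt_grid M J. gap k M (weighted g) <= t}) <= real (SUM q:Q. card (nearly_tied q))" by (rule of_nat_mono)
 also have "... <= (SUM q:Q. ?c)" unfolding of_nat_sum using card_nearly_tied[OF _ _ _ _ True] by (intro sum_mono) (auto simp: Q_def simp del: power_Suc)
 also have "... = real (card Q)*?c" by simp
 also have "... <= real (N*2^N)*?c" using cardQ t_pos by (intro mult_right_mono) (auto simp del: of_nat_mult)
 also have "... = tie_const N k * t^Suc k * real J^Suc M" unfolding tie_const_def by (simp add: power_mult_distrib mult_ac)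
 finally show ?thesis .
qed

end

lemma inverse_power_layers:
 fixes Y :: real
 assumes "0 <= Y"
 shows "1/(max Y (1/2^R))^k <= 1 + (SUM l<=R. (2^Suc l)^k * of_bool (Y <= 1/2^l))"
proof (cases "Y <= 1")
 case False
 hence "1/(max Y (1/2^R))^k <= 1" by (simp add: divide_le_eq_1 one_le_power)
 moreover have "0 <= (SUM l<=R. (2^Suc l)^k * of_bool (Y <= 1/2^l) :: real)" by (intro sum_nonneg) auto
 ultimately show ?thesis by linarith
next
 case True
 define S where "S = {l. l <= R & Y <= 1/2^l}"
 define l where "l = Max S"
 have fin: "finite S" and "0 : S" using True by (auto simp: S_def)
 hence l: "l : S" unfolding l_def by (intro Max_in) auto
 have "1/2^Suc l <= max Y (1/2^R)"
 proof (cases "l = R")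
  case True
  have "(1::real)/2^Suc R <= 1/2^R" by (intro divide_left_mono) auto
  thus ?thesis using True by simp
 next
  case False
  have "Suc l ~: S" using Max_ge[OF fin, of "Suc l"] by (auto simp: l_def)
  moreover have "Suc l <= R" using l False by (auto simp: S_def)
  ultimately show ?thesis by (simp add: S_def)
 qed
 hence "(1/2^Suc l)^k <= (max Y (1/2^R))^k" by (intro power_mono) auto
 moreover have "(0::real) < (1/2^Suc l)^k" by simp
 ultimately have "1/(max Y (1/2^R))^k <= 1/(1/2^Suc l)^k"
  by (intro divide_left_mono mult_pos_pos) (auto intro!: zero_less_power simp: less_max_iff_disj)
 also have "... = (2^Suc l)^k * of_bool (Y <= 1/2^l)" using l by (simp add: S_def power_divide)
 also have "... <= (SUM l<=R. (2^Suc l)^k * of_bool (Y <= 1/2^l))" using l by (intro member_le_sum) (auto simp: S_def)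
 finally show ?thesis by simp
qed

lemma sum_half_powers: "(SUM l<=R. 1/2^l) <= (2::real)"
proof -
 have "(SUM l<=R. 1/2^l) = 2 - (1::real)/2^R" by (induction R) (auto simp: field_simps)
 thus ?thesis by simp
qed

lemma exists_le_average:
 fixes f :: "'b => real"
 assumes "finite G" "G ~= {}" "sum f G <= A * real (card G)"
 obtains g where "g : G" "f g <= A"
proof -
 have "EX g:G. f g <= A"
 proof (rule ccontr)
  assume "~ ?thesis"
  hence "(SUM g:G. A) < sum f G" using assms(1,2) by (intro sum_strict_mono) (auto simp: not_le)
  thus False using assms(3) by (simp add: mult.commute)
 qed
 thus ?thesis using that by blast
qed

definition avg_const :: "nat => nat => real" where
 "avg_const N k = 1 + 2^Suc k * tie_const N k"

lemma avg_const_ge1: "1 <= avg_const N k"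
 using tie_const_nonneg[of N k] by (simp add: avg_const_def)

context
 fixes M N R k :: nat and u :: pt
 assumes u: "u : Sx M" and N: "card (support u) <= N"
begin

lemma sum_of_bool_small:
 assumes "1/2^R <= t"
 shows "(SUM g:wt_grid M (2^R). of_bool (gap k M (reweight (grid_wt M (2^R) g) u) <= t)) <= tie_const N k * t^Suc k * real (card (wt_grid M (2^R)))"
proof -
 have "(SUM g:wt_grid M (2^R). of_bool (gap k M (reweight (grid_wt M (2^R) g) u) <= t))
   = real (card {g : wt_grid M (2^R). gap k M (reweight (grid_wt M (2^R) g) u) <= t})"
  by (simp add: of_bool_def sum.If_cases Int_def)
 also have "... <= tie_const N k * t^Suc k * real (2^R)^Suc M" using assms by (intro count_small[OF u N]) auto
 finally show ?thesis by (simp add: card_wt_grid)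
qed

lemma inverse_moment:
 "(SUM g:wt_grid M (2^R). 1/(max (gap k M (reweight (grid_wt M (2^R) g) u)) (1/2^R))^k) <= avg_const N k * real (card (wt_grid M (2^R)))"
proof -
 let ?Y = "%g. gap k M (reweight (grid_wt M (2^R) g) u)" and ?G = "wt_grid M (2^R)"
 let ?V = "real (card ?G)"
 have "(SUM g:?G. 1/(max (?Y g) (1/2^R))^k) <= (SUM g:?G. 1 + (SUM l<=R. (2^Suc l)^k * of_bool (?Y g <= 1/2^l)))"
  by (intro sum_mono inverse_power_layers gap_nonneg)
 also have "... = ?V + (SUM l<=R. (2^Suc l)^k*(SUM g:?G. of_bool (?Y g <= 1/2^l)))"
  unfolding sum.distrib sum.swap[of _ "{..R}" ?G] sum_distrib_left by simp
 also have "... <= ?V + (SUM l<=R. (2^Suc l)^k*(tie_const N k*(1/2^l)^Suc k*?V))"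
  by (intro add_left_mono sum_mono mult_left_mono sum_of_bool_small) (auto intro!: divide_left_mono power_increasing)
 also have "(SUM l<=R. (2^Suc l)^k*(tie_const N k*(1/2^l)^Suc k*?V)) = 2^k * tie_const N k*?V*(SUM l<=R. 1/2^l)"
  unfolding sum_distrib_left by (intro sum.cong) (auto simp: power_mult_distrib power_divide field_simps)
 also have "... <= 2^k * tie_const N k*?V*2" using tie_const_nonneg[of N k] sum_half_powers[of R] by (intro mult_left_mono) auto
 finally show ?thesis by (simp add: avg_const_def algebra_simps)
qed

end

lemma average_select:
 fixes u :: "'c => nat => real" and w :: "'c => real"
 assumes Ce: "finite Ce" and u: "!!c. c : Ce ==> u c : Sx M" and N: "!!c. c : Ce ==> card (support (u c)) <= N"
  and w: "!!c. c : Ce ==> 0 <= w c" and W: "(SUM c:Ce. w c) <= W" "0 < W" and kap: "1 <= \<kappa>"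
  and small: "real (card Ce)*(tie_const N k*(\<kappa>/2^R)^Suc k) <= 1/4"
 shows "EX a. (ALL i. 1 <= a i & a i <= 2) & (ALL c:Ce. \<kappa>/2^R < gap k M (reweight a (u c))) &
   (SUM c:Ce. w c*(1/(gap k M (reweight a (u c)))^k)) <= 2 * avg_const N k * W"
proof -
 let ?G = "wt_grid M (2^R)"
 let ?V = "real (card ?G)"
 define A where "A = avg_const N k"
 have A_ge1: "1 <= A" unfolding A_def by (rule avg_const_ge1)
 define Y where "Y = (%g c. gap k M (reweight (grid_wt M (2^R) g) (u c)))"
 define iv where "iv = (%g c. 1/(max (Y g c) (1/2^R))^k)"
 define bad where "bad = (%g. SUM c:Ce. of_bool (Y g c <= \<kappa>/2^R) :: real)"
 define cost where "cost = (%g. (SUM c:Ce. w c * iv g c) + 4 * A * W * bad g)"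
 have kap2: "1/2^R <= \<kappa>/2^R" using kap by (intro divide_right_mono) auto
 have moments: "(SUM c:Ce. w c*(SUM g:?G. iv g c)) <= (SUM c:Ce. w c*(A*?V))"
  unfolding iv_def Y_def A_def by (intro sum_mono mult_left_mono inverse_moment u N w)
 have bads: "(SUM c:Ce. SUM g:?G. of_bool (Y g c <= \<kappa>/2^R)) <= (SUM c:Ce. tie_const N k*(\<kappa>/2^R)^Suc k*?V)"
  unfolding Y_def by (intro sum_mono sum_of_bool_small u N kap2)
 have "(SUM g:?G. cost g) = (SUM c:Ce. w c*(SUM g:?G. iv g c)) + 4 * A * W*(SUM c:Ce. SUM g:?G. of_bool (Y g c <= \<kappa>/2^R))"
  unfolding cost_def bad_def sum.distrib sum_distrib_left[symmetric] sum.swap[of _ Ce ?G] by (simp add: sum_distrib_left)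
 also have "... <= (SUM c:Ce. w c*(A*?V)) + 4 * A * W*(SUM c:Ce. tie_const N k*(\<kappa>/2^R)^Suc k*?V)"
  using A_ge1 W by (intro add_mono moments mult_left_mono[OF bads]) auto
 also have "... = (SUM c:Ce. w c)*(A*?V) + 4 * A * W*(real (card Ce)*(tie_const N k*(\<kappa>/2^R)^Suc k)*?V)" by (simp add: sum_distrib_right)
 also have "... <= W*(A*?V) + 4 * A * W*(1/4*?V)"
  using W A_ge1 small by (intro add_mono mult_right_mono mult_left_mono) auto
 finally have "(SUM g:?G. cost g) <= (2 * A * W)*?V" by (simp add: algebra_simps)
 moreover have "?G ~= {}" using card_wt_grid[of M "2^R"] by auto
 ultimately obtain g where g: "g : ?G" "cost g <= 2 * A * W" using exists_le_average[of ?G cost] by auto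
 have "0 <= iv g c" for c by (auto simp: iv_def le_max_iff_disj intro!: zero_le_power)
 hence moments_nonneg: "0 <= (SUM c:Ce. w c * iv g c)" using w by (intro sum_nonneg) auto
 have AW: "0 < A * W" using A_ge1 W by simp
 have bad_nonneg: "0 <= bad g" unfolding bad_def by (intro sum_nonneg) auto
 have good: "\<kappa>/2^R < Y g c" if c: "c : Ce" for c
 proof (rule ccontr)
  assume "~ ?thesis"
  hence "(1::real) = of_bool (Y g c <= \<kappa>/2^R)" by simp
  also have "... <= bad g" unfolding bad_def using c Ce by (intro member_le_sum) auto
  finally have "4 * (A * W)*1 <= 4 * (A * W) * bad g" using AW by (intro mult_left_mono) auto
  thus False using g(2) moments_nonneg AW unfolding cost_def by simp
 qed
 have "1/(Y g c)^k = iv g c" if "c : Ce" for c using good[OF that] kap2 by (simp add: iv_def max_def)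
 hence "(SUM c:Ce. w c*(1/(Y g c)^k)) = (SUM c:Ce. w c * iv g c)" by simp
 also have "... <= 2 * A * W" using g(2) mult_nonneg_nonneg[OF less_imp_le[OF AW] bad_nonneg] unfolding cost_def by simp
 finally show ?thesis using good grid_wt_ge1 grid_wt_le2[OF g(1)] unfolding A_def Y_def by blast
qed

section \<open>Hausdorff measure of Lipschitz images\<close>

lemma sets_hausdorff [simp]: "sets (hausdorff_measure k) = sets borel"
 unfolding hausdorff_measure_def by (simp add: sets_measure_of_conv) (metis sets.sigma_sets_eq space_borel)

lemma space_hausdorff [simp]: "space (hausdorff_measure k) = UNIV"
 unfolding hausdorff_measure_def by (simp add: space_measure_of_conv)

text \<open>If the outer measure were not additive on Borel sets, the measure would be zero by convention;
 both of the following facts hold either way.\<close>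

lemma hausdorff_le_outer: "emeasure (hausdorff_measure k) A <= hausdorff_outer k A"
 unfolding hausdorff_measure_def emeasure_measure_of_conv by auto

lemma hausdorff_scale:
 fixes A B :: "'a::metric_space set"
 assumes "A : sets borel" "hausdorff_outer k B <= c * hausdorff_outer k A"
 shows "emeasure (hausdorff_measure k) B <= c * emeasure (hausdorff_measure k) A"
proof -
 have sigma: "sigma_sets UNIV (sets borel) = (sets borel :: 'a set set)" by (metis sets.sigma_sets_eq space_borel)
 show ?thesis using assms unfolding hausdorff_measure_def emeasure_measure_of_conv sigma by auto
qed

definition cover_sum :: "nat => (nat => 'a::metric_space set) => ennreal" where
 "cover_sum k C = suminf (%i. if C i = {} then 0 else ennreal (diameter (C i))^k)"

lemma hausdorff_pre_le:
 "A <= (UN i. C i) ==> (!!i. bounded (C i) & diameter (C i) <= dlt) ==> hausdorff_pre k dlt A <= cover_sum k C"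
 unfolding hausdorff_pre_def cover_sum_def by (intro Inf_lower) auto

lemma le_hausdorff_pre:
 assumes "!!C. A <= (UN i. C i) ==> (!!i. bounded (C i) & diameter (C i) <= dlt) ==> x <= cover_sum k C"
 shows "x <= hausdorff_pre k dlt A"
 unfolding hausdorff_pre_def using assms unfolding cover_sum_def by (intro Inf_greatest) auto

lemma hausdorff_pre_finite:
 assumes I: "finite I" and A: "A <= (UN i:I. D i)"
  and D: "!!i. i : I ==> bounded (D i) & diameter (D i) <= r" and r: "r <= dlt" "0 <= r"
 shows "hausdorff_pre k dlt A <= of_nat (card I) * ennreal (r^k)"
proof -
 obtain e where e: "bij_betw e {..<card I} I" using ex_bij_betw_nat_finite[OF I] by (auto simp: atLeast0LessThan)
 define C where "C = (%i. if i < card I then D (e i) else {})"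
 have eI: "e i : I" if "i < card I" for i using e that by (auto simp: bij_betw_def)
 have "A <= (UN i. C i)"
 proof
  fix x assume "x : A"
  then obtain j where j: "j : I" "x : D j" using A by auto
  then obtain i where "i < card I" "j = e i" using e by (auto simp: bij_betw_def)
  thus "x : (UN i. C i)" using j by (intro UN_I[of i]) (simp_all add: C_def)
 qed
 moreover have "bounded (C i) & diameter (C i) <= dlt" for i
  using D[OF eI, of i] r by (cases "i < card I") (auto simp: C_def)
 ultimately have "hausdorff_pre k dlt A <= cover_sum k C" by (rule hausdorff_pre_le)
 also have "... = (SUM i<card I. if C i = {} then 0 else ennreal (diameter (C i))^k)"
  unfolding cover_sum_def by (intro suminf_finite) (auto simp: C_def)
 also have "... <= (SUM i<card I. ennreal (r^k))"
 proof (rule sum_mono)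
  fix i assume i: "i : {..<card I}"
  have "ennreal (diameter (C i))^k <= ennreal r^k" using D[OF eI[of i]] i by (intro power_mono ennreal_leI) (auto simp: C_def)
  thus "(if C i = {} then 0 else ennreal (diameter (C i))^k) <= ennreal (r^k)" using r by (simp add: ennreal_power)
 qed
 also have "... = of_nat (card I) * ennreal (r^k)" by simp
 finally show ?thesis .
qed

lemma diameter_le_metric:
 fixes S :: "'a::metric_space set"
 assumes "!!x y. x : S ==> y : S ==> dist x y <= r" "0 <= r"
 shows "diameter S <= r"
 using assms unfolding diameter_def by (auto intro!: cSUP_least)

lemma bounded_diameter_image:
 fixes g :: "'b => 'a::metric_space"
 assumes "!!x y. x : A ==> y : A ==> dist (g x) (g y) <= r" "0 <= r"
 shows "bounded (g ` A) & diameter (g ` A) <= r"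
proof
 show "bounded (g ` A)" unfolding bounded_two_points using assms by blast
 show "diameter (g ` A) <= r" using assms by (intro diameter_le_metric) auto
qed

context
 fixes A :: "'b set" and f g :: "'b => 'a::metric_space" and lmb :: real and k :: nat
 assumes lam: "0 < lmb" and lip: "!!x y. x : A ==> y : A ==> dist (g x) (g y) <= lmb * dist (f x) (f y)"
begin

lemma hausdorff_pre_le_cover_sum:
 assumes C: "f ` A <= (UN i. C i)" "!!i. bounded (C i) & diameter (C i) <= dlt"
 shows "hausdorff_pre k (lmb * dlt) (g ` A) <= ennreal (lmb^k) * cover_sum k C"
proof -
 define D where "D = (%i. g ` {x : A. f x : C i})"
 have D: "bounded (D i) & diameter (D i) <= lmb * diameter (C i)" for i
  unfolding D_def
 proof (rule bounded_diameter_image)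
  fix x y assume xy: "x : {x : A. f x : C i}" "y : {x : A. f x : C i}"
  have "dist (g x) (g y) <= lmb * dist (f x) (f y)" using lip xy by auto
  also have "... <= lmb * diameter (C i)" using lam C(2)[of i] xy by (intro mult_left_mono diameter_bounded_bound) auto
  finally show "dist (g x) (g y) <= lmb * diameter (C i)" .
 qed (use lam C(2)[of i] in \<open>simp add: diameter_ge_0\<close>)
 have "g ` A <= (UN i. D i)" using C(1) by (fastforce simp: D_def)
 moreover have "diameter (D i) <= lmb * dlt" for i using D[of i] C(2)[of i] lam by (meson mult_left_mono less_imp_le order_trans)
 ultimately have "hausdorff_pre k (lmb * dlt) (g ` A) <= cover_sum k D" using D by (intro hausdorff_pre_le) auto
 also have "... <= (suminf (%i. ennreal (lmb^k)*(if C i = {} then 0 else ennreal (diameter (C i))^k)))"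
  unfolding cover_sum_def
 proof (intro suminf_le allI)
  fix i
  have "ennreal (diameter (D i))^k <= ennreal (lmb * diameter (C i))^k" using D[of i] by (intro power_mono ennreal_leI) auto
  also have "... = ennreal (lmb^k) * ennreal (diameter (C i))^k"
   using lam C(2)[of i] by (simp add: ennreal_mult power_mult_distrib ennreal_power diameter_ge_0)
  finally show "(if D i = {} then 0 else ennreal (diameter (D i))^k) <= ennreal (lmb^k)*(if C i = {} then 0 else ennreal (diameter (C i))^k)"
   by (auto simp: D_def)
 qed auto
 also have "... = ennreal (lmb^k) * cover_sum k C" unfolding cover_sum_def by (rule ennreal_suminf_cmult)
 finally show ?thesis .
qed

lemma hausdorff_pre_lipschitz: "hausdorff_pre k (lmb * dlt) (g ` A) <= ennreal (lmb^k) * hausdorff_pre k dlt (f ` A)"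
proof -
 have cancel: "ennreal (lmb^k)*(ennreal (1/lmb^k) * X) = X" for X
  using lam by (simp add: mult.assoc[symmetric] ennreal_mult[symmetric])
 have "ennreal (1/lmb^k) * hausdorff_pre k (lmb * dlt) (g ` A) <= hausdorff_pre k dlt (f ` A)"
 proof (rule le_hausdorff_pre)
  fix C :: "nat => 'a set" assume C: "f ` A <= (UN i. C i)" "!!i. bounded (C i) & diameter (C i) <= dlt"
  have "ennreal (1/lmb^k) * hausdorff_pre k (lmb * dlt) (g ` A) <= ennreal (1/lmb^k)*(ennreal (lmb^k) * cover_sum k C)"
   by (intro mult_left_mono hausdorff_pre_le_cover_sum[OF C]) simp
  thus "ennreal (1/lmb^k) * hausdorff_pre k (lmb * dlt) (g ` A) <= cover_sum k C" using cancel[of "cover_sum k C"] by (simp add: mult.left_commute)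
 qed
 from mult_left_mono[OF this, of "ennreal (lmb^k)"] show ?thesis unfolding cancel by simp
qed

lemma hausdorff_outer_lipschitz: "hausdorff_outer k (g ` A) <= ennreal (lmb^k) * hausdorff_outer k (f ` A)"
 unfolding hausdorff_outer_def[of k "g ` A"]
proof (rule SUP_least)
 fix dlt :: real assume dlt: "dlt : {0<..}"
 have "hausdorff_pre k dlt (g ` A) <= ennreal (lmb^k) * hausdorff_pre k (dlt/lmb) (f ` A)" using hausdorff_pre_lipschitz[of "dlt/lmb"] lam by simp
 also have "... <= ennreal (lmb^k) * hausdorff_outer k (f ` A)"
  unfolding hausdorff_outer_def using dlt lam by (intro mult_left_mono SUP_upper) auto
 finally show "hausdorff_pre k dlt (g ` A) <= ennreal (lmb^k) * hausdorff_outer k (f ` A)" .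
qed

end

text \<open>The dyadic cells \<open>dcell k j q\<close> partition the simplex; the last barycentric coordinate is determined by the others.\<close>

definition idx :: "nat => nat => pt => (nat => nat)" where
 "idx k j x = restrict (%i. nat (floor (2^j * x i))) {..<k}"

definition dcell :: "nat => nat => (nat => nat) => pt set" where
 "dcell k j q = {x : Sx k. idx k j x = q}"

definition grid :: "nat => nat => (nat => nat) set" where
 "grid k j = PiE {..<k} (%_. {..2^j})"

lemma finite_grid [simp]: "finite (grid k j)"
 unfolding grid_def by (intro finite_PiE) auto

lemma card_grid: "card (grid k j) = (2^j + 1)^k"
 unfolding grid_def by (subst card_PiE) auto

lemma idx_in_grid: "x : Sx k ==> idx k j x : grid k j"
proof -
 assume x: "x : Sx k"
 have "nat (floor (2^j * x i)) <= 2^j" if "i < k" for i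
 proof -
  have "x i <= 1" using simplex_le1[OF x, of i] that by simp
  hence "2^j * x i <= 2^j*1" by (intro mult_left_mono) auto
  hence "floor (2^j * x i) <= floor (2^j :: real)" by (intro floor_mono) simp
  also have "floor (2^j :: real) = 2^j" by (metis floor_of_int of_int_numeral of_int_power)
  finally show ?thesis by (simp add: nat_le_iff)
 qed
 thus ?thesis by (auto simp: grid_def idx_def)
qed

lemma idx_mult:
 assumes x: "x : Sx k" and i: "i < k" and j: "j <= j'"
 shows "idx k j x i = idx k j' x i div 2^(j' - j)"
proof -
 have "2^j * x i = 2^j' * x i/2^(j' - j)" using j by (simp add: power_diff)
 hence "floor (2^j * x i) = floor (2^j' * x i/of_int (2^(j' - j)))" by simp
 also have "... = floor (2^j' * x i) div 2^(j' - j)" by (rule floor_divide_real_eq_div) simp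
 finally show ?thesis using i simplex_nonneg[OF x, of i] by (simp add: idx_def nat_div_distrib nat_power_eq)
qed

lemma idx_eq_mono:
 assumes "x : Sx k" "y : Sx k" "j <= j'" "idx k j' x = idx k j' y"
 shows "idx k j x = idx k j y"
proof
 fix i show "idx k j x i = idx k j y i"
 proof (cases "i < k")
  case True
  thus ?thesis by (simp only: idx_mult[OF assms(1) True assms(3)] idx_mult[OF assms(2) True assms(3)] assms(4))
 qed (simp add: idx_def)
qed

lemma dcell_diam:
 assumes "x : dcell k j q" "y : dcell k j q"
 shows "l1 k x y <= 2 * real k/2^j"
proof -
 have xs: "x : Sx k" "y : Sx k" and same_idx: "idx k j x = idx k j y" using assms by (auto simp: dcell_def)
 have diff: "abs (x i - y i) <= 1/2^j" if i: "i < k" for i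
 proof -
  have "nat (floor (2^j * x i)) = nat (floor (2^j * y i))" using fun_cong[OF same_idx, of i] i by (simp add: idx_def)
  moreover have "0 <= floor (2^j * x i)" "0 <= floor (2^j * y i)" using simplex_nonneg[OF xs(1), of i] simplex_nonneg[OF xs(2), of i] by simp_all
  ultimately have "floor (2^j * x i) = floor (2^j * y i)" by (metis int_nat_eq)
  hence "abs (2^j * x i - 2^j * y i) <= 1" by linarith
  hence "2^j * abs (x i - y i) <= 1" by (simp add: abs_mult right_diff_distrib[symmetric])
  thus ?thesis by (simp add: pos_le_divide_eq mult.commute)
 qed
 have sum_le: "(SUM i<k. abs (x i - y i)) <= real k/2^j" using sum_mono[of "{..<k}" "%i. abs (x i - y i)" "%_. 1/2^j"] diff by simp
 have last: "x k - y k = - (SUM i<k. x i - y i)" using xs by (simp add: simplex_k_def lessThan_Suc_atMost[symmetric] sum_subtractf)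
 have "abs (x k - y k) <= (SUM i<k. abs (x i - y i))" unfolding last abs_minus_cancel by (rule sum_abs)
 thus ?thesis using sum_le by (simp add: l1_def lessThan_Suc_atMost[symmetric])
qed

lemma card_subcells:
 assumes j: "j <= j'"
 shows "card {q' : grid k j'. dcell k j q Int dcell k j' q' ~= {}} <= (2^(j' - j))^k"
proof -
 let ?D = "2^(j' - j) :: nat"
 have "{q' : grid k j'. dcell k j q Int dcell k j' q' ~= {}} <= PiE {..<k} (%i. {q i*?D..<q i*?D + ?D})"
 proof
  fix q' assume "q' : {q' : grid k j'. dcell k j q Int dcell k j' q' ~= {}}"
  then obtain x where x: "x : Sx k" "idx k j x = q" "idx k j' x = q'" by (auto simp: dcell_def)
  have "q' i : {q i*?D..<q i*?D + ?D}" if "i < k" for i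
  proof -
   have "q i = q' i div ?D" using idx_mult[OF x(1) that j] x by simp
   moreover have "q' i < q' i div ?D*?D + ?D" by (metis dividend_less_div_times zero_less_numeral zero_less_power add.commute)
   ultimately show ?thesis by (simp add: div_times_less_eq_dividend)
  qed
  moreover have "q' : extensional {..<k}" using x(3) by (auto simp: idx_def)
  ultimately show "q' : PiE {..<k} (%i. {q i*?D..<q i*?D + ?D})" by (auto simp: PiE_iff)
 qed
 hence "card {q' : grid k j'. dcell k j q Int dcell k j' q' ~= {}} <= card (PiE {..<k} (%i. {q i*?D..<q i*?D + ?D}))"
  by (intro card_mono finite_PiE) auto
 also have "... = ?D^k" by (subst card_PiE) auto
 finally show ?thesis .
qed

lemma hausdorff_pre_cells:
 fixes g :: "pt => 'a::metric_space"
 assumes g: "lipl k L A g" and A: "A <= (UN q:I. dcell k j q)" and I: "finite I" and dlt: "L*(2 * real k/2^j) <= dlt"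
 shows "hausdorff_pre p dlt (g ` A) <= of_nat (card I) * ennreal ((L*(2 * real k/2^j))^p)"
proof (rule hausdorff_pre_finite[where D="%q. g ` (A Int dcell k j q)", OF I])
 have L0: "0 <= L" by (rule lipl_nonneg[OF g])
 thus r0: "0 <= L*(2 * real k/2^j)" by simp
 show "g ` A <= (UN q:I. g ` (A Int dcell k j q))" using A by blast
 fix q show "bounded (g ` (A Int dcell k j q)) & diameter (g ` (A Int dcell k j q)) <= L*(2 * real k/2^j)"
 proof (rule bounded_diameter_image[OF _ r0])
  fix x y assume xy: "x : A Int dcell k j q" "y : A Int dcell k j q"
  have "dist (g x) (g y) <= L * l1 k x y" using xy by (intro lipl_dist[OF g]) auto
  also have "... <= L*(2 * real k/2^j)" using dcell_diam[of x k j q y] xy L0 by (intro mult_left_mono) auto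
  finally show "dist (g x) (g y) <= L*(2 * real k/2^j)" .
 qed
qed (rule dlt)

lemma hausdorff_cell:
 fixes g :: "pt => 'a::metric_space"
 assumes g: "lipl k L (dcell k j q) g"
 shows "hausdorff_outer k (g ` (dcell k j q Int A)) <= ennreal ((2 * real k * L/2^j)^k)"
 unfolding hausdorff_outer_def
proof (rule SUP_least)
 fix dlt :: real assume dlt: "dlt : {0<..}"
 obtain j0 :: nat where j0: "2 * real k * L/dlt < 2^j0" using real_arch_pow[of 2 "2 * real k * L/dlt"] by auto
 define j' where "j' = max j j0"
 have jj: "j <= j'" by (simp add: j'_def)
 define r where "r = L*(2 * real k/2^j')"
 have r0: "0 <= r" unfolding r_def using lipl_nonneg[OF g] by simp
 have "2 * real k * L/dlt < 2^j'" by (rule less_le_trans[OF j0 power_increasing]) (auto simp: j'_def)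
 hence r: "r <= dlt" using dlt unfolding r_def by (simp add: field_simps)
 let ?I = "{q' : grid k j'. dcell k j q Int dcell k j' q' ~= {}}"
 have "hausdorff_pre k dlt (g ` (dcell k j q Int A)) <= of_nat (card ?I) * ennreal (r^k)"
  unfolding r_def
 proof (rule hausdorff_pre_cells[OF lipl_mono[OF g]])
  show "dcell k j q Int A <= (UN q':?I. dcell k j' q')"
  proof
   fix x assume x: "x : dcell k j q Int A"
   hence "x : dcell k j' (idx k j' x)" "idx k j' x : ?I" using idx_in_grid[of x k j'] by (auto simp: dcell_def)
   thus "x : (UN q':?I. dcell k j' q')" by blast
  qed
 qed (use r in \<open>auto simp: r_def\<close>)
 also have "... <= of_nat ((2^(j' - j))^k) * ennreal (r^k)" by (intro mult_right_mono of_nat_mono card_subcells[OF jj]) auto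
 also have "... = ennreal (real ((2^(j' - j))^k) * r^k)" using r0 by (simp add: ennreal_mult ennreal_of_nat_eq_real_of_nat)
 also have "real ((2^(j' - j))^k) * r^k = (2^(j' - j) * r)^k" by (simp add: power_mult_distrib)
 also have "2^(j' - j) * r = 2 * real k * L/2^j" unfolding r_def using jj by (simp add: power_diff)
 finally show "hausdorff_pre k dlt (g ` (dcell k j q Int A)) <= ennreal ((2 * real k * L/2^j)^k)" .
qed

lemma hausdorff_pre_lower_dim:
 fixes f :: "pt => 'a::metric_space"
 assumes f: "lipl p L (Sx p) f" and dlt: "0 < dlt" and j: "2 * real p * L/dlt < 2^j"
 shows "hausdorff_pre (Suc p) dlt (f ` Sx p) <= ennreal (2^p*(2 * real p * L)^Suc p/2^j)"
proof -
 define r where "r = L*(2 * real p/2^j)"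
 have r0: "0 <= r" unfolding r_def using lipl_nonneg[OF f] by simp
 have r: "L*(2 * real p/2^j) <= dlt" using dlt j by (simp add: field_simps)
 have "Sx p <= (UN q:grid p j. dcell p j q)" using idx_in_grid[of _ p j] by (auto simp: dcell_def)
 from hausdorff_pre_cells[OF f this finite_grid r, of "Suc p"]
 have "hausdorff_pre (Suc p) dlt (f ` Sx p) <= of_nat (card (grid p j)) * ennreal (r^Suc p)" by (simp only: r_def)
 also have "... = ennreal (real ((2^j + 1)^p) * r^Suc p)" using r0 by (simp add: card_grid ennreal_mult ennreal_of_nat_eq_real_of_nat del: power_Suc)
 also have "... <= ennreal ((2*2^j)^p * r^Suc p)"
 proof (intro ennreal_leI mult_right_mono)
  have "real (2^j + 1)^p <= (2*2^j)^p" by (intro power_mono) auto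
  thus "real ((2^j + 1)^p) <= (2*2^j)^p" by (simp only: of_nat_power)
 qed (use r0 in simp)
 also have "(2*2^j)^p * r^Suc p = 2^p*(2 * real p * L)^Suc p/2^j"
 proof -
  have "r^Suc p = (2 * real p * L)^Suc p/(2^j*(2^j)^p)" unfolding r_def by (simp add: power_divide power_mult_distrib mult_ac)
  thus ?thesis by (simp add: power_mult_distrib)
 qed
 finally show ?thesis .
qed

lemma hausdorff_lower_dim:
 fixes f :: "pt => 'a::metric_space"
 assumes f: "lipl p L (Sx p) f"
 shows "hausdorff_outer (Suc p) (f ` Sx p) = 0"
proof -
 let ?B = "2^p*(2 * real p * L)^Suc p"
 have "hausdorff_pre (Suc p) dlt (f ` Sx p) <= 0" if dlt: "0 < dlt" for dlt
 proof (rule ennreal_le_epsilon)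
  fix e :: real assume e: "0 < e"
  obtain j :: nat where j: "max (2 * real p * L/dlt) (?B/e) < 2^j" using real_arch_pow[of 2 "max (2 * real p * L/dlt) (?B/e)"] by auto
  have "hausdorff_pre (Suc p) dlt (f ` Sx p) <= ennreal (?B/2^j)" using hausdorff_pre_lower_dim[OF f dlt] j by simp
  also have "... <= ennreal e" using j e by (intro ennreal_leI) (simp add: pos_divide_less_eq pos_divide_le_eq mult.commute del: power_Suc)
  finally show "hausdorff_pre (Suc p) dlt (f ` Sx p) <= 0 + ennreal e" by simp
 qed
 hence "hausdorff_outer (Suc p) (f ` Sx p) <= 0" unfolding hausdorff_outer_def by (intro SUP_least) auto
 thus ?thesis by simp
qed

section \<open>Chains of affine simplices and their subdivision\<close>

abbreviation "keys == Poly_Mapping.keys"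

abbreviation "lkp == Poly_Mapping.lookup"

abbreviation abs_coeff :: "('b \<Rightarrow>\<^sub>0 int) => 'b => real" where
 "abs_coeff c x == abs (real_of_int (lkp c x))"

type_synonym 'v list_chain = "'v list \<Rightarrow>\<^sub>0 int"

definition nrm :: "('b \<Rightarrow>\<^sub>0 int) => real" where
 "nrm c = (SUM x:keys c. abs_coeff c x)"

lemma nrm_superset: "finite S ==> keys c <= S ==> nrm c = (SUM x:S. abs_coeff c x)"
 unfolding nrm_def by (rule sum.mono_neutral_left) (auto simp: in_keys_iff)

lemma nrm_nonneg [simp]: "0 <= nrm c"
 by (simp add: nrm_def sum_nonneg)

lemma nrm_0 [simp]: "nrm 0 = 0"
 by (simp add: nrm_def)

lemma nrm_of [simp]: "nrm (frag_of x) = 1"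
 by (simp add: nrm_def)

lemma nrm_add: "nrm (a + b) <= nrm a + nrm b"
proof -
 let ?S = "keys a Un keys b"
 have "nrm (a + b) = (SUM x:?S. abs_coeff (a + b) x)" by (rule nrm_superset) (auto simp: Poly_Mapping.keys_add)
 also have "... <= (SUM x:?S. abs_coeff a x + abs_coeff b x)" by (rule sum_mono) (simp add: lookup_add)
 also have "... = nrm a + nrm b" using nrm_superset[of ?S a] nrm_superset[of ?S b] by (simp add: sum.distrib)
 finally show ?thesis .
qed

lemma nrm_minus [simp]: "nrm (- a) = nrm a"
 by (simp add: nrm_def)

lemma nrm_diff: "nrm (a - b) <= nrm a + nrm b"
 using nrm_add[of a "- b"] by simp

lemma nrm_cmul: "nrm (frag_cmul k a) = abs (real_of_int k) * nrm a"
proof (cases "k = 0")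
 case False
 hence "keys (frag_cmul k a) = keys a" by auto
 thus ?thesis by (simp add: nrm_def abs_mult sum_distrib_left)
qed simp

lemma nrm_sum: "nrm (sum b I) <= (SUM i:I. nrm (b i))"
proof (induction I rule: infinite_finite_induct)
 case (insert i I)
 thus ?case using nrm_add[of "b i" "sum b I"] by simp
qed auto

lemma nrm_extend:
 assumes "!!x. x : keys c ==> nrm (f x) <= B"
 shows "nrm (frag_extend f c) <= B * nrm c"
proof -
 have "nrm (frag_extend f c) <= (SUM x:keys c. nrm (frag_cmul (lkp c x) (f x)))" unfolding frag_extend_def by (rule nrm_sum)
 also have "... <= (SUM x:keys c. abs_coeff c x * B)" unfolding nrm_cmul using assms by (intro sum_mono mult_left_mono) auto
 also have "... = B * nrm c" unfolding nrm_def sum_distrib_right[symmetric] by (rule mult.commute)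
 finally show ?thesis .
qed

lemma frag_extend_extend: "frag_extend f (frag_extend g c) = frag_extend (%x. frag_extend f (g x)) c"
 using subset_UNIV by (induction c rule: frag_induction) (auto simp: frag_extend_diff)

lemma frag_extend_fun_diff: "frag_extend (%x. f x - g x) c = frag_extend f c - frag_extend g c"
 using subset_UNIV by (induction c rule: frag_induction) (auto simp: frag_extend_diff)

lemma frag_extend_id: "frag_extend frag_of c = c"
 using frag_expansion by metis

definition lcons :: "'v => 'v list_chain => 'v list_chain" where
 "lcons v = frag_extend (%l. frag_of (v # l))"

definition lmap :: "('v => 'w) => 'v list_chain => 'w list_chain" where
 "lmap f = frag_extend (%l. frag_of (map f l))"

primrec bd :: "'v list => 'v list_chain" where
 "bd [] = 0"
| "bd (v # l) = frag_of l - lcons v (bd l)"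

definition BD :: "'v list_chain => 'v list_chain" where
 "BD = frag_extend bd"

lemma lcons_of [simp]: "lcons v (frag_of l) = frag_of (v # l)" and lcons_diff: "lcons v (a - b) = lcons v a - lcons v b"
 and lcons_0 [simp]: "lcons v 0 = 0"
 by (simp_all add: lcons_def frag_extend_diff)

lemma lmap_of [simp]: "lmap f (frag_of l) = frag_of (map f l)" and lmap_diff: "lmap f (a - b) = lmap f a - lmap f b"
 and lmap_0 [simp]: "lmap f 0 = 0"
 by (simp_all add: lmap_def frag_extend_diff)

lemma BD_of [simp]: "BD (frag_of l) = bd l" and BD_diff: "BD (a - b) = BD a - BD b"
 and BD_0 [simp]: "BD 0 = 0"
 by (simp_all add: BD_def frag_extend_diff)

lemma BD_sum: "finite I ==> BD (sum b I) = (SUM i:I. BD (b i))"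
 by (simp add: BD_def frag_extend_sum o_def)

lemma lmap_sum: "finite I ==> lmap f (sum b I) = (SUM i:I. lmap f (b i))"
 by (simp add: lmap_def frag_extend_sum o_def)

lemma BD_lcons: "BD (lcons v c) = c - lcons v (BD c)"
 using subset_UNIV by (induction c rule: frag_induction) (auto simp: lcons_diff BD_diff)

lemma BD_bd [simp]: "BD (bd l) = 0"
 by (induction l) (simp_all add: BD_diff BD_lcons)

lemma lmap_lcons: "lmap f (lcons v c) = lcons (f v) (lmap f c)"
 using subset_UNIV by (induction c rule: frag_induction) (auto simp: lcons_diff lmap_diff)

lemma bd_map: "bd (map f l) = lmap f (bd l)"
 by (induction l) (simp_all add: lmap_diff lmap_lcons)

lemma BD_lmap: "BD (lmap f c) = lmap f (BD c)"
 using subset_UNIV by (induction c rule: frag_induction) (auto simp: lmap_diff BD_diff bd_map)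

lemma lmap_lmap: "lmap f (lmap g c) = lmap (%x. f (g x)) c"
 using subset_UNIV by (induction c rule: frag_induction) (auto simp: lmap_diff comp_def)

lemma lmap_id: "lmap (%x. x) c = c"
 using subset_UNIV by (induction c rule: frag_induction) (auto simp: lmap_diff)

primrec pr :: "('v => 'w) => ('v => 'w) => 'v list => 'w list_chain" where
 "pr f g [] = 0"
| "pr f g (x # l) = frag_of (f x # g x # map g l) - lcons (f x) (pr f g l)"

definition PR :: "('v => 'w) => ('v => 'w) => 'v list_chain => 'w list_chain" where
 "PR f g = frag_extend (pr f g)"

lemma PR_of [simp]: "PR f g (frag_of l) = pr f g l" and PR_diff: "PR f g (a - b) = PR f g a - PR f g b" and PR_0 [simp]: "PR f g 0 = 0"
 by (simp_all add: PR_def frag_extend_diff)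

lemma PR_lcons: "PR f g (lcons x c) = lcons (f x) (lcons (g x) (lmap g c)) - lcons (f x) (PR f g c)"
 using subset_UNIV by (induction c rule: frag_induction) (auto simp: lcons_diff PR_diff lmap_diff)

lemma BD_pr: "BD (pr f g l) = frag_of (map g l) - frag_of (map f l) - PR f g (bd l)"
proof (induction l)
 case (Cons x l)
 show ?case
  by (simp add: BD_diff BD_lcons Cons.IH lcons_diff PR_diff PR_lcons bd_map)
qed simp

lemma BD_PR: "BD (PR f g c) = lmap g c - lmap f c - PR f g (BD c)"
 using subset_UNIV by (induction c rule: frag_induction) (auto simp: PR_diff BD_diff lmap_diff BD_pr)

lemma pr_map: "lmap h (pr f g l) = pr (%x. h (f x)) (%x. h (g x)) l"
 by (induction l) (simp_all add: lmap_diff lmap_lcons o_def)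

lemma pr_pre: "pr f g (map h l) = pr (%x. f (h x)) (%x. g (h x)) l"
 by (induction l) (simp_all add: o_def)

lemma lmap_PR: "lmap h (PR f g c) = PR (%x. h (f x)) (%x. h (g x)) c"
 using subset_UNIV by (induction c rule: frag_induction) (auto simp: PR_diff lmap_diff pr_map)

lemma PR_lmap: "PR f g (lmap h c) = PR (%x. f (h x)) (%x. g (h x)) c"
 using subset_UNIV by (induction c rule: frag_induction) (auto simp: PR_diff lmap_diff pr_pre)

lemma keys_lcons: "keys (lcons v c) <= Cons v ` keys c"
 using keys_frag_extend[of "%l. frag_of (v # l)" c] by (auto simp: lcons_def)

lemma keys_lmap: "keys (lmap f c) <= map f ` keys c"
 using keys_frag_extend[of "%l. frag_of (map f l)" c] by (auto simp: lmap_def)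

lemma keys_bd: "keys (bd l) <= {del i l |i. i < length l}"
proof (induction l)
 case (Cons v l)
 have "keys (bd (v # l)) <= {l} Un Cons v ` keys (bd l)"
  using keys_diff[of "frag_of l" "lcons v (bd l)"] keys_lcons[of v "bd l"] by auto
 also have "... <= {del i (v # l) |i. i < length (v # l)}"
 proof
  fix x assume "x : {l} Un Cons v ` keys (bd l)"
  thus "x : {del i (v # l) |i. i < length (v # l)}"
  proof
   assume "x : {l}" thus ?thesis by (auto intro!: exI[of _ 0])
  next
   assume "x : Cons v ` keys (bd l)"
   then obtain i where "i < length l" "x = v # del i l" using Cons by auto
   thus ?thesis by (auto intro!: exI[of _ "Suc i"])
  qed
 qed
 finally show ?case .
qed simp

lemma keys_pr: "m : keys (pr f g l) ==> length m = Suc (length l) & set m <= f ` set l Un g ` set l"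
proof (induction l arbitrary: m)
 case (Cons x l)
 have "m : {f x # g x # map g l} Un Cons (f x) ` keys (pr f g l)"
  using Cons.prems keys_diff[of "frag_of (f x # g x # map g l)" "lcons (f x) (pr f g l)"] keys_lcons[of "f x" "pr f g l"] by auto
 thus ?case using Cons.IH by fastforce
qed simp

lemma nrm_lcons: "nrm (lcons v c) <= nrm c"
 unfolding lcons_def using nrm_extend[of c "%l. frag_of (v # l)" 1] by simp

lemma nrm_lmap: "nrm (lmap f c) <= nrm c"
 unfolding lmap_def using nrm_extend[of c "%l. frag_of (map f l)" 1] by simp

lemma nrm_bd: "nrm (bd l) <= real (length l)"
proof (induction l)
 case (Cons v l)
 have "nrm (bd (v # l)) <= nrm (frag_of l) + nrm (lcons v (bd l))" unfolding bd.simps by (rule nrm_diff)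
 also have "... <= 1 + real (length l)" using nrm_lcons[of v "bd l"] Cons by simp
 finally show ?case by simp
qed simp

lemma nrm_pr: "nrm (pr f g l) <= real (length l)"
proof (induction l)
 case (Cons x l)
 have "nrm (pr f g (x # l)) <= nrm (frag_of (f x # g x # map g l)) + nrm (lcons (f x) (pr f g l))" unfolding pr.simps by (rule nrm_diff)
 also have "... <= 1 + real (length l)" using nrm_lcons[of "f x" "pr f g l"] Cons by simp
 finally show ?case by simp
qed simp

definition slide :: "nat => pt => nat => pt => pt" where
 "slide M p t x = seg x p (real t/real M)"

lemma slide_0 [simp]: "slide M p 0 x = x"
 by (simp add: slide_def)

text \<open>The boundary is subdivided first and then slid to the vertex \<open>hd l\<close> in \<open>M\<close> steps; the last step is a cone. This yields
 \<open>O(M^q)\<close> simplices of diameter \<open>O(1/M)\<close>, and so the total volume of the repairs tends to 0.\<close>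

primrec subdiv :: "nat => nat => pt list => pt list_chain" where
 "subdiv M 0 l = frag_of []"
| "subdiv M (Suc q) l = lcons (hd l) (lmap (slide M (hd l) (M - 1)) (frag_extend (subdiv M q) (bd l)))
   - (SUM t<M - 1. PR (slide M (hd l) t) (slide M (hd l) (Suc t)) (frag_extend (subdiv M q) (bd l)))"

lemma length_keys_bd: "length l = Suc q ==> m : keys (bd l) ==> length m = q"
 using keys_bd[of l] length_del[of _ l] by auto

lemma BD_subdiv: "length l = Suc q ==> BD (subdiv M (Suc q) l) = frag_extend (subdiv M q) (bd l)"
proof (induction q arbitrary: l)
 case 0
 then obtain v where l: "l = [v]" by (auto simp: length_Suc_conv)
 have [simp]: "frag_extend (subdiv M 0) (bd l) = frag_of []" by (simp add: l)
 show ?case by (simp add: l BD_lcons BD_diff BD_sum)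
next
 case (Suc q)
 let ?z = "frag_extend (subdiv M (Suc q)) (bd l)"
 have "BD ?z = frag_extend (%m. BD (subdiv M (Suc q) m)) (bd l)" unfolding BD_def by (rule frag_extend_extend)
 also have "... = frag_extend (%m. frag_extend (subdiv M q) (bd m)) (bd l)"
  by (rule frag_extend_eq) (use Suc.IH length_keys_bd[OF Suc.prems] in blast)
 also have "... = frag_extend (subdiv M q) (BD (bd l))" unfolding BD_def by (rule frag_extend_extend[symmetric])
 finally have cycle: "BD ?z = 0" by simp
 let ?f = "%t. slide M (hd l) t"
 have "BD (subdiv M (Suc (Suc q)) l) = lmap (?f (M - 1)) ?z - (SUM t<M - 1. lmap (?f (Suc t)) ?z - lmap (?f t) ?z)"
  by (simp add: BD_diff BD_lcons BD_lmap BD_sum BD_PR cycle)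
 also have "(SUM t<M - 1. lmap (?f (Suc t)) ?z - lmap (?f t) ?z) = lmap (?f (M - 1)) ?z - lmap (?f 0) ?z"
  by (rule sum_lessThan_telescope)
 also have "lmap (?f 0) ?z = ?z"
 proof -
  have "?f 0 = (%x. x)" by (rule ext) simp
  thus ?thesis by (simp only: lmap_id)
 qed
 finally show ?case by (simp only: diff_diff_eq2 add_diff_cancel_left')
qed

lemma slide_linear_map:
 assumes "!!a b x y. A (%i. a * x i + b * y i) = (%i. a * A x i + b * A y i)"
 shows "A (slide M p t x) = slide M (A p) t (A x)"
 unfolding slide_def seg_def by (rule assms)

lemma subdiv_natural:
 assumes A: "!!a b x y. A (%i. a * x i + b * y i) = (%i. a * A x i + b * A y i)"
 shows "length l = q ==> lmap A (subdiv M q l) = subdiv M q (map A l)"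
proof (induction q arbitrary: l)
 case (Suc q)
 have hd: "hd (map A l) = A (hd l)" using Suc.prems by (cases l) auto
 let ?z = "frag_extend (subdiv M q) (bd l)"
 have "lmap A ?z = frag_extend (%m. lmap A (subdiv M q m)) (bd l)" unfolding lmap_def by (rule frag_extend_extend)
 also have "... = frag_extend (%m. subdiv M q (map A m)) (bd l)"
  by (rule frag_extend_eq) (use Suc.IH length_keys_bd[OF Suc.prems] in blast)
 also have "... = frag_extend (subdiv M q) (bd (map A l))" unfolding bd_map lmap_def frag_extend_extend by simp
 finally have natural: "frag_extend (subdiv M q) (bd (map A l)) = lmap A ?z" by simp
 have "subdiv M (Suc q) (map A l) = lcons (A (hd l)) (lmap (slide M (A (hd l)) (M - 1)) (lmap A ?z))
   - (SUM t<M - 1. PR (slide M (A (hd l)) t) (slide M (A (hd l)) (Suc t)) (lmap A ?z))"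
  by (simp only: subdiv.simps hd natural)
 moreover have "lmap A (subdiv M (Suc q) l) = lcons (A (hd l)) (lmap A (lmap (slide M (hd l) (M - 1)) ?z))
   - (SUM t<M - 1. lmap A (PR (slide M (hd l) t) (slide M (hd l) (Suc t)) ?z))"
  by (simp only: subdiv.simps lmap_diff lmap_lcons lmap_sum[OF finite_lessThan])
 ultimately show ?case by (simp only: lmap_lmap lmap_PR PR_lmap slide_linear_map[of A, OF A])
qed simp

primrec sd_const :: "nat => real" where
 "sd_const 0 = 1"
| "sd_const (Suc q) = real (Suc q)*(real q + 1) * sd_const q"

lemma sd_const_pos: "0 < sd_const q"
 by (induction q) auto

lemma nrm_PR_le:
 assumes "!!l. l : keys c ==> length l = q" shows "nrm (PR f g c) <= real q * nrm c"
 unfolding PR_def using assms nrm_pr[of f g] by (intro nrm_extend) force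

lemma keys_diff_sum: "m : keys (a - (SUM t<n. b t)) ==> m : keys a Un (\<Union>t<(n::nat). keys (b t))"
 using keys_diff[of a "SUM t<n. b t"] keys_sum[of b "{..<n}"] by blast

lemma subdiv_length: "length l = q ==> m : keys (subdiv M q l) ==> length m = q"
proof (induction q arbitrary: l m)
 case (Suc q)
 let ?z = "frag_extend (subdiv M q) (bd l)"
 have len: "length w = q" if "w : keys ?z" for w
  using that keys_frag_extend[of "subdiv M q" "bd l"] Suc.IH length_keys_bd[OF Suc.prems(1)] by blast
 have "m : keys (lcons (hd l) (lmap (slide M (hd l) (M - 1)) ?z)) Un (UN t<M - 1. keys (PR (slide M (hd l) t) (slide M (hd l) (Suc t)) ?z))"
  using Suc.prems(2) unfolding subdiv.simps by (rule keys_diff_sum)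
 thus ?case
 proof
  assume "m : keys (lcons (hd l) (lmap (slide M (hd l) (M - 1)) ?z))"
  thus ?thesis using keys_lcons keys_lmap len by fastforce
 next
  assume "m : (UN t<M - 1. keys (PR (slide M (hd l) t) (slide M (hd l) (Suc t)) ?z))"
  then obtain t w where "w : keys ?z" "m : keys (pr (slide M (hd l) t) (slide M (hd l) (Suc t)) w)"
   unfolding PR_def using keys_frag_extend by fast
  thus ?thesis using keys_pr len by metis
 qed
qed simp

lemma nrm_subdiv: "0 < M ==> length l = Suc q ==> nrm (subdiv M (Suc q) l) <= sd_const (Suc q) * real M^q"
proof (induction q arbitrary: l)
 case 0
 then obtain v where l: "l = [v]" by (auto simp: length_Suc_conv)
 show ?case by (simp add: l)
next
 case (Suc q)
 let ?z = "frag_extend (subdiv M (Suc q)) (bd l)"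
 have M1: "1 <= real M" using Suc.prems by simp
 have "nrm ?z <= (sd_const (Suc q) * real M^q) * nrm (bd l)"
  by (rule nrm_extend) (use Suc.IH Suc.prems length_keys_bd in blast)
 also have "... <= (sd_const (Suc q) * real M^q) * real (Suc (Suc q))"
  using nrm_bd[of l] Suc.prems(2) sd_const_pos[of "Suc q"] M1 by (intro mult_left_mono) auto
 finally have nrm_le: "nrm ?z <= real (Suc (Suc q)) * sd_const (Suc q) * real M^q" by (simp add: mult_ac)
 have len: "length w = Suc q" if "w : keys ?z" for w
  using that keys_frag_extend[of "subdiv M (Suc q)" "bd l"] subdiv_length length_keys_bd[OF Suc.prems(2)] by blast
 have "nrm (subdiv M (Suc (Suc q)) l) <= nrm (lcons (hd l) (lmap (slide M (hd l) (M - 1)) ?z)) + nrm (SUM t<M - 1. PR (slide M (hd l) t) (slide M (hd l) (Suc t)) ?z)"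
  unfolding subdiv.simps(2)[of M "Suc q"] by (rule nrm_diff)
 also have "... <= nrm ?z + (SUM t<M - 1. real (Suc q) * nrm ?z)"
 proof (rule add_mono)
  show "nrm (lcons (hd l) (lmap (slide M (hd l) (M - 1)) ?z)) <= nrm ?z" by (rule order_trans[OF nrm_lcons nrm_lmap])
  show "nrm (SUM t<M - 1. PR (slide M (hd l) t) (slide M (hd l) (Suc t)) ?z) <= (SUM t<M - 1. real (Suc q) * nrm ?z)"
   by (rule order_trans[OF nrm_sum]) (intro sum_mono nrm_PR_le len)
 qed
 also have "... = (1 + real (M - 1) * real (Suc q)) * nrm ?z" by (simp add: algebra_simps)
 also have "... <= (real M*(real (Suc q) + 1)) * nrm ?z"
  using Suc.prems(1) by (intro mult_right_mono) (auto simp: of_nat_diff algebra_simps)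
 also have "... <= (real M*(real (Suc q) + 1))*(real (Suc (Suc q)) * sd_const (Suc q) * real M^q)" using nrm_le by (intro mult_left_mono) auto
 also have "... = sd_const (Suc (Suc q)) * real M^Suc q" by (simp only: sd_const.simps(2)[of "Suc q"] power_Suc mult_ac)
 finally show ?case .
qed

definition fine_in :: "nat => pt set => real => pt list => bool" where
 "fine_in K S e l = (set l <= S & (ALL x:set l. ALL y:set l. l1 K x y <= e))"

context
 fixes S :: "pt set" and D :: real and K M :: nat
 assumes S_convex: "seg_convex S" and D: "!!x y. x : S ==> y : S ==> l1 K x y <= D" and M: "0 < M"
begin

context
 fixes p :: pt and w :: "pt list" and e :: real
 assumes p: "p : S" and w: "fine_in K S e w" and e: "0 <= e"
begin

lemma D_nonneg: "0 <= D"
 using D[OF p p] by simp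

lemma slide_mem: "x : S ==> t <= M ==> slide M p t x : S"
 unfolding slide_def using p M by (intro seg_convexD[OF S_convex]) (auto simp: divide_le_eq)

lemma slide_contract:
 assumes "t <= M" shows "l1 K (slide M p t x) (slide M p t y) <= l1 K x y"
proof -
 have "abs (slide M p t x i - slide M p t y i) <= abs (x i - y i)" for i
 proof -
  have "slide M p t x i - slide M p t y i = (1 - real t/real M)*(x i - y i)" by (simp add: slide_def seg_def right_diff_distrib)
  moreover have "0 <= 1 - real t/real M" "1 - real t/real M <= 1" using assms M by simp_all
  ultimately show ?thesis by (simp add: abs_mult mult_left_le_one_le)
 qed
 thus ?thesis unfolding l1_def by (rule sum_mono)
qed

lemma slide_step:
 assumes "x : S" shows "l1 K (slide M p t x) (slide M p (Suc t) x) <= D/real M"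
proof -
 have "l1 K (slide M p t x) (slide M p (Suc t) x) = abs (real t/real M - real (Suc t)/real M) * l1 K x p"
  unfolding slide_def by (rule l1_seg)
 also have "abs (real t/real M - real (Suc t)/real M) = 1/real M" by (simp add: diff_divide_distrib[symmetric])
 also have "1/real M * l1 K x p <= 1/real M * D" using D[OF assms p] by (intro mult_left_mono) auto
 finally show ?thesis by simp
qed

lemma fine_in_cone: "fine_in K S (e + D/real M) (p # map (slide M p (M - 1)) w)"
proof -
 have "slide M p (Suc (M - 1)) x = p" for x using M by (auto simp: slide_def)
 hence apex: "l1 K p (slide M p (M - 1) x) <= D/real M" if "x : S" for x
  using slide_step[OF that, of "M - 1"] by (simp add: l1_commute)
 have DM: "0 <= D/real M" using D_nonneg by simp
 have "l1 K x y <= e + D/real M" if xy: "x : set (p # map (slide M p (M - 1)) w)" "y : set (p # map (slide M p (M - 1)) w)" for x y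
 proof -
  consider "x = p" "y = p" | x' where "x = p" "y = slide M p (M - 1) x'" "x' : set w"
   | x' where "y = p" "x = slide M p (M - 1) x'" "x' : set w"
   | x' y' where "x = slide M p (M - 1) x'" "y = slide M p (M - 1) y'" "x' : set w" "y' : set w"
   using xy by auto
  thus ?thesis
  proof cases
   case 1 thus ?thesis using e DM by simp
  next
   case (2 x') thus ?thesis using apex[of x'] w e by (force simp: fine_in_def)
  next
   case (3 x') thus ?thesis using apex[of x'] w e by (force simp: fine_in_def l1_commute)
  next
   case (4 x' y') thus ?thesis using slide_contract[of "M - 1" x' y'] w DM by (force simp: fine_in_def)
  qed
 qed
 moreover have "set (p # map (slide M p (M - 1)) w) <= S" using w p slide_mem[of _ "M - 1"] by (auto simp: fine_in_def)
 ultimately show ?thesis by (simp only: fine_in_def) blast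
qed

lemma fine_in_prism:
 assumes m: "m : keys (pr (slide M p t) (slide M p (Suc t)) w)" and t: "t < M - 1"
 shows "fine_in K S (e + D/real M) m"
proof -
 have verts: "x : slide M p t ` set w Un slide M p (Suc t) ` set w" if "x : set m" for x using keys_pr[OF m] that by blast
 have DM: "0 <= D/real M" using D_nonneg by simp
 have across: "l1 K (slide M p t x') (slide M p (Suc t) y') <= e + D/real M" if "x' : set w" "y' : set w" for x' y'
  using l1_triangle[of K "slide M p t x'" "slide M p (Suc t) y'" "slide M p t y'"] slide_contract[of t x' y'] slide_step[of y' t] w that t
  by (force simp: fine_in_def)
 have level: "l1 K (slide M p u x') (slide M p u y') <= e + D/real M" if "x' : set w" "y' : set w" "u <= Suc t" for x' y' u
  using slide_contract[of u x' y'] w that t DM by (force simp: fine_in_def)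
 have "l1 K x y <= e + D/real M" if "x : set m" "y : set m" for x y
  using verts[OF that(1)] verts[OF that(2)] across level[of _ _ t] level[of _ _ "Suc t"] by (auto simp: l1_commute)
 moreover have "set m <= S"
  using verts w t by (fastforce simp: fine_in_def intro: slide_mem)
 ultimately show ?thesis by (simp add: fine_in_def)
qed

end

lemma subdiv_mesh: "length l = q ==> set l <= S ==> m : keys (subdiv M q l) ==> fine_in K S (real q * D/real M) m"
proof (induction q arbitrary: l m)
 case 0 thus ?case by (simp add: fine_in_def)
next
 case (Suc q)
 let ?z = "frag_extend (subdiv M q) (bd l)" and ?p = "hd l"
 have p: "?p : S" using Suc.prems by (cases l) auto
 have mesh: "0 <= real q * D/real M" "real q * D/real M + D/real M = real (Suc q) * D/real M"
  using D[OF p p] by (simp_all add: add_divide_distrib distrib_right)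
 have faces: "fine_in K S (real q * D/real M) w" if w: "w : keys ?z" for w
 proof -
  obtain m' where m': "m' : keys (bd l)" "w : keys (subdiv M q m')" using w keys_frag_extend by fast
  have "set m' <= S" using m'(1) keys_bd[of l] set_del[of _ l] Suc.prems(2) by blast
  thus ?thesis using Suc.IH[OF length_keys_bd[OF Suc.prems(1) m'(1)] _ m'(2)] by blast
 qed
 have "m : keys (lcons ?p (lmap (slide M ?p (M - 1)) ?z)) Un (UN t<M - 1. keys (PR (slide M ?p t) (slide M ?p (Suc t)) ?z))"
  using Suc.prems(3) unfolding subdiv.simps by (rule keys_diff_sum)
 thus ?case
 proof
  assume "m : keys (lcons ?p (lmap (slide M ?p (M - 1)) ?z))"
  then obtain w where w: "w : keys ?z" "m = ?p # map (slide M ?p (M - 1)) w" using keys_lcons keys_lmap by fastforce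
  show ?thesis using fine_in_cone[OF p faces[OF w(1)] mesh(1)] unfolding w(2) mesh(2) .
 next
  assume "m : (UN t<M - 1. keys (PR (slide M ?p t) (slide M ?p (Suc t)) ?z))"
  then obtain t w where w: "w : keys ?z" "m : keys (pr (slide M ?p t) (slide M ?p (Suc t)) w)" and t: "t < M - 1"
   unfolding PR_def using keys_frag_extend by fast
  show ?thesis using fine_in_prism[OF p faces[OF w(1)] mesh(1) w(2) t] unfolding mesh(2) .
 qed
qed

end

primrec track :: "nat => nat => pt list => pt list_chain" where
 "track M 0 l = 0"
| "track M (Suc q) l = lcons (hd l) (frag_of l - subdiv M (Suc q) l - frag_extend (track M q) (bd l))"

lemma BD_track: "length l = Suc q ==> BD (track M (Suc q) l) = frag_of l - subdiv M (Suc q) l - frag_extend (track M q) (bd l)"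
proof (induction q arbitrary: l)
 case 0
 then obtain v where l: "l = [v]" by (auto simp: length_Suc_conv)
 show ?case by (simp add: l)
next
 case (Suc q)
 let ?c = "frag_of l - subdiv M (Suc (Suc q)) l - frag_extend (track M (Suc q)) (bd l)"
 have "BD (frag_extend (track M (Suc q)) (bd l)) = frag_extend (%m. BD (track M (Suc q) m)) (bd l)" unfolding BD_def by (rule frag_extend_extend)
 also have "... = frag_extend (%m. frag_of m - subdiv M (Suc q) m - frag_extend (track M q) (bd m)) (bd l)"
  by (rule frag_extend_eq) (use Suc.IH length_keys_bd[OF Suc.prems] in blast)
 also have "... = bd l - frag_extend (subdiv M (Suc q)) (bd l) - frag_extend (track M q) (BD (bd l))"
  by (simp only: frag_extend_fun_diff frag_extend_id BD_def frag_extend_extend)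
 finally have "BD ?c = 0" using BD_subdiv[OF Suc.prems] by (simp add: BD_diff del: subdiv.simps)
 moreover have "BD (track M (Suc (Suc q)) l) = ?c - lcons (hd l) (BD ?c)" unfolding track.simps(2)[of M "Suc q"] by (rule BD_lcons)
 ultimately show ?case by (simp only: lcons_0 diff_zero)
qed

lemma track_natural:
 assumes A: "!!a b x y. A (%i. a * x i + b * y i) = (%i. a * A x i + b * A y i)"
 shows "length l = q ==> lmap A (track M q l) = track M q (map A l)"
proof (induction q arbitrary: l)
 case (Suc q)
 have hd: "hd (map A l) = A (hd l)" using Suc.prems by (cases l) auto
 have "lmap A (frag_extend (track M q) (bd l)) = frag_extend (%m. lmap A (track M q m)) (bd l)" unfolding lmap_def by (rule frag_extend_extend)
 also have "... = frag_extend (%m. track M q (map A m)) (bd l)"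
  by (rule frag_extend_eq) (use Suc.IH length_keys_bd[OF Suc.prems] in blast)
 also have "... = frag_extend (track M q) (bd (map A l))" unfolding bd_map lmap_def frag_extend_extend by simp
 finally have natural: "frag_extend (track M q) (bd (map A l)) = lmap A (frag_extend (track M q) (bd l))" by simp
 show ?case unfolding track.simps hd natural lmap_lcons lmap_diff subdiv_natural[OF A Suc.prems] lmap_of ..
qed simp

lemma track_keys:
 assumes conv: "seg_convex S" and D: "!!x y. x : S ==> y : S ==> l1 K x y <= D" and M: "0 < M"
 shows "length l = q ==> set l <= S ==> m : keys (track M q l) ==> length m = Suc q & set m <= S"
proof (induction q arbitrary: l m)
 case (Suc q)
 have p: "hd l : S" using Suc.prems by (cases l) auto
 let ?c = "frag_of l - subdiv M (Suc q) l - frag_extend (track M q) (bd l)"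
 obtain w where w: "w : keys ?c" "m = hd l # w" using Suc.prems(3) keys_lcons unfolding track.simps by fast
 have "w : {l} Un keys (subdiv M (Suc q) l) Un keys (frag_extend (track M q) (bd l))"
  using w(1) keys_diff[of "frag_of l - subdiv M (Suc q) l" "frag_extend (track M q) (bd l)"] keys_diff[of "frag_of l" "subdiv M (Suc q) l"] by auto
 hence "length w = Suc q & set w <= S"
 proof (elim UnE)
  assume "w : {l}" thus ?thesis using Suc.prems by simp
 next
  assume "w : keys (subdiv M (Suc q) l)"
  thus ?thesis using subdiv_length[OF Suc.prems(1)] subdiv_mesh[OF conv D M Suc.prems(1,2)] by (auto simp: fine_in_def)
 next
  assume "w : keys (frag_extend (track M q) (bd l))"
  then obtain m' where m': "m' : keys (bd l)" "w : keys (track M q m')" using keys_frag_extend by fast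
  have "set m' <= S" using m'(1) keys_bd[of l] set_del[of _ l] Suc.prems(2) by blast
  thus ?thesis using Suc.IH[OF length_keys_bd[OF Suc.prems(1) m'(1)] _ m'(2)] by blast
 qed
 thus ?case using w p by auto
qed simp

section \<open>Volume of Lipschitz simplices\<close>

lemma compact_simplex: "compact (Sx k)"
proof -
 have "compactin (product_topology (%i::nat. euclidean) UNIV) (PiE UNIV (%_. {0..1::real}))" by (simp add: compactin_PiE)
 hence c: "compact (PiE UNIV (%_::nat. {0..1::real}))" by (simp add: euclidean_product_topology)
 have cont: "continuous_on UNIV (%x::nat=>real. x i)" for i by (rule continuous_on_product_coordinates)
 have "Sx k = PiE UNIV (%_. {0..1}) Int ((\<Inter>i\<in>{k<..}. {x. x i = 0}) Int {x. (SUM i<=k. x i) = 1})" (is "_ = _ Int ?C")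
 proof
  show "Sx k <= PiE UNIV (%_. {0..1}) Int ?C"
  proof
   fix x assume x: "x : Sx k"
   have "x i : {0..1}" for i using simplex_nonneg[OF x, of i] simplex_le1[OF x, of i] x by (cases "i <= k") (auto simp: simplex_k_def)
   thus "x : PiE UNIV (%_. {0..1}) Int ?C" using x by (auto simp: simplex_k_def)
  qed
  show "PiE UNIV (%_. {0..1}) Int ?C <= Sx k" by (auto simp: simplex_k_def PiE_iff)
 qed
 moreover have "closed ?C"
  by (intro closed_Int closed_INT ballI closed_Collect_eq continuous_on_sum cont continuous_on_const)
 ultimately show ?thesis using c by (simp add: compact_Int_closed)
qed

lemma lipl_continuous:
 assumes f: "lipl k L S f" shows "continuous_on S f"
proof -
 have "(f \<longlongrightarrow> f x) (at x within S)" if x: "x : S" for x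
 proof -
  have "continuous_on UNIV (%y. L * l1 k y x)" unfolding l1_def
   by (intro continuous_on_mult_left continuous_on_sum continuous_on_rabs continuous_on_diff continuous_on_const continuous_on_product_coordinates)
  hence "((%y. L * l1 k y x) \<longlongrightarrow> L * l1 k x x) (at x within S)"
   unfolding continuous_on_def by (metis UNIV_I tendsto_within_subset top_greatest)
  hence bound: "((%y. L * l1 k y x) \<longlongrightarrow> 0) (at x within S)" by simp
  have "((%y. dist (f y) (f x)) \<longlongrightarrow> 0) (at x within S)"
  proof (rule tendsto_sandwich[OF _ _ tendsto_const bound])
   show "\<forall>\<^sub>F y in at x within S. 0 <= dist (f y) (f x)" by simp
   show "\<forall>\<^sub>F y in at x within S. dist (f y) (f x) <= L * l1 k y x"
    unfolding eventually_at_filter using f x by (intro always_eventually) (auto simp: lipl_def)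
  qed
  thus ?thesis by (rule tendsto_dist_iff[THEN iffD2])
 qed
 thus ?thesis by (simp add: continuous_on_def)
qed

definition closed_dcell :: "nat => nat => (nat => nat) => nat => pt set" where
 "closed_dcell k j q m = Sx k Int (\<Inter>i\<in>{..<k}. {x. real (q i) <= 2^j * x i} Int {x. 2^j * x i <= real (q i) + 1 - 1/real (Suc m)})"

lemma compact_closed_dcell: "compact (closed_dcell k j q m)"
 unfolding closed_dcell_def
 by (intro compact_Int_closed compact_simplex closed_INT ballI closed_Int closed_Collect_le continuous_on_const continuous_on_mult_left continuous_on_product_coordinates)

lemma dcell_iff:
 assumes "q : extensional {..<k}"
 shows "x : dcell k j q \<longleftrightarrow> x : Sx k & (ALL i<k. real (q i) <= 2^j * x i & 2^j * x i < real (q i) + 1)"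
proof (cases "x : Sx k")
 case True
 have "nat (floor (2^j * x i)) = q i \<longleftrightarrow> real (q i) <= 2^j * x i & 2^j * x i < real (q i) + 1" for i
 proof -
  have "0 <= floor (2^j * x i)" using simplex_nonneg[OF True, of i] by simp
  hence "nat (floor (2^j * x i)) = q i \<longleftrightarrow> floor (2^j * x i) = int (q i)" by (simp only: nat_eq_iff if_True)
  thus ?thesis by (simp add: floor_eq_iff)
 qed
 moreover have "idx k j x = q \<longleftrightarrow> (ALL i<k. nat (floor (2^j * x i)) = q i)"
  using assms by (auto simp: idx_def extensional_def fun_eq_iff)
 ultimately show ?thesis using True by (simp add: dcell_def)
qed (simp add: dcell_def)

lemma dcell_eq_UN_closed_dcell:
 assumes q: "q : extensional {..<k}"
 shows "dcell k j q = (UN m. closed_dcell k j q m)"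
proof
 show "dcell k j q <= (UN m. closed_dcell k j q m)"
 proof
  fix x assume "x : dcell k j q"
  hence x: "x : Sx k" "!!i. i < k ==> real (q i) <= 2^j * x i" "!!i. i < k ==> 2^j * x i < real (q i) + 1"
   by (auto simp: dcell_iff[OF q])
  define r where "r = Min (insert 1 ((%i. real (q i) + 1 - 2^j * x i) ` {..<k}))"
  have "0 < r" unfolding r_def using x(3) by (subst Min_gr_iff) auto
  then obtain m where m: "inverse (real (Suc m)) < r" using reals_Archimedean by blast
  have "2^j * x i <= real (q i) + 1 - 1/real (Suc m)" if "i < k" for i
  proof -
   have "r <= real (q i) + 1 - 2^j * x i" unfolding r_def using that by (intro Min_le) auto
   thus ?thesis using m by (simp add: inverse_eq_divide)
  qed
  hence "x : closed_dcell k j q m" using x by (simp add: closed_dcell_def)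
  thus "x : (UN m. closed_dcell k j q m)" by blast
 qed
 show "(UN m. closed_dcell k j q m) <= dcell k j q"
 proof
  fix x assume "x : (UN m. closed_dcell k j q m)"
  then obtain m where x: "x : closed_dcell k j q m" by blast
  have "2^j * x i < real (q i) + 1" if "i < k" for i
  proof -
   have "2^j * x i <= real (q i) + 1 - 1/real (Suc m)" using x that by (simp add: closed_dcell_def)
   moreover have "0 < 1/real (Suc m)" by simp
   ultimately show ?thesis by linarith
  qed
  thus "x : dcell k j q" using x by (auto simp: dcell_iff[OF q] closed_dcell_def)
 qed

qed

lemma dcell_image_borel:
 fixes f :: "pt => 'a::metric_space"
 assumes f: "lipl k L (Sx k) f"
 shows "f ` dcell k j q : sets borel"
proof (cases "q : extensional {..<k}")
 case False
 hence "dcell k j q = {}" by (auto simp: dcell_def idx_def)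
 thus ?thesis by simp
next
 case True
 have "compact (f ` closed_dcell k j q m)" for m
  using lipl_continuous[OF f] compact_closed_dcell by (intro compact_continuous_image) (auto simp: closed_dcell_def intro: continuous_on_subset)
 hence "f ` closed_dcell k j q m : sets borel" for m by (simp add: borel_compact)
 thus ?thesis unfolding dcell_eq_UN_closed_dcell[OF True] image_UN by auto
qed

lemma dcell_Int: "dcell k j q Int dcell k j' q' = {} | dcell k j q Int dcell k j' q' = dcell k j q | dcell k j q Int dcell k j' q' = dcell k j' q'"
proof (cases "j <= j'")
 case True
 have "dcell k j' q' <= dcell k j q" if "x : dcell k j q Int dcell k j' q'" for x
  using that idx_eq_mono[of _ k x j j'] True by (auto simp: dcell_def)
 thus ?thesis by blast
next
 case False
 have "dcell k j q <= dcell k j' q'" if "x : dcell k j q Int dcell k j' q'" for x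
  using that idx_eq_mono[of _ k x j' j] False by (auto simp: dcell_def)
 thus ?thesis by blast
qed

lemma dcell_Int_borel:
 fixes f :: "pt => 'a::metric_space"
 assumes "lipl k L (Sx k) f" shows "f ` (dcell k j q Int dcell k j' q') : sets borel"
 using dcell_Int[of k j q j' q'] dcell_image_borel[OF assms] by (metis image_empty sets.empty_sets)

definition count_on :: "pt set => (pt => 'a) => 'a => ennreal" where
 "count_on A f y = emeasure (count_space UNIV) {x : A. f x = y}"

lemma multiplicity_count_on: "multiplicity k sig y = count_on (Sx k) sig y"
 by (simp add: multiplicity_def count_on_def Let_def emeasure_count_space)

definition cell_vol :: "nat => (pt => 'a::metric_space) => nat => (nat => nat) => ennreal" where
 "cell_vol k f j0 q0 = (\<integral>\<^sup>+ y. count_on (dcell k j0 q0) f y \<partial>hausdorff_measure k)"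

definition hits :: "nat => pt set => (pt => 'a) => nat => 'a => ennreal" where
 "hits k A f j y = (SUM q:grid k j. indicator (f ` (A Int dcell k j q)) y)"

lemma hits_card:
 assumes "A <= Sx k"
 shows "hits k A f j y = of_nat (card (idx k j ` {x : A. f x = y}))"
proof -
 let ?P = "{x : A. f x = y}"
 have hit: "y : f ` (A Int dcell k j q) \<longleftrightarrow> q : idx k j ` ?P" for q using assms by (auto simp: dcell_def)
 have "hits k A f j y = (SUM q:grid k j. if q : idx k j ` ?P then 1 else 0)" unfolding hits_def by (intro sum.cong) (auto simp: indicator_def hit)
 also have "... = of_nat (card (grid k j Int idx k j ` ?P))" by (simp add: sum.If_cases)
 also have "grid k j Int idx k j ` ?P = idx k j ` ?P" using assms idx_in_grid by blast
 finally show ?thesis .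
qed

lemma finite_idx_image: "A <= Sx k ==> finite (idx k j ` {x : A. f x = y})"
 by (rule finite_subset[OF _ finite_grid[of k j]]) (use idx_in_grid in blast)

lemma hits_mono:
 assumes A: "A <= Sx k" and j: "j <= j'" shows "hits k A f j y <= hits k A f j' y"
proof -
 let ?P = "{x : A. f x = y}"
 define h where "h = (%q. idx k j (SOME x. x : ?P & idx k j' x = q))"
 have "idx k j ` ?P <= h ` (idx k j' ` ?P)"
 proof
  fix q assume "q : idx k j ` ?P"
  then obtain x where x: "x : ?P" "q = idx k j x" by blast
  let ?x = "SOME u. u : ?P & idx k j' u = idx k j' x"
  have u: "?x : ?P & idx k j' ?x = idx k j' x" by (rule someI[of _ x]) (use x in simp)
  have "idx k j ?x = idx k j x" using u x A by (intro idx_eq_mono[OF _ _ j]) auto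
  hence "q = h (idx k j' x)" unfolding h_def x(2) by simp
  thus "q : h ` (idx k j' ` ?P)" using x(1) by blast
 qed
 hence "card (idx k j ` ?P) <= card (idx k j' ` ?P)"
  by (rule order_trans[OF card_mono[OF finite_imageI[OF finite_idx_image[OF A]]] card_image_le[OF finite_idx_image[OF A]]])
 thus ?thesis by (simp add: hits_card[OF A])
qed

lemma idx_separates:
 assumes F: "finite F" "F <= Sx k" shows "EX j. inj_on (idx k j) F"
proof -
 have "EX j. ALL x:F. ALL y:F. x ~= y --> 2 * real k/2^j < l1 k x y"
 proof -
  have "EX j::nat. x ~= y --> 2 * real k/2^j < l1 k x y" if "x : F" "y : F" for x y
  proof (cases "x = y")
   case False
   then obtain i where i: "x i ~= y i" by auto
   have xs: "x : Sx k" "y : Sx k" using that F by auto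
   have "i <= k" using i xs by (auto simp: simplex_k_def) (metis not_le)
   hence p: "0 < l1 k x y" using l1_component[of i k x y] i by linarith
   obtain j :: nat where "2 * real k/l1 k x y < 2^j" using real_arch_pow[of 2] by auto
   thus ?thesis using p by (intro exI[of _ j]) (simp add: field_simps)
  qed auto
  then obtain J where J: "!!x y. x : F ==> y : F ==> x ~= y ==> 2 * real k/2^J x y < l1 k x y" by metis
  define j where "j = Max (insert 0 ((%(x, y). J x y) ` (F \<times> F)))"
  have "2 * real k/2^j < l1 k x y" if "x : F" "y : F" "x ~= y" for x y
  proof -
   have "J x y <= j" unfolding j_def using that F(1) by (intro Max_ge) auto
   hence "2 * real k/2^j <= 2 * real k/2^J x y" by (intro divide_left_mono power_increasing) auto
   thus ?thesis using J[OF that] by linarith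
  qed
  thus ?thesis by blast
 qed
 then obtain j where j: "ALL x:F. ALL y:F. x ~= y --> 2 * real k/2^j < l1 k x y" by blast
 have "x = y" if "x : F" "y : F" "idx k j x = idx k j y" for x y
 proof (rule ccontr)
  assume ne: "x ~= y"
  have "l1 k x y <= 2 * real k/2^j" using that F(2) by (intro dcell_diam[of _ k j "idx k j x"]) (auto simp: dcell_def)
  thus False using j that ne by force
 qed
 thus ?thesis unfolding inj_on_def by blast
qed

lemma hits_le_count_on:
 assumes A: "A <= Sx k" shows "hits k A f j y <= count_on A f y"
proof (cases "finite {x : A. f x = y}")
 case True
 thus ?thesis using card_image_le[OF True, of "idx k j"] by (simp add: hits_card[OF A] count_on_def emeasure_count_space)
qed (simp add: count_on_def emeasure_count_space)

lemma card_le_SUP_hits: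
 assumes A: "A <= Sx k" and F: "finite F" "F <= {x : A. f x = y}"
 shows "of_nat (card F) <= (SUP j. hits k A f j y)"
proof -
 obtain j where "inj_on (idx k j) F" using idx_separates[OF F(1)] F(2) A by blast
 hence "card F = card (idx k j ` F)" by (simp add: card_image)
 also have "... <= card (idx k j ` {x : A. f x = y})" using F(2) finite_idx_image[OF A] by (intro card_mono) auto
 finally have "of_nat (card F) <= hits k A f j y" by (simp add: hits_card[OF A])
 also have "... <= (SUP j. hits k A f j y)" by (rule SUP_upper) simp
 finally show ?thesis .
qed

lemma count_on_SUP:
 assumes A: "A <= Sx k" shows "count_on A f y = (SUP j. hits k A f j y)"
proof (rule antisym)
 show "(SUP j. hits k A f j y) <= count_on A f y" by (intro SUP_least hits_le_count_on[OF A])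
 show "count_on A f y <= (SUP j. hits k A f j y)"
 proof (cases "finite {x : A. f x = y}")
  case True thus ?thesis using card_le_SUP_hits[OF A True order_refl] by (simp add: count_on_def emeasure_count_space)
 next
  case False
  have "of_nat n <= (SUP j. hits k A f j y)" for n
  proof -
   obtain F where "F <= {x : A. f x = y}" "finite F" "card F = n" using infinite_arbitrarily_large[OF False] by blast
   thus ?thesis using card_le_SUP_hits[OF A, of F f y] by blast
  qed
  hence "(SUP n. of_nat n :: ennreal) <= (SUP j. hits k A f j y)" by (intro SUP_least)
  hence "(SUP j. hits k A f j y) = top" unfolding ennreal_SUP_of_nat_eq_top by (simp add: top_unique)
  thus ?thesis by (simp only: top_greatest)
 qed
qed

lemma dcell_sub: "dcell k j q <= Sx k"
 by (auto simp: dcell_def)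

lemma hits_measurable:
 fixes f :: "pt => 'a::metric_space"
 assumes "lipl k L (Sx k) f"
 shows "hits k (dcell k j0 q0) f j : borel_measurable (hausdorff_measure k)"
 unfolding hits_def using dcell_Int_borel[OF assms, of j0 q0 j] by (intro borel_measurable_sum borel_measurable_indicator) auto

lemma cell_vol_SUP:
 fixes f :: "pt => 'a::metric_space"
 assumes L: "lipl k L (Sx k) f"
 shows "cell_vol k f j0 q0 = (SUP j. SUM q:grid k j. emeasure (hausdorff_measure k) (f ` (dcell k j0 q0 Int dcell k j q)))"
proof -
 have "cell_vol k f j0 q0 = (\<integral>\<^sup>+ y. (SUP j. hits k (dcell k j0 q0) f j y) \<partial>hausdorff_measure k)"
  unfolding cell_vol_def by (intro nn_integral_cong count_on_SUP dcell_sub)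
 also have "... = (SUP j. \<integral>\<^sup>+ y. hits k (dcell k j0 q0) f j y \<partial>hausdorff_measure k)"
  using hits_measurable[OF L] hits_mono[OF dcell_sub] by (intro nn_integral_monotone_convergence_SUP) (auto simp: incseq_def le_fun_def)
 also have "... = (SUP j. SUM q:grid k j. emeasure (hausdorff_measure k) (f ` (dcell k j0 q0 Int dcell k j q)))"
 proof (rule SUP_cong)
  fix j
  show "(\<integral>\<^sup>+ y. hits k (dcell k j0 q0) f j y \<partial>hausdorff_measure k) = (SUM q:grid k j. emeasure (hausdorff_measure k) (f ` (dcell k j0 q0 Int dcell k j q)))"
   unfolding hits_def using dcell_Int_borel[OF L, of j0 q0 j] by (subst nn_integral_sum) (auto intro!: borel_measurable_indicator)
 qed simp
 finally show ?thesis .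
qed

lemma count_on_measurable:
 fixes f :: "pt => 'a::metric_space"
 assumes "lipl k L (Sx k) f"
 shows "count_on (dcell k j0 q0) f : borel_measurable (hausdorff_measure k)"
proof -
 have "count_on (dcell k j0 q0) f = (%y. SUP j. hits k (dcell k j0 q0) f j y)" by (intro ext count_on_SUP dcell_sub)
 thus ?thesis using hits_measurable[OF assms] by simp
qed

lemma simplex_volume_sum:
 fixes f :: "pt => 'a::metric_space"
 assumes L: "lipl k L (Sx k) f"
 shows "simplex_volume k f = (SUM q:grid k j0. cell_vol k f j0 q)"
proof -
 have split: "count_on (Sx k) f = (%y. SUM q:grid k j0. count_on (dcell k j0 q) f y)"
 proof
  fix y
  have "{x : Sx k. f x = y} = (UN q:grid k j0. {x : dcell k j0 q. f x = y})" using idx_in_grid by (auto simp: dcell_def)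
  moreover have "disjoint_family_on (%q. {x : dcell k j0 q. f x = y}) (grid k j0)" by (auto simp: disjoint_family_on_def dcell_def)
  ultimately show "count_on (Sx k) f y = (SUM q:grid k j0. count_on (dcell k j0 q) f y)"
   unfolding count_on_def using sum_emeasure[of "%q. {x : dcell k j0 q. f x = y}" "grid k j0" "count_space UNIV"] by simp
 qed
 show ?thesis unfolding simplex_volume_def multiplicity_count_on cell_vol_def split
  by (rule nn_integral_sum) (rule count_on_measurable[OF L])
qed

lemma cell_vol_push:
 fixes f g :: "pt => 'a::metric_space"
 assumes f: "lipl k L (Sx k) f" and g: "lipl k L' (Sx k) g" and lam: "0 < lmb"
  and lip: "!!x y. x : dcell k j0 q0 ==> y : dcell k j0 q0 ==> dist (g x) (g y) <= lmb * dist (f x) (f y)"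
 shows "cell_vol k g j0 q0 <= ennreal (lmb^k) * cell_vol k f j0 q0"
 unfolding cell_vol_SUP[OF g]
proof (rule SUP_least)
 fix j
 have "(SUM q:grid k j. emeasure (hausdorff_measure k) (g ` (dcell k j0 q0 Int dcell k j q))) <= (SUM q:grid k j. ennreal (lmb^k) * emeasure (hausdorff_measure k) (f ` (dcell k j0 q0 Int dcell k j q)))"
  using lip by (intro sum_mono hausdorff_scale dcell_Int_borel[OF f] hausdorff_outer_lipschitz[OF lam]) auto
 also have "... = ennreal (lmb^k)*(SUM q:grid k j. emeasure (hausdorff_measure k) (f ` (dcell k j0 q0 Int dcell k j q)))"
  by (simp add: sum_distrib_left)
 also have "... <= ennreal (lmb^k) * cell_vol k f j0 q0" unfolding cell_vol_SUP[OF f] by (intro mult_left_mono SUP_upper) auto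
 finally show "(SUM q:grid k j. emeasure (hausdorff_measure k) (g ` (dcell k j0 q0 Int dcell k j q))) <= ennreal (lmb^k) * cell_vol k f j0 q0" .
qed

context
 fixes g :: "pt => 'a::metric_space" and k j0 :: nat and q0 :: "nat => nat" and L :: real
 assumes g: "lipl k L (dcell k j0 q0) g"
begin

abbreviation piece_volume :: "nat => (nat => nat) => ennreal" where
 "piece_volume j q == emeasure (hausdorff_measure k) (g ` (dcell k j0 q0 Int dcell k j q))"

definition meeting :: "nat => (nat => nat) set" where
 "meeting j = {q : grid k j. dcell k j0 q0 Int dcell k j q ~= {}}"

lemma sum_finer_pieces:
 assumes j: "j0 <= j"
 shows "(SUM q:meeting j. piece_volume j q) <= ennreal ((2 * real k * L/2^j0)^k)"
proof -
 let ?c = "(2 * real k * L/2^j)^k"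
 have "piece_volume j q <= ennreal ?c" if q: "q : meeting j" for q
 proof -
  obtain x where x: "x : dcell k j0 q0" "x : dcell k j q" using q unfolding meeting_def by blast
  have "dcell k j q <= dcell k j0 q0"
  proof
   fix y assume "y : dcell k j q"
   thus "y : dcell k j0 q0" using x idx_eq_mono[of y k x j0 j] j by (simp add: dcell_def)
  qed
  from hausdorff_cell[OF lipl_mono[OF g this order_refl], of "dcell k j0 q0"]
  show ?thesis using hausdorff_le_outer[of k] by (metis Int_commute order_trans)
 qed
 hence "(SUM q:meeting j. piece_volume j q) <= (SUM q:meeting j. ennreal ?c)" by (intro sum_mono)
 also have "... = of_nat (card (meeting j)) * ennreal ?c" by simp
 also have "... <= of_nat ((2^(j - j0))^k) * ennreal ?c" unfolding meeting_def by (intro mult_right_mono of_nat_mono card_subcells[OF j]) auto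
 also have "... = ennreal (real ((2^(j - j0))^k)*?c)" using lipl_nonneg[OF g] by (simp add: ennreal_mult ennreal_of_nat_eq_real_of_nat)
 also have "real ((2^(j - j0))^k)*?c = (2^(j - j0)*(2 * real k * L/2^j))^k"
  by (simp only: power_mult_distrib[of "2^(j - j0)"] of_nat_power of_nat_numeral)
 also have "2^(j - j0)*(2 * real k * L/2^j) = 2 * real k * L/2^j0" using j by (simp add: power_diff)
 finally show ?thesis .
qed

lemma sum_coarser_pieces:
 assumes j: "j <= j0"
 shows "(SUM q:meeting j. piece_volume j q) <= ennreal ((2 * real k * L/2^j0)^k)"
proof -
 have "q = q'" if qq: "q : meeting j" "q' : meeting j" for q q'
 proof -
  obtain x y where "x : dcell k j0 q0" "x : dcell k j q" "y : dcell k j0 q0" "y : dcell k j q'" using qq unfolding meeting_def by blast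
  thus ?thesis using idx_eq_mono[of x k y j j0] j by (simp add: dcell_def)
 qed
 moreover have "finite (meeting j)" by (simp add: meeting_def)
 ultimately have card: "card (meeting j) <= 1" by (simp add: card_le_Suc0_iff_eq)
 have "piece_volume j q <= ennreal ((2 * real k * L/2^j0)^k)" for q
  using hausdorff_cell[OF g, of "dcell k j q"] hausdorff_le_outer order_trans by blast
 hence "(SUM q:meeting j. piece_volume j q) <= of_nat (card (meeting j)) * ennreal ((2 * real k * L/2^j0)^k)"
  using sum_mono[of "meeting j" "piece_volume j" "%_. ennreal ((2 * real k * L/2^j0)^k)"] by simp
 also have "... <= 1 * ennreal ((2 * real k * L/2^j0)^k)" using card by (intro mult_right_mono) auto
 finally show ?thesis by simp
qed

lemma cell_vol_lip:
 assumes "lipl k L' (Sx k) g"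
 shows "cell_vol k g j0 q0 <= ennreal ((2 * real k * L/2^j0)^k)"
 unfolding cell_vol_SUP[OF assms]
proof (rule SUP_least)
 fix j
 have "(SUM q:grid k j. piece_volume j q) = (SUM q:meeting j. piece_volume j q)"
  unfolding meeting_def by (rule sum.mono_neutral_right) auto
 thus "(SUM q:grid k j. piece_volume j q) <= ennreal ((2 * real k * L/2^j0)^k)"
  using sum_finer_pieces[of j] sum_coarser_pieces[of j] by (cases "j0 <= j") auto
qed

end

lemma simplex_volume_lip:
 fixes g :: "pt => 'a::metric_space"
 assumes g: "lipl k L (Sx k) g"
 shows "simplex_volume k g <= ennreal ((4 * real k * L)^k)"
proof -
 have L0: "0 <= L" using g by (simp add: lipl_def)
 have "simplex_volume k g = (SUM q:grid k 0. cell_vol k g 0 q)" by (rule simplex_volume_sum[OF g])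
 also have "... <= (SUM q:grid k 0. ennreal ((2 * real k * L/2^0)^k))"
  by (intro sum_mono cell_vol_lip[OF lipl_mono[OF g dcell_sub order_refl] g])
 also have "... = ennreal (2^k*(2 * real k * L)^k)" using L0 by (simp add: card_grid ennreal_mult ennreal_of_nat_eq_real_of_nat numeral_2_eq_2)
 also have "2^k*(2 * real k * L)^k = (2*(2 * real k * L))^k" by (rule power_mult_distrib[symmetric])
 also have "2*(2 * real k * L) = 4 * real k * L" by simp
 finally show ?thesis .
qed

lemma simplex_volume_degenerate:
 fixes f g :: "pt => 'a::metric_space"
 assumes f: "lipl p L (Sx p) f" and g: "lipl (Suc p) L' (Sx (Suc p)) g" and sub: "g ` Sx (Suc p) <= f ` Sx p"
 shows "simplex_volume (Suc p) g = 0"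
proof -
 have "compact (f ` Sx p)" by (intro compact_continuous_image lipl_continuous[OF f] compact_simplex)
 hence b: "f ` Sx p : sets (hausdorff_measure (Suc p))" by (simp add: borel_compact)
 have null: "emeasure (hausdorff_measure (Suc p)) (f ` Sx p) = 0"
  using hausdorff_le_outer[of "Suc p" "f ` Sx p"] hausdorff_lower_dim[OF f] by simp
 have "emeasure (hausdorff_measure (Suc p)) (g ` (dcell (Suc p) j0 q0 Int dcell (Suc p) j q)) = 0" for j0 q0 j q
 proof -
  have "g ` (dcell (Suc p) j0 q0 Int dcell (Suc p) j q) <= f ` Sx p" using sub dcell_sub by blast
  from emeasure_mono[OF this b] show ?thesis using null by simp
 qed
 hence "cell_vol (Suc p) g j0 q0 = 0" for j0 q0 by (simp add: cell_vol_SUP[OF g])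
 thus ?thesis by (simp add: simplex_volume_sum[OF g, of 0])
qed

section \<open>Whitney partitions from the Assouad-Nagata dimension\<close>

definition rad :: "'a::metric_space set => real => 'a => real" where
 "rad Z eps x = max eps (infdist x Z)"

lemma infdist_lip: "Z ~= {} ==> abs (infdist x Z - infdist y Z) <= dist x (y::'a::metric_space)"
 using infdist_triangle[of x Z y] infdist_triangle[of y Z x] by (simp add: dist_commute abs_le_iff)

lemma rad_ge: "eps <= rad Z eps x"
 by (simp add: rad_def)

lemma rad_lip: "abs (rad Z eps x - rad Z eps y) <= dist x y"
 using infdist_triangle[of x Z y] infdist_triangle[of y Z x] by (simp add: rad_def dist_commute abs_le_iff) linarith

definition lev :: "real => nat => real" where
 "lev eps j = (if j = 0 then eps else 2^(j - 1) * eps)"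

definition annulus :: "'a::metric_space set => real => nat => 'a set" where
 "annulus Z eps j = (if j = 0 then {x. infdist x Z < eps} else {x. 2^(j - 1) * eps <= infdist x Z & infdist x Z < 2^j * eps})"

lemma lev_ge: "0 < eps ==> eps <= lev eps j"
 by (simp add: lev_def mult_le_cancel_right1)

lemma annulus_rad:
 assumes "0 < eps" "x : annulus Z eps j" shows "lev eps j <= rad Z eps x & rad Z eps x < 2 * lev eps j"
proof (cases j)
 case 0 thus ?thesis using assms by (auto simp: lev_def annulus_def rad_def)
next
 case (Suc i)
 have "eps <= 2^i * eps" using assms by (simp add: mult_le_cancel_right1)
 hence "eps < 2*(2^i * eps)" using assms by linarith
 thus ?thesis using assms(2) Suc by (auto simp: lev_def annulus_def rad_def simp del: mult_less_cancel_right1 mult_less_cancel_left1)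
qed

lemma annulus_cover:
 assumes e: "0 < eps" shows "EX j. x : annulus Z eps j"
proof (cases "infdist x Z < eps")
 case True thus ?thesis by (intro exI[of _ 0]) (simp add: annulus_def)
next
 case False
 obtain i0 :: nat where i0: "infdist x Z/eps < 2^i0" using real_arch_pow[of 2] by auto
 define i where "i = (LEAST i. infdist x Z < 2^i * eps)"
 have ex: "infdist x Z < 2^i0 * eps" using i0 e by (simp add: pos_divide_less_eq)
 have i: "infdist x Z < 2^i * eps" unfolding i_def by (rule LeastI[of _ i0]) (rule ex)
 have "i ~= 0" using i False by (metis mult_1 power_0)
 moreover have "~ infdist x Z < 2^(i - 1) * eps"
  unfolding i_def by (rule not_less_Least) (use \<open>i ~= 0\<close> in \<open>simp add: i_def\<close>)
 ultimately show ?thesis using i by (intro exI[of _ i]) (simp add: annulus_def)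
qed

lemma card_levels:
 assumes e: "0 < eps" and r: "!!j. j : S ==> lo < lev eps j & lev eps j < 4 * lo"
 shows "finite S & card S <= 3"
proof (cases "S - {0} = {}")
 case True
 hence "S <= {0}" by auto
 thus ?thesis using card_mono[of "{0::nat}" S] finite_subset by fastforce
next
 case False
 define j0 where "j0 = (LEAST j. j : S - {0})"
 have j0: "j0 : S - {0}" unfolding j0_def using False by (metis LeastI ex_in_conv)
 have "j <= Suc j0" if j: "j : S - {0}" for j
 proof (rule ccontr)
  assume "~ ?thesis"
  hence "j0 - 1 + 2 <= j - 1" using j0 by auto
  hence "(2::real)^(j0 - 1 + 2) <= 2^(j - 1)" by (intro power_increasing) auto
  hence "4*(2::real)^(j0 - 1) <= 2^(j - 1)" by (simp add: power_add)
  hence "4*(2::real)^(j0 - 1) * eps <= 2^(j - 1) * eps" using e by (intro mult_right_mono) auto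
  hence "4 * lev eps j0 <= lev eps j" using j0 j by (simp add: lev_def)
  thus False using r[of j] r[of j0] j j0 by auto
 qed
 moreover have "j0 <= j" if "j : S - {0}" for j unfolding j0_def using that by (rule Least_le)
 ultimately have "S <= {0, j0, Suc j0}" by (force simp: le_Suc_eq)
 moreover have "card {0, j0, Suc j0} <= 3" by (simp add: card_insert_if)
 ultimately show ?thesis by (meson card_mono finite.emptyI finite.insertI finite_subset le_trans)
qed

locale whitney_family =
 fixes Z :: "'a::metric_space set" and N :: nat and C eps :: real and w :: "'v => 'a => real" and z :: "'v => 'a"
 assumes eps: "0 < eps" and w_lip: "!!v x y. abs (w v x - w v y) <= dist x y" and w_nonneg: "!!v x. 0 <= w v x" and z_Z: "!!v. z v : Z"
  and active: "!!x. finite {v. EX y. dist x y < eps/16 & 0 < w v y}" "!!x. card {v. EX y. dist x y < eps/16 & 0 < w v y} <= N"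
  and w_sum: "!!x. rad Z eps x/16 <= (SUM v:{v. 0 < w v x}. w v x)"
  and z_near: "!!v x. 0 < w v x ==> dist x (z v) <= C * rad Z eps x"

definition AN_cover :: "nat => real => real => 'a::metric_space set set => bool" where
 "AN_cover N c s \<U> = (\<Union>\<U> = UNIV & (ALL U:\<U>. bounded U & diameter U <= c * s) &
   (ALL B. bounded B & diameter B <= s --> finite {U\<in>\<U>. U Int B ~= {}} & card {U\<in>\<U>. U Int B ~= {}} <= N + 1))"

locale AN_covers =
 fixes Z :: "'a::metric_space set" and N :: nat and c eps :: real and \<U> :: "real => 'a set set"
 assumes Z: "Z ~= {}" and c: "0 < c" and eps: "0 < eps" and cover: "!!s. 0 < s ==> AN_cover N c s (\<U> s)"
begin

definition tile :: "nat \<times> 'a set => 'a set" where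
 "tile v = (if snd v : \<U> (lev eps (fst v)/2) then snd v Int annulus Z eps (fst v) else {})"

definition bump :: "nat \<times> 'a set => 'a => real" where
 "bump v x = (if tile v = {} then 0 else max 0 (lev eps (fst v)/8 - infdist x (tile v)))"

definition base_point :: "nat \<times> 'a set => 'a" where
 "base_point v = (SOME y. y : tile v)"

definition nearby_Z :: "nat \<times> 'a set => 'a" where
 "nearby_Z v = (SOME z. z : Z & dist (base_point v) z < infdist (base_point v) Z + eps)"

definition tiles_near :: "'a => nat => 'a set set" where
 "tiles_near x j = {U : \<U> (lev eps j/2). U Int ball x (lev eps j/4) ~= {}}"

lemma lev_pos: "0 < lev eps j"
 using lev_ge[OF eps, of j] eps by linarith

lemma tileD: "y : tile v ==> snd v : \<U> (lev eps (fst v)/2) & y : snd v & y : annulus Z eps (fst v)"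
 by (auto simp: tile_def split: if_splits)

lemma nearby_Z: "nearby_Z v : Z & dist (base_point v) (nearby_Z v) < infdist (base_point v) Z + eps"
proof -
 let ?P = "%u. u : Z & dist (base_point v) u < infdist (base_point v) Z + eps"
 have "EX u. ?P u"
  using cInf_lessD[of "dist (base_point v) ` Z" "infdist (base_point v) Z + eps"] Z eps by (auto simp: infdist_def)
 from someI_ex[OF this] show ?thesis by (simp only: nearby_Z_def)
qed

lemma bump_lip: "abs (bump v x - bump v y) <= dist x y"
proof (cases "tile v = {}")
 case False
 show ?thesis using infdist_lip[OF False, of x y] zero_le_dist[of x y] False unfolding bump_def max_def abs_le_iff by (simp split: if_splits)
qed (simp add: bump_def)

lemma bump_pos:
 assumes "0 < bump v y" shows "EX y':tile v. dist y y' < lev eps (fst v)/8"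
proof -
 have "tile v ~= {}" "infdist y (tile v) < lev eps (fst v)/8" using assms by (auto simp: bump_def split: if_splits)
 thus ?thesis using cInf_lessD[of "dist y ` tile v" "lev eps (fst v)/8"] by (auto simp: infdist_def)
qed

lemma active_tile:
 assumes "EX y. dist x y < eps/16 & 0 < bump v y"
 obtains y' where "y' : tile v" "dist x y' < 3 * lev eps (fst v)/16"
proof -
 obtain y where y: "dist x y < eps/16" "0 < bump v y" using assms by blast
 obtain y' where y': "y' : tile v" "dist y y' < lev eps (fst v)/8" using bump_pos[OF y(2)] by blast
 have "dist x y' < 3 * lev eps (fst v)/16" using dist_triangle[of x y' y] y(1) y'(2) lev_ge[OF eps, of "fst v"] by linarith
 thus ?thesis using that y'(1) by blast
qed

lemma tile_level:
 assumes y: "y : tile v" and d: "dist x y < 3 * lev eps (fst v)/16"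
 shows "13 * lev eps (fst v)/16 < rad Z eps x" "rad Z eps x < 35 * lev eps (fst v)/16"
 using annulus_rad[OF eps, of y Z "fst v"] tileD[OF y] rad_lip[of Z eps x y] d by (auto simp: abs_le_iff)

lemma finite_tiles_near: "finite (tiles_near x j) & card (tiles_near x j) <= N + 1"
proof -
 have "dist a b <= lev eps j/2" if "a : ball x (lev eps j/4)" "b : ball x (lev eps j/4)" for a b
  using dist_triangle3[of a b x] that by auto
 hence "diameter (ball x (lev eps j/4)) <= lev eps j/2" using lev_pos[of j] by (intro diameter_le_metric) auto
 thus ?thesis using cover[of "lev eps j/2"] lev_pos[of j] by (simp add: AN_cover_def tiles_near_def)
qed

lemma active_bumps:
 "finite {v. EX y. dist x y < eps/16 & 0 < bump v y} & card {v. EX y. dist x y < eps/16 & 0 < bump v y} <= 3*(N + 1)"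
 (is "finite ?V & card ?V <= _")
proof -
 let ?levels = "fst ` ?V"
 have levels: "finite ?levels & card ?levels <= 3"
 proof (rule card_levels[OF eps, of _ "16 * rad Z eps x/35"])
  fix j assume "j : ?levels"
  then obtain v where v: "EX y. dist x y < eps/16 & 0 < bump v y" "j = fst v" by blast
  obtain y where "y : tile v" "dist x y < 3 * lev eps (fst v)/16" by (rule active_tile[OF v(1)])
  from tile_level[OF this] show "16 * rad Z eps x/35 < lev eps j & lev eps j < 4*(16 * rad Z eps x/35)" unfolding v(2) by linarith
 qed
 have "?V <= Sigma ?levels (tiles_near x)"
 proof
  fix v assume v: "v : ?V"
  then obtain y where y: "y : tile v" "dist x y < 3 * lev eps (fst v)/16" using active_tile[of x v] by blast
  hence "y : ball x (lev eps (fst v)/4)" using lev_pos[of "fst v"] by auto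
  hence "snd v : tiles_near x (fst v)" using tileD[OF y(1)] by (auto simp: tiles_near_def)
  thus "v : Sigma ?levels (tiles_near x)" using v by (cases v) force
 qed
 moreover have "finite (Sigma ?levels (tiles_near x))" using levels finite_tiles_near by (intro finite_SigmaI) auto
 ultimately have "finite ?V" "card ?V <= card (Sigma ?levels (tiles_near x))" by (auto intro: finite_subset card_mono)
 moreover have "card (Sigma ?levels (tiles_near x)) = (SUM j:?levels. card (tiles_near x j))"
  using levels finite_tiles_near by (intro card_SigmaI) auto
 moreover have "... <= (SUM j:?levels. N + 1)" using finite_tiles_near by (intro sum_mono) blast
 moreover have "... <= 3*(N + 1)" using mult_right_mono[OF conjunct2[OF levels], of "N + 1"] by simp
 ultimately show ?thesis by linarith
qed

lemma bump_sum: "rad Z eps x/16 <= (SUM v:{v. 0 < bump v x}. bump v x)"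
proof -
 obtain j where j: "x : annulus Z eps j" using annulus_cover[OF eps] by blast
 have "x : \<Union>(\<U> (lev eps j/2))" using cover[of "lev eps j/2"] lev_pos[of j] by (simp add: AN_cover_def)
 then obtain U where "U : \<U> (lev eps j/2)" "x : U" by blast
 hence "x : tile (j, U)" using j by (simp add: tile_def)
 hence bump: "bump (j, U) x = lev eps j/8" using lev_pos[of j] by (auto simp: bump_def)
 have "finite {v. 0 < bump v x}" by (rule finite_subset[OF _ conjunct1[OF active_bumps[of x]]]) (use eps in \<open>auto intro!: exI[of _ x]\<close>)
 hence "bump (j, U) x <= (SUM v:{v. 0 < bump v x}. bump v x)" using bump lev_pos[of j] by (intro member_le_sum) auto
 thus ?thesis using bump annulus_rad[OF eps j] by linarith
qed

lemma nearby_Z_dist: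
 assumes bump: "0 < bump v x" shows "dist x (nearby_Z v) <= 2*(c + 4) * rad Z eps x"
proof -
 obtain y where y: "y : tile v" "dist x y < lev eps (fst v)/8" using bump_pos[OF bump] by blast
 let ?l = "lev eps (fst v)" and ?b = "base_point v"
 have b: "?b : tile v" unfolding base_point_def using y(1) by (rule someI)
 have U: "bounded (snd v)" "diameter (snd v) <= c*(?l/2)"
  using cover[of "?l/2"] lev_pos[of "fst v"] tileD[OF b] by (auto simp: AN_cover_def)
 have yb: "dist y ?b <= c*(?l/2)"
  using diameter_bounded_bound[OF U(1), of y ?b] tileD[OF y(1)] tileD[OF b] U(2) by linarith
 have "infdist ?b Z <= rad Z eps ?b" by (simp add: rad_def)
 hence bz: "dist ?b (nearby_Z v) < 3*?l"
  using nearby_Z[of v] annulus_rad[OF eps, of ?b Z "fst v"] tileD[OF b] lev_ge[OF eps, of "fst v"] by linarith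
 have "dist x (nearby_Z v) <= dist x y + dist y ?b + dist ?b (nearby_Z v)"
  using dist_triangle[of x "nearby_Z v" y] dist_triangle[of y "nearby_Z v" ?b] by linarith
 also have "... <= ?l/8 + c*(?l/2) + 3*?l" using y(2) yb bz by linarith
 also have "... <= (c + 4)*?l" using lev_pos[of "fst v"] mult_pos_pos[OF c lev_pos[of "fst v"]] by (simp add: distrib_right)
 also have "... <= (c + 4)*(2 * rad Z eps x)"
 proof (rule mult_left_mono)
  show "?l <= 2 * rad Z eps x" using tile_level(1)[OF y(1), of x] y(2) lev_pos[of "fst v"] by linarith
 qed (use c in simp)
 finally show ?thesis by (simp only: mult_ac)
qed

lemma whitney_bumps
: "whitney_family Z (3*(N + 1)) (2*(c + 4)) eps bump nearby_Z"
 using eps bump_lip nearby_Z active_bumps bump_sum nearby_Z_dist by unfold_locales (auto simp: bump_def)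

end

lemma whitney_exists:
 fixes Z :: "'a::metric_space set"
 assumes AN: "AN_dim_finite TYPE('a)" and Z: "Z ~= {}"
 shows "EX N C. 0 < C & (ALL eps>0. EX (w :: nat \<times> 'a set => 'a => real) z. whitney_family Z N C eps w z)"
proof -
 have "EX N. EX c>0. ALL s>0. EX \<U>::'a set set. AN_cover N c s \<U>"
  using AN unfolding AN_dim_finite_def AN_dim_le_def AN_cover_def .
 then obtain N c where c: "c > 0" and covers: "!!s. s > 0 ==> EX \<U>::'a set set. AN_cover N c s \<U>" by blast
 obtain \<U> :: "real => 'a set set" where "!!s. s > 0 ==> AN_cover N c s (\<U> s)" using covers by metis
 hence "AN_covers Z N c eps \<U>" if "0 < eps" for eps using Z c that by unfold_locales
 thus ?thesis using c AN_covers.whitney_bumps by (intro exI[of _ "3*(N + 1)"] exI[of _ "2*(c + 4)"]) fastforce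
qed

locale coordinates =
 fixes Z K P :: "'a::metric_space set" and N :: nat and C C2 eps :: real and M :: nat and z :: "nat => 'a"
  and phi :: "'a => pt" and lab :: "'a => nat"
 assumes eps: "0 < eps" and z_Z: "!!i. z i : Z" and label: "!!p. p : P ==> lab p <= M" "!!p. p : P ==> z (lab p) = p"
  and phi_simplex: "!!x. x : K ==> phi x : Sx M" and phi_card: "!!x. x : K ==> card (support (phi x)) <= N"
  and phi_near: "!!x i. x : K ==> i : support (phi x) ==> dist x (z i) <= C * rad Z eps x"
  and phi_lip: "!!x y. x : K ==> y : K ==> dist x y < eps/16 ==> l1 M (phi x) (phi y) <= C2/rad Z eps x * dist x y"

lemma sum_nth:
 fixes g :: "'v => real"
 assumes "distinct vs" "length vs <= M"
 shows "(SUM i<=M. if i < length vs then g (vs ! i) else 0) = (SUM v:set vs. g v)"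
proof -
 have "(SUM i<=M. if i < length vs then g (vs ! i) else 0) = (SUM i<length vs. g (vs ! i))"
  using assms(2) by (intro sum.mono_neutral_cong_right) auto
 also have "... = (SUM v:set vs. g v)" using sum.reindex_bij_betw[OF bij_betw_nth[OF assms(1) refl refl], of g] by simp
 finally show ?thesis .
qed

context whitney_family
begin

definition active_at :: "'a => 'v set" where
 "active_at x = {v. EX y. dist x y < eps/16 & 0 < w v y}"

lemma active_at: "finite (active_at x)" "card (active_at x) <= N"
 using active unfolding active_at_def by auto

lemma inactive: "v ~: active_at x ==> dist x y < eps/16 ==> w v y = 0"
 using w_nonneg[of v y] by (force simp: active_at_def)

context
 fixes K :: "'a set" and vs :: "'v list" and M :: nat
 assumes vs: "distinct vs" "length vs <= M" and complete: "!!x v. x : K ==> 0 < w v x ==> v : set vs"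
begin

definition weights :: "'a => pt" where
 "weights x i = (if i < length vs then w (vs ! i) x else 0)"

definition total :: "'a => real" where
 "total x = (SUM v:set vs. w v x)"

definition barycentric :: "'a => pt" where
 "barycentric x = (%i. weights x i/total x)"

lemma sum_weights: "(SUM i<=M. weights x i) = total x"
 unfolding weights_def total_def by (rule sum_nth[OF vs])

lemma weights_nonneg: "0 <= weights x i"
 using w_nonneg by (simp add: weights_def)

lemma total_ge: "x : K ==> rad Z eps x/16 <= total x"
proof -
 assume x: "x : K"
 have "(SUM v:{v. 0 < w v x}. w v x) = total x" unfolding total_def
  using complete[OF x] w_nonneg[of _ x] by (intro sum.mono_neutral_left) (auto simp: not_less antisym)
 thus ?thesis using w_sum[of x] by simp
qed

lemma total_pos: "x : K ==> 0 < total x"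
 using total_ge[of x] rad_ge[of eps Z x] eps by linarith

lemma barycentric_simplex:
 assumes x: "x : K" shows "barycentric x : Sx M"
proof -
 have "(SUM i<=M. barycentric x i) = 1"
  unfolding barycentric_def sum_divide_distrib[symmetric] sum_weights using total_pos[OF x] by simp
 moreover have "barycentric x i = 0" if "i > M" for i using that vs(2) by (simp add: barycentric_def weights_def)
 moreover have "0 <= barycentric x i" for i using weights_nonneg[of x i] total_pos[OF x] by (simp add: barycentric_def)
 ultimately show ?thesis by (simp add: simplex_k_def)
qed

lemma barycentric_support: "i : support (barycentric x) ==> i < length vs & 0 < w (vs ! i) x"
 using w_nonneg[of "vs ! i" x] by (auto simp: support_def barycentric_def weights_def split: if_splits)

lemma card_barycentric: "card (support (barycentric x)) <= N"
proof -
 have "card (support (barycentric x)) <= card (active_at x)"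
 proof (rule card_inj_on_le[of "(!) vs"])
  show "inj_on ((!) vs) (support (barycentric x))"
   using barycentric_support vs(1) by (auto intro!: inj_onI simp: nth_eq_iff_index_eq)
  show "(!) vs ` support (barycentric x) <= active_at x"
   using barycentric_support eps by (auto simp: active_at_def intro!: exI[of _ x])
 qed (rule active_at)
 thus ?thesis using active_at(2)[of x] by simp
qed

lemma weights_lip:
 assumes d: "dist x y < eps/16" shows "l1 M (weights x) (weights y) <= real N * dist x y"
proof -
 have "l1 M (weights x) (weights y) = (SUM i<=M. if i < length vs then abs (w (vs ! i) x - w (vs ! i) y) else 0)"
  unfolding l1_def weights_def by (intro sum.cong) auto
 also have "... = (SUM v:set vs. abs (w v x - w v y))" by (rule sum_nth[OF vs])
 also have "... = (SUM v:set vs Int active_at x. abs (w v x - w v y))"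
  using inactive[of _ x x] inactive[of _ x y] d eps by (intro sum.mono_neutral_right) auto
 also have "... <= (SUM v:set vs Int active_at x. dist x y)" by (intro sum_mono w_lip)
 also have "... = real (card (set vs Int active_at x)) * dist x y" by simp
 also have "card (set vs Int active_at x) <= N"
  using card_mono[OF active_at(1)[of x], of "set vs Int active_at x"] active_at(2)[of x] by simp
 finally show ?thesis by (simp add: mult_right_mono)
qed

lemma barycentric_lip:
 assumes x: "x : K" and y: "y : K" and d: "dist x y < eps/16"
 shows "l1 M (barycentric x) (barycentric y) <= 64 * real N/rad Z eps x * dist x y"
proof -
 define r where "r = rad Z eps x/32"
 have r0: "0 < r" unfolding r_def using rad_ge[of eps Z x] eps by linarith
 have rx: "r <= total x" using total_ge[OF x] r0 unfolding r_def by linarith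
 have ry: "r <= total y" using total_ge[OF y] rad_lip[of Z eps x y] d rad_ge[of eps Z x] eps unfolding r_def by linarith
 have diff: "abs (total x - total y) <= l1 M (weights x) (weights y)"
  unfolding sum_weights[symmetric] l1_def sum_subtractf[symmetric] by (rule sum_abs)
 have "l1 M (weights y) (%_. 0) <= 1 * total y" unfolding l1_def sum_weights[symmetric] using weights_nonneg by simp
 hence "l1 M (barycentric x) (barycentric y) <= (1 + 1)/r * l1 M (weights x) (weights y)"
  unfolding barycentric_def by (rule l1_normalize[OF r0 rx ry diff])
 also have "... <= (1 + 1)/r*(real N * dist x y)" using weights_lip[OF d] r0 by (intro mult_left_mono) auto
 finally show ?thesis unfolding r_def by (simp add: mult_ac)
qed

end

lemma finite_active_list:
 assumes K: "compact K"
 obtains vs where "distinct vs" "!!x v. x : K ==> 0 < w v x ==> v : set vs"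
proof -
 have "K <= (UN x:K. ball x (eps/16))" using eps by force
 then obtain T where T: "T <= K" "finite T" "K <= (UN x:T. ball x (eps/16))"
  using compactE_image[OF K, of K "%x. ball x (eps/16)"] by auto
 have "finite (UN x:T. active_at x)" using T(2) active_at(1) by auto
 then obtain vs where vs: "set vs = (UN x:T. active_at x)" "distinct vs" using finite_distinct_list by blast
 have "v : set vs" if "x : K" "0 < w v x" for x v
  using T(3) that unfolding vs(1) active_at_def by force
 thus ?thesis using that vs(2) by blast
qed

lemma coordinates_exist:
 assumes K: "compact K" and P: "finite P" "P <= Z"
 shows "EX M z phi lab. coordinates Z K P N C (64 * real N) eps M z phi lab"
proof -
 obtain vs where vs: "distinct vs" "!!x v. x : K ==> 0 < w v x ==> v : set vs" using finite_active_list[OF K] by blast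
 obtain ps where ps: "set ps = P" using finite_list[OF P(1)] by blast
 define M where "M = length vs + length ps"
 define z' where "z' = (%i. if i < length vs then z (vs ! i) else if i < M then ps ! (i - length vs) else z undefined)"
 define lab where "lab = (%p. length vs + (SOME j. j < length ps & ps ! j = p))"
 have M: "length vs <= M" by (simp add: M_def)
 have "z' i : Z" for i using z_Z P(2) ps nth_mem[of "i - length vs" ps] by (auto simp: z'_def M_def)
 moreover have "lab p <= M & z' (lab p) = p" if push_pt: "p : P" for p
 proof -
  obtain j where "j < length ps & ps ! j = p" using push_pt ps by (auto simp: in_set_conv_nth)
  from someI[of "%j. j < length ps & ps ! j = p", OF this] show ?thesis by (simp add: lab_def z'_def M_def)
 qed
 moreover have "dist x (z' i) <= C * rad Z eps x" if "i : support (barycentric vs x)" for x i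
  using barycentric_support[OF vs(1) M vs(2) that] z_near by (simp add: z'_def)
 ultimately have "coordinates Z K P N C (64 * real N) eps M z' (barycentric vs) lab"
  using eps barycentric_simplex[OF vs(1) M vs(2)] card_barycentric[OF vs(1) M vs(2)] barycentric_lip[OF vs(1) M vs(2)] by unfold_locales auto
 thus ?thesis by blast
qed

end

section \<open>Singular Lipschitz chains\<close>

type_synonym 'a sing_chain = "(pt => 'a) \<Rightarrow>\<^sub>0 int"

definition aff :: "pt list => pt => pt" where
 "aff l y = (%i. SUM j<length l. y j*(l ! j) i)"

definition sing :: "(pt => 'a) => pt list => (pt => 'a)" where
 "sing f l = (%y. if y : Sx (length l - 1) then f (aff l y) else undefined)"

definition sings :: "(pt => 'a) => pt list_chain => 'a sing_chain" where
 "sings f = frag_extend (%l. frag_of (sing f l))"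

definition sface :: "nat => (pt => 'a) => 'a sing_chain" where
 "sface p sig = (if p = 0 then 0 else SUM i<=p. frag_cmul ((-1)^i) (frag_of (face p i sig)))"

definition sbd :: "nat => 'a sing_chain => 'a sing_chain" where
 "sbd p = frag_extend (sface p)"

definition std :: "nat => pt list" where
 "std p = map vtx [0..<Suc p]"

lemma sings_of [simp]: "sings f (frag_of l) = frag_of (sing f l)" and sings_diff: "sings f (a - b) = sings f a - sings f b"
 and sings_0 [simp]: "sings f 0 = 0" and sings_cmul: "sings f (frag_cmul k a) = frag_cmul k (sings f a)"
 by (simp_all add: sings_def frag_extend_diff frag_extend_cmul)

lemma sings_sum: "finite I ==> sings f (sum b I) = (SUM i:I. sings f (b i))"
 by (simp add: sings_def frag_extend_sum o_def)

lemma sbd_of [simp]: "sbd p (frag_of sig) = sface p sig" and sbd_diff: "sbd p (a - b) = sbd p a - sbd p b"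
 and sbd_add: "sbd p (a + b) = sbd p a + sbd p b" and sbd_0 [simp]: "sbd p 0 = 0"
 by (simp_all add: sbd_def frag_extend_diff frag_extend_add)

lemma length_std [simp]: "length (std p) = Suc p"
 by (simp add: std_def)

lemma nth_std: "j <= p ==> std p ! j = vtx j"
 by (simp add: std_def del: upt_Suc)

lemma set_std: "set (std p) <= Sx p"
 using vtx_simplex by (auto simp: std_def)

lemma del_nth: "i < length l ==> j < length l - 1 ==> del i l ! j = l ! (if j < i then j else Suc j)"
 by (auto simp: del_def nth_append min_def)

lemma aff_face_map:
 assumes "length l = Suc (Suc p)" "i <= Suc p"
 shows "aff l (face_map i y) = aff (del i l) y"
proof
 fix t
 have "aff l (face_map i y) t = (SUM j<=Suc p. face_map i y j*(l ! j) t)" by (simp add: aff_def assms(1) lessThan_Suc_atMost)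
 also have "... = (SUM j<=p. y j*(l ! (if j < i then j else Suc j)) t)"
  unfolding sum_remove_index[OF assms(2)] face_map_index by simp
 also have "... = (SUM j<=p. y j*(del i l ! j) t)" using del_nth[of i l] assms by (intro sum.cong) auto
 also have "... = aff (del i l) y t" using length_del[of i l] assms by (simp add: aff_def lessThan_Suc_atMost)
 finally show "aff l (face_map i y) t = aff (del i l) y t" .
qed

lemma face_sing:
 assumes "length l = Suc (Suc p)" "i <= Suc p"
 shows "face (Suc p) i (sing f l) = sing f (del i l)"
proof
 fix y
 have len: "length (del i l) - 1 = p" using length_del[of i l] assms by simp
 show "face (Suc p) i (sing f l) y = sing f (del i l) y"
 proof (cases "y : Sx p")
  case True
  thus ?thesis using face_map_simplex[OF True assms(2)] aff_face_map[OF assms] len assms(1) by (simp add: face_apply sing_def)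
 next
  case False thus ?thesis using len by (simp add: face_outside sing_def)
 qed
qed

lemma bd_sum: "bd l = (SUM i<length l. frag_cmul ((-1)^i) (frag_of (del i l)))"
proof (induction l)
 case (Cons v l)
 have "lcons v (bd l) = (SUM i<length l. frag_cmul ((-1)^i) (frag_of (v # del i l)))"
  unfolding Cons.IH lcons_def by (simp add: frag_extend_sum frag_extend_cmul o_def)
 hence "bd (v # l) = frag_of l + (SUM i<length l. frag_cmul ((-1)^Suc i) (frag_of (del (Suc i) (v # l))))"
  by (simp add: sum_negf[symmetric])
 also have "... = (SUM i<length (v # l). frag_cmul ((-1)^i) (frag_of (del i (v # l))))"
  by (simp only: list.size(4) add_0_right add_Suc_right sum.lessThan_Suc_shift) simp
 finally show ?case .
qed simp

lemma sface_sing: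
 assumes "length l = Suc (Suc p)" shows "sface (Suc p) (sing f l) = sings f (bd l)"
proof -
 have "sface (Suc p) (sing f l) = (SUM i<=Suc p. frag_cmul ((-1)^i) (frag_of (sing f (del i l))))"
  (is "_ = ?R")
 proof -
  have "sface (Suc p) (sing f l) = (SUM i<=Suc p. frag_cmul ((-1)^i) (frag_of (face (Suc p) i (sing f l))))" by (simp only: sface_def) simp
  also have "... = ?R" by (intro sum.cong refl) (simp add: face_sing[OF assms])
  finally show ?thesis .
 qed
 also have "... = sings f (bd l)" unfolding bd_sum assms lessThan_Suc_atMost by (simp add: sings_sum sings_cmul del: sum.atMost_Suc)
 finally show ?thesis .
qed

lemma sbd_sings:
 assumes "!!l. l : keys c ==> length l = Suc (Suc p)" shows "sbd (Suc p) (sings f c) = sings f (BD c)"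
proof -
 have "keys c <= {l. length l = Suc (Suc p)}" using assms by blast
 thus ?thesis by (induction c rule: frag_induction) (auto simp: sings_diff sbd_diff BD_diff sface_sing)
qed

lemma aff_std: "y : Sx p ==> aff (std p) y = y"
proof
 fix i assume y: "y : Sx p"
 have "aff (std p) y i = (SUM j<Suc p. if j = i then y j else 0)" unfolding aff_def length_std by (intro sum.cong) (auto simp: nth_std vtx_def)
 also have "... = (if i < Suc p then y i else 0)" by (subst sum.delta) auto
 also have "... = y i" using y by (auto simp: simplex_k_def)
 finally show "aff (std p) y i = y i" .
qed

lemma sing_std: "(!!x. x ~: Sx p ==> sig x = undefined) ==> sing sig (std p) = sig"
 by (rule ext) (auto simp: sing_def aff_std)

lemma face_map_vtx: "face_map i (vtx j) = vtx (if j < i then j else Suc j)"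
 by (rule ext) (auto simp: face_map_def vtx_def)

lemma del_std: "i <= Suc p ==> del i (std (Suc p)) = map (face_map i) (std p)"
 by (rule nth_equalityI) (auto simp: length_del del_nth nth_std face_map_vtx)

lemma face_map_linear: "face_map i (%j. a * x j + b * y j) = (%j. a * face_map i x j + b * face_map i y j)"
 by (rule ext) (simp add: face_map_def)

lemma aff_map_face: "aff (map (face_map i) l) y = face_map i (aff l y)"
proof
 fix t
 have "aff (map (face_map i) l) y t = (SUM j<length l. y j * face_map i (l ! j) t)" by (simp add: aff_def)
 also have "... = face_map i (aff l y) t" by (simp add: face_map_def aff_def)
 finally show "aff (map (face_map i) l) y t = face_map i (aff l y) t" .
qed

lemma sing_face_natural:
 assumes "!!y. y : Sx (length l - 1) ==> f (face_map i (aff l y)) = g (aff l y)"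
 shows "sing f (map (face_map i) l) = sing g l"
 using assms by (auto simp: sing_def aff_map_face)

lemma sings_face_natural:
 assumes "!!l y. l : keys c ==> y : Sx (length l - 1) ==> f (face_map i (aff l y)) = g (aff l y)"
 shows "sings f (lmap (face_map i) c) = sings g c"
proof -
 have "sings f (lmap (face_map i) c) = frag_extend (%l. frag_of (sing f (map (face_map i) l))) c"
  unfolding sings_def lmap_def frag_extend_extend by simp
 also have "... = sings g c" unfolding sings_def
 proof (rule frag_extend_eq)
  fix l assume "l : keys c"
  hence "sing f (map (face_map i) l) = sing g l" by (intro sing_face_natural assms)
  thus "frag_of (sing f (map (face_map i) l)) = frag_of (sing g l)" by simp
 qed
 finally show ?thesis .
qed

lemma sings_bd_natural:
 assumes O: "!!i. i <= Suc p ==> O1 (map (face_map i) (std p)) = lmap (face_map i) c"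
  and f: "!!i l y. i <= Suc p ==> l : keys c ==> y : Sx (length l - 1) ==> f (face_map i (aff l y)) = g i (aff l y)"
 shows "sings f (frag_extend O1 (bd (std (Suc p)))) = (SUM i<=Suc p. frag_cmul ((-1)^i) (sings (g i) c))"
proof -
 have "frag_extend O1 (bd (std (Suc p))) = (SUM i<=Suc p. frag_cmul ((-1)^i) (O1 (del i (std (Suc p)))))"
  unfolding bd_sum length_std lessThan_Suc_atMost by (simp add: frag_extend_sum frag_extend_cmul o_def del: sum.atMost_Suc)
 also have "sings f ... = (SUM i<=Suc p. frag_cmul ((-1)^i) (sings f (O1 (del i (std (Suc p))))))"
  by (simp add: sings_sum sings_cmul del: sum.atMost_Suc)
 also have "... = (SUM i<=Suc p. frag_cmul ((-1)^i) (sings (g i) c))"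
  using O f by (intro sum.cong arg_cong[of _ _ "frag_cmul _"]) (auto simp: del_std intro!: sings_face_natural)
 finally show ?thesis .
qed

lemma aff_simplex:
 assumes "set l <= Sx p" "length l = Suc q" "y : Sx q"
 shows "aff l y : Sx p"
proof -
 have lj: "l ! j : Sx p" if "j <= q" for j using assms that by (auto intro!: nth_mem[THEN subsetD[rotated]])
 have "(SUM i<=p. aff l y i) = (SUM j<=q. y j*(SUM i<=p. (l ! j) i))"
  unfolding aff_def assms(2) lessThan_Suc_atMost sum_distrib_left by (rule sum.swap)
 also have "... = (SUM j<=q. y j)" using lj by (intro sum.cong) (auto simp: simplex_k_def)
 also have "... = 1" using assms(3) by (simp add: simplex_k_def)
 finally have total: "(SUM i<=p. aff l y i) = 1" .
 have "0 <= aff l y i" for i unfolding aff_def using assms(2) simplex_nonneg[OF lj] simplex_nonneg[OF assms(3)] by (intro sum_nonneg mult_nonneg_nonneg) auto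
 moreover have "aff l y i = 0" if "i > p" for i unfolding aff_def using assms(2) lj that by (intro sum.neutral) (auto simp: simplex_k_def)
 ultimately show ?thesis using total by (simp add: simplex_k_def)
qed

lemma aff_lip:
 assumes len: "length l = Suc q" and D: "!!a b. a : set l ==> b : set l ==> l1 p a b <= D" and y: "y : Sx q" "y' : Sx q"
 shows "l1 p (aff l y) (aff l y') <= D * l1 q y y'"
proof -
 have sum_diff: "(SUM j<=q. y j - y' j) = 0" using y by (simp add: sum_subtractf simplex_k_def)
 have aff_diff: "aff l y i - aff l y' i = (SUM j<=q. (y j - y' j)*((l ! j) i - (l ! 0) i))" for i
 proof -
  have "aff l y i - aff l y' i = (SUM j<=q. (y j - y' j)*(l ! j) i)"
   unfolding aff_def len lessThan_Suc_atMost sum_subtractf[symmetric] by (simp add: left_diff_distrib)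
  moreover have "(SUM j<=q. (y j - y' j)*(l ! 0) i) = 0" using sum_diff by (simp add: sum_distrib_right[symmetric])
  ultimately show ?thesis by (simp add: right_diff_distrib sum_subtractf)
 qed
 have "l1 p (aff l y) (aff l y') <= (SUM i<=p. SUM j<=q. abs (y j - y' j) * abs ((l ! j) i - (l ! 0) i))"
  unfolding l1_def aff_diff abs_mult[symmetric] by (intro sum_mono sum_abs)
 also have "... = (SUM j<=q. abs (y j - y' j) * l1 p (l ! j) (l ! 0))" unfolding l1_def sum_distrib_left by (rule sum.swap)
 also have "... <= (SUM j<=q. abs (y j - y' j) * D)" using D len by (intro sum_mono mult_left_mono) auto
 also have "... = D * l1 q y y'" unfolding l1_def sum_distrib_right[symmetric] by (rule mult.commute)
 finally show ?thesis .
qed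

lemma sing_lipl:
 assumes L: "lipl p L W sig" and W: "!!y. y : Sx q ==> aff l y : W" and len: "length l = Suc q"
  and D: "0 <= D" "!!a b. a : set l ==> b : set l ==> l1 p a b <= D"
 shows "lipl q (L * D) (Sx q) (sing sig l)"
proof (rule liplI)
 note L0 = lipl_nonneg[OF L]
 thus "0 <= L * D" using D by simp
 fix y y' assume y: "y : Sx q" "y' : Sx q"
 have "dist (sing sig l y) (sing sig l y') = dist (sig (aff l y)) (sig (aff l y'))" using y len by (simp add: sing_def)
 also have "... <= L * l1 p (aff l y) (aff l y')" using L W[OF y(1)] W[OF y(2)] by (simp add: lipl_def)
 also have "... <= L*(D * l1 q y y')" using aff_lip[OF len D(2) y] L0 by (rule mult_left_mono)
 finally show "dist (sing sig l y) (sing sig l y') <= L * D * l1 q y y'" by (simp add: mult.assoc)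
qed

lemma sing_lip_simplex:
 assumes s: "lip_simplex S p sig" and l: "set l <= Sx p" "length l = Suc q"
 shows "lip_simplex S q (sing sig l)"
proof -
 obtain L where L: "lipl p L (Sx p) sig" using s by (auto simp: lip_simplex_iff)
 have "lipl q (L*2) (Sx q) (sing sig l)"
 proof (rule sing_lipl[OF L _ l(2)])
  show "l1 p a b <= 2" if "a : set l" "b : set l" for a b using that l(1) by (intro simplex_diam) auto
 qed (use aff_simplex[OF l] in auto)
 thus ?thesis using s aff_simplex[OF l] l(2) unfolding lip_simplex_iff by (auto simp: sing_def)
qed

definition subdiv_sing :: "nat => nat => (pt => 'a) => 'a sing_chain" where
 "subdiv_sing M p sig = sings sig (subdiv M (Suc p) (std p))"

definition track_sing :: "nat => nat => (pt => 'a) => 'a sing_chain" where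
 "track_sing M p sig = sings sig (track M (Suc p) (std p))"

lemma subdiv_simplex:
 assumes M: "0 < M" and l: "length l = q" "set l <= Sx p" "m : keys (subdiv M q l)"
 shows "set m <= Sx p & (ALL x:set m. ALL y:set m. l1 p x y <= real q*2/real M)"
 using subdiv_mesh[OF simplex_convex simplex_diam M l] by (auto simp: fine_in_def)

lemma track_simplex:
 assumes M: "0 < M" and l: "length l = q" "set l <= Sx p" "m : keys (track M q l)"
 shows "length m = Suc q & set m <= Sx p"
 by (rule track_keys[OF _ _ M l, where K=p and D=2]) (auto intro: simplex_convex simplex_diam)

lemma face_aff:
 assumes "set l <= Sx p" "y : Sx (length l - 1)" "l ~= []"
 shows "sig (face_map i (aff l y)) = face (Suc p) i sig (aff l y)"
 using aff_simplex[OF assms(1), of "length l - 1" y] assms by (simp add: face_apply)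

lemma sum_sings_faces:
 "(SUM i<=Suc p. frag_cmul ((-1)^i) (sings (face (Suc p) i sig) c)) = frag_extend (%tau. sings tau c) (sface (Suc p) sig)"
 by (simp add: sface_def frag_extend_sum frag_extend_cmul o_def del: sum.atMost_Suc)

lemma sbd_track_sing:
 assumes M: "0 < M" and ext: "!!x. x ~: Sx p ==> sig x = undefined"
 shows "sbd (Suc p) (track_sing M p sig) = frag_of sig - subdiv_sing M p sig - frag_extend (track_sing M (p - 1)) (sface p sig)"
proof -
 have "sbd (Suc p) (track_sing M p sig) = sings sig (BD (track M (Suc p) (std p)))"
  unfolding track_sing_def by (rule sbd_sings) (use track_simplex[OF M length_std set_std] in blast)
 also have "... = frag_of sig - subdiv_sing M p sig - sings sig (frag_extend (track M p) (bd (std p)))"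
  using BD_track[of "std p" p M] sing_std[OF ext] by (simp add: sings_diff subdiv_sing_def del: track.simps subdiv.simps)
 also have "sings sig (frag_extend (track M p) (bd (std p))) = frag_extend (track_sing M (p - 1)) (sface p sig)"
 proof (cases p)
  case 0
  have "frag_extend (track M 0) (bd (std 0)) = 0" by (rule frag_extend_eq_0) simp
  thus ?thesis using 0 by (simp add: sface_def)
 next
  case (Suc q)
  have "sings sig (frag_extend (track M (Suc q)) (bd (std (Suc q)))) = (SUM i<=Suc q. frag_cmul ((-1)^i) (sings (face (Suc q) i sig) (track M (Suc q) (std q))))"
  proof (rule sings_bd_natural)
   fix i assume "i <= Suc q"
   show "track M (Suc q) (map (face_map i) (std q)) = lmap (face_map i) (track M (Suc q) (std q))"
    using track_natural[of "face_map i" "std q" "Suc q" M] face_map_linear by simp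
   fix l y assume l: "l : keys (track M (Suc q) (std q))" "y : Sx (length l - 1)"
   have "length l = Suc (Suc q)" "set l <= Sx q" using track_simplex[OF M length_std set_std l(1)] by auto
   thus "sig (face_map i (aff l y)) = face (Suc q) i sig (aff l y)" by (intro face_aff l(2)) auto
  qed
  also have "... = frag_extend (track_sing M q) (sface (Suc q) sig)" unfolding sum_sings_faces track_sing_def ..
  finally show ?thesis using Suc by simp
 qed
 finally show ?thesis .
qed

lemma sbd_zero: "sbd 0 c = 0"
 unfolding sbd_def by (rule frag_extend_eq_0) (simp add: sface_def)

lemma sbd_extend: "sbd p (frag_extend f c) = frag_extend (%x. sbd p (f x)) c"
 unfolding sbd_def by (rule frag_extend_extend)

lemma sbd_sbd:
 assumes ext: "!!sig x. sig : keys c ==> x ~: Sx (Suc p) ==> sig x = undefined"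
 shows "sbd p (sbd (Suc p) c) = 0"
proof (cases p)
 case 0 thus ?thesis by (simp add: sbd_zero)
next
 case (Suc q)
 have "sbd p (sface (Suc p) sig) = 0" if "sig : keys c" for sig
 proof -
  have sing: "sig = sing sig (std (Suc p))" using sing_std[of "Suc p" sig] ext[OF that] by simp
  have "sface (Suc p) (sing sig (std (Suc p))) = sings sig (bd (std (Suc p)))" by (rule sface_sing) (simp add: Suc)
  moreover have "sbd (Suc q) (sings sig (bd (std (Suc p)))) = sings sig (BD (bd (std (Suc p))))"
   by (rule sbd_sings) (use length_keys_bd[of "std (Suc p)" "Suc p"] Suc in simp)
  ultimately show ?thesis using sing Suc by simp
 qed
 moreover have "sbd p (sbd (Suc p) c) = frag_extend (%sig. sbd p (sface (Suc p) sig)) c"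
  unfolding sbd_def by (rule frag_extend_extend)
 ultimately show ?thesis by (simp add: frag_extend_eq_0)
qed

definition fmass :: "nat => 'a::metric_space sing_chain => ennreal" where
 "fmass k c = (SUM sig:keys c. ennreal (abs_coeff c sig) * simplex_volume k sig)"

lemma fmass_superset: "finite S ==> keys c <= S ==> fmass k c = (SUM sig:S. ennreal (abs_coeff c sig) * simplex_volume k sig)"
 unfolding fmass_def by (rule sum.mono_neutral_left) (auto simp: in_keys_iff)

lemma fmass_add: "fmass k (a + b) <= fmass k a + fmass k b"
proof -
 let ?S = "keys a Un keys b"
 have "fmass k (a + b) = (SUM sig:?S. ennreal (abs_coeff (a + b) sig) * simplex_volume k sig)"
  by (rule fmass_superset) (auto simp: Poly_Mapping.keys_add)
 also have "... <= (SUM sig:?S. ennreal (abs_coeff a sig) * simplex_volume k sig + ennreal (abs_coeff b sig) * simplex_volume k sig)"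
 proof (rule sum_mono)
  fix sig
  have "ennreal (abs_coeff (a + b) sig) <= ennreal (abs_coeff a sig + abs_coeff b sig)"
   by (intro ennreal_leI) (simp add: lookup_add)
  also have "... = ennreal (abs_coeff a sig) + ennreal (abs_coeff b sig)" by (rule ennreal_plus) auto
  finally show "ennreal (abs_coeff (a + b) sig) * simplex_volume k sig <= ennreal (abs_coeff a sig) * simplex_volume k sig + ennreal (abs_coeff b sig) * simplex_volume k sig"
   unfolding distrib_right[symmetric] by (rule mult_right_mono) simp
 qed
 also have "... = fmass k a + fmass k b" using fmass_superset[of ?S a] fmass_superset[of ?S b] by (simp add: sum.distrib)
 finally show ?thesis .
qed

lemma fmass_0 [simp]: "fmass k 0 = 0" and fmass_of [simp]: "fmass k (frag_of sig) = simplex_volume k sig"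
 by (simp_all add: fmass_def)

lemma fmass_minus [simp]: "fmass k (- a) = fmass k a"
 by (simp add: fmass_def)

lemma fmass_diff: "fmass k (a - b) <= fmass k a + fmass k b"
 using fmass_add[of k a "- b"] by simp

lemma fmass_sum: "fmass k (sum b I) <= (SUM i:I. fmass k (b i))"
proof (induction I rule: infinite_finite_induct)
 case (insert i I)
 thus ?case using fmass_add[of k "b i" "sum b I"] by (simp add: add_left_mono order_trans)
qed auto

lemma fmass_cmul: "fmass k (frag_cmul t a) <= ennreal (abs (real_of_int t)) * fmass k a"
proof (cases "t = 0")
 case False
 hence "keys (frag_cmul t a) = keys a" by auto
 hence "fmass k (frag_cmul t a) = (SUM sig:keys a. ennreal (abs (real_of_int t))*(ennreal (abs_coeff a sig) * simplex_volume k sig))"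
  unfolding fmass_def by (intro sum.cong) (auto simp: abs_mult ennreal_mult mult.assoc)
 thus ?thesis by (simp add: fmass_def sum_distrib_left)
qed simp

lemma fmass_bound:
 assumes "!!sig. sig : keys c ==> simplex_volume k sig <= ennreal B" "0 <= B"
 shows "fmass k c <= ennreal (B * nrm c)"
proof -
 have "fmass k c <= (SUM sig:keys c. ennreal (abs_coeff c sig * B))"
  unfolding fmass_def using assms by (intro sum_mono) (simp add: ennreal_mult mult_left_mono)
 also have "... = ennreal (SUM sig:keys c. abs_coeff c sig * B)" using assms(2) by (intro sum_ennreal) auto
 also have "(SUM sig:keys c. abs_coeff c sig * B) = B * nrm c" unfolding nrm_def sum_distrib_right[symmetric] by (rule mult.commute)
 finally show ?thesis .
qed

definition to_frag :: "((pt => 'a) => int) => 'a sing_chain" where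
 "to_frag c = Abs_poly_mapping c"

lemma lkp_to_frag: "finite (supp c) ==> lkp (to_frag c) = c"
 unfolding to_frag_def by (rule Abs_poly_mapping_inverse) (simp add: supp_def)

lemma supp_lkp: "supp (lkp c) = keys c"
 by (auto simp: supp_def in_keys_iff)

lemma boundary_lkp: "boundary (Suc k) (lkp c) = lkp (sbd (Suc k) c)"
proof
 fix tau
 have "lkp (sbd (Suc k) c) tau = (SUM sig:keys c. lkp c sig*(SUM i<=Suc k. (-1)^i*(if tau = face (Suc k) i sig then 1 else 0)))"
  unfolding sbd_def frag_extend_def sface_def by (simp add: lookup_sum del: sum.atMost_Suc)
 also have "... = (SUM sig:keys c. SUM i<=Suc k. if face (Suc k) i sig = tau then (-1)^i * lkp c sig else 0)"
  unfolding sum_distrib_left by (intro sum.cong refl) auto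
 finally show "boundary (Suc k) (lkp c) tau = lkp (sbd (Suc k) c) tau" unfolding boundary_def supp_lkp by simp
qed

lemma mass_lkp: "mass k (lkp c) = fmass k c"
 unfolding mass_def fmass_def supp_lkp by simp

lemma filling_volume_le:
 assumes "!!sig. sig : keys gam ==> lip_simplex S (Suc m) sig" "sbd (Suc m) gam = alp"
 shows "filling_volume S m (lkp alp) <= fmass (Suc m) gam"
 unfolding filling_volume_def
proof (rule Inf_lower, rule CollectI, intro exI conjI)
 show "fmass (Suc m) gam = mass (Suc m) (lkp gam)" by (simp add: mass_lkp)
 show "lip_chain S (Suc m) (lkp gam)" using assms(1) by (simp add: lip_chain_def supp_lkp)
 show "boundary (Suc m) (lkp gam) = lkp alp" using assms(2) by (simp add: boundary_lkp)
qed

section \<open>Pushed simplices\<close>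

definition restr :: "nat => (pt => 'a) => (pt => 'a)" where
 "restr k f = (%x. if x : Sx k then f x else undefined)"

definition push_map :: "'a::metric_space set => real => (nat => 'a) => nat => nat => pt => pt => 'a" where
 "push_map Z c z k M a p = lab_map Z c z (push_pt k M (reweight a p))"

lemma cell_vol_empty: "dcell k j q = {} ==> cell_vol k f j q = 0"
 by (simp add: cell_vol_def count_on_def)

context
 fixes a :: pt
 assumes a: "!!i. 1 <= a i & a i <= 2"
begin

lemma reweight_lip: "l1 M (reweight a p) (reweight a q) <= 2 * l1 M p q"
proof -
 have "abs (reweight a p i - reweight a q i) <= 2 * abs (p i - q i)" for i
 proof -
  have "abs (reweight a p i - reweight a q i) = a i * abs (p i - q i)"
   using a[of i] by (simp add: reweight_def right_diff_distrib[symmetric] abs_mult)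
  also have "... <= 2 * abs (p i - q i)" using a[of i] by (intro mult_right_mono) auto
  finally show ?thesis .
 qed
 thus ?thesis unfolding l1_def sum_distrib_left by (intro sum_mono)
qed

lemma support_pushed:
 assumes Y: "0 < gap k M (reweight a p)"
 shows "support (push_pt k M (reweight a p)) <= support p" "card (support (push_pt k M (reweight a p))) <= Suc k"
 using thresh_nonneg[of k M "reweight a p"] thresh_card[of M "reweight a p" k] unfolding push_pt_support[OF Y]
 by (auto simp: support_def above_set_def reweight_def)

context
 fixes Z :: "'a::metric_space set" and z :: "nat => 'a" and c :: real and n k :: nat
 assumes target: "lip_connected_const Z n c" and z_Z: "!!i. z i : Z" and k: "k <= Suc n"
begin

lemma push_map_in: "0 < gap k M (reweight a p) ==> push_map Z c z k M a p : Z"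
 unfolding push_map_def using support_pushed(2)[of k M p] k by (intro lab_map_in[OF target z_Z push_pt_simplex]) auto

lemma push_map_lip:
 assumes r: "0 < r" "r <= gap k M (reweight a p)" "r <= gap k M (reweight a q)"
  and s: "0 <= s" "!!i j. i : support p Un support q ==> j : support p Un support q ==> dist (z i) (z j) <= s"
 shows "dist (push_map Z c z k M a p) (push_map Z c z k M a q) <= (9 * lab_const c n + 1) * s*(2/r * real (2 * k + 3)*(2 * l1 M p q))"
proof -
 let ?p = "push_pt k M (reweight a p)" and ?q = "push_pt k M (reweight a q)"
 have pos: "0 < gap k M (reweight a p)" "0 < gap k M (reweight a q)" using r by linarith+
 have "dist (lab_map Z c z ?p) (lab_map Z c z ?q) <= (9 * lab_const c n + 1) * s * l1 M ?p ?q"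
 proof (rule lab_map_lip[OF target z_Z push_pt_simplex[OF pos(1)] push_pt_simplex[OF pos(2)] _ _ s(1)])
  show "card (support ?p) <= Suc (Suc n)" "card (support ?q) <= Suc (Suc n)"
   using support_pushed(2)[OF pos(1)] support_pushed(2)[OF pos(2)] k by simp_all
  fix i j assume "i : support ?p Un support ?q" "j : support ?p Un support ?q"
  thus "dist (z i) (z j) <= s" using support_pushed(1)[OF pos(1)] support_pushed(1)[OF pos(2)] by (intro s(2)) blast+
 qed
 also have "... <= (9 * lab_const c n + 1) * s*(2/r * real (2 * k + 3)*(2 * l1 M p q))"
 proof (rule mult_left_mono)
  have "l1 M ?p ?q <= 2/r * real (2 * k + 3) * l1 M (reweight a p) (reweight a q)" by (rule push_pt_lip[OF r])
  also have "... <= 2/r * real (2 * k + 3)*(2 * l1 M p q)" using r reweight_lip by (intro mult_left_mono) auto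
  finally show "l1 M ?p ?q <= 2/r * real (2 * k + 3)*(2 * l1 M p q)" .
 qed (use s lab_const_nonneg[of c n] in auto)
 finally show ?thesis by (simp add: push_map_def)
qed

end

end

definition nonempty_cells :: "nat => nat => (nat => nat) set" where
 "nonempty_cells k R = {q : grid k R. dcell k R q ~= {}}"

definition cell_point :: "nat => nat => (nat => nat) => pt" where
 "cell_point k R q = (SOME x. x : dcell k R q)"

lemma nonempty_cells: "finite (nonempty_cells k R)" "nonempty_cells k R <= grid k R"
 by (auto simp: nonempty_cells_def)

lemma cell_point: "q : nonempty_cells k R ==> cell_point k R q : dcell k R q"
 unfolding cell_point_def nonempty_cells_def by (metis (mono_tags, lifting) ex_in_conv mem_Collect_eq someI_ex)

lemma cell_point_simplex: "q : nonempty_cells k R ==> cell_point k R q : Sx k"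
 using cell_point dcell_sub by blast

lemma half_bounds:
 fixes y p e :: real
 assumes "e < y" shows "abs (y - p) <= e/2 ==> y/2 <= p" and "y/2 <= p ==> e/2 <= p"
 using assms by linarith+

lemma in_nonempty_cell: "x : Sx k ==> EX q:nonempty_cells k R. x : dcell k R q"
 using idx_in_grid[of x k R] by (intro bexI[of _ "idx k R x"]) (auto simp: nonempty_cells_def dcell_def)

definition margin :: "nat => real => real" where
 "margin k Lu = max 1 (8 * real k * real (2 * k + 3) * Lu)"

text \<open>A map \<open>u\<close> into a simplex with labelled vertices. The gauge \<open>d\<close> dominates the distances between nearby labels, weighted by \<open>u\<close>,
 and the cell weights \<open>V\<close> bound the volume of every map that is Lipschitz for \<open>d\<close>.\<close>

locale pushable =
 fixes z :: "nat => 'a::metric_space" and k M N :: nat and Lu \<eta> C1 :: real and u :: "pt => pt"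
  and d :: "pt => pt => real" and V :: "nat => (nat => nat) => ennreal" and V0 :: real
 assumes Lu_nonneg: "0 <= Lu" and C1_pos: "0 < C1" and V0_nonneg: "0 <= V0"
  and u_simplex: "!!x. x : Sx k ==> u x : Sx M"
  and u_card: "!!x. x : Sx k ==> card (support (u x)) <= N"
  and u_lip: "!!x y. x : Sx k ==> y : Sx k ==> l1 M (u x) (u y) <= Lu * l1 k x y"
  and labels_close: "!!x y. x : Sx k ==> y : Sx k ==> l1 k x y <= \<eta> ==>
   EX s>=0. (ALL i:support (u x) Un support (u y). ALL j:support (u x) Un support (u y). dist (z i) (z j) <= s) &
    s * l1 M (u x) (u y) <= C1 * d x y"
  and volume: "!!j q g L lmb. 0 < lmb ==> lipl k L (Sx k) (g :: pt => 'a) ==>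
   (!!x y. x : dcell k j q ==> y : dcell k j q ==> dist (g x) (g y) <= lmb * d x y) ==> cell_vol k g j q <= ennreal (lmb^k) * V j q"
  and V_sum: "!!j. (SUM q:grid k j. V j q) <= ennreal V0"
begin

lemma V_finite: "q : grid k R ==> V R q < top"
proof -
 assume "q : grid k R"
 hence "V R q <= (SUM q:grid k R. V R q)" by (intro member_le_sum) auto
 also have "... <= ennreal V0" by (rule V_sum)
 finally show ?thesis using ennreal_less_top le_less_trans by blast
qed

lemma sum_V: "(SUM q:nonempty_cells k R. enn2real (V R q)) <= V0"
proof -
 have "ennreal (SUM q:nonempty_cells k R. enn2real (V R q)) = (SUM q:nonempty_cells k R. ennreal (enn2real (V R q)))"
  by (rule sum_ennreal[symmetric]) simp
 also have "... = (SUM q:nonempty_cells k R. V R q)" using V_finite nonempty_cells(2) by (intro sum.cong) (auto simp: subset_iff)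
 also have "... <= (SUM q:grid k R. V R q)" using nonempty_cells by (intro sum_mono2) auto
 also have "... <= ennreal V0" by (rule V_sum)
 finally show ?thesis using V0_nonneg by (simp add: ennreal_le_iff)
qed

end

definition push_const :: "real => nat => nat => real => real" where
 "push_const c n k C1 = 8*(9 * lab_const c n + 1) * real (2 * k + 3) * C1"

context pushable
begin

context
 fixes Z :: "'a set" and n R :: nat and c :: real and a :: pt
 assumes target: "lip_connected_const Z n c" and z_Z: "!!i. z i : Z" and k_le: "k <= Suc n" and a: "!!i. 1 <= a i & a i <= 2"
  and fine: "2 * real k/2^R <= \<eta>"
  and clear: "!!q. q : nonempty_cells k R ==> margin k Lu/2^R < gap k M (reweight a (u (cell_point k R q)))"
begin

abbreviation depth :: "(nat => nat) => real" where
 "depth q == gap k M (reweight a (u (cell_point k R q)))"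

abbreviation pushed :: "pt => 'a" where
 "pushed == restr k (%x. push_map Z c z k M a (u x))"

lemma margin_pos: "0 < margin k Lu/2^R"
 by (simp add: margin_def)

lemma depth_pos: "q : nonempty_cells k R ==> 0 < depth q"
 using clear margin_pos less_trans by blast

lemma half_depth_le:
 assumes q: "q : nonempty_cells k R" and x: "x : dcell k R q"
 shows "depth q/2 <= gap k M (reweight a (u x))"
proof -
 let ?y = "cell_point k R q" and ?D = "real (2 * k + 3)"
 have xy: "x : Sx k" "?y : Sx k" using x dcell_sub cell_point_simplex[OF q] by blast+
 have "abs (depth q - gap k M (reweight a (u x))) <= ?D * l1 M (reweight a (u ?y)) (reweight a (u x))" by (rule gap_lip)
 also have "... <= ?D*(2*(Lu*(2 * real k/2^R)))"
 proof (rule mult_left_mono)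
  have "l1 M (reweight a (u ?y)) (reweight a (u x)) <= 2 * l1 M (u ?y) (u x)" by (rule reweight_lip[OF a])
  also have "... <= 2*(Lu * l1 k ?y x)" using u_lip xy by simp
  also have "... <= 2*(Lu*(2 * real k/2^R))" using dcell_diam[OF cell_point[OF q] x] Lu_nonneg by (intro mult_left_mono) auto
  finally show "l1 M (reweight a (u ?y)) (reweight a (u x)) <= 2*(Lu*(2 * real k/2^R))" .
 qed simp
 also have "... = (8 * real k*?D * Lu)/2^R/2" by simp
 also have "... <= margin k Lu/2^R/2" unfolding margin_def by (intro divide_right_mono) auto
 finally show ?thesis by (rule half_bounds(1)[OF clear[OF q]])
qed

lemma gap_ge: "x : Sx k ==> margin k Lu/2^R/2 <= gap k M (reweight a (u x))"
proof -
 assume x: "x : Sx k"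
 obtain q where q: "q : nonempty_cells k R" "x : dcell k R q" using in_nonempty_cell[OF x] by blast
 show ?thesis by (rule half_bounds(2)[OF clear[OF q(1)] half_depth_le[OF q]])
qed

lemma gap_pos: "x : Sx k ==> 0 < gap k M (reweight a (u x))"
 by (rule less_le_trans[OF _ gap_ge]) (use margin_pos in simp)

lemma pushed_lip: "EX L. lipl k L (Sx k) pushed"
proof -
 define D where "D = (SUM i<=M. SUM j<=M. dist (z i) (z j))"
 define r where "r = margin k Lu/2^R/2"
 let ?B = "9 * lab_const c n + 1"
 let ?L = "?B * D*(2/r * real (2 * k + 3)*(2 * Lu))"
 have D_nonneg: "0 <= D" unfolding D_def by (intro sum_nonneg) auto
 have D: "dist (z i) (z j) <= D" if "i <= M" "j <= M" for i j
 proof -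
  have "dist (z i) (z j) <= (SUM j<=M. dist (z i) (z j))" using that by (intro member_le_sum) auto
  also have "... <= D" unfolding D_def using that by (intro member_le_sum[of i _ "%i. SUM j<=M. dist (z i) (z j)"] sum_nonneg) auto
  finally show ?thesis .
 qed
 have r: "0 < r" using margin_pos by (simp add: r_def)
 have "lipl k ?L (Sx k) pushed"
 proof (rule liplI)
  show "0 <= ?L" using D_nonneg r Lu_nonneg lab_const_nonneg[of c n] by simp
  fix x y assume xy: "x : Sx k" "y : Sx k"
  have "dist (pushed x) (pushed y) = dist (push_map Z c z k M a (u x)) (push_map Z c z k M a (u y))" using xy by (simp add: restr_def)
  also have "... <= ?B * D*(2/r * real (2 * k + 3)*(2 * l1 M (u x) (u y)))"
  proof (rule push_map_lip[OF a target z_Z k_le r gap_ge[OF xy(1), folded r_def] gap_ge[OF xy(2), folded r_def] D_nonneg])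
   fix i j assume "i : support (u x) Un support (u y)" "j : support (u x) Un support (u y)"
   hence "i : {..M}" "j : {..M}" using support_simplex[OF u_simplex[OF xy(1)]] support_simplex[OF u_simplex[OF xy(2)]] by blast+
   thus "dist (z i) (z j) <= D" by (intro D) auto
  qed
  also have "... <= ?B * D*(2/r * real (2 * k + 3)*(2*(Lu * l1 k x y)))"
   using u_lip[OF xy] D_nonneg r lab_const_nonneg[of c n] by (intro mult_left_mono) auto
  also have "... = ?L * l1 k x y" by (simp only: mult_ac)
  finally show "dist (pushed x) (pushed y) <= ?L * l1 k x y" .
 qed
 thus ?thesis ..
qed

lemma pushed_lip_simplex: "lip_simplex Z k pushed"
proof -
 have "pushed x : Z" if "x : Sx k" for x using push_map_in[OF a target z_Z k_le gap_pos[OF that]] that by (simp add: restr_def)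
 thus ?thesis unfolding lip_simplex_iff using pushed_lip by (auto simp: restr_def)
qed

lemma pushed_cell_lip:
 assumes q: "q : nonempty_cells k R" and x: "x : dcell k R q" and y: "y : dcell k R q"
 shows "dist (pushed x) (pushed y) <= push_const c n k C1/depth q * d x y"
proof -
 define B where "B = (9 * lab_const c n + 1) * real (2 * k + 3)"
 let ?Y = "depth q"
 have xy: "x : Sx k" "y : Sx k" using x y dcell_sub by blast+
 have "l1 k x y <= \<eta>" using dcell_diam[OF x y] fine by linarith
 then obtain s where s: "0 <= s"
  "!!i j. i : support (u x) Un support (u y) ==> j : support (u x) Un support (u y) ==> dist (z i) (z j) <= s"
  "s * l1 M (u x) (u y) <= C1 * d x y" using labels_close[OF xy] by blast
 have Y: "0 < ?Y" "0 < ?Y/2" using depth_pos[OF q] by simp_all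
 have "dist (pushed x) (pushed y) = dist (push_map Z c z k M a (u x)) (push_map Z c z k M a (u y))" using xy by (simp add: restr_def)
 also have "... <= (9 * lab_const c n + 1) * s*(2/(?Y/2) * real (2 * k + 3)*(2 * l1 M (u x) (u y)))"
  by (rule push_map_lip[OF a target z_Z k_le Y(2) half_depth_le[OF q x] half_depth_le[OF q y] s(1) s(2)])
 also have "... = 8 * B/?Y*(s * l1 M (u x) (u y))" unfolding B_def by (simp add: mult.assoc mult.left_commute)
 also have "... <= 8 * B/?Y*(C1 * d x y)" using s(3) Y lab_const_nonneg[of c n] by (intro mult_left_mono) (auto simp: B_def)
 also have "... = push_const c n k C1/?Y * d x y" unfolding push_const_def B_def by (simp only: mult_ac times_divide_eq_left times_divide_eq_right)
 finally show ?thesis .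
qed

lemma pushed_volume:
 "simplex_volume k pushed <= ennreal (push_const c n k C1^k*(SUM q:nonempty_cells k R. enn2real (V R q)*(1/depth q^k)))"
 (is "_ <= ennreal (?K^k*?S)")
proof -
 have K: "0 < ?K" using C1_pos lab_const_nonneg[of c n] by (simp add: push_const_def add_nonneg_pos)
 obtain L where L: "lipl k L (Sx k) pushed" using pushed_lip by blast
 have "simplex_volume k pushed = (SUM q:grid k R. cell_vol k pushed R q)" by (rule simplex_volume_sum[OF L])
 also have "... = (SUM q:nonempty_cells k R. cell_vol k pushed R q)"
  by (intro sum.mono_neutral_right) (auto simp: nonempty_cells_def cell_vol_empty)
 also have "... <= (SUM q:nonempty_cells k R. ennreal (?K^k*(enn2real (V R q)*(1/depth q^k))))"
 proof (rule sum_mono)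
  fix q assume q: "q : nonempty_cells k R"
  have pos: "0 < ?K/depth q" using K depth_pos[OF q] by simp
  have "cell_vol k pushed R q <= ennreal ((?K/depth q)^k) * V R q" by (rule volume[OF pos L pushed_cell_lip[OF q]])
  also have "V R q = ennreal (enn2real (V R q))" using V_finite nonempty_cells(2) q by (auto simp: subset_iff)
  also have "ennreal ((?K/depth q)^k) * ennreal (enn2real (V R q)) = ennreal ((?K/depth q)^k * enn2real (V R q))"
   using pos by (intro ennreal_mult[symmetric]) auto
  finally show "cell_vol k pushed R q <= ennreal (?K^k*(enn2real (V R q)*(1/depth q^k)))" by (simp add: power_divide)
 qed
 also have "... = ennreal (SUM q:nonempty_cells k R. ?K^k*(enn2real (V R q)*(1/depth q^k)))"
  using K depth_pos by (intro sum_ennreal) (simp add: less_imp_le)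
 finally show ?thesis by (simp only: sum_distrib_left)
qed

end

end

definition family_const :: "real => nat => nat => nat => real => real" where
 "family_const c n k N C1 = push_const c n k C1^k*(2 * avg_const N k)"

locale pushable_family =
 fixes z :: "nat => 'a::metric_space" and k M N :: nat and Lu \<eta> C1 :: real and u :: "'i => pt => pt"
  and d :: "'i => pt => pt => real" and V :: "'i => nat => (nat => nat) => ennreal" and V0 :: "'i => real"
  and I :: "'i set" and co :: "'i => real" and Z :: "'a set" and n :: nat and c :: real
 assumes item: "!!i. i : I ==> pushable z k M N Lu \<eta> C1 (u i) (d i) (V i) (V0 i)"
  and finite_I: "finite I" and C1_nonneg: "0 <= C1" and co_nonneg: "!!i. i : I ==> 0 <= co i" and eta: "0 < \<eta>"
  and target: "lip_connected_const Z n c" and z_Z: "!!i. z i : Z" and k_le: "k <= Suc n"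
begin

definition cell_cost :: "pt => nat => 'i => real" where
 "cell_cost a R i = (SUM q:nonempty_cells k R. enn2real (V i R q)*(1/gap k M (reweight a (u i (cell_point k R q)))^k))"

lemma sum_cells: "(SUM e:I \<times> nonempty_cells k R. case e of (i, q) => f i q) = (SUM i:I. SUM q:nonempty_cells k R. f i q)"
 by (simp add: sum.cartesian_product)

lemma card_cells_le: "real (card (I \<times> nonempty_cells k R)) <= real (card I)*(2*2^R)^k"
proof -
 have "card (I \<times> nonempty_cells k R) <= card (I \<times> grid k R)"
  using finite_I nonempty_cells(2)[of k R] by (intro card_mono Sigma_mono) auto
 hence "real (card (I \<times> nonempty_cells k R)) <= real (card I*(2^R + 1)^k)" by (simp only: card_cartesian_product card_grid of_nat_mono)
 also have "... = real (card I)*(2^R + 1)^k" by (simp add: add.commute)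
 also have "... <= real (card I)*(2*2^R)^k" by (intro mult_left_mono power_mono) auto
 finally show ?thesis .
qed

lemma weights_exist:
 assumes small: "real (card I)*2^k * tie_const N k * margin k Lu^Suc k/2^R <= 1/4" and dlt: "0 < dlt"
 obtains a where "!!i. 1 <= a i & a i <= 2"
  "!!i q. i : I ==> q : nonempty_cells k R ==> margin k Lu/2^R < gap k M (reweight a (u i (cell_point k R q)))"
  "(SUM i:I. co i * cell_cost a R i)
 <= 2 * avg_const N k*((SUM i:I. co i * V0 i) + dlt)"
proof -
 let ?E = "I \<times> nonempty_cells k R" and ?X = "tie_const N k*(margin k Lu/2^R)^Suc k" and ?W = "(SUM i:I. co i * V0 i) + dlt"
 let ?u = "%(i, q). u i (cell_point k R q)" and ?w = "%(i, q). co i * enn2real (V i R q)"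
 have "0 <= ?X" using tie_const_nonneg[of N k] by (simp add: margin_def)
 hence "real (card ?E)*?X <= real (card I)*(2*2^R)^k*?X" using card_cells_le by (rule mult_right_mono[rotated])
 also have "... = real (card I)*2^k * tie_const N k * margin k Lu^Suc k/2^R" by (simp add: power_mult_distrib power_divide)
 finally have few: "real (card ?E)*?X <= 1/4" using small by linarith
 have "(SUM e:?E. ?w e) = (SUM i:I. co i*(SUM q:nonempty_cells k R. enn2real (V i R q)))" unfolding sum_cells sum_distrib_left ..
 also have "... <= (SUM i:I. co i * V0 i)" using co_nonneg pushable.sum_V[OF item] by (intro sum_mono mult_left_mono)
 finally have weight: "(SUM e:?E. ?w e) <= ?W" using dlt by linarith
 have W: "0 < ?W" using co_nonneg pushable.V0_nonneg[OF item] dlt by (intro add_nonneg_pos sum_nonneg) auto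
 have "EX a. (ALL i. 1 <= a i & a i <= 2) & (ALL e:?E. margin k Lu/2^R < gap k M (reweight a (?u e))) &
   (SUM e:?E. ?w e*(1/(gap k M (reweight a (?u e)))^k)) <= 2 * avg_const N k*?W"
 proof (rule average_select[OF _ _ _ _ weight W _ few])
  show "finite ?E" using finite_I nonempty_cells by simp
  show "1 <= margin k Lu" by (simp add: margin_def)
  fix e assume "e : ?E"
  then obtain i q where e: "e = (i, q)" "i : I" "q : nonempty_cells k R" by blast
  note x = cell_point_simplex[OF e(3)]
  show "?u e : Sx M" "card (support (?u e)) <= N" using pushable.u_simplex[OF item[OF e(2)] x] pushable.u_card[OF item[OF e(2)] x] e(1) by simp_all
  show "0 <= ?w e" using e co_nonneg by simp
 qed
 then obtain a where a: "!!i. 1 <= a i & a i <= 2" "!!e. e : ?E ==> margin k Lu/2^R < gap k M (reweight a (?u e))"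
  "(SUM e:?E. ?w e*(1/(gap k M (reweight a (?u e)))^k)) <= 2 * avg_const N k*?W" by blast
 have "(SUM e:?E. ?w e*(1/(gap k M (reweight a (?u e)))^k)) =
   (SUM i:I. co i * cell_cost a R i)"
  unfolding cell_cost_def sum_distrib_left by (simp add: sum.cartesian_product split_def mult.assoc)
 thus ?thesis using a by (intro that[of a]) auto
qed

theorem pushed_family:
 assumes dlt: "0 < dlt"
 obtains a where "!!i. 1 <= a i & a i <= 2" "!!i. i : I ==> lip_simplex Z k (restr k (%x. push_map Z c z k M a (u i x)))"
  "(SUM i:I. ennreal (co i) * simplex_volume k (restr k (%x. push_map Z c z k M a (u i x))))
    <= ennreal (family_const c n k N C1*((SUM i:I. co i * V0 i) + dlt))"
proof -
 define X where "X = real (card I)*2^k * tie_const N k * margin k Lu^Suc k"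
 obtain R :: nat where R: "max (2 * real k/\<eta>) (4 * X) < 2^R" using real_arch_pow[of 2 "max (2 * real k/\<eta>) (4 * X)"] by auto
 hence fine: "2 * real k/2^R <= \<eta>" and small: "X/2^R <= 1/4" using eta by (simp_all add: field_simps)
 obtain a where a: "!!i. 1 <= a i & a i <= 2"
  and clear: "!!i q. i : I ==> q : nonempty_cells k R ==> margin k Lu/2^R < gap k M (reweight a (u i (cell_point k R q)))"
  and total: "(SUM i:I. co i * cell_cost a R i)
    <= 2 * avg_const N k*((SUM i:I. co i * V0 i) + dlt)"
  using weights_exist[OF small[unfolded X_def] dlt] by blast
 let ?G = "%i. restr k (%x. push_map Z c z k M a (u i x))" and ?K = "push_const c n k C1^k"
 have simplex: "lip_simplex Z k (?G i)" if i: "i : I" for i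
  by (rule pushable.pushed_lip_simplex[OF item[OF i] target z_Z k_le a fine clear[OF i]])
 have vol: "simplex_volume k (?G i) <= ennreal (?K * cell_cost a R i)" if i: "i : I" for i
  unfolding cell_cost_def by (rule pushable.pushed_volume[OF item[OF i] target z_Z k_le a fine clear[OF i]])
 have K: "0 <= ?K" using C1_nonneg lab_const_nonneg[of c n] by (simp add: push_const_def)
 have S: "0 <= cell_cost a R i" for i unfolding cell_cost_def by (intro sum_nonneg mult_nonneg_nonneg) (auto simp: gap_nonneg)
 have "(SUM i:I. ennreal (co i) * simplex_volume k (?G i)) <= (SUM i:I. ennreal (co i) * ennreal (?K * cell_cost a R i))"
  by (intro sum_mono mult_left_mono vol) auto
 also have "... = ennreal (SUM i:I. co i*(?K * cell_cost a R i))"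
  using co_nonneg K S by (subst sum_ennreal[symmetric]) (auto simp: ennreal_mult intro!: sum.cong)
 also have "(SUM i:I. co i*(?K * cell_cost a R i)) = ?K*(SUM i:I. co i * cell_cost a R i)"
  by (subst sum_distrib_left) (intro sum.cong refl, rule mult.left_commute)
 also have "ennreal ... <= ennreal (?K*(2 * avg_const N k*((SUM i:I. co i * V0 i) + dlt)))"
  by (intro ennreal_leI mult_left_mono total K)
 finally have "(SUM i:I. ennreal (co i) * simplex_volume k (?G i)) <= ennreal (family_const c n k N C1*((SUM i:I. co i * V0 i) + dlt))"
  by (simp add: family_const_def mult.assoc)
 thus ?thesis using a simplex by (intro that[of a])
qed

end

lemma sface_0 [simp]: "sface 0 sig = 0"
 by (simp add: sface_def)

lemma frag_extend_sface:
 "frag_extend f (sface (Suc p) sig) = (SUM i<=Suc p. frag_cmul ((-1)^i) (f (face (Suc p) i sig)))"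
 by (simp add: sface_def frag_extend_sum frag_extend_cmul o_def del: sum.atMost_Suc)

lemma sface_Suc: "sface (Suc p) sig = (SUM i<=Suc p. frag_cmul ((-1)^i) (frag_of (face (Suc p) i sig)))"
 by (simp add: sface_def del: sum.atMost_Suc)

lemma keys_sface: "tau : keys (sface (Suc p) sig) ==> EX i<=Suc p. tau = face (Suc p) i sig"
proof -
 assume "tau : keys (sface (Suc p) sig)"
 hence "tau : (UN i:{..Suc p}. keys (frag_cmul ((-1)^i) (frag_of (face (Suc p) i sig))))"
  unfolding sface_Suc using keys_sum[of "%i. frag_cmul ((-1)^i) (frag_of (face (Suc p) i sig))" "{..Suc p}"] by blast
 then obtain i where i: "i <= Suc p" "tau : keys (frag_cmul ((-1)^i) (frag_of (face (Suc p) i sig)))" by blast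
 hence "tau : keys (frag_of (face (Suc p) i sig))" using keys_cmul by blast
 thus ?thesis using i(1) by auto
qed

lemma nrm_sface: "nrm (sface p sig) <= real (Suc p)"
proof (cases p)
 case (Suc q)
 have "nrm (sface (Suc q) sig) <= (SUM i<=Suc q. nrm (frag_cmul ((-1)^i) (frag_of (face (Suc q) i sig))))" unfolding sface_Suc by (rule nrm_sum)
 also have "... = real (Suc (Suc q))" by (simp add: nrm_cmul del: sum.atMost_Suc)
 finally show ?thesis using Suc by simp
qed simp

lemma sbd_natural:
 assumes "!!sig i. sig : keys c ==> i <= Suc p ==> face (Suc p) i (Q1 sig) = Q0 (face (Suc p) i sig)"
 shows "sbd (Suc p) (frag_extend (%sig. frag_of (Q1 sig)) c) = frag_extend (%sig. frag_of (Q0 sig)) (sbd (Suc p) c)"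
proof -
 have "sbd (Suc p) (frag_extend (%sig. frag_of (Q1 sig)) c) = frag_extend (%sig. sface (Suc p) (Q1 sig)) c"
  unfolding sbd_def frag_extend_extend by simp
 also have "... = frag_extend (%sig. frag_extend (%sig. frag_of (Q0 sig)) (sface (Suc p) sig)) c"
 proof (rule frag_extend_eq)
  fix sig assume "sig : keys c"
  thus "sface (Suc p) (Q1 sig) = frag_extend (%sig. frag_of (Q0 sig)) (sface (Suc p) sig)"
   unfolding frag_extend_sface sface_Suc[of p "Q1 sig"] by (intro sum.cong refl) (simp add: assms)
 qed
 also have "... = frag_extend (%sig. frag_of (Q0 sig)) (sbd (Suc p) c)" unfolding sbd_def frag_extend_extend ..
 finally show ?thesis .
qed

lemma face_restr:
 assumes "i <= Suc p" shows "face (Suc p) i (restr (Suc p) f) = restr p (%x. f (face_map i x))"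
proof
 fix x show "face (Suc p) i (restr (Suc p) f) x = restr p (%x. f (face_map i x)) x"
  using face_map_simplex[OF _ assms, of x] by (cases "x : Sx p") (auto simp: face_apply face_outside restr_def)
qed

section \<open>Homotopies made of cones\<close>

definition lip_within :: "'a::metric_space set => nat => real => 'a => (pt => 'a) => bool" where
 "lip_within Z p L z tau = (lip_simplex Z p tau & lipl p L (Sx p) tau & (ALL x:Sx p. dist (tau x) z <= L))"

lemma lip_within_shift:
 assumes "lip_within Z p L z tau" "dist z z' <= r" "0 <= r" shows "lip_within Z p (L + r) z' tau"
proof -
 have "dist (tau x) z' <= L + r" if "x : Sx p" for x
  using assms(1,2) that dist_triangle[of "tau x" z' z] by (fastforce simp: lip_within_def)
 thus ?thesis using assms lipl_mono[OF _ order_refl, of p L "Sx p" tau "L + r"] by (simp add: lip_within_def)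
qed

lemma lip_within_mono: "lip_within Z p L z tau ==> L <= L' ==> lip_within Z p L' z tau"
 using lip_within_shift[of Z p L z tau z "L' - L"] by simp

lemma simplex_image_diam:
 assumes L: "lipl p L (Sx p) rho" and x: "x : Sx p" and y: "y : Sx p" shows "dist (rho x) (rho y) <= 2 * L"
proof -
 have "dist (rho x) (rho y) <= L * l1 p x y" by (rule lipl_dist[OF L x y])
 also have "... <= L*2" using simplex_diam[OF x y] lipl_nonneg[OF L] by (intro mult_left_mono)
 finally show ?thesis by simp
qed

lemma lip_within_vertex: "lip_simplex Z p rho ==> lipl p L (Sx p) rho ==> lip_within Z p (2 * L) (rho (vtx 0)) rho"
 using simplex_image_diam[of p L rho] lipl_nonneg[of p L "Sx p" rho] vtx_simplex[of 0 p]
 by (auto simp: lip_within_def intro: lipl_mono[OF _ order_refl])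

definition cone_chain :: "'a::metric_space set => real => 'a => nat => 'a sing_chain => 'a sing_chain" where
 "cone_chain Z c z p = frag_extend (%tau. frag_of (coneS Z c z p tau))"

lemma nrm_cone_chain: "nrm (cone_chain Z c z p E) <= nrm E"
 unfolding cone_chain_def using nrm_extend[of E "%tau. frag_of (coneS Z c z p tau)" 1] by simp

context
 fixes Z :: "'a::metric_space set" and n :: nat and c :: real and z :: 'a
 assumes target: "lip_connected_const Z n c" and z: "z : Z"
begin

lemma sbd_cone_chain:
 assumes q: "Suc q <= n" and E: "!!tau. tau : keys E ==> lip_simplex Z (Suc q) tau"
 shows "sbd (Suc (Suc q)) (cone_chain Z c z (Suc q) E) = E - cone_chain Z c z q (sbd (Suc q) E)"
proof -
 have faces: "sface (Suc (Suc q)) (coneS Z c z (Suc q) tau) = frag_of tau - cone_chain Z c z q (sface (Suc q) tau)" if t: "tau : keys E" for tau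
 proof -
  have "sface (Suc (Suc q)) (coneS Z c z (Suc q) tau) = frag_of (face (Suc (Suc q)) 0 (coneS Z c z (Suc q) tau)) +
    (SUM i<=Suc q. frag_cmul ((-1)^Suc i) (frag_of (face (Suc (Suc q)) (Suc i) (coneS Z c z (Suc q) tau))))"
   unfolding sface_Suc by (subst sum.atMost_Suc_shift) simp
  also have "... = frag_of tau + (SUM i<=Suc q. - frag_cmul ((-1)^i) (frag_of (coneS Z c z q (face (Suc q) i tau))))"
   using cone_face_0[OF target z q E[OF t]] cone_face_Suc[OF target z q E[OF t]]
   by (intro arg_cong2[of _ _ _ _ "(+)"] sum.cong refl) simp_all
  also have "... = frag_of tau - cone_chain Z c z q (sface (Suc q) tau)" unfolding cone_chain_def frag_extend_sface sum_negf by simp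
  finally show ?thesis .
 qed
 have "sbd (Suc (Suc q)) (cone_chain Z c z (Suc q) E) = frag_extend (%tau. sface (Suc (Suc q)) (coneS Z c z (Suc q) tau)) E"
  unfolding sbd_def cone_chain_def frag_extend_extend by simp
 also have "... = frag_extend (%tau. frag_of tau - cone_chain Z c z q (sface (Suc q) tau)) E" by (rule frag_extend_eq) (rule faces)
 also have "... = E - cone_chain Z c z q (sbd (Suc q) E)"
  unfolding frag_extend_fun_diff frag_extend_id cone_chain_def sbd_def frag_extend_extend ..
 finally show ?thesis .
qed

lemma sbd_cone_chain_0:
 assumes "lip_simplex Z 0 tau" "lip_simplex Z 0 tau'"
 shows "sbd (Suc 0) (cone_chain Z c z 0 (frag_of tau - frag_of tau')) = frag_of tau - frag_of tau'"
proof -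
 have "sface (Suc 0) (coneS Z c z 0 tau) = frag_of tau - frag_of (constS z)" if "lip_simplex Z 0 tau" for tau
  unfolding sface_Suc using cone_face_0[OF target z le0 that] cone_face_const[OF target z that] by simp
 thus ?thesis using assms by (simp add: cone_chain_def frag_extend_diff sbd_diff)
qed

lemma cone_chain_within:
 assumes p: "p <= n" and L: "0 <= L" and E: "!!tau. tau : keys E ==> lip_within Z p L z tau" and t: "tau' : keys (cone_chain Z c z p E)"
 shows "lip_within Z (Suc p) ((2 * cone_const c p + 1) * L) z tau'"
proof -
 obtain tau where tau: "tau : keys E" "tau' = coneS Z c z p tau"
  using t keys_frag_extend[of "%tau. frag_of (coneS Z c z p tau)" E] unfolding cone_chain_def by auto
 have within: "lip_simplex Z p tau" "lipl p L (Sx p) tau" "!!x. x : Sx p ==> dist (tau x) z <= L"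
  using E[OF tau(1)] by (simp_all add: lip_within_def)
 have cc: "0 <= cone_const c p" by (rule cone_const_nonneg)
 have simplex: "lip_simplex Z (Suc p) tau'" unfolding tau(2) by (rule cone_lip_simplex[OF target z p within(1)])
 have lip: "lipl (Suc p) (cone_const c p * L) (Sx (Suc p)) tau'" unfolding tau(2) by (rule cone_lipl[OF target z p within])
 have "dist (tau' x) z <= (2 * cone_const c p + 1) * L" if x: "x : Sx (Suc p)" for x
 proof -
  let ?y = "face_map 0 (vtx 0)"
  have v: "vtx 0 : Sx p" by (simp add: vtx_simplex)
  have "tau' ?y = face (Suc p) 0 tau' (vtx 0)" by (rule face_apply[OF v, symmetric])
  hence "tau' ?y = tau (vtx 0)" unfolding tau(2) cone_face_0[OF target z p within(1)] .
  moreover have "dist (tau' x) (tau' ?y) <= 2*(cone_const c p * L)"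
   by (rule simplex_image_diam[OF lip x face_map_simplex[OF v]]) simp
  ultimately show ?thesis using dist_triangle[of "tau' x" z "tau (vtx 0)"] within(3)[OF v] by (simp add: distrib_right)
 qed
 moreover have "cone_const c p * L <= (2 * cone_const c p + 1) * L" using cc L by (intro mult_right_mono) auto
 hence "lipl (Suc p) ((2 * cone_const c p + 1) * L) (Sx (Suc p)) tau'" by (rule lipl_mono[OF lip order_refl])
 ultimately show ?thesis using simplex by (simp add: lip_within_def)
qed

end

text \<open>\<open>htpy Z c Q (Suc p)\<close> maps a \<open>p\<close>-simplex \<open>rho\<close> to a chain of dimension \<open>Suc p\<close> which connects \<open>rho\<close> to its approximation
 \<open>Q p rho\<close>.\<close>

primrec htpy :: "'a::metric_space set => real => (nat => (pt => 'a) => (pt => 'a)) => nat => (pt => 'a) => 'a sing_chain" where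
 "htpy Z c Q 0 rho = 0"
| "htpy Z c Q (Suc p) rho = cone_chain Z c (rho (vtx 0)) p (frag_of rho - frag_of (Q p rho) - frag_extend (htpy Z c Q p) (sface p rho))"

primrec htpy_lip :: "real => real => nat => real" where
 "htpy_lip c A 0 = 0"
| "htpy_lip c A (Suc p) = (2 * cone_const c p + 1)*(A + htpy_lip c A p)"

primrec htpy_size :: "nat => real" where
 "htpy_size 0 = 0"
| "htpy_size (Suc p) = 2 + htpy_size p * real (Suc p)"

lemma htpy_lip_nonneg: "0 <= A ==> 0 <= htpy_lip c A p"
 using cone_const_nonneg[of c] by (induction p) (auto intro!: mult_nonneg_nonneg add_nonneg_nonneg)

lemma htpy_size_nonneg: "0 <= htpy_size p"
 by (induction p) auto

locale simplicial_approximation =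
 fixes Z :: "'a::metric_space set" and n :: nat and c e A :: real and G :: "nat => (pt => 'a) => bool"
  and Q :: "nat => (pt => 'a) => (pt => 'a)"
 assumes target: "lip_connected_const Z n c" and e: "0 <= e" and A: "2 <= A"
  and G_simplex: "!!p rho. G p rho ==> lip_simplex Z p rho" and G_lip: "!!p rho. G p rho ==> lipl p e (Sx p) rho"
  and G_face: "!!p rho i. G (Suc p) rho ==> i <= Suc p ==> G p (face (Suc p) i rho)"
  and Q_within: "!!p rho. p <= n ==> G p rho ==> lip_within Z p (A * e) (rho (vtx 0)) (Q p rho)"
  and Q_face: "!!p rho i. G (Suc p) rho ==> i <= Suc p ==> face (Suc p) i (Q (Suc p) rho) = Q p (face (Suc p) i rho)"
begin

abbreviation H :: "nat => (pt => 'a) => 'a sing_chain" where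
 "H == htpy Z c Q"

definition error :: "nat => (pt => 'a) => 'a sing_chain" where
 "error p rho = frag_of rho - frag_of (Q p rho) - frag_extend (H p) (sface p rho)"

definition good_htpy :: "nat => (pt => 'a) => bool" where
 "good_htpy p rho = ((ALL tau:keys (H (Suc p) rho). lip_within Z (Suc p) (htpy_lip c A (Suc p) * e) (rho (vtx 0)) tau) &
  nrm (H (Suc p) rho) <= htpy_size (Suc p) & sbd (Suc p) (H (Suc p) rho) = error p rho)"

lemma htpy_Suc: "H (Suc p) rho = cone_chain Z c (rho (vtx 0)) p (error p rho)"
 by (simp add: error_def)

lemma base_point: "G p rho ==> rho (vtx 0) : Z"
 using G_simplex[of p rho] vtx_simplex[of 0 p] by (auto simp: lip_simplex_def)

lemma G_keys_sface: "G p rho ==> rho' : keys (sface p rho) ==> EX q i. p = Suc q & i <= p & rho' = face p i rho & G q rho'"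
 using keys_sface[of rho' "p - 1" rho] G_face[of "p - 1" rho] by (cases p) auto

context
 fixes p :: nat and rho :: "pt => 'a"
 assumes p: "p <= n" and rho: "G p rho" and IH: "!!q rho'. p = Suc q ==> G q rho' ==> good_htpy q rho'"
begin

lemma side_within:
 assumes tau: "tau : keys (frag_extend (H p) (sface p rho))"
 shows "lip_within Z p ((A + htpy_lip c A p) * e) (rho (vtx 0)) tau"
proof -
 obtain rho' where rho': "rho' : keys (sface p rho)" "tau : keys (H p rho')" using tau keys_frag_extend[of "H p" "sface p rho"] by blast
 then obtain q i where q: "p = Suc q" "i <= p" "rho' = face p i rho" "G q rho'" using G_keys_sface[OF rho] by blast
 have v: "vtx 0 : Sx q" "vtx 0 : Sx p" by (simp_all add: vtx_simplex)
 have "rho' (vtx 0) = rho (face_map i (vtx 0))" unfolding q(3) q(1) by (rule face_apply[OF v(1)])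
 moreover have "face_map i (vtx 0) : Sx p" using face_map_simplex[OF v(1)] q by simp
 ultimately have "dist (rho' (vtx 0)) (rho (vtx 0)) <= 2 * e" using simplex_image_diam[OF G_lip[OF rho] _ v(2)] by simp
 moreover have "lip_within Z p (htpy_lip c A p * e) (rho' (vtx 0)) tau" using IH[OF q(1,4)] rho'(2) q(1) by (auto simp: good_htpy_def)
 ultimately have "lip_within Z p (htpy_lip c A p * e + 2 * e) (rho (vtx 0)) tau" using e by (intro lip_within_shift) auto
 thus ?thesis using mult_right_mono[OF A e] by (rule_tac lip_within_mono) (auto simp: distrib_right)
qed

lemma error_within:
 assumes tau: "tau : keys (error p rho)"
 shows "lip_within Z p ((A + htpy_lip c A p) * e) (rho (vtx 0)) tau"
proof -
 let ?S = "frag_extend (H p) (sface p rho)"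
 have "0 <= htpy_lip c A p" using A by (intro htpy_lip_nonneg) simp
 hence le: "A * e <= (A + htpy_lip c A p) * e" using e by (intro mult_right_mono) auto
 moreover have "2 * e <= A * e" by (rule mult_right_mono[OF A e])
 ultimately have rho_within: "lip_within Z p ((A + htpy_lip c A p) * e) (rho (vtx 0)) rho"
  using lip_within_mono[OF lip_within_vertex[OF G_simplex[OF rho] G_lip[OF rho]]] by simp
 have "keys (error p rho) <= keys (frag_of rho - frag_of (Q p rho)) Un keys ?S" unfolding error_def by (rule keys_diff)
 moreover have "keys (frag_of rho - frag_of (Q p rho)) <= {rho, Q p rho}" using keys_diff[of "frag_of rho" "frag_of (Q p rho)"] by auto
 ultimately consider "tau = rho" | "tau = Q p rho" | "tau : keys ?S" using tau by blast
 thus ?thesis using rho_within lip_within_mono[OF Q_within[OF p rho] le] side_within by cases auto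
qed

lemma nrm_error: "nrm (error p rho) <= htpy_size (Suc p)"
proof -
 have "nrm (H p rho') <= htpy_size p" if "rho' : keys (sface p rho)" for rho'
  using G_keys_sface[OF rho that] IH by (auto simp: good_htpy_def)
 hence "nrm (frag_extend (H p) (sface p rho)) <= htpy_size p * nrm (sface p rho)" by (rule nrm_extend)
 also have "... <= htpy_size p * real (Suc p)" by (intro mult_left_mono nrm_sface htpy_size_nonneg)
 finally show ?thesis
  using nrm_diff[of "frag_of rho - frag_of (Q p rho)" "frag_extend (H p) (sface p rho)"] nrm_diff[of "frag_of rho" "frag_of (Q p rho)"]
  by (simp add: error_def del: of_nat_Suc)
qed

lemma error_cycle:
 assumes q: "p = Suc q" shows "sbd p (error p rho) = 0"
proof -
 have "sbd p (frag_extend (H p) (sface p rho)) = frag_extend (%rho'. sbd p (H p rho')) (sface p rho)"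
  by (rule sbd_extend)
 also have "... = frag_extend (error q) (sface p rho)"
  using G_keys_sface[OF rho] IH unfolding good_htpy_def q by (intro frag_extend_eq) blast
 also have "... = sface p rho - frag_extend (%rho'. frag_of (Q q rho')) (sface p rho) - frag_extend (H q) (sbd q (sface p rho))"
  unfolding error_def frag_extend_fun_diff frag_extend_id sbd_def frag_extend_extend ..
 also have "sbd q (sface p rho) = 0" using sbd_sbd[of "frag_of rho" q] G_simplex[OF rho] q by (simp add: lip_simplex_def)
 also have "frag_extend (%rho'. frag_of (Q q rho')) (sface p rho) = sface p (Q p rho)"
  unfolding q frag_extend_sface sface_Suc[of q "Q (Suc q) rho"] using Q_face[of q rho] rho q by (intro sum.cong refl) simp
 finally show ?thesis by (simp add: error_def sbd_diff)
qed

lemma sbd_htpy: "sbd (Suc p) (H (Suc p) rho) = error p rho"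
proof (cases p)
 case 0
 thus ?thesis unfolding htpy_Suc using sbd_cone_chain_0[OF target base_point[OF rho], of rho "Q 0 rho"] G_simplex[OF rho] Q_within[OF p rho]
  by (simp add: error_def lip_within_def)
next
 case (Suc q)
 have "lip_simplex Z p tau" if "tau : keys (error p rho)" for tau using error_within[OF that] by (simp add: lip_within_def)
 thus ?thesis unfolding htpy_Suc using sbd_cone_chain[OF target base_point[OF rho], of q "error p rho"] p error_cycle[OF Suc] Suc
  by (simp add: cone_chain_def)
qed

lemma good_htpy_step: "good_htpy p rho"
proof -
 have "0 <= (A + htpy_lip c A p) * e" using A e htpy_lip_nonneg[of A c p] by simp
 hence "lip_within Z (Suc p) (htpy_lip c A (Suc p) * e) (rho (vtx 0)) tau" if "tau : keys (H (Suc p) rho)" for tau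
  using cone_chain_within[OF target base_point[OF rho] p _ error_within that[unfolded htpy_Suc]] by (simp add: mult.assoc)
 moreover have "nrm (H (Suc p) rho) <= htpy_size (Suc p)" unfolding htpy_Suc by (rule order_trans[OF nrm_cone_chain nrm_error])
 ultimately show ?thesis using sbd_htpy unfolding good_htpy_def by blast
qed

end

lemma good_htpy: "p <= n ==> G p rho ==> good_htpy p rho"
proof (induction p arbitrary: rho)
 case 0 show ?case by (rule good_htpy_step[OF 0]) simp
next
 case (Suc p) show ?case by (rule good_htpy_step[OF Suc.prems]) (use Suc in auto)
qed

end

section \<open>Prisms and the vertex approximation\<close>

definition lift_top :: "nat => pt => pt" where
 "lift_top q x = x(q := 1)"

definition prism :: "nat => pt list_chain" where
 "prism m = pr (%x. x) (lift_top (Suc m)) (std m)"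

definition base :: "nat => pt => pt" where
 "base m w = w(Suc m := 0)"

text \<open>A point \<open>w\<close> of the prism has height \<open>w (Suc m)\<close>; \<open>blend\<close> is \<open>phi\<close> on the bottom and \<open>vertex_map\<close> on the top.\<close>

definition vertex_map :: "('a => nat) => nat => (pt => 'a) => pt => pt" where
 "vertex_map lab m rho x = (%i. SUM j<=m. x j * of_bool (lab (rho (vtx j)) = i))"

definition blend :: "('a => pt) => ('a => nat) => nat => (pt => 'a) => pt => pt" where
 "blend phi lab m rho w = seg (phi (rho (base m w))) (vertex_map lab m rho (base m w)) (w (Suc m))"

definition prism_chain :: "(pt => 'b) => ('a => pt) => ('a => nat) => nat => (pt => 'a) => 'b sing_chain" where
 "prism_chain F phi lab m rho = sings (%w. F (blend phi lab m rho w)) (prism m)"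

definition point_push :: "(pt => 'b) => ('a => pt) => nat => (pt => 'a) => (pt => 'b)" where
 "point_push F phi m rho = restr m (%x. F (phi (rho x)))"

definition vertex_push :: "(pt => 'b) => ('a => nat) => nat => (pt => 'a) => (pt => 'b)" where
 "vertex_push F lab m rho = restr m (%x. F (vertex_map lab m rho x))"

lemma face_map_lift_top: "i <= q ==> face_map i (lift_top q x) = lift_top (Suc q) (face_map i x)"
 by (rule ext) (auto simp: face_map_def lift_top_def)

lemma base_simplex: "x : Sx m ==> base m x = x"
 by (auto simp: base_def simplex_k_def)

lemma base_lift_top: "base m (lift_top (Suc m) x) = base m x"
 by (simp add: base_def lift_top_def)

lemma l1_base: "l1 m (base m w) (base m w') = l1 m w w'"
 by (simp add: base_def l1_def)

lemma prism_keys: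
 assumes "l : keys (prism m)"
 shows "length l = Suc (Suc m)" "e : set l ==> base m e : Sx m & 0 <= e (Suc m) & e (Suc m) <= 1"
proof -
 have l: "length l = Suc (length (std m)) & set l <= (%x. x) ` set (std m) Un lift_top (Suc m) ` set (std m)"
  using keys_pr assms unfolding prism_def by blast
 thus "length l = Suc (Suc m)" by simp
 assume "e : set l"
 then obtain x where x: "x : set (std m)" "e = x | e = lift_top (Suc m) x" using l by blast
 have "x : Sx m" using x(1) set_std by blast
 thus "base m e : Sx m & 0 <= e (Suc m) & e (Suc m) <= 1"
  using x(2) base_simplex[of x m] base_lift_top[of m x] by (auto simp: lift_top_def simplex_k_def)
qed

lemma prism_aff:
 assumes l: "l : keys (prism m)" and y: "y : Sx (Suc m)"
 shows "base m (aff l y) : Sx m & 0 <= aff l y (Suc m) & aff l y (Suc m) <= 1"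
proof -
 note len = prism_keys(1)[OF l] and el = prism_keys(2)[OF l]
 have "aff (map (base m) l) y : Sx m" using el len by (intro aff_simplex[OF _ _ y]) auto
 moreover have "aff (map (base m) l) y = base m (aff l y)" by (rule ext) (simp add: aff_def base_def)
 moreover have height: "0 <= (l ! j) (Suc m) & (l ! j) (Suc m) <= 1" if "j < Suc (Suc m)" for j using el[of "l ! j"] len that by simp
 have y0: "0 <= y j" for j by (rule simplex_nonneg[OF y])
 have "0 <= aff l y (Suc m)" unfolding aff_def len using height y0 by (intro sum_nonneg mult_nonneg_nonneg) auto
 moreover have "aff l y (Suc m) <= (SUM j<Suc (Suc m). y j*1)" unfolding aff_def len using height y0 by (intro sum_mono mult_left_mono) auto
 moreover have "(SUM j<Suc (Suc m). y j*1) = 1" using y by (simp add: simplex_k_def lessThan_Suc_atMost del: sum.lessThan_Suc sum.atMost_Suc)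
 ultimately show ?thesis by simp
qed

lemma prism_diam:
 assumes l: "l : keys (prism m)" and e: "e : set l" "e' : set l"
 shows "l1 (Suc m) e e' <= 3"
proof -
 note vertices = prism_keys(2)[OF l e(1)] prism_keys(2)[OF l e(2)]
 have "l1 m (base m e) (base m e') <= 2" using vertices by (intro simplex_diam) auto
 moreover have "abs (e (Suc m) - e' (Suc m)) <= 1" using vertices by auto
 ultimately show ?thesis unfolding l1_base by (simp add: l1_def)
qed

lemma vertex_map_face:
 assumes i: "i <= Suc p"
 shows "vertex_map lab (Suc p) rho (face_map i x) = vertex_map lab p (face (Suc p) i rho) x"
proof
 fix t
 have "vertex_map lab (Suc p) rho (face_map i x) t = face_map i x i * of_bool (lab (rho (vtx i)) = t) +
   (SUM j<=p. face_map i x (if j < i then j else Suc j) * of_bool (lab (rho (vtx (if j < i then j else Suc j))) = t))"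
  unfolding vertex_map_def by (rule sum_remove_index[OF i])
 also have "... = (SUM j<=p. x j * of_bool (lab (face (Suc p) i rho (vtx j)) = t))"
  by (simp only: face_map_index face_map_zero mult_zero_left add_0_left)
   (intro sum.cong refl, simp only: face_apply vtx_simplex atMost_iff face_map_vtx)
 finally show "vertex_map lab (Suc p) rho (face_map i x) t = vertex_map lab p (face (Suc p) i rho) x t" by (simp only: vertex_map_def)
qed

lemma blend_face:
 assumes i: "i <= Suc p" and w: "base p w : Sx p"
 shows "blend phi lab (Suc p) rho (face_map i w) = blend phi lab p (face (Suc p) i rho) w"
proof -
 have "face_map i w (Suc (Suc p)) = w (Suc p)" using i by (simp add: face_map_def)
 moreover have "base (Suc p) (face_map i w) = face_map i (base p w)" using i by (intro ext) (auto simp: base_def face_map_def)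
 ultimately show ?thesis by (simp only: blend_def vertex_map_face[OF i] face_apply[OF w])
qed

lemma vertex_push_face:
 "i <= Suc p ==> face (Suc p) i (vertex_push F lab (Suc p) rho) = vertex_push F lab p (face (Suc p) i rho)"
 by (simp add: vertex_push_def face_restr vertex_map_face)

lemma point_push_face: "i <= Suc p ==> face (Suc p) i (point_push F phi (Suc p) rho) = point_push F phi p (face (Suc p) i rho)"
 by (simp add: point_push_def face_restr) (rule ext, simp add: restr_def face_apply)

lemma sing_eq_restr: "length l = Suc q ==> sing f l = restr q (%x. f (aff l x))"
 by (simp add: sing_def restr_def)

lemma prism_bottom: "sing (%w. F (blend phi lab m rho w)) (std m) = point_push F phi m rho"
proof
 fix y
 have "blend phi lab m rho (aff (std m) y) = phi (rho y)" if y: "y : Sx m"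
  using y unfolding aff_std[OF y] blend_def base_simplex[OF y] by (simp add: simplex_k_def)
 thus "sing (%w. F (blend phi lab m rho w)) (std m) y = point_push F phi m rho y" by (simp add: sing_def point_push_def restr_def)
qed

lemma aff_lift_top:
 assumes y: "y : Sx m" shows "aff (map (lift_top (Suc m)) (std m)) y = lift_top (Suc m) y"
proof
 fix t show "aff (map (lift_top (Suc m)) (std m)) y t = lift_top (Suc m) y t"
 proof (cases "t = Suc m")
  case True
  have "aff (map (lift_top (Suc m)) (std m)) y t = (SUM j<Suc m. y j)"
   unfolding aff_def using True by (simp add: lift_top_def del: sum.lessThan_Suc)
  thus ?thesis using y True by (simp add: lift_top_def simplex_k_def lessThan_Suc_atMost del: sum.lessThan_Suc sum.atMost_Suc)
 next
  case False
  have "aff (map (lift_top (Suc m)) (std m)) y t = aff (std m) y t"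
   unfolding aff_def using False by (simp add: lift_top_def del: sum.lessThan_Suc)
  thus ?thesis using aff_std[OF y] False by (simp add: lift_top_def)
 qed
qed

lemma prism_top: "sing (%w. F (blend phi lab m rho w)) (map (lift_top (Suc m)) (std m)) = vertex_push F lab m rho"
proof
 fix y
 have "blend phi lab m rho (lift_top (Suc m) y) = vertex_map lab m rho y" if "y : Sx m"
  using base_simplex[OF that] by (simp add: blend_def base_lift_top) (simp add: lift_top_def)
 thus "sing (%w. F (blend phi lab m rho w)) (map (lift_top (Suc m)) (std m)) y = vertex_push F lab m rho y"
  by (simp add: sing_def vertex_push_def restr_def aff_lift_top)
qed

lemma prism_sides:
 "sings (%w. F (blend phi lab m rho w)) (PR (%x. x) (lift_top (Suc m)) (bd (std m))) = frag_extend (prism_chain F phi lab (m - 1)) (sface m rho)"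
proof (cases m)
 case 0
 have "bd (std 0) = frag_of []" by (simp add: std_def)
 thus ?thesis using 0 by simp
next
 case (Suc p)
 have "sings (%w. F (blend phi lab m rho w)) (PR (%x. x) (lift_top (Suc m)) (bd (std m)))
   = (SUM i<=Suc p. frag_cmul ((-1)^i) (sings (%w. F (blend phi lab p (face (Suc p) i rho) w)) (prism p)))"
  unfolding PR_def Suc
 proof (rule sings_bd_natural)
  fix i assume i: "i <= Suc p"
  show "pr (%x. x) (lift_top (Suc (Suc p))) (map (face_map i) (std p)) = lmap (face_map i) (prism p)"
   unfolding prism_def pr_pre pr_map face_map_lift_top[OF i] ..
  fix l y assume l: "l : keys (prism p)" "y : Sx (length l - 1)"
  have "base p (aff l y) : Sx p" using prism_aff[OF l(1), of y] l(2) prism_keys(1)[OF l(1)] by simp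
  thus "F (blend phi lab (Suc p) rho (face_map i (aff l y))) = F (blend phi lab p (face (Suc p) i rho) (aff l y))"
   by (simp only: blend_face[OF i])
 qed
 thus ?thesis unfolding Suc diff_Suc_1 frag_extend_sface prism_chain_def .
qed

lemma sbd_prism_chain:
 "sbd (Suc m) (prism_chain F phi lab m rho) =
  frag_of (vertex_push F lab m rho) - frag_of (point_push F phi m rho) - frag_extend (prism_chain F phi lab (m - 1)) (sface m rho)"
proof -
 have "sbd (Suc m) (prism_chain F phi lab m rho) = sings (%w. F (blend phi lab m rho w)) (BD (prism m))"
  unfolding prism_chain_def by (rule sbd_sings) (rule prism_keys(1))
 thus ?thesis unfolding prism_def BD_pr by (simp add: sings_diff prism_top prism_bottom prism_sides)
qed

lemma gap_ge_1:
 assumes a: "!!i. 1 <= a i & a i <= (2::real)" and p: "p : Sx M" and card: "card (support p) <= Suc k"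
 shows "1 <= gap k M (reweight a p)"
proof -
 let ?b = "reweight a p"
 have "card (above_set M ?b 0) <= card (support p)"
  by (intro card_mono finite_support[OF p]) (auto simp: above_set_def reweight_def support_def)
 hence "thresh k M ?b <= 0" using card by (intro thresh_le) auto
 hence thresh: "thresh k M ?b = 0" using thresh_nonneg[of k M ?b] by linarith
 have "p i <= excess k M ?b i" if "i <= M" for i
 proof -
  have "1 * p i <= a i * p i" using a[of i] simplex_nonneg[OF p, of i] by (intro mult_right_mono) auto
  thus ?thesis using that thresh by (simp add: excess_def reweight_def)
 qed
 hence "(SUM i<=M. p i) <= gap k M ?b" unfolding gap_def by (intro sum_mono) auto
 thus ?thesis using p by (simp add: simplex_k_def)
qed

lemma vertex_map_simplex:
 assumes l: "!!j. j <= p ==> lab (rho (vtx j)) <= M" and x: "x : Sx p"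
 shows "vertex_map lab p rho x : Sx M"
 unfolding simplex_k_def
proof (intro CollectI conjI allI impI)
 show "vertex_map lab p rho x i = 0" if "i > M" for i
  unfolding vertex_map_def
 proof (intro sum.neutral ballI)
  fix j assume "j : {..p}"
  hence "lab (rho (vtx j)) ~= i" using l[of j] that by auto
  thus "x j * of_bool (lab (rho (vtx j)) = i) = 0" by simp
 qed
 show "0 <= vertex_map lab p rho x i" for i unfolding vertex_map_def using simplex_nonneg[OF x] by (intro sum_nonneg mult_nonneg_nonneg) auto
 have "(SUM i<=M. vertex_map lab p rho x i) = (SUM j<=p. SUM i<=M. x j * of_bool (lab (rho (vtx j)) = i))"
  unfolding vertex_map_def by (rule sum.swap)
 also have "... = (SUM j<=p. x j)"
 proof (rule sum.cong[OF refl])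
  fix j assume "j : {..p}"
  hence "lab (rho (vtx j)) : {..M}" using l by auto
  hence "(SUM i<=M. of_bool (lab (rho (vtx j)) = i)) = (1::real)" by (simp add: of_bool_def)
  thus "(SUM i<=M. x j * of_bool (lab (rho (vtx j)) = i)) = x j" by (simp only: sum_distrib_left[symmetric] mult_1_right)
 qed
 also have "... = 1" using x by (simp add: simplex_k_def)
 finally show "(SUM i<=M. vertex_map lab p rho x i) = 1" .
qed

lemma support_vertex_map: "support (vertex_map lab p rho x) <= (%j. lab (rho (vtx j))) ` {..p}"
proof
 fix i assume "i : support (vertex_map lab p rho x)"
 then obtain j where "j <= p" "x j * of_bool (lab (rho (vtx j)) = i) ~= 0"
  unfolding support_def vertex_map_def using sum.not_neutral_contains_not_neutral by (metis (mono_tags, lifting) atMost_iff mem_Collect_eq)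
 thus "i : (%j. lab (rho (vtx j))) ` {..p}" by auto
qed

lemma card_sup_vertex_map: "card (support (vertex_map lab p rho x)) <= Suc p"
proof -
 have "card (support (vertex_map lab p rho x)) <= card ((%j. lab (rho (vtx j))) ` {..p})" by (rule card_mono[OF _ support_vertex_map]) simp
 also have "... <= card {..p}" by (rule card_image_le) simp
 finally show ?thesis by simp
qed

lemma vertex_map_lip: "l1 M (vertex_map lab p rho x) (vertex_map lab p rho y) <= l1 p x y"
proof -
 have diff: "vertex_map lab p rho x i - vertex_map lab p rho y i = (SUM j<=p. (x j - y j) * of_bool (lab (rho (vtx j)) = i))" for i
  unfolding vertex_map_def sum_subtractf[symmetric] by (intro sum.cong refl) (simp add: left_diff_distrib)
 have "l1 M (vertex_map lab p rho x) (vertex_map lab p rho y) <= (SUM i<=M. SUM j<=p. abs (x j - y j) * of_bool (lab (rho (vtx j)) = i))"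
  unfolding l1_def diff by (intro sum_mono order_trans[OF sum_abs]) (simp add: abs_mult)
 also have "... = (SUM j<=p. abs (x j - y j)*(SUM i<=M. of_bool (lab (rho (vtx j)) = i)))" unfolding sum_distrib_left by (rule sum.swap)
 also have "... <= (SUM j<=p. abs (x j - y j)*1)"
 proof (intro sum_mono mult_left_mono)
  fix j show "(SUM i<=M. of_bool (lab (rho (vtx j)) = i)) <= (1::real)" by (simp add: of_bool_def)
 qed simp
 finally show ?thesis by (simp add: l1_def)
qed

lemma l1_seg_le:
 assumes t: "t : {0..1}"
 shows "l1 M (seg x y t) (seg x' y' t') <= l1 M x x' + l1 M y y' + abs (t - t') * l1 M x' y'"
proof -
 have "abs (seg x y t i - seg x' y' t' i) <= abs (x i - x' i) + abs (y i - y' i) + abs (t - t') * abs (x' i - y' i)" for i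
 proof -
  have diff: "seg x y t i - seg x' y' t' i = (1 - t)*(x i - x' i) + t*(y i - y' i) + (t' - t)*(x' i - y' i)" by (simp add: seg_def algebra_simps)
  have "abs (seg x y t i - seg x' y' t' i) <= abs ((1 - t)*(x i - x' i)) + abs (t*(y i - y' i)) + abs ((t' - t)*(x' i - y' i))"
   unfolding diff by (intro order_trans[OF abs_triangle_ineq] add_right_mono abs_triangle_ineq)
  also have "... <= abs (x i - x' i) + abs (y i - y' i) + abs (t - t') * abs (x' i - y' i)"
   using t by (intro add_mono) (simp_all add: abs_mult mult_left_le_one_le abs_minus_commute)
  finally show ?thesis .
 qed
 thus ?thesis unfolding l1_def sum_distrib_left sum.distrib[symmetric] by (intro sum_mono)
qed

lemma blend_lip:
 assumes w': "phi (rho (base m w')) : Sx M" "vertex_map lab m rho (base m w') : Sx M" and t: "0 <= w (Suc m)" "w (Suc m) <= 1"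
  and phi: "l1 M (phi (rho (base m w))) (phi (rho (base m w'))) <= D * l1 m w w'" and D: "0 <= D"
 shows "l1 M (blend phi lab m rho w) (blend phi lab m rho w') <= (D + 3) * l1 (Suc m) w w'"
proof -
 let ?h = "abs (w (Suc m) - w' (Suc m))" and ?psi = "%w. vertex_map lab m rho (base m w)"
 have "l1 M (blend phi lab m rho w) (blend phi lab m rho w')
   <= l1 M (phi (rho (base m w))) (phi (rho (base m w'))) + l1 M (?psi w) (?psi w') + ?h * l1 M (phi (rho (base m w'))) (?psi w')"
  unfolding blend_def using t by (intro l1_seg_le) auto
 also have "... <= D * l1 m w w' + l1 m w w' + ?h*2"
  using vertex_map_lip[of M lab m rho "base m w" "base m w'"] unfolding l1_base by (intro add_mono phi mult_left_mono simplex_diam w') auto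
 also have "... <= (D + 3) * l1 (Suc m) w w'" using D by (simp add: l1_def distrib_left distrib_right)
 finally show ?thesis .
qed

definition approx_const :: "real => nat => nat => real" where
 "approx_const c n k = (9 * lab_const c n + 1)*8 * real (2 * k + 3) + 4 * lab_const c n + 2"

lemma approx_const_ge2: "2 <= approx_const c n k"
 using lab_const_nonneg[of c n] by (simp add: approx_const_def)

definition fine_simplex :: "'a::metric_space set => real => 'a set => nat => (pt => 'a) => bool" where
 "fine_simplex Z eps P p rho = (lip_simplex Z p rho & lipl p eps (Sx p) rho & (ALL j<=p. rho (vtx j) : P))"

lemma fine_simplex_face:
 assumes rho: "fine_simplex Z eps P (Suc p) rho" and i: "i <= Suc p" shows "fine_simplex Z eps P p (face (Suc p) i rho)"
proof -
 have "face (Suc p) i rho (vtx j) : P" if "j <= p" for j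
 proof -
  have "face (Suc p) i rho (vtx j) = rho (vtx (if j < i then j else Suc j))"
   using face_apply[OF vtx_simplex[OF that], of i rho] by (simp only: face_map_vtx)
  thus ?thesis using rho that by (auto simp: fine_simplex_def)
 qed
 thus ?thesis using rho face_lip_simplex[OF _ i, of Z rho] face_lipl[OF _ i, of eps rho] by (simp add: fine_simplex_def)
qed

context coordinates
begin

context
 fixes n k p :: nat and c :: real and a :: pt and rho :: "pt => 'a"
 assumes target: "lip_connected_const Z n c" and k: "k <= Suc n" and a: "!!i. 1 <= a i & a i <= 2"
  and rho: "fine_simplex Z eps P p rho" and p: "p <= k"
begin

abbreviation psi :: "pt => pt" where
 "psi == vertex_map lab p rho"

abbreviation approx :: "pt => 'a" where
 "approx == vertex_push (push_map Z c z k M a) lab p rho"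

lemma rho_lip: "lipl p eps (Sx p) rho"
 using rho by (simp add: fine_simplex_def)

lemma psi_simplex: "x : Sx p ==> psi x : Sx M"
 using rho label(1) by (intro vertex_map_simplex) (auto simp: fine_simplex_def)

lemma psi_label: "i : support (psi x) ==> EX j<=p. z i = rho (vtx j)"
 using support_vertex_map[of lab p rho x] rho label(2) by (fastforce simp: fine_simplex_def)

lemma psi_labels_close: "i : support (psi x) Un support (psi y) ==> j : support (psi x) Un support (psi y) ==> dist (z i) (z j) <= 2 * eps"
 using psi_label simplex_image_diam[OF rho_lip] vtx_simplex by (metis Un_iff)

lemma gap_psi: "x : Sx p ==> 1 <= gap k M (reweight a (psi x))"
 using card_sup_vertex_map[of lab p rho x] p by (intro gap_ge_1[OF a psi_simplex]) auto

lemma approx_lip: "lipl p (approx_const c n k * eps) (Sx p) approx"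
proof (rule liplI)
 let ?F = "push_map Z c z k M a" and ?B = "9 * lab_const c n + 1" and ?D = "real (2 * k + 3)"
 show "0 <= approx_const c n k * eps" using approx_const_ge2[of c n k] eps by simp
 have B: "0 <= ?B" using lab_const_nonneg[of c n] by simp
 fix x y assume xy: "x : Sx p" "y : Sx p"
 have "dist (approx x) (approx y) = dist (?F (psi x)) (?F (psi y))" using xy by (simp add: vertex_push_def restr_def)
 also have "... <= ?B*(2 * eps)*(2/1*?D*(2 * l1 M (psi x) (psi y)))"
  using eps by (intro push_map_lip[OF a target z_Z k zero_less_one gap_psi[OF xy(1)] gap_psi[OF xy(2)] _ psi_labels_close]) auto
 also have "... <= ?B*(2 * eps)*(2/1*?D*(2 * l1 p x y))"
  using B eps vertex_map_lip[of M lab p rho x y] by (intro mult_left_mono) auto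
 also have "... = ?B*8*?D * eps * l1 p x y" by (simp add: algebra_simps)
 also have "... <= approx_const c n k * eps * l1 p x y"
  unfolding approx_const_def using lab_const_nonneg[of c n] eps by (intro mult_right_mono) auto
 finally show "dist (approx x) (approx y) <= approx_const c n k * eps * l1 p x y" .
qed

lemma approx_near:
 assumes x: "x : Sx p" shows "dist (approx x) (rho (vtx 0)) <= approx_const c n k * eps"
proof -
 let ?q = "push_pt k M (reweight a (psi x))"
 have pos: "0 < gap k M (reweight a (psi x))" using gap_psi[OF x] by linarith
 have q: "?q : Sx M" by (rule push_pt_simplex[OF pos])
 obtain i where i: "i : support ?q" using support_nonempty[OF q] by blast
 have sub: "support ?q <= support (psi x)" and "card (support ?q) <= Suc (Suc n)" using support_pushed[OF a pos] k by auto
 hence "dist (lab_map Z c z ?q) (z i) <= 2 * lab_const c n*(2 * eps)"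
  using eps by (intro lab_map_near[OF target z_Z q _ i]) (use psi_labels_close[of _ x x] in auto)
 moreover obtain j where "j <= p" "z i = rho (vtx j)" using psi_label i sub by blast
 hence "dist (z i) (rho (vtx 0)) <= 2 * eps" using simplex_image_diam[OF rho_lip vtx_simplex vtx_simplex] by simp
 moreover have "approx x = lab_map Z c z ?q" using x by (simp add: vertex_push_def restr_def push_map_def)
 ultimately have "dist (approx x) (rho (vtx 0)) <= (4 * lab_const c n + 2) * eps"
  using dist_triangle[of "lab_map Z c z ?q" "rho (vtx 0)" "z i"] by (simp add: distrib_right)
 also have "... <= approx_const c n k * eps" unfolding approx_const_def using lab_const_nonneg[of c n] eps by (intro mult_right_mono) auto
 finally show ?thesis .
qed

lemma approx_within: "lip_within Z p (approx_const c n k * eps) (rho (vtx 0)) approx"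
proof -
 have "approx x : Z" if x: "x : Sx p" for x
  using push_map_in[OF a target z_Z k, where p="psi x"] gap_psi[OF x] x by (simp add: vertex_push_def restr_def)
 hence "lip_simplex Z p approx" unfolding lip_simplex_iff using approx_lip by (auto simp: vertex_push_def restr_def)
 thus ?thesis using approx_lip approx_near by (simp add: lip_within_def)
qed

end

end

section \<open>Filling in the subspace\<close>

lemma fmass_extend_le:
 "fmass k (frag_extend f c) <= (SUM sig:keys c. ennreal (abs_coeff c sig) * fmass k (f sig))"
proof -
 have "fmass k (frag_extend f c) <= (SUM sig:keys c. fmass k (frag_cmul (lkp c sig) (f sig)))"
  unfolding frag_extend_def by (rule fmass_sum)
 also have "... <= (SUM sig:keys c. ennreal (abs_coeff c sig) * fmass k (f sig))" by (intro sum_mono fmass_cmul)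
 finally show ?thesis .
qed

lemma fmass_sings_le: "fmass k (sings f c) <= (SUM l:keys c. ennreal (abs_coeff c l) * simplex_volume k (sing f l))"
 using fmass_extend_le[of k "%l. frag_of (sing f l)" c] by (simp add: sings_def)

lemma common_lip_const:
 assumes fin: "finite S" and lip: "!!sig. sig : S ==> lip_simplex Y k sig"
 obtains L where "0 < L" "!!sig. sig : S ==> lipl k L (Sx k) sig"
proof -
 have "EX L. lipl k L (Sx k) sig" if "sig : S" for sig using lip[OF that] by (auto simp: lip_simplex_iff)
 then obtain Ls where Ls: "!!sig. sig : S ==> lipl k (Ls sig) (Sx k) sig" by metis
 have nonneg: "0 <= Ls sig" if "sig : S" for sig by (rule lipl_nonneg[OF Ls[OF that]])
 have "lipl k (sum Ls S + 1) (Sx k) sig" if sig: "sig : S" for sig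
 proof (rule lipl_mono[OF Ls[OF sig] order_refl])
  have "Ls sig <= sum Ls S" using sig nonneg fin by (intro member_le_sum) auto
  thus "Ls sig <= sum Ls S + 1" by simp
 qed
 moreover have "0 < sum Ls S + 1" using nonneg by (intro add_nonneg_pos sum_nonneg) auto
 ultimately show ?thesis using that by blast
qed

definition real_mass :: "nat => 'a::metric_space sing_chain => real" where
 "real_mass k c = (SUM sig:keys c. abs_coeff c sig * enn2real (simplex_volume k sig))"

lemma simplex_volume_finite: "lipl k L (Sx k) sig ==> simplex_volume k sig < top"
 using simplex_volume_lip ennreal_less_top le_less_trans by blast

lemma fmass_real_mass:
 assumes lip: "!!sig. sig : keys c ==> lip_simplex S k sig"
 shows "fmass k c = ennreal (real_mass k c)"
proof -
 have "simplex_volume k sig < top" if "sig : keys c" for sig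
  using lip[OF that] simplex_volume_finite by (auto simp: lip_simplex_iff)
 hence "fmass k c = (SUM sig:keys c. ennreal (abs_coeff c sig * enn2real (simplex_volume k sig)))"
  unfolding fmass_def by (intro sum.cong refl) (simp add: ennreal_mult)
 also have "... = ennreal (real_mass k c)" unfolding real_mass_def by (rule sum_ennreal) simp
 finally show ?thesis .
qed

lemma real_mass_nonneg: "0 <= real_mass k c"
 unfolding real_mass_def by (intro sum_nonneg) auto

lemma sum_cell_volumes_le:
 assumes e: "0 <= e"
 shows "(SUM q:grid k j. ennreal ((2 * real k * e/2^j)^k)) <= ennreal ((4 * real k * e)^k)"
proof -
 let ?t = "2 * real k * e/2^j"
 have t: "0 <= ?t" using e by simp
 have "(SUM q:grid k j. ennreal (?t^k)) = ennreal (real (card (grid k j))*?t^k)"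
  using t by (simp add: ennreal_mult ennreal_of_nat_eq_real_of_nat)
 also have "... <= ennreal ((4 * real k * e)^k)"
 proof (rule ennreal_leI)
  have "real (card (grid k j)) = real (2^j + 1)^k" by (simp only: card_grid of_nat_power)
  also have "... <= (2*2^j)^k" by (intro power_mono) auto
  finally have "real (card (grid k j))*?t^k <= (2*2^j)^k*?t^k" using t by (intro mult_right_mono zero_le_power) auto
  also have "... = (4 * real k * e)^k" unfolding power_mult_distrib[symmetric] by (intro arg_cong[of _ _ "%x. x^k"]) simp
  finally show "real (card (grid k j))*?t^k <= (4 * real k * e)^k" .
 qed
 finally show ?thesis .
qed

context coordinates
begin

lemma phi_lip_global:
 assumes C2: "0 <= C2" and x: "x : K" and y: "y : K"
 shows "l1 M (phi x) (phi y) <= (C2 + 32)/eps * dist x y"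
proof (cases "dist x y < eps/16")
 case True
 have "l1 M (phi x) (phi y) <= C2/rad Z eps x * dist x y" by (rule phi_lip[OF x y True])
 also have "... <= (C2 + 32)/eps * dist x y" using rad_ge[of eps Z x] eps C2 by (intro mult_right_mono frac_le) auto
 finally show ?thesis .
next
 case False
 have "l1 M (phi x) (phi y) <= 2" by (rule simplex_diam[OF phi_simplex[OF x] phi_simplex[OF y]])
 also have "2 <= 32/eps * dist x y" using False eps by (simp add: field_simps)
 also have "... <= (C2 + 32)/eps * dist x y" using eps C2 by (intro mult_right_mono divide_right_mono) auto
 finally show ?thesis .
qed

lemma phi_label_near:
 assumes C: "0 < C" and x: "x : K" and y: "y : K" and near: "dist x y < eps/16" and i: "i : support (phi x) Un support (phi y)"
 shows "dist x (z i) <= (2 * C + 1) * rad Z eps x"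
proof -
 let ?R = "rad Z eps x"
 have R: "eps <= ?R" by (rule rad_ge)
 hence CR: "0 <= C*?R" using C eps by simp
 have "rad Z eps y <= 2*?R" using rad_lip[of Z eps x y] near R eps by linarith
 hence "C * rad Z eps y <= C*(2*?R)" using C by (intro mult_left_mono) auto
 moreover have "dist x (z i) <= C*?R | dist y (z i) <= C * rad Z eps y" using i phi_near[OF x] phi_near[OF y] by blast
 moreover have "(2 * C + 1)*?R = C*(2*?R) + ?R" by (simp add: algebra_simps)
 ultimately show ?thesis using dist_triangle[of x "z i" y] near R eps CR by auto
qed

lemma phi_labels_close:
 assumes C: "0 < C" and x: "x : K" and y: "y : K" and near: "dist x y < eps/16"
 shows "EX s>=0. (ALL i:support (phi x) Un support (phi y). ALL j:support (phi x) Un support (phi y). dist (z i) (z j) <= s) &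
  s * l1 M (phi x) (phi y) <= (4 * C + 2) * C2 * dist x y"
proof -
 let ?R = "rad Z eps x"
 have R: "0 < ?R" using rad_ge[of eps Z x] eps by linarith
 have "dist (z i) (z j) <= (4 * C + 2)*?R" if "i : support (phi x) Un support (phi y)" "j : support (phi x) Un support (phi y)" for i j
 proof -
  have "dist (z i) (z j) <= (2 * C + 1)*?R + (2 * C + 1)*?R"
   using dist_triangle3[of "z i" "z j" x] phi_label_near[OF C x y near that(1)] phi_label_near[OF C x y near that(2)] by linarith
  thus ?thesis by (simp add: algebra_simps)
 qed
 moreover have "(4 * C + 2)*?R * l1 M (phi x) (phi y) <= (4 * C + 2)*?R*(C2/?R * dist x y)"
  using phi_lip[OF x y near] C R by (intro mult_left_mono) auto
 hence "(4 * C + 2)*?R * l1 M (phi x) (phi y) <= (4 * C + 2) * C2 * dist x y" using R by simp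
 ultimately show ?thesis using C R by (intro exI[of _ "(4 * C + 2)*?R"]) auto
qed

end

definition gauge_const :: "real => real => real" where
 "gauge_const C C2 = (4 * C + 2) * C2 + 6*(C + 4)*(C2 + 35) + 1"

lemma gauge_const_ge:
 assumes "0 < C" "0 <= C2"
 shows "(4 * C + 2) * C2 <= gauge_const C C2" "6*(C + 4)*(C2 + 35) <= gauge_const C C2" "0 < gauge_const C C2"
proof -
 have "0 <= (4 * C + 2) * C2" "0 <= 6*(C + 4)*(C2 + 35)" using assms by (auto intro!: mult_nonneg_nonneg)
 thus "(4 * C + 2) * C2 <= gauge_const C C2" "6*(C + 4)*(C2 + 35) <= gauge_const C C2" "0 < gauge_const C C2"
  unfolding gauge_const_def by linarith+
qed

definition mass_const :: "real => nat => nat => nat => real => real => real" where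
 "mass_const c n m N C C2 = family_const c n (Suc m) (N + Suc m) (gauge_const C C2)"

definition htpy_mass_const :: "real => nat => nat => real" where
 "htpy_mass_const c n m = htpy_size (Suc m)*(4 * real (Suc m) * htpy_lip c (approx_const c n (Suc m)) (Suc m))^Suc m"

definition boundary_const :: "real => nat => nat => nat => real => real => real" where
 "boundary_const c n m N C C2 = mass_const c n m N C C2*(real (Suc m)*(4 * real (Suc m))^Suc m) + htpy_mass_const c n m"

lemma mass_const_nonneg: "0 < C ==> 0 <= C2 ==> 0 <= mass_const c n m N C C2"
 using lab_const_nonneg[of c n] avg_const_ge1[of "N + Suc m" "Suc m"] gauge_const_ge(3)[of C C2]
 unfolding mass_const_def family_const_def push_const_def by (intro mult_nonneg_nonneg zero_le_power) auto

lemma htpy_mass_const_nonneg: "0 <= htpy_mass_const c n m"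
proof -
 have "0 <= htpy_lip c (approx_const c n (Suc m)) (Suc m)" using approx_const_ge2[of c n "Suc m"] by (intro htpy_lip_nonneg) simp
 thus ?thesis unfolding htpy_mass_const_def by (intro mult_nonneg_nonneg zero_le_power htpy_size_nonneg) auto
qed

lemma boundary_const_nonneg: "0 < C ==> 0 <= C2 ==> 0 <= boundary_const c n m N C C2"
 unfolding boundary_const_def by (intro add_nonneg_nonneg mult_nonneg_nonneg mass_const_nonneg htpy_mass_const_nonneg) auto

locale filling_problem = coordinates Z K P N C C2 eps M z phi lab
 for Z K P :: "'a::metric_space set" and N :: nat and C C2 eps :: real and M :: nat and z :: "nat => 'a"
  and phi :: "'a => pt" and lab :: "'a => nat" +
 fixes n m :: nat and c :: real and bet :: "'a sing_chain"
 assumes target: "lip_connected_const Z n c" and m_le: "m <= n" and C: "0 < C" and C2: "0 <= C2"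
  and bet_simplex: "!!sig. sig : keys bet ==> lip_simplex UNIV (Suc m) sig"
  and bet_K: "!!sig x. sig : keys bet ==> x : Sx (Suc m) ==> sig x : K"
  and bd_fine: "!!rho. rho : keys (sbd (Suc m) bet) ==> fine_simplex Z eps P m rho"
  and bd_K: "!!rho x. rho : keys (sbd (Suc m) bet) ==> x : Sx m ==> rho x : K"
begin

abbreviation alp :: "'a sing_chain" where
 "alp == sbd (Suc m) bet"

lemma sbd_alp: "sbd m alp = 0"
 by (rule sbd_sbd) (use bet_simplex in \<open>auto simp: lip_simplex_def\<close>)

lemma alp_lip: "rho : keys alp ==> lipl m eps (Sx m) rho"
 using bd_fine[of rho] by (simp add: fine_simplex_def)

lemma alp_rad: "rho : keys alp ==> x : Sx m ==> rad Z eps (rho x) = eps"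
 using bd_fine[of rho] eps by (auto simp: fine_simplex_def lip_simplex_def rad_def)

lemma alp_vertex_map_simplex: "rho : keys alp ==> x : Sx m ==> vertex_map lab m rho x : Sx M"
 using bd_fine[of rho] label(1) by (intro vertex_map_simplex) (auto simp: fine_simplex_def)

context
 fixes rho :: "pt => 'a" and l :: "pt list"
 assumes rho: "rho : keys alp" and l: "l : keys (prism m)"
begin

abbreviation wall :: "pt => pt" where
 "wall x == blend phi lab m rho (aff l x)"

lemma wall_base: "x : Sx (Suc m) ==> base m (aff l x) : Sx m"
 using prism_aff[OF l] by blast

lemma wall_simplex: "x : Sx (Suc m) ==> wall x : Sx M"
 using prism_aff[OF l, of x] unfolding blend_def
 by (intro seg_convexD[OF simplex_convex] phi_simplex bd_K[OF rho] alp_vertex_map_simplex[OF rho]) auto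

lemma card_support_wall:
 assumes x: "x : Sx (Suc m)" shows "card (support (wall x)) <= N + Suc m"
proof -
 let ?p = "phi (rho (base m (aff l x)))" and ?q = "vertex_map lab m rho (base m (aff l x))"
 have p: "?p : Sx M" "card (support ?p) <= N" using phi_simplex phi_card bd_K[OF rho wall_base[OF x]] by auto
 have q: "?q : Sx M" by (rule alp_vertex_map_simplex[OF rho wall_base[OF x]])
 have "support (wall x) <= support ?p Un support ?q" by (auto simp: blend_def seg_def support_def)
 hence "card (support (wall x)) <= card (support ?p Un support ?q)" using finite_support[OF p(1)] finite_support[OF q] by (intro card_mono) auto
 thus ?thesis using card_Un_le[of "support ?p" "support ?q"] p(2) card_sup_vertex_map[of lab m rho "base m (aff l x)"] by linarith
qed

lemma wall_lip:
 assumes x: "x : Sx (Suc m)" and y: "y : Sx (Suc m)"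
 shows "l1 M (wall x) (wall y) <= 3*(C2 + 35) * l1 (Suc m) x y"
proof -
 let ?w = "aff l x" and ?w' = "aff l y"
 note wx = wall_base[OF x] and wy = wall_base[OF y]
 have "l1 M (phi (rho (base m ?w))) (phi (rho (base m ?w'))) <= (C2 + 32)/eps * dist (rho (base m ?w)) (rho (base m ?w'))"
  using wx wy by (intro phi_lip_global C2 bd_K[OF rho])
 also have "... <= (C2 + 32)/eps*(eps * l1 m (base m ?w) (base m ?w'))"
  using eps C2 by (intro mult_left_mono lipl_dist[OF alp_lip[OF rho] wx wy]) auto
 also have "... = (C2 + 32) * l1 m ?w ?w'" using eps by (simp add: l1_base)
 finally have "l1 M (wall x) (wall y) <= (C2 + 32 + 3) * l1 (Suc m) ?w ?w'"
  using prism_aff[OF l x] C2 by (intro blend_lip phi_simplex bd_K[OF rho wy] alp_vertex_map_simplex[OF rho wy]) auto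
 also have "... <= (C2 + 32 + 3)*(3 * l1 (Suc m) x y)"
  using C2 by (intro mult_left_mono aff_lip[OF prism_keys(1)[OF l] prism_diam[OF l] x y]) auto
 finally show ?thesis by (simp add: algebra_simps)
qed

lemma wall_label_near:
 assumes x: "x : Sx (Suc m)" and i: "i : support (wall x)"
 shows "dist (rho (base m (aff l x))) (z i) <= (C + 2) * eps"
proof -
 let ?x = "base m (aff l x)"
 note xs = wall_base[OF x]
 have "i : support (phi (rho ?x)) Un support (vertex_map lab m rho ?x)" using i by (auto simp: blend_def seg_def support_def)
 then consider "i : support (phi (rho ?x))" | "i : support (vertex_map lab m rho ?x)" by blast
 thus ?thesis
 proof cases
  case 1
  hence "dist (rho ?x) (z i) <= C * eps" using phi_near[OF bd_K[OF rho xs]] alp_rad[OF rho xs] by simp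
  thus ?thesis using eps by (simp add: distrib_right)
 next
  case 2
  then obtain j where j: "j <= m" "z i = rho (vtx j)"
   using support_vertex_map[of lab m rho ?x] bd_fine[OF rho] label(2) by (fastforce simp: fine_simplex_def)
  have "dist (rho ?x) (rho (vtx j)) <= 2 * eps" by (rule simplex_image_diam[OF alp_lip[OF rho] xs vtx_simplex[OF j(1)]])
  moreover have "0 <= C * eps" using C eps by simp
  ultimately show ?thesis using j(2) by (simp add: distrib_right)
 qed
qed

lemma wall_labels_close:
 assumes x: "x : Sx (Suc m)" and y: "y : Sx (Suc m)"
 shows "EX s>=0. (ALL i:support (wall x) Un support (wall y). ALL j:support (wall x) Un support (wall y). dist (z i) (z j) <= s) &
  s * l1 M (wall x) (wall y) <= 6*(C + 4)*(C2 + 35)*(eps * l1 (Suc m) x y)"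
proof -
 let ?a = "rho (base m (aff l x))" and ?b = "rho (base m (aff l y))"
 have ab: "dist ?a ?b <= 2 * eps" by (rule simplex_image_diam[OF alp_lip[OF rho] wall_base[OF x] wall_base[OF y]])
 have near: "dist ?a (z i) <= (C + 4) * eps" if "i : support (wall x) Un support (wall y)" for i
 proof -
  have "dist ?a (z i) <= (C + 2) * eps | dist ?b (z i) <= (C + 2) * eps" using that wall_label_near[OF x] wall_label_near[OF y] by blast
  moreover have "(C + 4) * eps = (C + 2) * eps + 2 * eps" by (simp add: algebra_simps)
  ultimately show ?thesis using dist_triangle[of ?a "z i" ?b] ab eps by auto
 qed
 have "dist (z i) (z j) <= 2*(C + 4) * eps" if "i : support (wall x) Un support (wall y)" "j : support (wall x) Un support (wall y)" for i j
  using dist_triangle3[of "z i" "z j" ?a] near[OF that(1)] near[OF that(2)] by (simp add: algebra_simps)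
 moreover have "2*(C + 4) * eps * l1 M (wall x) (wall y) <= 2*(C + 4) * eps*(3*(C2 + 35) * l1 (Suc m) x y)"
  using wall_lip[OF x y] C eps by (intro mult_left_mono) auto
 hence "2*(C + 4) * eps * l1 M (wall x) (wall y) <= 6*(C + 4)*(C2 + 35)*(eps * l1 (Suc m) x y)" by (simp add: algebra_simps)
 ultimately show ?thesis using C eps by (intro exI[of _ "2*(C + 4) * eps"]) auto
qed

end

end

context filling_problem
begin

definition total_lip :: "real => real" where
 "total_lip Lm = (C2 + 32)/eps * Lm + 3*(C2 + 35)"

lemma simplex_pushable:
 assumes Lm: "0 < Lm" and bet_lip: "!!sig. sig : keys bet ==> lipl (Suc m) Lm (Sx (Suc m)) sig" and sig: "sig : keys bet"
 shows "pushable z (Suc m) M (N + Suc m) (total_lip Lm) (eps/(32*(Lm + 1))) (gauge_const C C2)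
  (%x. phi (sig x)) (%x y. dist (sig x) (sig y)) (cell_vol (Suc m) sig) (enn2real (simplex_volume (Suc m) sig))"
proof (rule pushable.intro)
 let ?k = "Suc m" and ?\<eta> = "eps/(32*(Lm + 1))"
 note L = bet_lip[OF sig] and inK = bet_K[OF sig]
 show "0 <= total_lip Lm" using C2 eps Lm by (simp add: total_lip_def)
 show "0 < gauge_const C C2" by (rule gauge_const_ge(3)[OF C C2])
 show "phi (sig x) : Sx M" "card (support (phi (sig x))) <= N + ?k" if "x : Sx ?k" for x
  using phi_simplex phi_card inK[OF that] trans_le_add1 by blast+
 show "l1 M (phi (sig x)) (phi (sig y)) <= total_lip Lm * l1 ?k x y" if x: "x : Sx ?k" and y: "y : Sx ?k" for x y
 proof -
  have "l1 M (phi (sig x)) (phi (sig y)) <= (C2 + 32)/eps * dist (sig x) (sig y)" by (rule phi_lip_global[OF C2 inK[OF x] inK[OF y]])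
  also have "... <= (C2 + 32)/eps*(Lm * l1 ?k x y)" using lipl_dist[OF L x y] C2 eps by (intro mult_left_mono) auto
  also have "... <= total_lip Lm * l1 ?k x y" using C2 by (simp add: total_lip_def distrib_right mult.assoc[symmetric])
  finally show ?thesis .
 qed
 show "EX s>=0. (ALL i:support (phi (sig x)) Un support (phi (sig y)). ALL j:support (phi (sig x)) Un support (phi (sig y)). dist (z i) (z j) <= s) &
   s * l1 M (phi (sig x)) (phi (sig y)) <= gauge_const C C2 * dist (sig x) (sig y)"
  if x: "x : Sx ?k" and y: "y : Sx ?k" and xy: "l1 ?k x y <= ?\<eta>" for x y
 proof -
  have "dist (sig x) (sig y) <= Lm * l1 ?k x y" by (rule lipl_dist[OF L x y])
  also have "... <= (Lm + 1)*?\<eta>" using xy Lm by (intro mult_mono) auto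
  also have "... = eps/32" using Lm by (simp add: field_simps)
  also have "... < eps/16" using eps by simp
  finally have "dist (sig x) (sig y) < eps/16" .
  moreover have "(4 * C + 2) * C2 * dist (sig x) (sig y) <= gauge_const C C2 * dist (sig x) (sig y)"
   by (intro mult_right_mono gauge_const_ge C C2) auto
  ultimately show ?thesis using phi_labels_close[OF C inK[OF x] inK[OF y]] by (meson order_trans)
 qed
 show "cell_vol ?k g j q <= ennreal (lmb^?k) * cell_vol ?k sig j q"
  if "0 < lmb" "lipl ?k L' (Sx ?k) g" "!!x y. x : dcell ?k j q ==> y : dcell ?k j q ==> dist (g x) (g y) <= lmb * dist (sig x) (sig y)"
  for j q L' lmb and g :: "pt => 'a"
  by (rule cell_vol_push[OF L that(2,1,3)])
 show "(SUM q:grid ?k j. cell_vol ?k sig j q) <= ennreal (enn2real (simplex_volume ?k sig))" for j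
  using simplex_volume_finite[OF L] simplex_volume_sum[OF L, of j] by simp
qed simp_all

lemma wall_pushable:
 assumes Lm: "0 < Lm" and rho: "rho : keys alp" and l: "l : keys (prism m)"
 shows "pushable z (Suc m) M (N + Suc m) (total_lip Lm) (eps/(32*(Lm + 1))) (gauge_const C C2)
  (wall rho l) (%x y. eps * l1 (Suc m) x y) (%j q. ennreal ((2 * real (Suc m) * eps/2^j)^Suc m)) ((4 * real (Suc m) * eps)^Suc m)"
proof (rule pushable.intro)
 let ?k = "Suc m"
 show "0 <= total_lip Lm" using C2 eps Lm by (simp add: total_lip_def)
 show "0 < gauge_const C C2" by (rule gauge_const_ge(3)[OF C C2])
 show "0 <= (4 * real ?k * eps)^?k" using eps by (intro zero_le_power) auto
 show "wall rho l x : Sx M" "card (support (wall rho l x)) <= N + ?k" if "x : Sx ?k" for x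
  using wall_simplex[OF rho l that] card_support_wall[OF rho l that] by auto
 show "l1 M (wall rho l x) (wall rho l y) <= total_lip Lm * l1 ?k x y" if "x : Sx ?k" "y : Sx ?k" for x y
 proof -
  have "3*(C2 + 35) * l1 ?k x y <= total_lip Lm * l1 ?k x y" using C2 eps Lm by (intro mult_right_mono) (auto simp: total_lip_def)
  thus ?thesis using wall_lip[OF rho l that] by linarith
 qed
 show "EX s>=0. (ALL i:support (wall rho l x) Un support (wall rho l y). ALL j:support (wall rho l x) Un support (wall rho l y). dist (z i) (z j) <= s) &
   s * l1 M (wall rho l x) (wall rho l y) <= gauge_const C C2*(eps * l1 ?k x y)" if "x : Sx ?k" "y : Sx ?k" for x y
 proof -
  have "6*(C + 4)*(C2 + 35)*(eps * l1 ?k x y) <= gauge_const C C2*(eps * l1 ?k x y)"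
   using eps by (intro mult_right_mono gauge_const_ge C C2) auto
  thus ?thesis using wall_labels_close[OF rho l that] by (meson order_trans)
 qed
 show "cell_vol ?k g j q <= ennreal (lmb^?k) * ennreal ((2 * real ?k * eps/2^j)^?k)"
  if lmb: "0 < lmb" and g: "lipl ?k L' (Sx ?k) g" and cell_lip: "!!x y. x : dcell ?k j q ==> y : dcell ?k j q ==> dist (g x) (g y) <= lmb*(eps * l1 ?k x y)"
  for j q L' lmb and g :: "pt => 'a"
 proof -
  have "lipl ?k (lmb * eps) (dcell ?k j q) g" using cell_lip lmb eps by (intro liplI) (auto simp: mult.assoc)
  hence "cell_vol ?k g j q <= ennreal ((2 * real ?k*(lmb * eps)/2^j)^?k)" by (rule cell_vol_lip[OF _ g])
  also have "(2 * real ?k*(lmb * eps)/2^j)^?k = lmb^?k*(2 * real ?k * eps/2^j)^?k"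
   unfolding power_mult_distrib[symmetric] by (intro arg_cong[of _ _ "%x. x^?k"]) simp
  also have "ennreal ... = ennreal (lmb^?k) * ennreal ((2 * real ?k * eps/2^j)^?k)" using lmb eps by (intro ennreal_mult zero_le_power) auto
  finally show ?thesis .
 qed
 show "(SUM q:grid ?k j. ennreal ((2 * real ?k * eps/2^j)^?k)) <= ennreal ((4 * real ?k * eps)^?k)" for j
  using eps by (intro sum_cell_volumes_le) simp
qed

abbreviation K1 :: real where
 "K1 == mass_const c n m N C C2"

abbreviation K2 :: real where
 "K2 == boundary_const c n m N C C2"

definition push_bound :: real where
 "push_bound = real_mass (Suc m) bet + real (Suc m)*(4 * real (Suc m) * eps)^Suc m * nrm alp"

abbreviation push :: "pt => pt => 'a" where
 "push a == push_map Z c z (Suc m) M a"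

abbreviation pushed_wall :: "pt => (pt => 'a) => pt list => (pt => 'a)" where
 "pushed_wall a rho l == sing (%w. push a (blend phi lab m rho w)) l"

lemma pushed_wall_eq: "l : keys (prism m) ==> pushed_wall a rho l = restr (Suc m) (%x. push a (wall rho l x))"
 using prism_keys(1) by (rule sing_eq_restr)

definition pushed_mass :: "pt => ennreal" where
 "pushed_mass a = (SUM sig:keys bet. ennreal (abs_coeff bet sig) * simplex_volume (Suc m) (point_push (push a) phi (Suc m) sig)) +
  (SUM rho:keys alp. SUM l:keys (prism m). ennreal (abs_coeff alp rho * abs_coeff (prism m) l) * simplex_volume (Suc m) (pushed_wall a rho l))"

definition good_weights :: "pt => real => bool" where
 "good_weights a dlt = ((ALL i. 1 <= a i & a i <= 2) & (ALL sig:keys bet. lip_simplex Z (Suc m) (point_push (push a) phi (Suc m) sig)) &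
  (ALL rho:keys alp. ALL l:keys (prism m). lip_simplex Z (Suc m) (pushed_wall a rho l)) &
  pushed_mass a <= ennreal (K1*(push_bound + dlt)))"

lemma good_weights_exist:
 assumes dlt: "0 < dlt" shows "EX a. good_weights a dlt"
proof -
 let ?k = "Suc m" and ?I = "keys bet <+> keys alp \<times> keys (prism m)"
 let ?T = "(4 * real ?k * eps)^?k"
 define u where "u = case_sum (%sig x. phi (sig x)) (%(rho, l). wall rho l)"
 define d where "d = case_sum (%(sig::pt => 'a) x y. dist (sig x) (sig y)) (%(rho::pt => 'a, l::pt list) x y. eps * l1 ?k x y)"
 define V where "V = case_sum (%sig::pt => 'a. cell_vol ?k sig) (%(rho::pt => 'a, l::pt list) j q. ennreal ((2 * real ?k * eps/2^j)^?k))"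
 define V0 where "V0 = case_sum (%sig::pt => 'a. enn2real (simplex_volume ?k sig)) (%(rho::pt => 'a, l::pt list). ?T)"
 define co where "co = case_sum (%sig. abs_coeff bet sig) (%(rho, l). abs_coeff alp rho*abs_coeff (prism m) l)"
 have sum_items: "(SUM i:?I. f i) = (SUM sig:keys bet. f (Inl sig)) + (SUM rho:keys alp. SUM l:keys (prism m). f (Inr (rho, l)))"
  for f :: "_ => 'z::comm_monoid_add"
  by (simp add: sum.Plus sum.cartesian_product o_def split_def)
 obtain Lm where Lm: "0 < Lm" "!!sig. sig : keys bet ==> lipl ?k Lm (Sx ?k) sig" using common_lip_const[OF finite_keys bet_simplex] by blast
 have "pushable_family z ?k M (N + ?k) (total_lip Lm) (eps/(32*(Lm + 1))) (gauge_const C C2) u d V V0 ?I co Z n c"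
 proof (rule pushable_family.intro)
  fix i assume i: "i : ?I"
  show "pushable z ?k M (N + ?k) (total_lip Lm) (eps/(32*(Lm + 1))) (gauge_const C C2) (u i) (d i) (V i) (V0 i)"
   using i simplex_pushable[OF Lm] wall_pushable[OF Lm(1)] by (auto simp: u_def d_def V_def V0_def)
  show "0 <= co i" by (cases i) (auto simp: co_def)
 qed (use gauge_const_ge(3)[OF C C2] m_le eps Lm target z_Z in auto)
 then obtain a where a: "!!i. 1 <= a i & a i <= 2" and simplex: "!!i. i : ?I ==> lip_simplex Z ?k (restr ?k (%x. push a (u i x)))"
  and mass: "(SUM i:?I. ennreal (co i) * simplex_volume ?k (restr ?k (%x. push a (u i x))))
    <= ennreal (K1*((SUM i:?I. co i * V0 i) + dlt))"
  unfolding mass_const_def using pushable_family.pushed_family[OF _ dlt] by blast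
 have pushed: "restr ?k (%x. push a (u (Inl sig) x)) = point_push (push a) phi ?k sig"
  "l : keys (prism m) ==> restr ?k (%x. push a (u (Inr (rho, l)) x)) = pushed_wall a rho l" for sig rho l
  by (simp_all add: u_def point_push_def pushed_wall_eq)
 have "(SUM i:?I. co i * V0 i) = real_mass ?k bet + nrm alp * nrm (prism m)*?T"
  unfolding sum_items real_mass_def nrm_def sum_product unfolding sum_distrib_right by (simp add: co_def V0_def del: power_Suc)
 also have "nrm alp * nrm (prism m)*?T <= nrm alp * real ?k*?T"
  using nrm_pr[of "%x. x" "lift_top (Suc m)" "std m"] eps unfolding prism_def length_std by (intro mult_right_mono mult_left_mono zero_le_power) auto
 finally have "(SUM i:?I. co i * V0 i) <= push_bound" by (simp add: push_bound_def mult_ac del: of_nat_Suc power_Suc)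
 hence "ennreal (K1*((SUM i:?I. co i * V0 i) + dlt)) <= ennreal (K1*(push_bound + dlt))"
  using mass_const_nonneg[OF C C2] by (intro ennreal_leI mult_left_mono) auto
 with mass have "(SUM i:?I. ennreal (co i) * simplex_volume ?k (restr ?k (%x. push a (u i x)))) <= ennreal (K1*(push_bound + dlt))"
  by (rule order_trans)
 hence "pushed_mass a <= ennreal (K1*(push_bound + dlt))"
  by (simp add: pushed_mass_def sum_items pushed co_def cong: sum.cong)
 thus ?thesis unfolding good_weights_def using a simplex[OF InlI] simplex[OF InrI] pushed by (intro exI[of _ a]) auto
qed

context
 fixes a :: pt and dlt :: real
 assumes dlt: "0 < dlt" and good: "good_weights a dlt"
begin

abbreviation Q :: "nat => (pt => 'a) => (pt => 'a)" where
 "Q == vertex_push (push a) lab"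

abbreviation A :: real where
 "A == approx_const c n (Suc m)"

interpretation approx: simplicial_approximation Z m c eps A "fine_simplex Z eps P" Q
proof
 show "lip_connected_const Z m c" using target m_le unfolding lip_connected_const_def by auto
 show "2 <= A" by (rule approx_const_ge2)
 show "lip_within Z p (A * eps) (rho (vtx 0)) (Q p rho)" if "p <= m" "fine_simplex Z eps P p rho" for p rho
  using that m_le good by (intro approx_within[OF target]) (auto simp: good_weights_def)
 show "lip_simplex Z p rho" "lipl p eps (Sx p) rho" if "fine_simplex Z eps P p rho" for p rho using that by (simp_all add: fine_simplex_def)
qed (use eps in \<open>auto simp: fine_simplex_face vertex_push_face\<close>)

definition pushed_chain :: "'a sing_chain" where
 "pushed_chain = frag_extend (%sig. frag_of (point_push (push a) phi (Suc m) sig)) bet"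

definition prism_part :: "'a sing_chain" where
 "prism_part = frag_extend (prism_chain (push a) phi lab m) alp"

definition htpy_part :: "'a sing_chain" where
 "htpy_part = frag_extend (htpy Z c Q (Suc m)) alp"

lemma sbd_pushed_chain: "sbd (Suc m) pushed_chain = frag_extend (%rho. frag_of (point_push (push a) phi m rho)) alp"
 unfolding pushed_chain_def by (rule sbd_natural) (rule point_push_face)

lemma sbd_prism_part:
 "sbd (Suc m) prism_part = frag_extend (%rho. frag_of (Q m rho)) alp - frag_extend (%rho. frag_of (point_push (push a) phi m rho)) alp"
proof -
 have "sbd (Suc m) prism_part = frag_extend (%rho. frag_of (Q m rho)) alp - frag_extend (%rho. frag_of (point_push (push a) phi m rho)) alp -
   frag_extend (prism_chain (push a) phi lab (m - 1)) (sbd m alp)"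
  unfolding prism_part_def sbd_extend sbd_prism_chain frag_extend_fun_diff by (simp only: sbd_def frag_extend_extend)
 thus ?thesis by (simp add: sbd_alp)
qed

lemma sbd_htpy_part: "sbd (Suc m) htpy_part = alp - frag_extend (%rho. frag_of (Q m rho)) alp"
proof -
 have "sbd (Suc m) htpy_part = frag_extend (approx.error m) alp"
  unfolding htpy_part_def sbd_extend using approx.good_htpy[OF order_refl bd_fine] by (intro frag_extend_eq) (simp add: approx.good_htpy_def)
 also have "... = alp - frag_extend (%rho. frag_of (Q m rho)) alp - frag_extend (htpy Z c Q m) (sbd m alp)"
  unfolding approx.error_def frag_extend_fun_diff frag_extend_id by (simp only: sbd_def frag_extend_extend)
 finally show ?thesis by (simp add: sbd_alp)
qed

lemma filling_boundary: "sbd (Suc m) (pushed_chain + prism_part + htpy_part) = alp"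
 by (simp add: sbd_add sbd_pushed_chain sbd_prism_part sbd_htpy_part)

lemma filling_simplex:
 assumes tau: "tau : keys (pushed_chain + prism_part + htpy_part)" shows "lip_simplex Z (Suc m) tau"
proof -
 consider "tau : keys pushed_chain" | "tau : keys prism_part" | "tau : keys htpy_part"
  using tau Poly_Mapping.keys_add[of "pushed_chain + prism_part" htpy_part] Poly_Mapping.keys_add[of pushed_chain prism_part] by blast
 thus ?thesis
 proof cases
  case 1
  then obtain sig where "sig : keys bet" "tau = point_push (push a) phi (Suc m) sig"
   unfolding pushed_chain_def using keys_frag_extend[of "%sig. frag_of (point_push (push a) phi (Suc m) sig)" bet] by auto
  thus ?thesis using good by (simp add: good_weights_def)
 next
  case 2
  then obtain rho where rho: "rho : keys alp" "tau : keys (prism_chain (push a) phi lab m rho)"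
   unfolding prism_part_def using keys_frag_extend[of "prism_chain (push a) phi lab m" alp] by blast
  then obtain l where "l : keys (prism m)" "tau = pushed_wall a rho l"
   unfolding prism_chain_def sings_def using keys_frag_extend[of "%l. frag_of (pushed_wall a rho l)" "prism m"] by auto
  thus ?thesis using good rho(1) by (simp add: good_weights_def)
 next
  case 3
  then obtain rho where "rho : keys alp" "tau : keys (htpy Z c Q (Suc m) rho)"
   unfolding htpy_part_def using keys_frag_extend[of "htpy Z c Q (Suc m)" alp] by blast
  thus ?thesis using approx.good_htpy[OF order_refl bd_fine] unfolding approx.good_htpy_def lip_within_def by blast
 qed
qed

lemma pushed_part_mass: "fmass (Suc m) (pushed_chain + prism_part) <= ennreal (K1*(push_bound + dlt))"
proof -
 let ?k = "Suc m"
 have "fmass ?k pushed_chain <= (SUM sig:keys bet. ennreal (abs_coeff bet sig) * simplex_volume ?k (point_push (push a) phi ?k sig))"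
  unfolding pushed_chain_def using fmass_extend_le[of ?k "%sig. frag_of (point_push (push a) phi ?k sig)" bet] by simp
 moreover have "fmass ?k prism_part <= (SUM rho:keys alp. ennreal (abs_coeff alp rho) *
   (SUM l:keys (prism m). ennreal (abs_coeff (prism m) l) * simplex_volume ?k (pushed_wall a rho l)))"
  unfolding prism_part_def prism_chain_def by (rule order_trans[OF fmass_extend_le]) (intro sum_mono mult_left_mono fmass_sings_le, simp)
 ultimately have "fmass ?k (pushed_chain + prism_part) <= pushed_mass a"
  using order_trans[OF fmass_add add_mono] by (simp add: pushed_mass_def sum_distrib_left ennreal_mult mult.assoc)
 thus ?thesis using good order_trans unfolding good_weights_def by blast
qed

lemma htpy_part_mass: "fmass (Suc m) htpy_part <= ennreal (htpy_mass_const c n m * eps^Suc m * nrm alp)"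
proof -
 let ?k = "Suc m"
 define W where "W = (4 * real ?k*(htpy_lip c A ?k * eps))^?k"
 have "0 <= htpy_lip c A ?k" using approx_const_ge2[of c n ?k] by (intro htpy_lip_nonneg) simp
 hence W: "0 <= W" unfolding W_def using eps by (intro zero_le_power mult_nonneg_nonneg) auto
 have one: "fmass ?k (htpy Z c Q ?k rho) <= ennreal (W * htpy_size ?k)" if rho: "rho : keys alp" for rho
 proof -
  note good = approx.good_htpy[OF order_refl bd_fine[OF rho], unfolded approx.good_htpy_def]
  have "fmass ?k (htpy Z c Q ?k rho) <= ennreal (W * nrm (htpy Z c Q ?k rho))"
  proof (rule fmass_bound[OF _ W])
   fix tau assume "tau : keys (htpy Z c Q ?k rho)"
   hence "lipl ?k (htpy_lip c A ?k * eps) (Sx ?k) tau" using good unfolding lip_within_def by blast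
   thus "simplex_volume ?k tau <= ennreal W" unfolding W_def by (rule simplex_volume_lip)
  qed
  also have "... <= ennreal (W * htpy_size ?k)" using good W by (intro ennreal_leI mult_left_mono) blast+
  finally show ?thesis .
 qed
 have nonneg: "0 <= W * htpy_size ?k" using W htpy_size_nonneg by (rule mult_nonneg_nonneg)
 have "fmass ?k htpy_part <= (SUM rho:keys alp. ennreal (abs_coeff alp rho) * fmass ?k (htpy Z c Q ?k rho))"
  unfolding htpy_part_def by (rule fmass_extend_le)
 also have "... <= (SUM rho:keys alp. ennreal (abs_coeff alp rho) * ennreal (W * htpy_size ?k))" by (intro sum_mono mult_left_mono one) auto
 also have "... = (SUM rho:keys alp. ennreal (abs_coeff alp rho*(W * htpy_size ?k)))"
  using nonneg by (intro sum.cong refl ennreal_mult[symmetric]) auto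
 also have "... = ennreal (nrm alp*(W * htpy_size ?k))"
  unfolding nrm_def sum_distrib_right by (intro sum_ennreal mult_nonneg_nonneg[OF abs_ge_zero nonneg])
 also have "W = (4 * real ?k * htpy_lip c A ?k)^?k * eps^?k" unfolding W_def power_mult_distrib[symmetric] by (simp only: mult.assoc)
 finally show ?thesis by (simp only: htpy_mass_const_def mult_ac)
qed

lemma filling_mass:
 "fmass (Suc m) (pushed_chain + prism_part + htpy_part)
  <= ennreal K1 * fmass (Suc m) bet + ennreal (K2 * eps^Suc m * nrm alp + K1 * dlt)"
proof -
 let ?k = "Suc m" and ?X = "htpy_mass_const c n m" and ?B = "real_mass (Suc m) bet"
 have "0 <= push_bound" unfolding push_bound_def using eps by (intro add_nonneg_nonneg mult_nonneg_nonneg zero_le_power real_mass_nonneg) auto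
 hence nonneg: "0 <= K1" "0 <= ?X" "0 <= ?B" "0 <= push_bound"
  using mass_const_nonneg[OF C C2] htpy_mass_const_nonneg real_mass_nonneg by auto
 have "fmass ?k (pushed_chain + prism_part + htpy_part) <= fmass ?k (pushed_chain + prism_part) + fmass ?k htpy_part" by (rule fmass_add)
 also have "... <= ennreal (K1*(push_bound + dlt)) + ennreal (?X * eps^?k * nrm alp)" by (intro add_mono pushed_part_mass htpy_part_mass)
 also have "... = ennreal (K1*(push_bound + dlt) + ?X * eps^?k * nrm alp)"
  using nonneg dlt eps by (intro ennreal_plus[symmetric] mult_nonneg_nonneg add_nonneg_nonneg zero_le_power) auto
 also have "K1*(push_bound + dlt) + ?X * eps^?k * nrm alp = K1*?B + (K2 * eps^?k * nrm alp + K1 * dlt)"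
  unfolding push_bound_def boundary_const_def power_mult_distrib by (simp only: distrib_left distrib_right mult_ac add_ac)
 also have "ennreal ... = ennreal (K1*?B) + ennreal (K2 * eps^?k * nrm alp + K1 * dlt)"
  using nonneg boundary_const_nonneg[OF C C2, of c n m N] eps dlt by (intro ennreal_plus mult_nonneg_nonneg add_nonneg_nonneg zero_le_power) auto
 also have "ennreal (K1*?B) = ennreal K1 * fmass ?k bet"
  using fmass_real_mass[of bet UNIV ?k] bet_simplex nonneg(1,3) by (simp add: ennreal_mult)
 finally show ?thesis .
qed

end

theorem filling_exists:
 assumes dlt: "0 < dlt"
 shows "EX gam. (ALL sig:keys gam. lip_simplex Z (Suc m) sig) & sbd (Suc m) gam = alp &
  fmass (Suc m) gam <= ennreal K1 * fmass (Suc m) bet + ennreal (K2 * eps^Suc m * nrm alp + dlt)"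
proof -
 define dlt' where "dlt' = dlt/(K1 + 1)"
 have K1_nonneg: "0 <= K1" by (rule mass_const_nonneg[OF C C2])
 have dlt': "0 < dlt'" unfolding dlt'_def using dlt K1_nonneg by simp
 have "K1 * dlt' <= (K1 + 1) * dlt'" using dlt' by (intro mult_right_mono) auto
 also have "... = dlt" unfolding dlt'_def using K1_nonneg by simp
 finally have "ennreal (K2 * eps^Suc m * nrm alp + K1 * dlt')
   <= ennreal (K2 * eps^Suc m * nrm alp + dlt)" by (intro ennreal_leI) simp
 moreover obtain a where "good_weights a dlt'" using good_weights_exist[OF dlt'] by blast
 note weights = dlt' this
 ultimately show ?thesis
  using filling_simplex[OF weights] filling_boundary[OF weights] order_trans[OF filling_mass[OF weights] add_left_mono] by blast
qed

end

definition fine_filling :: "'a::metric_space set => nat => real => real => bool" where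
 "fine_filling Z m K1 K2 = (0 <= K1 & 0 <= K2 & (ALL eps>0. ALL dlt>0. ALL bet. (ALL sig:keys bet. lip_simplex UNIV (Suc m) sig) -->
   (ALL rho:keys (sbd (Suc m) bet). lip_simplex Z m rho & lipl m eps (Sx m) rho) -->
   (EX gam. (ALL sig:keys gam. lip_simplex Z (Suc m) sig) & sbd (Suc m) gam = sbd (Suc m) bet &
    fmass (Suc m) gam <= ennreal K1 * fmass (Suc m) bet + ennreal (K2 * eps^Suc m * nrm (sbd (Suc m) bet) + dlt))))"

lemma fine_fillingE:
 assumes fill: "fine_filling Z m K1 K2" and eps: "0 < eps" and dlt: "0 < dlt" and bet: "!!sig. sig : keys bet ==> lip_simplex UNIV (Suc m) sig"
  and bd: "!!rho. rho : keys (sbd (Suc m) bet) ==> lip_simplex Z m rho" "!!rho. rho : keys (sbd (Suc m) bet) ==> lipl m eps (Sx m) rho"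
 obtains gam where "ALL sig:keys gam. lip_simplex Z (Suc m) sig" "sbd (Suc m) gam = sbd (Suc m) bet"
  "fmass (Suc m) gam <= ennreal K1 * fmass (Suc m) bet + ennreal (K2 * eps^Suc m * nrm (sbd (Suc m) bet) + dlt)"
proof -
 note all = fill[unfolded fine_filling_def, THEN conjunct2, THEN conjunct2, rule_format, OF eps dlt]
 have "EX gam. (ALL sig:keys gam. lip_simplex Z (Suc m) sig) & sbd (Suc m) gam = sbd (Suc m) bet &
   fmass (Suc m) gam <= ennreal K1 * fmass (Suc m) bet + ennreal (K2 * eps^Suc m * nrm (sbd (Suc m) bet) + dlt)"
  by (rule all) (simp_all add: bet bd)
 thus ?thesis using that by blast
qed

lemma compact_simplices:
 assumes "!!sig. sig : keys b ==> lip_simplex S q sig" shows "compact (UN sig:keys b. sig ` Sx q)"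
proof (rule compact_UN[OF finite_keys])
 fix sig assume "sig : keys b"
 hence "lip_simplex S q sig" by (rule assms)
 then obtain L where "lipl q L (Sx q) sig" by (auto simp: lip_simplex_iff)
 thus "compact (sig ` Sx q)" by (intro compact_continuous_image lipl_continuous compact_simplex)
qed

lemma filling_problem_exists:
 fixes Z :: "'a::metric_space set" and w :: "'v => 'a => real"
 assumes Y: "lip_connected_const Z n c" and mn: "m <= n" and C: "0 < C" and w: "whitney_family Z N C eps w zw"
  and bet: "!!sig. sig : keys bet ==> lip_simplex UNIV (Suc m) sig"
  and bd: "!!rho. rho : keys (sbd (Suc m) bet) ==> lip_simplex Z m rho & lipl m eps (Sx m) rho"
 shows "EX K P M z phi lab. filling_problem Z K P N C (64 * real N) eps M z phi lab n m c bet"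
proof -
 let ?alp = "sbd (Suc m) bet"
 define K where "K = (UN sig:keys bet. sig ` Sx (Suc m)) Un (UN rho:keys ?alp. rho ` Sx m)"
 define P where "P = (UN rho:keys ?alp. (%j. rho (vtx j)) ` {..m})"
 have "compact K" unfolding K_def using bet bd by (intro compact_Un compact_simplices) auto
 moreover have "finite P" by (simp add: P_def)
 moreover have "P <= Z"
 proof
  fix x assume "x : P"
  then obtain rho j where "rho : keys ?alp" "j <= m" "x = rho (vtx j)" unfolding P_def by auto
  thus "x : Z" using bd vtx_simplex[of j m] unfolding lip_simplex_def by blast
 qed
 ultimately have "EX M z phi lab. coordinates Z K P N C (64 * real N) eps M z phi lab" by (rule whitney_family.coordinates_exist[OF w])
 then obtain M z phi lab where "coordinates Z K P N C (64 * real N) eps M z phi lab" by blast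
 moreover have "fine_simplex Z eps P m rho" if "rho : keys ?alp" for rho
  using bd[OF that] that by (auto simp: fine_simplex_def P_def)
 moreover have "sig x : K" if "sig : keys bet" "x : Sx (Suc m)" for sig x using that unfolding K_def by blast
 moreover have "rho x : K" if "rho : keys ?alp" "x : Sx m" for rho x using that unfolding K_def by blast
 ultimately have "filling_problem Z K P N C (64 * real N) eps M z phi lab n m c bet"
  using Y mn C bet by (intro filling_problem.intro filling_problem_axioms.intro) simp_all
 thus ?thesis by blast
qed

lemma fine_filling_exists:
 fixes Z :: "'a::metric_space set"
 assumes Y: "lip_connected_const Z n c" and AN: "AN_dim_finite TYPE('a)" and Z: "Z ~= {}" and mn: "m <= n"
 obtains K1 K2 where "fine_filling Z m K1 K2"
proof -
 obtain N C where C: "0 < C" and whitney: "!!eps. 0 < eps ==> EX (w :: nat \<times> 'a set => 'a => real) z. whitney_family Z N C eps w z"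
  using whitney_exists[OF AN Z] by blast
 let ?K1 = "mass_const c n m N C (64 * real N)" and ?K2 = "boundary_const c n m N C (64 * real N)"
 have "EX gam. (ALL sig:keys gam. lip_simplex Z (Suc m) sig) & sbd (Suc m) gam = sbd (Suc m) bet &
   fmass (Suc m) gam <= ennreal ?K1 * fmass (Suc m) bet + ennreal (?K2 * eps^Suc m * nrm (sbd (Suc m) bet) + dlt)"
  if eps: "0 < eps" and dlt: "0 < dlt" and bet: "ALL sig:keys bet. lip_simplex (UNIV :: 'a set) (Suc m) sig"
   and bd: "ALL rho:keys (sbd (Suc m) bet). lip_simplex Z m rho & lipl m eps (Sx m) rho" for eps dlt bet
 proof -
  obtain w :: "nat \<times> 'a set => 'a => real" and zw where w: "whitney_family Z N C eps w zw" using whitney[OF eps] by blast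
  have "EX K P M z phi lab. filling_problem Z K P N C (64 * real N) eps M z phi lab n m c bet"
   by (rule filling_problem_exists[OF Y mn C w]) (use bet bd in auto)
  thus ?thesis using filling_problem.filling_exists[OF _ dlt] by (elim exE)
 qed
 hence "fine_filling Z m ?K1 ?K2" unfolding fine_filling_def using mass_const_nonneg[OF C] boundary_const_nonneg[OF C] by auto
 thus ?thesis by (rule that)
qed

lemma lip_simplex_mono: "lip_simplex S k sig ==> S <= T ==> lip_simplex T k sig"
 unfolding lip_simplex_def by blast

lemma keys_extend_sings: "tau : keys (frag_extend (%sig. sings sig c) a) ==> EX sig:keys a. EX l:keys c. tau = sing sig l"
proof -
 assume "tau : keys (frag_extend (%sig. sings sig c) a)"
 then obtain sig where sig: "sig : keys a" "tau : keys (sings sig c)" using keys_frag_extend[of "%sig. sings sig c" a] by blast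
 then obtain l where "l : keys c" "tau = sing sig l" unfolding sings_def using keys_frag_extend[of "%l. frag_of (sing sig l)" c] by auto
 thus ?thesis using sig(1) by blast
qed

lemma nrm_sings: "nrm (sings f c) <= nrm c"
 unfolding sings_def using nrm_extend[of c "%l. frag_of (sing f l)" 1] by simp

definition subdivision :: "nat => nat => 'a sing_chain => 'a sing_chain" where
 "subdivision M m = frag_extend (subdiv_sing M m)"

definition subdivision_track :: "nat => nat => 'a sing_chain => 'a sing_chain" where
 "subdivision_track M m = frag_extend (track_sing M m)"

lemma nrm_subdivision:
 assumes M: "0 < M" shows "nrm (subdivision M m a) <= sd_const (Suc m) * real M^m * nrm a"
 unfolding subdivision_def
 by (rule nrm_extend) (use order_trans[OF nrm_sings nrm_subdiv[OF M length_std]] in \<open>simp add: subdiv_sing_def del: subdiv.simps sd_const.simps\<close>)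

context
 fixes Z :: "'a::metric_space set" and m M :: nat and a :: "'a sing_chain"
 assumes M: "0 < M" and simplex: "!!rho. rho : keys a ==> lip_simplex Z m rho" and cycle: "sbd m a = 0"
begin

lemma sbd_subdivision_track: "sbd (Suc m) (subdivision_track M m a) = a - subdivision M m a"
proof -
 have "sbd (Suc m) (subdivision_track M m a) = frag_extend (%rho. frag_of rho - subdiv_sing M m rho - frag_extend (track_sing M (m - 1)) (sface m rho)) a"
  unfolding subdivision_track_def sbd_extend by (intro frag_extend_eq sbd_track_sing[OF M]) (use simplex in \<open>auto simp: lip_simplex_def\<close>)
 also have "... = a - subdivision M m a - frag_extend (track_sing M (m - 1)) (sbd m a)"
  unfolding frag_extend_fun_diff frag_extend_id subdivision_def by (simp only: sbd_def frag_extend_extend)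
 finally show ?thesis by (simp add: cycle)
qed

lemma subdivision_track_simplex:
 assumes tau: "tau : keys (subdivision_track M m a)"
 shows "lip_simplex Z (Suc m) tau" "simplex_volume (Suc m) tau = 0"
proof -
 obtain rho l where rho: "rho : keys a" and l: "l : keys (track M (Suc m) (std m))" and eq: "tau = sing rho l"
  using tau keys_extend_sings[of tau "track M (Suc m) (std m)" a] unfolding subdivision_track_def track_sing_def by blast
 have len: "length l = Suc (Suc m)" and vertices: "set l <= Sx m" using track_simplex[OF M length_std set_std l] by auto
 show lip: "lip_simplex Z (Suc m) tau" unfolding eq by (rule sing_lip_simplex[OF simplex[OF rho] vertices len])
 obtain L L' where "lipl m L (Sx m) rho" "lipl (Suc m) L' (Sx (Suc m)) tau" using simplex[OF rho] lip by (auto simp: lip_simplex_iff)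
 moreover have "tau ` Sx (Suc m) <= rho ` Sx m" using aff_simplex[OF vertices len] len by (auto simp: eq sing_def)
 ultimately show "simplex_volume (Suc m) tau = 0" by (rule simplex_volume_degenerate)
qed

lemma fmass_subdivision_track: "fmass (Suc m) (subdivision_track M m a) = 0"
 unfolding fmass_def using subdivision_track_simplex(2) by (intro sum.neutral) auto

lemma subdivision_fine:
 assumes L: "!!rho. rho : keys a ==> lipl m L (Sx m) rho" and tau: "tau : keys (subdivision M m a)"
 shows "lip_simplex Z m tau" "lipl m (L*(real (Suc m)*2/real M)) (Sx m) tau"
proof -
 obtain rho l where rho: "rho : keys a" and l: "l : keys (subdiv M (Suc m) (std m))" and eq: "tau = sing rho l"
  using tau keys_extend_sings[of tau "subdiv M (Suc m) (std m)" a] unfolding subdivision_def subdiv_sing_def by blast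
 have len: "length l = Suc m" by (rule subdiv_length[OF length_std l])
 have vertices: "set l <= Sx m" and mesh: "!!x y. x : set l ==> y : set l ==> l1 m x y <= real (Suc m)*2/real M"
  using subdiv_simplex[OF M length_std set_std l] by blast+
 show "lip_simplex Z m tau" unfolding eq by (rule sing_lip_simplex[OF simplex[OF rho] vertices len])
 show "lipl m (L*(real (Suc m)*2/real M)) (Sx m) tau"
  unfolding eq by (rule sing_lipl[OF L[OF rho] aff_simplex[OF vertices len] len _ mesh]) simp_all
qed

lemma filling_volume_subdivided:
 assumes fill: "fine_filling Z m K1 K2" and L: "0 < L" "!!rho. rho : keys a ==> lipl m L (Sx m) rho"
  and b: "!!sig. sig : keys b ==> lip_simplex UNIV (Suc m) sig" "sbd (Suc m) b = a" and dlt: "0 < dlt"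
 shows "filling_volume Z m (lkp a) <= ennreal K1 * fmass (Suc m) b +
  ennreal (K2*(L*(real (Suc m)*2))^Suc m*(sd_const (Suc m) * nrm a)/real M + dlt)"
proof -
 let ?T = "subdivision_track M m a" and ?eps = "L*(real (Suc m)*2/real M)" and ?b = "b - subdivision_track M m a"
 have bd: "sbd (Suc m) ?b = subdivision M m a" by (simp add: sbd_diff b(2) sbd_subdivision_track)
 have eps: "0 < ?eps" using L M by simp
 have b': "lip_simplex UNIV (Suc m) sig" if "sig : keys ?b" for sig
  using that keys_diff[of b ?T] b(1) lip_simplex_mono[OF subdivision_track_simplex(1) subset_UNIV] by blast
 have fine: "lip_simplex Z m rho" "lipl m ?eps (Sx m) rho" if "rho : keys (sbd (Suc m) ?b)" for rho
  using subdivision_fine[OF L(2)] that unfolding bd by blast+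
 obtain g where g: "ALL sig:keys g. lip_simplex Z (Suc m) sig" "sbd (Suc m) g = sbd (Suc m) ?b"
  "fmass (Suc m) g <= ennreal K1 * fmass (Suc m) ?b + ennreal (K2*?eps^Suc m * nrm (sbd (Suc m) ?b) + dlt)"
  by (rule fine_fillingE[OF fill eps dlt b' fine])
 note g = g[unfolded bd]
 have "filling_volume Z m (lkp a) <= fmass (Suc m) (g + ?T)"
 proof (rule filling_volume_le)
  show "sbd (Suc m) (g + ?T) = a" by (simp add: sbd_add g(2) sbd_subdivision_track)
  show "lip_simplex Z (Suc m) sig" if "sig : keys (g + ?T)" for sig
   using that g(1) subdivision_track_simplex(1) Poly_Mapping.keys_add[of g ?T] by blast
 qed
 also have "... <= fmass (Suc m) g" using fmass_add[of "Suc m" g ?T] by (simp add: fmass_subdivision_track)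
 also note g(3)
 also have "ennreal K1 * fmass (Suc m) ?b + ennreal (K2*?eps^Suc m * nrm (subdivision M m a) + dlt) <= ennreal K1 * fmass (Suc m) b +
  ennreal (K2*(L*(real (Suc m)*2))^Suc m*(sd_const (Suc m) * nrm a)/real M + dlt)"
 proof (intro add_mono mult_left_mono ennreal_leI order_refl)
  show "fmass (Suc m) ?b <= fmass (Suc m) b" using fmass_diff[of "Suc m" b ?T] by (simp add: fmass_subdivision_track)
  have pow: "?eps^Suc m = (L*(real (Suc m)*2))^Suc m/real M^Suc m" unfolding power_divide[symmetric] by simp
  have "K2*?eps^Suc m * nrm (subdivision M m a) <= K2*?eps^Suc m*(sd_const (Suc m) * real M^m * nrm a)"
   using fill L nrm_subdivision[OF M] by (intro mult_left_mono mult_nonneg_nonneg zero_le_power) (auto simp: fine_filling_def)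
  also have "... = K2*(L*(real (Suc m)*2))^Suc m*(sd_const (Suc m) * nrm a)/real M"
   unfolding pow using M by (simp add: field_simps del: sd_const.simps of_nat_Suc)
  finally show "K2*?eps^Suc m * nrm (subdivision M m a) <= K2*(L*(real (Suc m)*2))^Suc m*(sd_const (Suc m) * nrm a)/real M" .
 qed simp
 finally show ?thesis .
qed

end

lemma filling_volume_le_mass:
 assumes fill: "fine_filling Z m K1 K2" and a: "!!rho. rho : keys a ==> lip_simplex Z m rho" "sbd m a = 0"
  and b: "!!sig. sig : keys b ==> lip_simplex UNIV (Suc m) sig" "sbd (Suc m) b = a"
 shows "filling_volume Z m (lkp a) <= ennreal K1 * fmass (Suc m) b"
proof (rule ennreal_le_epsilon)
 fix dlt :: real assume dlt: "0 < dlt"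
 obtain L where L: "0 < L" "!!rho. rho : keys a ==> lipl m L (Sx m) rho" using common_lip_const[OF finite_keys a(1)] by blast
 define X where "X = K2*(L*(real (Suc m)*2))^Suc m*(sd_const (Suc m) * nrm a)"
 obtain M :: nat where M: "2 * X/dlt < real M" "0 < M"
  using reals_Archimedean2[of "max 1 (2 * X/dlt)"] by (metis less_max_iff_disj max_less_iff_conj of_nat_0_less_iff zero_less_one less_trans)
 have "X/real M + dlt/2 <= dlt" using M dlt by (simp add: field_simps)
 moreover have "filling_volume Z m (lkp a) <= ennreal K1 * fmass (Suc m) b + ennreal (X/real M + dlt/2)"
  unfolding X_def using dlt by (intro filling_volume_subdivided[OF M(2) a fill L b]) auto
 ultimately show "filling_volume Z m (lkp a) <= ennreal K1 * fmass (Suc m) b + ennreal dlt"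
  by (meson add_left_mono ennreal_leI order_trans)
qed

lemma le_mult_Inf:
 fixes y :: ennreal
 assumes K: "0 < K" and le: "!!x. x : S ==> y <= ennreal K * x" shows "y <= ennreal K * Inf S"
proof -
 have cancel: "ennreal (1/K)*(ennreal K * x) = x" "ennreal K*(ennreal (1/K) * x) = x" for x
  using K by (simp_all add: mult.assoc[symmetric] ennreal_mult[symmetric])
 have "ennreal (1/K) * y <= Inf S"
 proof (rule Inf_greatest)
  fix x assume "x : S"
  hence "ennreal (1/K) * y <= ennreal (1/K)*(ennreal K * x)" by (intro mult_left_mono le) auto
  thus "ennreal (1/K) * y <= x" unfolding cancel .
 qed
 hence "ennreal K*(ennreal (1/K) * y) <= ennreal K * Inf S" by (rule mult_left_mono) simp
 thus ?thesis unfolding cancel .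
qed

lemma filling_volume_comparison:
 fixes Z :: "'a::metric_space set"
 assumes fill: "fine_filling Z m K1 K2" and cycle: "lip_cycle Z m alp"
 shows "filling_volume Z m alp <= ennreal (K1 + 1) * filling_volume (UNIV :: 'a set) m alp"
 unfolding filling_volume_def[of UNIV]
proof (rule le_mult_Inf)
 have "0 <= K1" using fill by (simp add: fine_filling_def)
 thus "0 < K1 + 1" by simp
 fix x assume "x : {mass (Suc m) bet |bet. lip_chain (UNIV :: 'a set) (Suc m) bet & boundary (Suc m) bet = alp}"
 then obtain bet where x: "x = mass (Suc m) bet" and bet: "lip_chain (UNIV :: 'a set) (Suc m) bet" "boundary (Suc m) bet = alp" by blast
 let ?a = "to_frag alp" and ?b = "to_frag bet"
 have alp: "lip_chain Z m alp" using cycle by (simp add: lip_cycle_def)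
 have lkp: "lkp ?a = alp" "lkp ?b = bet" using alp bet(1) by (simp_all add: lkp_to_frag lip_chain_def)
 have a: "!!rho. rho : keys ?a ==> lip_simplex Z m rho" and b: "!!sig. sig : keys ?b ==> lip_simplex UNIV (Suc m) sig"
  using alp bet(1) unfolding supp_lkp[symmetric] lkp lip_chain_def by blast+
 have "sbd m ?a = 0"
 proof (cases m)
  case 0 thus ?thesis by (simp add: sbd_zero)
 next
  case (Suc q)
  hence "lkp (sbd m ?a) = (%_. 0)" using cycle boundary_lkp[of q ?a] lkp by (simp add: lip_cycle_def)
  thus ?thesis by (intro poly_mapping_eqI) simp
 qed
 moreover have "lkp (sbd (Suc m) ?b) = lkp ?a" unfolding boundary_lkp[symmetric] lkp bet(2) ..
 hence "sbd (Suc m) ?b = ?a" by (simp only: lookup_inject)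
 ultimately have "filling_volume Z m alp <= ennreal K1 * x"
  using filling_volume_le_mass[OF fill, of ?a ?b] a b by (simp add: x lkp mass_lkp[symmetric])
 also have "... <= ennreal (K1 + 1) * x" by (intro mult_right_mono ennreal_leI) auto
 finally show "filling_volume Z m alp <= ennreal (K1 + 1) * x" .
qed

lemma undistorted_of_lip_connected:
 fixes Z :: "'a::metric_space set"
 assumes Y: "lip_connected Z n" and AN: "AN_dim_finite TYPE('a)" and Z: "Z ~= {}"
 shows "undistorted_up_to Z n"
proof -
 obtain c where c: "lip_connected_const Z n c" using Y by (auto simp: lip_connected_def)
 have "EX K1 K2. fine_filling Z m K1 K2" if "m <= n" for m using fine_filling_exists[OF c AN Z that] by blast
 then obtain K1 K2 where fill: "!!m. m <= n ==> fine_filling Z m (K1 m) (K2 m)" by metis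
 define K where "K = (SUM m<=n. K1 m + 1)"
 have nonneg: "0 <= K1 m + 1" if "m <= n" for m using fill[OF that] by (simp add: fine_filling_def)
 have "filling_volume Z m alp <= ennreal K * filling_volume (UNIV :: 'a set) m alp" if m: "m <= n" and cycle: "lip_cycle Z m alp" for m alp
 proof -
  have "K1 m + 1 <= K" unfolding K_def using m nonneg by (intro member_le_sum) auto
  hence "ennreal (K1 m + 1) * filling_volume (UNIV :: 'a set) m alp <= ennreal K * filling_volume (UNIV :: 'a set) m alp"
   by (intro mult_right_mono ennreal_leI) auto
  thus ?thesis using filling_volume_comparison[OF fill[OF m] cycle] order_trans by blast
 qed
 moreover have "0 <= K" unfolding K_def using nonneg by (intro sum_nonneg) auto
 ultimately show ?thesis unfolding undistorted_up_to_def by blast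
qed

theorem theorem1p3:
  fixes Z :: "'a::metric_space set" and n :: nat
  assumes "closed Z" and "Z \<noteq> {}"
    and "geodesic_space TYPE('a)"
    and "AN_dim_finite TYPE('a)"
    and "lip_connected Z n \<or>
         (lip_connected (UNIV::'a set) n \<and>
          (\<exists>c. \<forall>p\<in>- Z. lip_connected_const (frontier (connected_component_set (- Z) p)) n c))"
  shows "undistorted_up_to Z n"
proof -
 have "lip_connected Z n"
  using assms(5)
 proof
  assume complement: "lip_connected (UNIV::'a set) n & (EX c. ALL p:- Z. lip_connected_const (frontier (connected_component_set (- Z) p)) n c)"
  then obtain c where "ALL p:- Z. lip_connected_const (frontier (connected_component_set (- Z) p)) n c" by blast
  with complement show ?thesis by (intro lip_connected_of_complement[OF assms(1,3)]) auto
 qed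
 thus ?thesis using undistorted_of_lip_connected assms(2,4) by blast
qed

end
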